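(* Let $\mathcal{A}$ be a $C^*$-algebra and let $n\geq 1$ be a finite integer. The following are equivalent: (i) $\mathcal{A}$ is $n$-homogeneous; (ii) there is an $n$-space $(X,.)$ such that $\mathcal{A}$ is isomorphic (as a $C^*$-algebra) to $C^*(X,.)$. Moreover, if $\mathcal{A}$ is $n$-homogeneous, the $n$-space $(X,.)$ in (ii) is unique up to isomorphism of $n$-spaces.
   Context: A $C^*$-algebra is $n$-homogeneous if every nonzero irreducible representation of it acts on an $n$-dimensional Hilbert space. Let $M_n$ be the $C^*$-algebra of complex $n\times n$ matrices (operator norm), $\mathcal{U}_n$ its unitary group, $I$ the identity matrix, $\mathbb{T}$ the unit circle, and $\mathbb{U}_n=\mathcal{U}_n/(\mathbb{T}\cdot I)$ (a compact group). For $\mathfrak{u}\in\mathbb{U}_n$ and $A\in M_n$ put $\mathfrak{u}.A=UAU^{-1}$ where $U\in\mathcal{U}_n$ is any representative of $\mathfrak{u}$. An $n$-space is a pair $(X,.)$ where $X$ is a locally compact Hausdorff space and $\mathbb{U}_n\times X\ni(\mathfrak{u},x)\mapsto \mathfrak{u}.x\in X$ is a continuous free action (free: $\mathfrak{u}.x=x$ for some $x$ implies $\mathfrak{u}$ is the neutral element). $C^*(X,.)$ is the $C^*$-algebra (pointwise operations, supremum norm) of all continuous maps $f\colon X\to M_n$ vanishing at infinity such that $f(\mathfrak{u}.x)=\mathfrak{u}.f(x)$ for all $\mathfrak{u}\in\mathbb{U}_n$, $x\in X$. A morphism of $n$-spaces $(X,.)\to(Y,* )$ is a proper continuous map $\psi$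 with $\psi(\mathfrak{u}.x)=\mathfrak{u}*\psi(x)$; an isomorphism is a morphism which is a homeomorphism. *)

theory Defs
  imports "HOL-Analysis.Analysis"
begin

definition complex_vs :: "'v set \<Rightarrow> 'v \<Rightarrow> ('v \<Rightarrow> 'v \<Rightarrow> 'v) \<Rightarrow> (complex \<Rightarrow> 'v \<Rightarrow> 'v) \<Rightarrow> bool" where
  "complex_vs V z add sm \<longleftrightarrow>
     z \<in> V \<and> (\<forall>x\<in>V. \<forall>y\<in>V. add x y \<in> V) \<and> (\<forall>c. \<forall>x\<in>V. sm c x \<in> V) \<and>
     (\<forall>x\<in>V. \<forall>y\<in>V. \<forall>w\<in>V. add (add x y) w = add x (add y w)) \<and>
     (\<forall>x\<in>V. \<forall>y\<in>V. add x y = add y x) \<and>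
     (\<forall>x\<in>V. add z x = x) \<and>
     (\<forall>x\<in>V. add x (sm (-1) x) = z) \<and>
     (\<forall>a b. \<forall>x\<in>V. sm a (sm b x) = sm (a * b) x) \<and>
     (\<forall>x\<in>V. sm 1 x = x) \<and>
     (\<forall>a. \<forall>x\<in>V. \<forall>y\<in>V. sm a (add x y) = add (sm a x) (sm a y)) \<and>
     (\<forall>a b. \<forall>x\<in>V. sm (a + b) x = add (sm a x) (sm b x))"

definition is_norm_on :: "'v set \<Rightarrow> 'v \<Rightarrow> ('v \<Rightarrow> 'v \<Rightarrow> 'v) \<Rightarrow> (complex \<Rightarrow> 'v \<Rightarrow> 'v) \<Rightarrow> ('v \<Rightarrow> real) \<Rightarrow> bool" where
  "is_norm_on V z add sm nrm \<longleftrightarrow>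
     (\<forall>x\<in>V. nrm x \<ge> 0) \<and> (\<forall>x\<in>V. nrm x = 0 \<longleftrightarrow> x = z) \<and>
     (\<forall>c. \<forall>x\<in>V. nrm (sm c x) = cmod c * nrm x) \<and>
     (\<forall>x\<in>V. \<forall>y\<in>V. nrm (add x y) \<le> nrm x + nrm y)"

definition complete_on :: "'v set \<Rightarrow> ('v \<Rightarrow> 'v \<Rightarrow> 'v) \<Rightarrow> (complex \<Rightarrow> 'v \<Rightarrow> 'v) \<Rightarrow> ('v \<Rightarrow> real) \<Rightarrow> bool" where
  "complete_on V add sm nrm \<longleftrightarrow>
     (\<forall>s. (\<forall>k. s k \<in> V) \<and>
          (\<forall>e>0. \<exists>N. \<forall>m\<ge>N. \<forall>k\<ge>N. nrm (add (s m) (sm (-1) (s k))) < e)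
        \<longrightarrow> (\<exists>l\<in>V. (\<lambda>k. nrm (add (s k) (sm (-1) l))) \<longlonglongrightarrow> 0))"

record 'a cstar_alg =
  ca_carrier :: "'a set"
  ca_zero :: 'a
  ca_add :: "'a \<Rightarrow> 'a \<Rightarrow> 'a"
  ca_smul :: "complex \<Rightarrow> 'a \<Rightarrow> 'a"
  ca_mult :: "'a \<Rightarrow> 'a \<Rightarrow> 'a"
  ca_star :: "'a \<Rightarrow> 'a"
  ca_norm :: "'a \<Rightarrow> real"

definition cstar_algebra :: "'a cstar_alg \<Rightarrow> bool" where
  "cstar_algebra A \<longleftrightarrow>
    (let V = ca_carrier A; add = ca_add A; sm = ca_smul A; mu = ca_mult A;
         st = ca_star A; nr = ca_norm A in
     complex_vs V (ca_zero A) add sm \<and> is_norm_on V (ca_zero A) add sm nr \<and>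
     complete_on V add sm nr \<and>
     (\<forall>x\<in>V. \<forall>y\<in>V. mu x y \<in> V) \<and>
     (\<forall>x\<in>V. \<forall>y\<in>V. \<forall>w\<in>V. mu (mu x y) w = mu x (mu y w)) \<and>
     (\<forall>x\<in>V. \<forall>y\<in>V. \<forall>w\<in>V. mu (add x y) w = add (mu x w) (mu y w)) \<and>
     (\<forall>x\<in>V. \<forall>y\<in>V. \<forall>w\<in>V. mu x (add y w) = add (mu x y) (mu x w)) \<and>
     (\<forall>c. \<forall>x\<in>V. \<forall>y\<in>V. mu (sm c x) y = sm c (mu x y) \<and> mu x (sm c y) = sm c (mu x y)) \<and>
     (\<forall>x\<in>V. \<forall>y\<in>V. nr (mu x y) \<le> nr x * nr y) \<and>
     (\<forall>x\<in>V. st x \<in> V) \<and>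
     (\<forall>x\<in>V. st (st x) = x) \<and>
     (\<forall>x\<in>V. \<forall>y\<in>V. st (add x y) = add (st x) (st y)) \<and>
     (\<forall>c. \<forall>x\<in>V. st (sm c x) = sm (cnj c) (st x)) \<and>
     (\<forall>x\<in>V. \<forall>y\<in>V. st (mu x y) = mu (st y) (st x)) \<and>
     (\<forall>x\<in>V. nr (mu (st x) x) = (nr x)\<^sup>2))"

definition cstar_hom :: "'a cstar_alg \<Rightarrow> 'b cstar_alg \<Rightarrow> ('a \<Rightarrow> 'b) \<Rightarrow> bool" where
  "cstar_hom A B f \<longleftrightarrow>
     (\<forall>x\<in>ca_carrier A. f x \<in> ca_carrier B) \<and>
     (\<forall>x\<in>ca_carrier A. \<forall>y\<in>ca_carrier A. f (ca_add A x y) = ca_add B (f x) (f y)) \<and>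
     (\<forall>c. \<forall>x\<in>ca_carrier A. f (ca_smul A c x) = ca_smul B c (f x)) \<and>
     (\<forall>x\<in>ca_carrier A. \<forall>y\<in>ca_carrier A. f (ca_mult A x y) = ca_mult B (f x) (f y)) \<and>
     (\<forall>x\<in>ca_carrier A. f (ca_star A x) = ca_star B (f x))"

definition cstar_iso :: "'a cstar_alg \<Rightarrow> 'b cstar_alg \<Rightarrow> bool" where
  "cstar_iso A B \<longleftrightarrow> (\<exists>f. cstar_hom A B f \<and> bij_betw f (ca_carrier A) (ca_carrier B))"

record 'h hilb =
  hs_carrier :: "'h set"
  hs_zero :: 'h
  hs_add :: "'h \<Rightarrow> 'h \<Rightarrow> 'h"
  hs_smul :: "complex \<Rightarrow> 'h \<Rightarrow> 'h"
  hs_inner :: "'h \<Rightarrow> 'h \<Rightarrow> complex"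

definition hs_norm :: "'h hilb \<Rightarrow> 'h \<Rightarrow> real" where
  "hs_norm H x = sqrt (Re (hs_inner H x x))"

definition hilbert_space :: "'h hilb \<Rightarrow> bool" where
  "hilbert_space H \<longleftrightarrow>
    (let V = hs_carrier H; add = hs_add H; sm = hs_smul H; ip = hs_inner H in
     complex_vs V (hs_zero H) add sm \<and>
     (\<forall>x\<in>V. \<forall>y\<in>V. \<forall>w\<in>V. ip (add x y) w = ip x w + ip y w) \<and>
     (\<forall>c. \<forall>x\<in>V. \<forall>y\<in>V. ip (sm c x) y = c * ip x y) \<and>
     (\<forall>x\<in>V. \<forall>y\<in>V. ip y x = cnj (ip x y)) \<and>
     (\<forall>x\<in>V. Im (ip x x) = 0 \<and> Re (ip x x) \<ge> 0) \<and>
     (\<forall>x\<in>V. ip x x = 0 \<longrightarrow> x = hs_zero H) \<and>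
     complete_on V add sm (hs_norm H))"

definition is_rep :: "'a cstar_alg \<Rightarrow> 'h hilb \<Rightarrow> ('a \<Rightarrow> 'h \<Rightarrow> 'h) \<Rightarrow> bool" where
  "is_rep A H \<pi> \<longleftrightarrow>
    (\<forall>a\<in>ca_carrier A.
        (\<forall>x\<in>hs_carrier H. \<pi> a x \<in> hs_carrier H) \<and>
        (\<forall>x\<in>hs_carrier H. \<forall>y\<in>hs_carrier H. \<pi> a (hs_add H x y) = hs_add H (\<pi> a x) (\<pi> a y)) \<and>
        (\<forall>c. \<forall>x\<in>hs_carrier H. \<pi> a (hs_smul H c x) = hs_smul H c (\<pi> a x)) \<and>
        (\<exists>C. \<forall>x\<in>hs_carrier H. hs_norm H (\<pi> a x) \<le> C * hs_norm H x)) \<and>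
    (\<forall>a\<in>ca_carrier A. \<forall>b\<in>ca_carrier A. \<forall>x\<in>hs_carrier H.
        \<pi> (ca_add A a b) x = hs_add H (\<pi> a x) (\<pi> b x) \<and>
        \<pi> (ca_mult A a b) x = \<pi> a (\<pi> b x)) \<and>
    (\<forall>c. \<forall>a\<in>ca_carrier A. \<forall>x\<in>hs_carrier H. \<pi> (ca_smul A c a) x = hs_smul H c (\<pi> a x)) \<and>
    (\<forall>a\<in>ca_carrier A. \<forall>x\<in>hs_carrier H. \<forall>y\<in>hs_carrier H.
        hs_inner H (\<pi> a x) y = hs_inner H x (\<pi> (ca_star A a) y))"

definition closed_subspace :: "'h hilb \<Rightarrow> 'h set \<Rightarrow> bool" where
  "closed_subspace H K \<longleftrightarrow>
     K \<subseteq> hs_carrier H \<and> hs_zero H \<in> K \<and>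
     (\<forall>x\<in>K. \<forall>y\<in>K. hs_add H x y \<in> K) \<and> (\<forall>c. \<forall>x\<in>K. hs_smul H c x \<in> K) \<and>
     (\<forall>s l. (\<forall>k. s k \<in> K) \<and> l \<in> hs_carrier H \<and>
            (\<lambda>k. hs_norm H (hs_add H (s k) (hs_smul H (-1) l))) \<longlonglongrightarrow> 0 \<longrightarrow> l \<in> K)"

definition nonzero_irreducible_rep :: "'a cstar_alg \<Rightarrow> 'h hilb \<Rightarrow> ('a \<Rightarrow> 'h \<Rightarrow> 'h) \<Rightarrow> bool" where
  "nonzero_irreducible_rep A H \<pi> \<longleftrightarrow>
     is_rep A H \<pi> \<and>
     (\<exists>a\<in>ca_carrier A. \<exists>x\<in>hs_carrier H. \<pi> a x \<noteq> hs_zero H) \<and>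
     (\<forall>K. closed_subspace H K \<and> (\<forall>a\<in>ca_carrier A. \<forall>x\<in>K. \<pi> a x \<in> K)
          \<longrightarrow> K = {hs_zero H} \<or> K = hs_carrier H)"

fun hs_lincomb :: "'h hilb \<Rightarrow> (nat \<Rightarrow> complex) \<Rightarrow> (nat \<Rightarrow> 'h) \<Rightarrow> nat \<Rightarrow> 'h" where
  "hs_lincomb H c b 0 = hs_zero H"
| "hs_lincomb H c b (Suc k) = hs_add H (hs_lincomb H c b k) (hs_smul H (c k) (b k))"

definition hs_has_dim :: "'h hilb \<Rightarrow> nat \<Rightarrow> bool" where
  "hs_has_dim H n \<longleftrightarrow>
     (\<exists>b. (\<forall>i<n. b i \<in> hs_carrier H) \<and>
          (\<forall>c. hs_lincomb H c b n = hs_zero H \<longrightarrow> (\<forall>i<n. c i = 0)) \<and>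
          (\<forall>x\<in>hs_carrier H. \<exists>c. x = hs_lincomb H c b n))"

definition n_homogeneous :: "'h itself \<Rightarrow> nat \<Rightarrow> 'a cstar_alg \<Rightarrow> bool" where
  "n_homogeneous (_::'h itself) n A \<longleftrightarrow>
     (\<forall>(H::'h hilb) \<pi>. hilbert_space H \<and> nonzero_irreducible_rep A H \<pi> \<longrightarrow> hs_has_dim H n)"

definition mat_adj :: "complex^'n^'n \<Rightarrow> complex^'n^'n" where
  "mat_adj M = (\<chi> i j. cnj (M $ j $ i))"

definition mat_scale :: "complex \<Rightarrow> complex^'n^'n \<Rightarrow> complex^'n^'n" where
  "mat_scale c M = (\<chi> i j. c * M $ i $ j)"

definition unitary_mat :: "complex^'n^'n \<Rightarrow> bool" where
  "unitary_mat U \<longleftrightarrow> U ** mat_adj U = mat 1 \<and> mat_adj U ** U = mat 1"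

definition mat_opnorm :: "complex^'n^'n \<Rightarrow> real" where
  "mat_opnorm M = onorm (\<lambda>v::complex^'n. M *v v)"

text \<open>An n-space: the action of the projective unitary group is given via its lift to
  the unitary group, required to be trivial on scalar unitaries.\<close>

definition n_space :: "'x topology \<Rightarrow> (complex^'n^'n \<Rightarrow> 'x \<Rightarrow> 'x) \<Rightarrow> bool" where
  "n_space X act \<longleftrightarrow>
     Hausdorff_space X \<and> locally_compact_space X \<and>
     (\<forall>U. \<forall>x\<in>topspace X. unitary_mat U \<longrightarrow> act U x \<in> topspace X) \<and>
     (\<forall>x\<in>topspace X. act (mat 1) x = x) \<and>
     (\<forall>U V. \<forall>x\<in>topspace X. unitary_mat U \<and> unitary_mat V \<longrightarrow> act (U ** V) x = act U (act V x)) \<and>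
     (\<forall>c U. \<forall>x\<in>topspace X. cmod c = 1 \<and> unitary_mat U \<longrightarrow> act (mat c ** U) x = act U x) \<and>
     continuous_map (prod_topology (top_of_set {U. unitary_mat U}) X) X (\<lambda>(U, x). act U x) \<and>
     (\<forall>U. \<forall>x\<in>topspace X. unitary_mat U \<and> act U x = x \<longrightarrow> (\<exists>c. U = mat c))"

definition CX :: "'x topology \<Rightarrow> (complex^'n^'n \<Rightarrow> 'x \<Rightarrow> 'x) \<Rightarrow> ('x \<Rightarrow> complex^'n^'n) cstar_alg" where
  "CX X act =
    \<lparr> ca_carrier = {f. continuous_map X euclidean f \<and>
                       (\<forall>e>0. \<exists>K. compactin X K \<and> (\<forall>x\<in>topspace X - K. mat_opnorm (f x) < e)) \<and>
                       (\<forall>U. \<forall>x\<in>topspace X. unitary_mat U \<longrightarrow> f (act U x) = U ** f x ** mat_adj U) \<and>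
                       (\<forall>x. x \<notin> topspace X \<longrightarrow> f x = 0)},
      ca_zero = (\<lambda>x. 0),
      ca_add = (\<lambda>f g x. f x + g x),
      ca_smul = (\<lambda>c f x. mat_scale c (f x)),
      ca_mult = (\<lambda>f g x. f x ** g x),
      ca_star = (\<lambda>f x. mat_adj (f x)),
      ca_norm = (\<lambda>f. if topspace X = {} then 0 else (SUP x\<in>topspace X. mat_opnorm (f x))) \<rparr>"

definition nspace_iso :: "'x topology \<Rightarrow> (complex^'n^'n \<Rightarrow> 'x \<Rightarrow> 'x) \<Rightarrow> 'y topology \<Rightarrow> (complex^'n^'n \<Rightarrow> 'y \<Rightarrow> 'y) \<Rightarrow> bool" where
  "nspace_iso X actX Y actY \<longleftrightarrow>
     (\<exists>\<psi>. homeomorphic_map X Y \<psi> \<and>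
          (\<forall>U. \<forall>x\<in>topspace X. unitary_mat U \<longrightarrow> \<psi> (actX U x) = actY U (\<psi> x)))"

end

theory Submission
  imports Defs
begin

text \<open>Norm-attaining pure states come from extreme points of a face of state functionals (a Zorn argument on
sublinear functionals), and the GNS construction turns them into irreducible representations; so every norm in an
\<open>n\<close>-homogeneous algebra \<open>A\<close> is attained by a *-homomorphism \<open>A \<rightarrow> M\<^sub>n\<close>. The space \<open>X\<close> is the set of nonzero such
homomorphisms with pointwise convergence, on which unitaries act by conjugation. Functional calculus near a rank one
projection gives central bump elements of \<open>A\<close>, and a partition of unity made of them shows that \<open>A\<close> fills \<open>C*(X)\<close>.
Conversely equivariant functions on an \<open>n\<close>-space, built with Chebyshev centres, separate points and evaluate onto \<open>M\<^sub>n\<close>,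
and a primeness argument shows that irreducible representations factor through evaluations.\<close>

text \<open>\<open>A\<close> comes with a norm but without a unit, so everything about positivity is
  drawn from norm inequalities. States are studied on a unital algebra that carries only a
  C*-seminorm: words over \<open>A\<close>, measured by their action on \<open>A\<close> by left
  multiplication. No completeness holds there, hence positivity of h is the condition that t - h has
  norm at most t, and square roots exist only up to an error. The hard point is that
  \<open>st x * x\<close> is positive; the GNS norm bound and the irreducibility proof rest on it.
  Homogeneity makes the spectrum manageable. All irreducible representations live on one C^n, so the
  maps into n by n matrices see every norm, form a compact set once the zero map is added, and are
  unitarily equivalent as soon as their kernels agree. Freeness plays a double part: on the spectrum
  it holds because only scalars commute with all matrices, and on a given n-space it is what lets an
  equivariant function take any prescribed value at a point. Uniqueness never compares two n-spaces
  directly; each is compared with the concrete spectrum \<open>XS\<close>.\<close>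

section \<open>Positivity and states in a C*-seminormed algebra\<close>

text \<open>A fixed point y satisfies (1 - y)^2 = 1 - x, so the iterates approximate 1 - sqrt (1 -
  x) while remaining polynomials in x without constant term.\<close>

primrec sqrt_iter :: "'w::real_algebra_1 \<Rightarrow> nat \<Rightarrow> 'w" where
 "sqrt_iter x 0 = 0"
| "sqrt_iter x (Suc m) = (1/2) *\<^sub>R (x + sqrt_iter x m * sqrt_iter x m)"

lemma sqrt_iter_commute:
 assumes "z * x = x * z"
 shows "z * sqrt_iter x m = sqrt_iter x m * z"
proof (induction m)
 case (Suc m)
 have "z * (sqrt_iter x m * sqrt_iter x m) = sqrt_iter x m * sqrt_iter x m * z" by (metis Suc mult.assoc)
 then show ?case by (simp add: distrib_left distrib_right assms)
qed simp

text \<open>Short steps thus mean that 1 - \<open>sqrt_iter x m\<close> is nearly a square root of 1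
  - x.\<close>

lemma sqrt_iter_residual:
 "(1 - sqrt_iter x m) * (1 - sqrt_iter x m) - (1 - x) = 2 *\<^sub>R (sqrt_iter x (Suc m) - sqrt_iter x m)" by (simp add: algebra_simps scaleR_2)

text \<open>A complex unital *-algebra presented as a real one with a central, skew-adjoint square
  root \<open>J\<close> of -1, so that the type class of real algebras applies. The seminorm may
  have a null space and need not be complete; \<open>p_one\<close> excludes the zero
  seminorm.\<close>

locale cstar_seminorm =
 fixes st :: "'w::real_algebra_1 \<Rightarrow> 'w" and J :: 'w and p :: "'w \<Rightarrow> real"
 assumes st_add: "st (x + y) = st x + st y"
  and st_mult: "st (x * y) = st y * st x"
  and st_st [simp]: "st (st x) = x"
  and st_scaleR: "st (r *\<^sub>R x) = r *\<^sub>R st x"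
  and st_J: "st J = - J"
  and J_sq: "J * J = -1"
  and J_comm: "J * x = x * J"
  and p_tri: "p (x + y) \<le> p x + p y"
  and p_scaleR: "p (r *\<^sub>R x) = \<bar>r\<bar> * p x"
  and p_mult: "p (x * y) \<le> p x * p y"
  and p_cstar: "p (st x * x) = (p x)\<^sup>2"
  and p_one [simp]: "p 1 = 1"
begin

lemma st_one [simp]: "st 1 = 1" by (metis mult_1 mult_1_right st_mult st_st)

lemma st_zero [simp]: "st 0 = 0" using st_scaleR[of 0 0] by simp

lemma st_minus: "st (- x) = - st x" using st_scaleR[of "-1" x] by simp

lemma st_diff: "st (x - y) = st x - st y" using st_add[of x "- y"] by (simp add: st_minus)

lemma st_of_real [simp]: "st (of_real r) = of_real r" by (simp add: of_real_def st_scaleR)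

lemma p_zero [simp]: "p 0 = 0" using p_scaleR[of 0 0] by simp

lemma p_minus [simp]: "p (- x) = p x" using p_scaleR[of "-1" x] by simp

lemma p_commute: "p (x - y) = p (y - x)" by (metis minus_diff_eq p_minus)

lemma p_nonneg [simp]: "0 \<le> p x" using p_tri[of x "- x"] by simp

lemma p_of_real [simp]: "p (of_real r) = \<bar>r\<bar>" by (simp add: of_real_def p_scaleR)

lemma p_diff: "p (x - y) \<le> p x + p y" using p_tri[of x "- y"] by simp

lemma p_tri_diff: "p x \<le> p y + p (x - y)" using p_tri[of y "x - y"] by simp

lemma p_st [simp]: "p (st x) = p x"
proof -
 have le: "p x \<le> p (st x)" for x
 proof (cases "p x = 0")
  case False
  then have "p x * p x \<le> p (st x) * p x" using p_mult[of "st x" x] by (simp add: p_cstar power2_eq_square)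
  then show ?thesis using False p_nonneg[of x] by simp
 qed simp
 show ?thesis using le[of x] le[of "st x"] by simp
qed

lemma p_herm_sq: "st h = h \<Longrightarrow> p (h * h) = (p h)\<^sup>2" using p_cstar[of h] by simp

lemma st_sqrt_iter: "st x = x \<Longrightarrow> st (sqrt_iter x m) = sqrt_iter x m" by (induction m) (simp_all add: st_scaleR st_add st_mult)

lemma p_sqrt_iter:
 assumes "p x \<le> r" "r \<le> 1" shows "p (sqrt_iter x m) \<le> r"
proof (induction m)
 case 0
 then show ?case using order_trans[OF p_nonneg assms(1)] by simp
next
 case (Suc m)
 have r0: "0 \<le> r" using assms(1) p_nonneg[of x] by linarith
 have "p (sqrt_iter x m * sqrt_iter x m) \<le> r * 1" by (rule order_trans[OF p_mult]) (use Suc assms r0 in \<open>intro mult_mono; simp\<close>)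
 then show ?case using p_tri[of x "sqrt_iter x m * sqrt_iter x m"] assms by (simp add: p_scaleR)
qed

text \<open>Consecutive iterates a, b commute, so a^2 - b^2 = (a - b) (a + b), and the second factor
  has norm at most 2 r. Each step therefore shrinks by the factor r.\<close>

lemma p_sqrt_iter_step:
 assumes "p x \<le> r" "r \<le> 1" shows "p (sqrt_iter x (Suc m) - sqrt_iter x m) \<le> r ^ Suc m"
proof (induction m)
 case 0
 then show ?case using assms order_trans[OF p_nonneg assms(1)] by (simp add: p_scaleR)
next
 case (Suc m)
 have r0: "0 \<le> r" using assms(1) p_nonneg[of x] by linarith
 let ?a = "sqrt_iter x (Suc m)" and ?b = "sqrt_iter x m"
 have comm: "?a * ?b = ?b * ?a" by (intro sqrt_iter_commute sqrt_iter_commute[symmetric] refl)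
 have eq: "sqrt_iter x (Suc (Suc m)) - ?a = (1/2) *\<^sub>R ((?a - ?b) * (?a + ?b))"
 proof -
  have "sqrt_iter x (Suc (Suc m)) - ?a = (1/2) *\<^sub>R (x + ?a * ?a) - (1/2) *\<^sub>R (x + ?b * ?b)" by (simp only: sqrt_iter.simps)
  also have "\<dots> = (1/2) *\<^sub>R (?a * ?a - ?b * ?b)" by (simp add: scaleR_diff_right[symmetric] del: sqrt_iter.simps)
  also have "?a * ?a - ?b * ?b = (?a - ?b) * (?a + ?b)" by (simp add: algebra_simps comm del: sqrt_iter.simps)
  finally show ?thesis .
 qed
 have "p ((?a - ?b) * (?a + ?b)) \<le> r ^ Suc m * (r + r)"
  by (rule order_trans[OF p_mult], intro mult_mono Suc order_trans[OF p_tri] add_mono p_sqrt_iter assms) (use r0 in auto)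
 then show ?case unfolding eq p_scaleR by (simp add: mult_ac del: sqrt_iter.simps)
qed

lemma sqrt_approx:
 assumes "st x = x" "p x \<le> r" "r < 1" "0 < e"
 obtains y where "st y = y" "p y \<le> r" "\<And>z. z * x = x * z \<Longrightarrow> z * y = y * z"
  "p ((1 - y) * (1 - y) - (1 - x)) < e"
proof -
 have r0: "0 \<le> r" using assms(2) p_nonneg[of x] by linarith
 have "(\<lambda>m. 2 * r ^ Suc m) \<longlonglongrightarrow> 2 * 0" using r0 \<open>r < 1\<close> by (intro tendsto_mult_left LIMSEQ_Suc LIMSEQ_realpow_zero)
 then have "\<forall>\<^sub>F m in sequentially. 2 * r ^ Suc m < e" by (rule order_tendstoD(2)) (use \<open>0 < e\<close> in simp)
 then obtain m where m: "2 * r ^ Suc m < e" by (auto simp: eventually_sequentially)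
 have "p (2 *\<^sub>R (sqrt_iter x (Suc m) - sqrt_iter x m)) < e"
  using p_sqrt_iter_step[of x r m] assms m by (simp add: p_scaleR del: sqrt_iter.simps power_Suc)
 then show ?thesis using that[of "sqrt_iter x m"] st_sqrt_iter p_sqrt_iter sqrt_iter_commute sqrt_iter_residual assms by (metis less_imp_le)
qed

text \<open>The element u = \<open>c + J * d\<close> is normal with \<open>st u * u\<close> = c^2 +
  d^2, and c is the real part of u, so p c is at most p u.\<close>

lemma comm_sq:
 assumes "st c = c" "st d = d" "c * d = d * c"
 shows "(p c)\<^sup>2 \<le> p (c * c + d * d)"
proof -
 let ?u = "c + J * d"
 have su: "st ?u = c - J * d" by (simp add: st_add st_mult assms st_J J_comm)
 have JJ: "J * d * (J * d) = - (d * d)"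
 proof -
  have "J * d * (J * d) = (J * J) * (d * d)" by (metis J_comm mult.assoc)
  then show ?thesis by (simp add: J_sq)
 qed
 have "c * (J * d) = J * d * c" by (metis J_comm assms(3) mult.assoc)
 then have "st ?u * ?u = c * c + d * d" unfolding su by (simp add: distrib_left distrib_right left_diff_distrib right_diff_distrib JJ)
 then have 1: "(p ?u)\<^sup>2 = p (c * c + d * d)" by (metis p_cstar)
 have "2 *\<^sub>R c = ?u + st ?u" unfolding su by (simp add: scaleR_2)
 then have "2 * p c \<le> p ?u + p (st ?u)" by (metis p_scaleR p_tri abs_numeral)
 then have "p c \<le> p ?u" by simp
 then show ?thesis using 1 by (metis p_nonneg power_mono)
qed

text \<open>Positivity without a spectrum: in a C*-algebra the inequality places the spectrum of the
  hermitian h in the interval from 0 to 2 t.\<close>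

definition Pos :: "'w \<Rightarrow> bool" where
 "Pos h \<longleftrightarrow> st h = h \<and> (\<exists>t\<ge>0. p (of_real t - h) \<le> t)"

lemma Pos_herm: "Pos h \<Longrightarrow> st h = h" by (simp add: Pos_def)

lemma Pos_diff: "st h = h \<Longrightarrow> p h \<le> s \<Longrightarrow> Pos (of_real s - h)"
 unfolding Pos_def using order_trans[OF p_nonneg, of h s] by (intro conjI exI[of _ s]) (auto simp: st_diff)

lemma Pos_plus: "st h = h \<Longrightarrow> p h \<le> s \<Longrightarrow> Pos (of_real s + h)" using Pos_diff[of "- h" s] by (simp add: st_minus)

lemma Pos_of_real: "0 \<le> s \<Longrightarrow> Pos (of_real s)" using Pos_diff[of 0 s] by simp

lemma Pos_add: assumes "Pos a" "Pos b" shows "Pos (a + b)"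
proof -
 obtain s t where st: "0 \<le> s" "p (of_real s - a) \<le> s" "0 \<le> t" "p (of_real t - b) \<le> t" using assms unfolding Pos_def by blast
 have "of_real (s + t) - (a + b) = (of_real s - a) + (of_real t - b)" by simp
 then have "p (of_real (s + t) - (a + b)) \<le> s + t" using p_tri[of "of_real s - a" "of_real t - b"] st by (simp only:)
 then show ?thesis using assms st unfolding Pos_def by (auto simp: st_add intro!: exI[of _ "s + t"])
qed

lemma Pos_scaleR: assumes "Pos a" "0 \<le> r" shows "Pos (r *\<^sub>R a)"
proof -
 obtain s where st: "0 \<le> s" "p (of_real s - a) \<le> s" using assms unfolding Pos_def by blast
 have "of_real (r * s) - r *\<^sub>R a = r *\<^sub>R (of_real s - a)" by (simp add: of_real_def scaleR_diff_right)
 then have "p (of_real (r * s) - r *\<^sub>R a) \<le> r * s" using st assms by (simp add: p_scaleR mult_left_mono)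
 then show ?thesis using assms st unfolding Pos_def by (auto simp: st_scaleR intro!: exI[of _ "r * s"])
qed

text \<open>After scaling to \<open>p h < 1\<close>, take a hermitian c that commutes with h and has
  c^2 close to 1 - h^2. Since c^2 + h^2 is close to 1, \<open>comm_sq\<close> bounds p c by about 1,
  and 1 - h^2 is nearly c^2.\<close>

lemma Pos_sq: assumes h: "st h = h" shows "Pos (h * h)"
proof -
 have small: "p (1 - h * h) \<le> 1" if h: "st h = h" "p h < 1" for h
 proof (rule field_le_epsilon)
  fix e :: real assume e: "0 < e"
  have hh: "st (h * h) = h * h" by (simp add: st_mult h)
  have "p (h * h) < 1" using h by (simp add: p_herm_sq power_less_one_iff abs_square_less_1)
  then obtain y where y: "st y = y" "\<And>z. z * (h * h) = h * h * z \<Longrightarrow> z * y = y * z"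
   "p ((1 - y) * (1 - y) - (1 - h * h)) < e / 2" using sqrt_approx[OF hh order_refl _ half_gt_zero[OF e]] by metis
  let ?c = "1 - y"
  have "h * y = y * h" by (rule y(2)) (simp add: mult.assoc)
  then have "(p ?c)\<^sup>2 \<le> p (?c * ?c + h * h)" by (intro comm_sq) (simp_all add: st_diff y h algebra_simps)
  also have "?c * ?c + h * h = 1 + (?c * ?c - (1 - h * h))" by simp
  also have "p \<dots> \<le> 1 + e / 2" using p_tri[of 1 "?c * ?c - (1 - h * h)"] y(3) by simp
  finally have "p (?c * ?c) \<le> 1 + e / 2" by (simp add: p_herm_sq st_diff y)
  then show "p (1 - h * h) \<le> 1 + e" using p_tri_diff[of "1 - h * h" "?c * ?c"] y(3) p_commute[of "1 - h * h" "?c * ?c"] by linarith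
 qed
 define s where "s = p h + 1"
 have s: "0 < s" "p h < s" by (auto simp: s_def add_nonneg_pos)
 define g where "g = (1/s) *\<^sub>R h"
 have g: "st g = g" "p g < 1" "h = s *\<^sub>R g" using s h by (auto simp: g_def st_scaleR p_scaleR)
 have "of_real (s\<^sup>2) - h * h = s\<^sup>2 *\<^sub>R (1 - g * g)" unfolding g(3) by (simp add: of_real_def scaleR_diff_right power2_eq_square)
 then have "p (of_real (s\<^sup>2) - h * h) \<le> s\<^sup>2" using small[OF g(1,2)] by (simp add: p_scaleR mult_left_le)
 then show ?thesis unfolding Pos_def by (auto simp: st_mult h intro!: exI[of _ "s\<^sup>2"])
qed

lemma Pos_approx:
 assumes "Pos h" "0 < e"
 obtains g where "st g = g" "\<And>z. z * h = h * z \<Longrightarrow> z * g = g * z" "p (h - g * g) < e"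
proof -
 obtain t0 where t0: "0 \<le> t0" "p (of_real t0 - h) \<le> t0" and h: "st h = h" using assms unfolding Pos_def by blast
 \<comment> \<open>The shift by 1 makes t positive, so that h can be divided by it.\<close>
 define t where "t = t0 + 1"
 have t: "0 < t" "p (of_real t - h) \<le> t"
 proof -
  have "of_real t - h = (of_real t0 - h) + of_real 1" by (simp add: t_def)
  then have "p (of_real t - h) \<le> p (of_real t0 - h) + p (of_real 1)" by (metis p_tri)
  then show "p (of_real t - h) \<le> t" using t0 by (simp add: t_def)
 qed (use t0 in \<open>simp add: t_def\<close>)
 define q where "q = 1 - (1/t) *\<^sub>R h"
 have ht: "h = t *\<^sub>R (1 - q)" using t by (simp add: q_def)
 have q: "st q = q" "p q \<le> 1"
 proof -
  have "t *\<^sub>R q = of_real t - h" using t by (simp add: q_def of_real_def scaleR_diff_right)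
  then have "t * p q \<le> t * 1" using t p_scaleR[of t q] by simp
  then show "p q \<le> 1" using t by simp
 qed (simp add: q_def st_diff st_scaleR h)
 \<comment> \<open>\<open>sqrt_approx\<close> needs a norm strictly below 1. Shrinking q by the
   factor r provides this at a cost of t * (1 - r), kept below e / 4.\<close>
 define r where "r = 1 - min (1/2) (e / (4 * t))"
 have r: "1/2 \<le> r" "r < 1" "t * (1 - r) \<le> e / 4"
 proof -
  have "t * (1 - r) \<le> t * (e / (4 * t))" unfolding r_def using t by (intro mult_left_mono) auto
  then show "t * (1 - r) \<le> e / 4" using t by simp
 qed (use t assms in \<open>auto simp: r_def\<close>)
 have "p (r *\<^sub>R q) \<le> r" using q r by (simp add: p_scaleR mult_left_le)
 moreover have "st (r *\<^sub>R q) = r *\<^sub>R q" by (simp add: st_scaleR q)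
 moreover have "0 < e / (4 * t)" using t assms by simp
 ultimately obtain y where y: "st y = y" "\<And>z. z * (r *\<^sub>R q) = r *\<^sub>R q * z \<Longrightarrow> z * y = y * z"
   "p ((1 - y) * (1 - y) - (1 - r *\<^sub>R q)) < e / (4 * t)" using sqrt_approx[of "r *\<^sub>R q" r "e / (4 * t)"] r by metis
 define g where "g = sqrt t *\<^sub>R (1 - y)"
 have gg: "g * g = t *\<^sub>R ((1 - y) * (1 - y))" using t by (simp add: g_def)
 have "h - g * g = t *\<^sub>R ((1 - q) - (1 - y) * (1 - y))" unfolding gg by (subst ht) (simp add: scaleR_diff_right)
 also have "(1 - q) - (1 - y) * (1 - y) = - ((1 - y) * (1 - y) - (1 - r *\<^sub>R q)) - (1 - r) *\<^sub>R q" by (simp add: scaleR_diff_left)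
 finally have "p (h - g * g) \<le> t * (p ((1 - y) * (1 - y) - (1 - r *\<^sub>R q)) + p ((1 - r) *\<^sub>R q))"
  using t p_diff[of "- ((1 - y) * (1 - y) - (1 - r *\<^sub>R q))" "(1 - r) *\<^sub>R q"] by (simp only: p_scaleR p_minus abs_of_pos mult_le_cancel_left_pos)
 also have "\<dots> \<le> t * (e / (4 * t) + (1 - r) * 1)" using t y(3) r q by (intro mult_left_mono add_mono) (auto simp: p_scaleR mult_left_le)
 also have "\<dots> = e / 4 + t * (1 - r)" using t by (simp add: distrib_left)
 also have "\<dots> < e" using r assms by simp
 finally have "p (h - g * g) < e" .
 moreover have "z * g = g * z" if "z * h = h * z" for z
 proof -
  have "z * q = q * z" using that by (simp add: q_def algebra_simps)
  then have "z * y = y * z" by (intro y(2)) simp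
  then show ?thesis by (simp add: g_def algebra_simps)
 qed
 moreover have "st g = g" by (simp add: g_def st_scaleR st_diff y)
 ultimately show ?thesis using that by blast
qed

text \<open>The witness t in \<open>Pos\<close> can be replaced by any bound s of the norm: g is
  nearly a square, and for a scaled root d with p (d * d) at most 1 the argument of
  \<open>Pos_sq\<close> gives that 1 - d^2 has norm at most 1.\<close>

lemma Pos_norm:
 assumes "Pos g" "p g \<le> s" shows "p (of_real s - g) \<le> s"
proof (rule field_le_epsilon)
 fix e :: real assume "0 < e"
 then have "0 < e / 8" by simp
 then obtain c where c: "st c = c" "p (g - c * c) < e / 8" by (rule Pos_approx[OF assms(1)])
 define t where "t = s + e / 4"
 have "0 \<le> s" using assms p_nonneg[of g] by linarith
 then have t: "0 < t" using \<open>0 < e\<close> by (simp add: t_def)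
 have "p (c * c) < t" using p_tri_diff[of "c * c" g] c(2) assms p_commute[of g] \<open>0 < e\<close> by (simp add: t_def)
 then have pc: "(p c)\<^sup>2 < t" using c by (simp add: p_herm_sq)
 define d where "d = (1 / sqrt t) *\<^sub>R c"
 have d: "st d = d" "c * c = t *\<^sub>R (d * d)" using t by (auto simp: d_def st_scaleR c)
 have pd: "p (d * d) \<le> 1" using pc t d(2) p_herm_sq[OF c(1)] by (simp add: p_scaleR) (metis less_imp_le mult_le_cancel_left_pos mult.right_neutral)
 have "p (1 - d * d) \<le> 1"
 proof -
  have P: "Pos (d * d)" by (rule Pos_sq) (rule d)
  show ?thesis
  proof (rule field_le_epsilon)
   fix f :: real assume f: "0 < f"
   define r where "r = 1 - min (1/2) (f/2)"
   have r: "0 < r" "r < 1" "1 - r \<le> f / 2" using f by (auto simp: r_def)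
   have sr: "st (r *\<^sub>R (d * d)) = r *\<^sub>R (d * d)" by (simp add: st_scaleR st_mult d)
   have pr: "p (r *\<^sub>R (d * d)) \<le> r" using pd r by (simp add: p_scaleR mult_left_le)
   obtain y where y: "st y = y" "\<And>z. z * (r *\<^sub>R (d * d)) = r *\<^sub>R (d * d) * z \<Longrightarrow> z * y = y * z"
    "p ((1 - y) * (1 - y) - (1 - r *\<^sub>R (d * d))) < f / 4" using sqrt_approx[OF sr pr r(2), of "f/4"] f by (metis divide_pos_pos zero_less_numeral)
   let ?b = "1 - y" and ?a = "sqrt r *\<^sub>R d"
   have aa: "?a * ?a = r *\<^sub>R (d * d)" using r by simp
   have "d * y = y * d" by (rule y(2)) (simp add: mult.assoc)
   then have "(p ?b)\<^sup>2 \<le> p (?b * ?b + ?a * ?a)" by (intro comm_sq) (simp_all add: st_diff st_scaleR y d algebra_simps)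
   also have "?b * ?b + ?a * ?a = 1 + (?b * ?b - (1 - r *\<^sub>R (d * d)))" unfolding aa by simp
   also have "p \<dots> \<le> 1 + f / 4" using p_tri[of 1 "?b * ?b - (1 - r *\<^sub>R (d * d))"] y(3) by simp
   finally have b: "p (?b * ?b) \<le> 1 + f / 4" by (simp add: p_herm_sq st_diff y)
   have "1 - d * d = (?b * ?b) - (?b * ?b - (1 - r *\<^sub>R (d * d))) - (1 - r) *\<^sub>R (d * d)" by (simp add: scaleR_diff_left)
   then have "p (1 - d * d) \<le> p (?b * ?b) + p (?b * ?b - (1 - r *\<^sub>R (d * d))) + p ((1 - r) *\<^sub>R (d * d))" by (smt (verit) p_diff)
   moreover have "p ((1 - r) *\<^sub>R (d * d)) \<le> f / 2" using r pd by (simp add: p_scaleR) (smt (verit) mult_left_le)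
   ultimately show "p (1 - d * d) \<le> 1 + f" using b y(3) by linarith
  qed
 qed
 moreover have "of_real t - c * c = t *\<^sub>R (1 - d * d)" unfolding d(2) by (simp add: of_real_def scaleR_diff_right)
 ultimately have 1: "p (of_real t - c * c) \<le> t" using t by (simp add: p_scaleR)
 have "of_real s - g = (of_real t - c * c) - of_real (e / 4) - (g - c * c)" by (simp add: t_def)
 then have "p (of_real s - g) \<le> p (of_real t - c * c) + p (of_real (e/4)) + p (g - c * c)" by (smt (verit) p_diff)
 then show "p (of_real s - g) \<le> s + e" using 1 c(2) \<open>0 < e\<close> unfolding t_def p_of_real by linarith
qed

text \<open>The witness t may vary with the approximating elements; \<open>Pos_norm\<close> supplies
  the common value p h + 1 for all positive elements near h.\<close>

lemma Pos_closed:
 assumes "st h = h" "\<And>e. 0 < e \<Longrightarrow> \<exists>g. Pos g \<and> p (h - g) < e"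
 shows "Pos h"
proof -
 define t where "t = p h + 1"
 have "p (of_real t - h) \<le> t"
 proof (rule field_le_epsilon)
  fix e :: real assume "0 < e"
  then obtain g where g: "Pos g" "p (h - g) < min e 1" using assms(2)[of "min e 1"] by auto
  have "p g \<le> t" using p_tri_diff[of g h] g p_commute[of g h] by (simp add: t_def)
  then have "p (of_real t - g) \<le> t" using g by (intro Pos_norm)
  moreover have "of_real t - h = (of_real t - g) - (h - g)" by simp
  ultimately have "p (of_real t - h) \<le> t + p (h - g)" using p_diff[of "of_real t - g" "h - g"] by simp
  then show "p (of_real t - h) \<le> t + e" using g by simp
 qed
 then show ?thesis unfolding Pos_def using assms(1) by (auto simp: t_def intro!: exI[of _ "p h + 1"] add_nonneg_nonneg)
qed

text \<open>Let c and d be approximate roots of s - a and s + a. They commute with each other and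
  with a, and (c d)^2 is close to s^2 - a^2. So a^2 + (c d)^2 is close to s^2, and
  \<open>comm_sq\<close> bounds p a.\<close>

lemma two_sided:
 assumes a: "st a = a" "Pos (of_real s - a)" "Pos (of_real s + a)"
 shows "p a \<le> \<bar>s\<bar>"
proof -
 have "(p a)\<^sup>2 \<le> s\<^sup>2"
 proof (rule field_le_epsilon)
  fix e :: real assume e: "0 < e"
  let ?u = "of_real s - a" and ?v = "of_real s + a"
  define K where "K = p ?u + p ?v + 2"
  have K: "0 < K" unfolding K_def by (smt (verit) p_nonneg)
  define f where "f = min 1 (e / (2 * K))"
  have f: "0 < f" "f \<le> 1" "K * f \<le> e / 2"
  proof -
   have "K * f \<le> K * (e / (2 * K))" unfolding f_def using K by (intro mult_left_mono) auto
   then show "K * f \<le> e / 2" using K by simp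
  qed (use e K in \<open>auto simp: f_def\<close>)
  obtain c where c: "st c = c" "\<And>z. z * ?u = ?u * z \<Longrightarrow> z * c = c * z" "p (?u - c * c) < f" using Pos_approx[OF a(2) f(1)] by metis
  obtain d where d: "st d = d" "\<And>z. z * ?v = ?v * z \<Longrightarrow> z * d = d * z" "p (?v - d * d) < f" using Pos_approx[OF a(3) f(1)] by metis
  have ac: "a * c = c * a" by (rule c(2)) (simp add: algebra_simps of_real_def)
  have ad: "a * d = d * a" by (rule d(2)) (simp add: algebra_simps of_real_def)
  have cd: "c * d = d * c" by (rule d(2)) (simp add: algebra_simps of_real_def ac)
  have cdcd: "c * d * (c * d) = (c * c) * (d * d)" by (metis cd mult.assoc)
  have "(p a)\<^sup>2 \<le> p (a * a + (c * d) * (c * d))"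
  proof (rule comm_sq)
   show "a * (c * d) = c * d * a" by (metis ac ad mult.assoc)
  qed (simp_all add: a st_mult c d cd)
  also have "a * a + (c * d) * (c * d) = of_real (s\<^sup>2) - ((?u - c * c) * ?v + (c * c) * (?v - d * d))"
   unfolding cdcd by (simp add: algebra_simps of_real_def power2_eq_square)
  also have "p \<dots> \<le> s\<^sup>2 + (p (?u - c * c) * p ?v + p (c * c) * p (?v - d * d))"

   by (rule order_trans[OF p_diff], intro add_mono order_trans[OF p_tri] p_mult) (simp only: p_of_real, simp)
  also have "\<dots> \<le> s\<^sup>2 + (f * p ?v + (p ?u + 1) * f)"
  proof -
   have "p (c * c) \<le> p ?u + 1" using p_tri_diff[of "c * c" ?u] c(3) f p_commute[of ?u] by simp
   then show ?thesis using c(3) d(3) f by (intro add_mono mult_mono order_refl) auto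
  qed
  also have "\<dots> \<le> s\<^sup>2 + K * f" unfolding K_def using f by (simp add: algebra_simps)
  finally show "(p a)\<^sup>2 \<le> s\<^sup>2 + e" using f e by linarith
 qed
 then show ?thesis by (simp add: abs_le_square_iff[symmetric])
qed

lemma Pos_le_norm:
 assumes "Pos a" "Pos (of_real s - a)" "0 \<le> s" shows "p a \<le> s"
proof -
 have "Pos (of_real s + a)" using assms by (intro Pos_add Pos_of_real)
 then show ?thesis using two_sided[of a s] assms Pos_herm by simp
qed

lemma Pos_mono: assumes "Pos a" "Pos b" shows "p a \<le> p (a + b)"
proof (rule Pos_le_norm[OF assms(1)])
 have "Pos (of_real (p (a + b)) - (a + b) + b)" using assms by (intro Pos_add Pos_diff) (auto simp: st_add Pos_herm)
 then show "Pos (of_real (p (a + b)) - a)" by simp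
qed simp

lemma Pos_mult_sq:
 assumes "st g = g" "Pos k" "g * k = k * g" shows "Pos (g * k * g)"
proof (rule Pos_closed)
 show "st (g * k * g) = g * k * g" using assms(1,2) by (simp add: st_mult Pos_herm mult.assoc)
 fix e :: real assume e: "0 < e"
 define f where "f = e / ((p g)\<^sup>2 + 1)"
 have p1: "0 < (p g)\<^sup>2 + 1" by (simp add: add_nonneg_pos)
 then have f0: "0 < f" using e by (simp add: f_def)
 have "((p g)\<^sup>2 + 1) * f = e" using p1 by (simp add: f_def)
 with f0 have f: "0 < f" "(p g)\<^sup>2 * f < e" by (simp_all add: distrib_right)
 obtain c where c: "st c = c" "\<And>z. z * k = k * z \<Longrightarrow> z * c = c * z" "p (k - c * c) < f" using Pos_approx[OF assms(2) f(1)] by metis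
 have gc: "g * c = c * g" using assms c by blast
 have "g * (c * c) * g = (g * c) * (g * c)" by (metis gc mult.assoc)
 moreover have "Pos ((g * c) * (g * c))" by (rule Pos_sq) (simp add: st_mult assms c gc)
 moreover have "p (g * k * g - g * (c * c) * g) < e"
 proof -
  have "g * k * g - g * (c * c) * g = g * (k - c * c) * g" by (simp add: algebra_simps)
  also have "p \<dots> \<le> p g * p (k - c * c) * p g" by (rule order_trans[OF p_mult]) (intro mult_right_mono p_mult p_nonneg)
  also have "\<dots> = (p g)\<^sup>2 * p (k - c * c)" by (simp add: power2_eq_square)
  also have "\<dots> \<le> (p g)\<^sup>2 * f" using c(3) by (intro mult_left_mono) auto
  finally show ?thesis using f by linarith
 qed
 ultimately show "\<exists>h. Pos h \<and> p (g * k * g - h) < e" by metis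
qed

lemma norm_le_one_of_square_le_one:
 assumes "Pos (1 - st y * y)" shows "p y \<le> 1"
proof -
 define N where "N = (p y)\<^sup>2"
 define v where "v = st y * y"
 define w where "w = y * st y"
 have st: "st v = v" "st w = w" by (simp_all add: v_def w_def st_mult)
 have pv: "p v = N" by (simp add: v_def N_def p_cstar)
 have pw: "p w = N" using p_cstar[of "st y"] by (simp add: w_def N_def)
 have "N \<le> 1"
 proof (rule ccontr)
  assume "\<not> N \<le> 1"
  then have N: "1 < N" by simp
  \<comment> \<open>This s balances two estimates: v \<le> 1 and v \<ge> -N place v + s between -(N
    + 1)/2 and (N + 1)/2.\<close>
  define s where "s = (N - 1) / 2"
  define M where "M = p (w + of_real (s/2))"
  have "Pos (v + w)"
  proof -
   let ?a = "y + st y" and ?b = "J * (y - st y)"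
   have bb: "?b * ?b = - ((y - st y) * (y - st y))"
   proof -
    have "?b * ?b = (J * J) * ((y - st y) * (y - st y))" by (metis J_comm mult.assoc)
    then show ?thesis by (simp add: J_sq)
   qed
   have "st ?b = ?b" unfolding st_mult st_J st_diff st_st using J_comm[of "y - st y"] by (simp add: algebra_simps)
   then have "Pos (?a * ?a + ?b * ?b)" by (intro Pos_add Pos_sq) (simp_all add: st_add)
   then have "Pos ((1/2) *\<^sub>R (?a * ?a + ?b * ?b))" by (rule Pos_scaleR) simp
   moreover have "(1/2) *\<^sub>R (?a * ?a + ?b * ?b) = v + w"
   proof -
    have "?a * ?a + ?b * ?b = 2 *\<^sub>R (v + w)" unfolding bb v_def w_def by (simp add: algebra_simps scaleR_2)
    then show ?thesis by simp
   qed
   ultimately show ?thesis by simp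
  qed
  then have "Pos ((v + w) + (1 - v))" using assms by (rule_tac Pos_add) (simp_all add: v_def)
  then have w1: "Pos (1 + w)" by (simp add: add.commute)
  have up: "Pos (of_real M - (w + of_real (s/2)))" by (rule Pos_diff) (simp_all add: st_add st M_def)
  \<comment> \<open>From below w is bounded by -1, from above by M - s/2. As N > 1, the bound N
    \<le> T from \<open>two_sided\<close> can only come from M - s/2.\<close>
  define T where "T = max 1 (M - s/2)"
  have "Pos ((of_real M - (w + of_real (s/2))) + of_real (T - (M - s/2)))" by (intro Pos_add up Pos_of_real) (simp add: T_def)
  then have 1: "Pos (of_real T - w)" by simp
  have "Pos (of_real (T - 1) + (1 + w))" by (intro Pos_add w1 Pos_of_real) (simp add: T_def)
  then have 2: "Pos (of_real T + w)" by simp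
  have "p w \<le> \<bar>T\<bar>" by (rule two_sided) (use st 1 2 in auto)
  then have "N \<le> M - s / 2" using N unfolding pw T_def by linarith
  then have "(N + s/2)\<^sup>2 \<le> M\<^sup>2" using N by (intro power_mono) (auto simp: s_def)
  also have "M\<^sup>2 = p (w * w + s *\<^sub>R w + of_real (s\<^sup>2/4))"
  proof -
   have "M\<^sup>2 = p ((w + of_real (s/2)) * (w + of_real (s/2)))" unfolding M_def by (rule p_herm_sq[symmetric]) (simp add: st_add st)
   also have "(w + of_real (s/2)) * (w + of_real (s/2)) = w * w + s *\<^sub>R w + of_real (s\<^sup>2/4)"
   proof -
    have "s *\<^sub>R w = (s/2) *\<^sub>R w + (s/2) *\<^sub>R w" by (simp add: scaleR_add_left[symmetric])
    then show ?thesis by (simp add: algebra_simps of_real_def power2_eq_square)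
   qed
   finally show ?thesis .
  qed
  also have "\<dots> \<le> p (w * w + s *\<^sub>R w) + s\<^sup>2/4" using p_tri[of "w * w + s *\<^sub>R w" "of_real (s\<^sup>2/4)"] by (simp only: p_of_real) simp
  also have "w * w + s *\<^sub>R w = y * (v + of_real s) * st y" by (simp add: w_def v_def algebra_simps of_real_def)
  also have "p \<dots> \<le> p y * p (v + of_real s) * p (st y)" by (rule order_trans[OF p_mult]) (intro mult_right_mono p_mult p_nonneg)
  also have "p (v + of_real s) \<le> (N + 1) / 2"
  proof -
   have "of_real ((N + 1)/2) - (v + of_real s) = 1 - v"
   proof -
    have "(N + 1) / 2 = 1 + s" by (simp add: s_def field_simps)
    then show ?thesis by (simp only: of_real_add of_real_1) simp
   qed
   moreover have "Pos (1 - v)" using assms by (simp add: v_def)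
   ultimately have a: "Pos (of_real ((N + 1)/2) - (v + of_real s))" by (simp only:)
   have "of_real ((N + 1)/2) + (v + of_real s) = of_real N + v"
   proof -
    have "N = (N + 1) / 2 + s" by (simp add: s_def field_simps)
    then have "(of_real N :: 'w) = of_real ((N + 1)/2) + of_real s" by (metis of_real_add)
    then show ?thesis by (simp add: add_ac)
   qed
   moreover have "Pos (of_real N + v)" by (rule Pos_plus) (use st pv in auto)
   ultimately have b: "Pos (of_real ((N + 1)/2) + (v + of_real s))" by (simp only:)
   have "p (v + of_real s) \<le> \<bar>(N + 1)/2\<bar>" by (rule two_sided[OF _ a b]) (simp add: st_add st)
   then show ?thesis using N by simp
  qed
  finally have "(N + s/2)\<^sup>2 \<le> p y * ((N + 1) / 2) * p y + s\<^sup>2/4" by (simp add: mult_left_mono mult_right_mono)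
  then have "(N + s/2)\<^sup>2 \<le> N * ((N + 1) / 2) + s\<^sup>2/4" by (simp add: N_def power2_eq_square mult_ac)
  then have "N * (N + s) \<le> N * ((N + 1) / 2)" by (simp add: power2_eq_square algebra_simps)
  then show False using N by (simp add: s_def field_simps)
 qed
 then show ?thesis using p_nonneg[of y] unfolding N_def by (simp add: abs_square_le_1)
qed

text \<open>The C*-identity doubles exponents, which settles powers of two. Splitting k^(2^j) into
  k^j and the remaining factor carries equality down to every j.\<close>

lemma p_herm_power: assumes "st k = k" shows "p (k ^ j) = (p k) ^ j"
proof (cases "p k = 0")
 case True
 have "p (k ^ Suc i) = 0" for i using p_mult[of k "k ^ i"] True p_nonneg[of "k ^ Suc i"] by (simp del: p_nonneg)
 then show ?thesis using True by (cases j) auto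
next
 case False
 then have K: "0 < p k" using p_nonneg[of k] by linarith
 have hp: "st (k ^ i) = k ^ i" for i by (induction i) (simp_all add: st_mult assms power_commutes)
 have dbl: "p (k ^ (2 ^ i)) = (p k) ^ (2 ^ i)" for i
 proof (induction i)
  case (Suc i)
  have "k ^ (2 ^ Suc i) = k ^ (2 ^ i) * k ^ (2 ^ i)" by (simp add: power_add[symmetric] mult_2)
  then have "p (k ^ (2 ^ Suc i)) = (p (k ^ (2 ^ i)))\<^sup>2" by (simp add: p_herm_sq hp)
  then show ?case by (simp add: Suc power_mult[symmetric] mult.commute)
 qed simp
 have le: "p (k ^ i) \<le> (p k) ^ i" for i
 proof (induction i)
  case (Suc i)
  have "p (k * k ^ i) \<le> p k * (p k) ^ i" by (rule order_trans[OF p_mult]) (use Suc K in \<open>simp add: mult_left_mono\<close>)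
  then show ?case by simp
 qed simp
 have j: "j \<le> 2 ^ j" by (simp add: less_imp_le)
 have "(p k) ^ j * (p k) ^ (2 ^ j - j) = p (k ^ j * k ^ (2 ^ j - j))" using j dbl[of j] by (simp flip: power_add)
 also have "\<dots> \<le> p (k ^ j) * (p k) ^ (2 ^ j - j)" by (rule order_trans[OF p_mult]) (simp add: mult_left_mono le)
 finally have "(p k) ^ j \<le> p (k ^ j)" using K by simp
 then show ?thesis using le[of j] by simp
qed

text \<open>Scale so that h = \<open>st x' * x'\<close> has norm at most 1; then k = 1 - h must be
  shown to have norm at most 1. The elements h k^(2m) have the form \<open>st y * y\<close> and lie
  below 1, so their norms are at most 1. But h k^(2m) = k^(2m) - k^(2m+1), which grows beyond every
  bound if p k > 1.\<close>

theorem Pos_star_mult: "Pos (st x * x)"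
proof -
 define s where "s = p x + 1"
 have s: "0 < s" by (simp add: s_def add_nonneg_pos)
 define x' where "x' = (1/s) *\<^sub>R x"
 have px: "p x' \<le> 1" using s by (simp add: x'_def p_scaleR) (simp add: s_def)
 define h where "h = st x' * x'"
 define k where "k = 1 - h"
 have h: "st h = h" "p h \<le> 1" using px by (simp_all add: h_def st_mult p_cstar abs_square_le_1)
 have k: "st k = k" by (simp add: k_def st_diff h)
 have Pk: "Pos k" using Pos_diff[OF h] by (simp add: k_def)
 have hk: "h * k ^ i = k ^ i * h" for i by (rule power_commuting_commutes[symmetric]) (simp add: k_def algebra_simps)
 have kp: "st (k ^ i) = k ^ i" for i by (induction i) (simp_all add: st_mult k power_commutes)
 \<comment> \<open>The increment from m to m + 1 is h k^(2m) (1 - k^2). Because 1 - k = h, it equals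
   \<open>?g * (1 + k) * ?g\<close>, which is positive by \<open>Pos_mult_sq\<close>.\<close>
 have P: "Pos (h - h * k ^ (2 * m))" for m
 proof (induction m)
  case (Suc m)
  let ?g = "h * k ^ m"
  have "k * (h * k ^ m) = h * k ^ m * k" by (metis hk power_one_right mult.assoc power_commutes)
  then have "Pos (?g * (1 + k) * ?g)" by (intro Pos_mult_sq) (use Pos_add[OF Pos_of_real[of 1] Pk] in \<open>simp_all add: st_mult h kp hk algebra_simps\<close>)
  then have "Pos ((h - h * k ^ (2 * m)) + ?g * (1 + k) * ?g)" by (intro Pos_add Suc)
  also have "?g * (1 + k) * ?g = h * k ^ (2 * m) - h * k ^ (2 * Suc m)"
  proof -
   have "?g * (1 + k) * ?g = h * (1 + k) * k ^ m * (k ^ m * h)"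
    by (metis (no_types, lifting) hk mult.assoc power_commutes distrib_left distrib_right mult.right_neutral mult_1)
   also have "\<dots> = h * ((1 + k) * h) * (k ^ m * k ^ m)" by (metis (no_types, lifting) hk mult.assoc)
   also have "(1 + k) * h = 1 - k * k" by (simp add: k_def algebra_simps mult_2)
   also have "h * (1 - k * k) * (k ^ m * k ^ m) = h * (k ^ m * k ^ m) - h * ((k * k) * (k ^ m * k ^ m))" by (simp add: algebra_simps)
   also have "k ^ m * k ^ m = k ^ (2 * m)" by (simp add: mult_2 power_add)
   also have "(k * k) * k ^ (2 * m) = k ^ (2 * Suc m)" by (simp add: mult.assoc)
   finally show ?thesis .
  qed
  finally show ?case by simp
 qed (use Pos_of_real[of 0] in simp)
 have small: "p (h * k ^ (2 * m)) \<le> 1" for m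
 proof -
  let ?y = "x' * k ^ m"
  have y: "st ?y * ?y = h * k ^ (2 * m)"
  proof -
   have "st ?y * ?y = k ^ m * h * k ^ m" by (simp add: st_mult kp h_def mult.assoc)
   then show ?thesis by (simp add: hk[symmetric] mult.assoc mult_2 power_add)
  qed
  have "Pos ((1 - h) + (h - h * k ^ (2 * m)))" by (intro Pos_add P) (use Pk in \<open>simp add: k_def\<close>)
  then have "Pos (1 - st ?y * ?y)" unfolding y by simp
  then have "p ?y \<le> 1" by (rule norm_le_one_of_square_le_one)
  then show ?thesis using p_cstar[of ?y] by (simp add: y abs_square_le_1)
 qed
 have "p k \<le> 1"
 proof (rule ccontr)
  assume "\<not> p k \<le> 1"
  then have K: "1 < p k" by simp
  define d where "d = p k - 1"
  have d: "0 < d" using K by (simp add: d_def)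
  \<comment> \<open>Norms of powers of k are exact powers of p k, so (1 + d)^(2m) d stays below 1
    for all m; Bernoulli's inequality makes this visibly impossible.\<close>
  have "(1 + 2 * real m * d) * d \<le> 1" for m
  proof -
   have "h * k ^ (2 * m) = k ^ (2 * m) - k ^ Suc (2 * m)" by (simp add: k_def algebra_simps)
   then have "p (k ^ Suc (2 * m)) \<le> p (k ^ (2 * m)) + 1"
    using small[of m] p_tri_diff[of "k ^ Suc (2 * m)" "k ^ (2 * m)"] p_commute[of "k ^ Suc (2 * m)"] by simp
   then have "p k ^ (2 * m) * d \<le> 1" unfolding p_herm_power[OF k] d_def by (simp add: algebra_simps)
   moreover have "1 + real (2 * m) * d \<le> (1 + d) ^ (2 * m)" by (rule Bernoulli_inequality) (use d in simp)
   then have "(1 + real (2 * m) * d) * d \<le> (1 + d) ^ (2 * m) * d" using d by (intro mult_right_mono) auto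
   ultimately show ?thesis by (simp add: d_def)
  qed
  moreover obtain m :: nat where "1 / (2 * d * d) < m" using reals_Archimedean2 by blast
  then have "1 < real m * (2 * d * d)" using d by (simp add: divide_less_eq)
  then have "1 < (1 + 2 * real m * d) * d" using d by (simp add: algebra_simps)
  ultimately show False by (meson linorder_not_le)
 qed
 then have "Pos h" using h unfolding Pos_def k_def by (intro conjI exI[of _ 1]) auto
 then have "Pos (s\<^sup>2 *\<^sub>R h)" by (rule Pos_scaleR) simp
 moreover have "s\<^sup>2 *\<^sub>R h = st x * x" using s by (simp add: h_def x'_def st_scaleR power2_eq_square)
 ultimately show ?thesis by simp
qed

lemma Pos_conj: assumes "Pos u" shows "Pos (st w * u * w)"
proof (rule Pos_closed)
 show "st (st w * u * w) = st w * u * w" using assms by (simp add: st_mult Pos_herm mult.assoc)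
 fix e :: real assume e: "0 < e"
 define f where "f = e / ((p w)\<^sup>2 + 1)"
 have p1: "0 < (p w)\<^sup>2 + 1" by (simp add: add_nonneg_pos)
 then have f0: "0 < f" using e by (simp add: f_def)
 have "((p w)\<^sup>2 + 1) * f = e" using p1 by (simp add: f_def)
 with f0 have f: "0 < f" "(p w)\<^sup>2 * f < e" by (simp_all add: distrib_right)
 obtain c where c: "st c = c" "p (u - c * c) < f" using Pos_approx[OF assms f(1)] by metis
 have "Pos (st (c * w) * (c * w))" by (rule Pos_star_mult)
 moreover have "p (st w * u * w - st (c * w) * (c * w)) < e"
 proof -
  have "st w * u * w - st (c * w) * (c * w) = st w * (u - c * c) * w" by (simp add: algebra_simps st_mult c)
  also have "p \<dots> \<le> p (st w) * p (u - c * c) * p w" by (rule order_trans[OF p_mult]) (intro mult_right_mono p_mult p_nonneg)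
  also have "\<dots> = (p w)\<^sup>2 * p (u - c * c)" by (simp add: power2_eq_square)
  also have "\<dots> \<le> (p w)\<^sup>2 * f" using c(2) by (intro mult_left_mono) auto
  finally show ?thesis using f by linarith
 qed
 ultimately show "\<exists>h. Pos h \<and> p (st w * u * w - h) < e" by metis
qed

definition re :: "'w \<Rightarrow> 'w" where "re w = (1/2) *\<^sub>R (w + st w)"

lemma re_herm [simp]: "st (re w) = re w" by (simp add: re_def st_scaleR st_add add.commute)

lemma re_id: "st w = w \<Longrightarrow> re w = w" by (simp add: re_def flip: scaleR_2)

lemma re_add: "re (x + y) = re x + re y" by (simp add: re_def st_add algebra_simps)

lemma re_scaleR: "re (r *\<^sub>R x) = r *\<^sub>R re x" by (simp add: re_def st_scaleR algebra_simps)

text \<open>In a C*-algebra this is the top of the spectrum of the real part of w. It is sublinear,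
  and its linear minorants are the real parts of states.\<close>

definition upper :: "'w \<Rightarrow> real" where
 "upper w = Inf {t. Pos (of_real t - re w)}"

text \<open>Keeps the infimum in \<open>upper\<close> finite.\<close>

lemma upper_bound: assumes "st h = h" "Pos (of_real t - h)" shows "- p h \<le> t"
proof (rule ccontr)
 assume "\<not> - p h \<le> t"
 then have t: "p h \<le> - t" by simp
 have "Pos (of_real (- t) + h)" by (rule Pos_plus) (use assms t in auto)
 then have "p (of_real t - h) = 0" using Pos_mono[OF assms(2), of "of_real (-t) + h"] p_nonneg[of "of_real t - h"] by simp
 then have "\<bar>t\<bar> \<le> p h" using p_tri_diff[of "of_real t" h] by simp
 moreover have "p h = 0 \<or> t < 0" using t p_nonneg[of h] by linarith
 ultimately show False using \<open>\<not> - p h \<le> t\<close> by linarith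
qed

lemma upper_le: "Pos (of_real t - re w) \<Longrightarrow> upper w \<le> t"
 unfolding upper_def by (intro cInf_lower bdd_belowI[of _ "- p (re w)"]) (auto intro: upper_bound)

lemma upper_approx: assumes "upper w < s" obtains t where "t < s" "Pos (of_real t - re w)"
proof -
 have "Pos (of_real (p (re w)) - re w)" by (intro Pos_diff) auto
 then have "{t. Pos (of_real t - re w)} \<noteq> {}" by blast
 then show ?thesis using cInf_lessD[of "{t. Pos (of_real t - re w)}" s] assms that unfolding upper_def by blast
qed

lemma upper_add: "upper (x + y) \<le> upper x + upper y"
proof (rule field_le_epsilon)
 fix e :: real assume "0 < e"
 then have "upper x < upper x + e/2" "upper y < upper y + e/2" by auto
 then obtain s t where st: "s < upper x + e/2" "Pos (of_real s - re x)" "t < upper y + e/2" "Pos (of_real t - re y)" by (metis upper_approx)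
 have "Pos ((of_real s - re x) + (of_real t - re y))" by (intro Pos_add st)
 then have "upper (x + y) \<le> s + t" by (intro upper_le) (simp add: re_add algebra_simps)
 then show "upper (x + y) \<le> upper x + upper y + e" using st by linarith
qed

lemma upper_scaleR_le: assumes "0 < r" shows "upper (r *\<^sub>R x) \<le> r * upper x"
proof (rule field_le_epsilon)
 fix e :: real assume "0 < e"
 then have "upper x < upper x + e/r" using assms by simp
 then obtain s where st: "s < upper x + e/r" "Pos (of_real s - re x)" by (metis upper_approx)
 have "Pos (r *\<^sub>R (of_real s - re x))" by (intro Pos_scaleR st) (use assms in simp)
 then have "upper (r *\<^sub>R x) \<le> r * s" by (intro upper_le) (simp add: re_scaleR algebra_simps of_real_def)
 also have "\<dots> \<le> r * (upper x + e/r)" using st assms by (intro mult_left_mono) auto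
 finally show "upper (r *\<^sub>R x) \<le> r * upper x + e" using assms by (simp add: distrib_left)
qed

lemma upper_le_p: "st h = h \<Longrightarrow> upper h \<le> p h" by (intro upper_le) (simp add: re_id Pos_diff)

text \<open>Together with \<open>upper_le_p\<close> this identifies \<open>upper\<close> with p on
  positive elements, so a state attaining \<open>upper\<close> at such an element attains its
  norm.\<close>

lemma p_le_upper: assumes "Pos a" shows "p a \<le> upper a"
proof (rule field_le_epsilon)
 fix e :: real assume "0 < e"
 then have "upper a < upper a + e" by simp
 then obtain t where t: "t < upper a + e" "Pos (of_real t - re a)" by (metis upper_approx)
 have "Pos (of_real t - a)" using t assms by (simp add: re_id Pos_herm)
 then have "Pos a" "Pos (of_real \<bar>t\<bar> - a)" using assms Pos_add[OF _ Pos_of_real[of "\<bar>t\<bar> - t"], of "of_real t - a"] by (auto simp: algebra_simps)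
 then have 1: "p a \<le> \<bar>t\<bar>" by (intro Pos_le_norm) auto
 have "0 \<le> t"
 proof (rule ccontr)
  assume "\<not> 0 \<le> t"
  then have "Pos (of_real (- t))" by (intro Pos_of_real) auto
  moreover have "Pos (of_real t)" using Pos_add[OF \<open>Pos (of_real t - a)\<close> assms] by simp
  ultimately have "p (of_real t) \<le> p (of_real t + of_real (- t))" by (intro Pos_mono)
  then show False using \<open>\<not> 0 \<le> t\<close> by simp
 qed
 then show "p a \<le> upper a + e" using 1 t by simp
qed

text \<open>Only the real part of a state is kept; \<open>phi\<close> later restores the complex
  functional.\<close>

definition state :: "('w \<Rightarrow> real) \<Rightarrow> bool" where
 "state f \<longleftrightarrow> linear f \<and> (\<forall>w. f w \<le> upper w)"

lemma state_st: assumes "state f" shows "f (st w) = f w"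
proof -
 interpret linear f using assms by (simp add: state_def)
 have "upper w \<le> 0" if "st w = - w" for w by (rule upper_le) (use that Pos_of_real[of 0] in \<open>simp add: re_def\<close>)
 then have "f (w - st w) \<le> 0" "f (st w - w) \<le> 0" using assms unfolding state_def by (metis order_trans st_diff st_st minus_diff_eq)+
 then show ?thesis by (simp add: diff)
qed

lemma state_Pos: assumes "state f" "Pos h" shows "0 \<le> f h"
proof -
 interpret linear f using assms by (simp add: state_def)
 have "upper (- h) \<le> 0" using assms(2) by (intro upper_le) (simp add: re_id Pos_herm st_minus)
 then have "f (- h) \<le> 0" using assms unfolding state_def by (metis order_trans)
 then show ?thesis by (simp add: neg)
qed

lemma state_one: assumes "state f" shows "f 1 = 1"
proof -
 interpret linear f using assms by (simp add: state_def)
 have "upper 1 \<le> 1" using upper_le_p[of 1] by simp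
 moreover have "upper (- 1) \<le> - 1" by (rule upper_le) (use Pos_of_real[of 0] in \<open>simp add: re_id st_minus\<close>)
 ultimately have "f 1 \<le> 1" "f (- 1) \<le> - 1" using assms unfolding state_def by (metis order_trans)+
 then show ?thesis by (simp add: neg)
qed

text \<open>Elements satisfying \<open>Pos\<close> are merely limits of squares; the bound by C
  extends nonnegativity from \<open>st w * w\<close> to them.\<close>

lemma stateI:
 assumes "linear g" "\<And>w. g (st w) = g w" "g 1 = 1" "\<And>w. 0 \<le> g (st w * w)" "\<And>w. \<bar>g w\<bar> \<le> C * p w"
 shows "state g" unfolding state_def
proof (intro conjI allI assms(1))
 interpret linear g by fact
 have pos: "0 \<le> g u" if u: "Pos u" for u
 proof (rule field_le_epsilon)
  fix e :: real assume e: "0 < e"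
  define f where "f = e / (\<bar>C\<bar> + 1)"
  have f: "0 < f" "\<bar>C\<bar> * f \<le> e" using e by (auto simp: f_def field_simps add_nonneg_pos)
  obtain c where c: "st c = c" "p (u - c * c) < f" using Pos_approx[OF u f(1)] by metis
  have "0 \<le> g (c * c)" using assms(4)[of c] c by simp
  moreover have "\<bar>g (u - c * c)\<bar> \<le> \<bar>C\<bar> * f" by (rule order_trans[OF assms(5)], rule mult_mono) (use c in auto)
  ultimately show "0 \<le> g u + e" using f by (simp add: diff abs_le_iff)
 qed
 fix w
 show "g w \<le> upper w"
 proof (rule field_le_epsilon)
  fix e :: real assume "0 < e"
  then have "upper w < upper w + e" by simp
  then obtain t where t: "t < upper w + e" "Pos (of_real t - re w)" by (metis upper_approx)
  have "g (of_real t - re w) = t - g w" using assms(2)[of w] by (simp add: diff add scaleR re_def of_real_def assms(3))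
  then show "g w \<le> upper w + e" using pos[OF t(2)] t(1) by simp
 qed
qed

end

section \<open>Extreme linear minorants of a sublinear functional\<close>

definition sublin :: "('v::real_vector \<Rightarrow> real) \<Rightarrow> bool" where
 "sublin Q \<longleftrightarrow> (\<forall>x y. Q (x + y) \<le> Q x + Q y) \<and> (\<forall>r>0. \<forall>x. Q (r *\<^sub>R x) \<le> r * Q x)"

text \<open>The support function of a face: for sublinear Q, a linear g lies below
  \<open>tilt Q v\<close> exactly if it lies below Q and g v = Q v.\<close>

definition tilt :: "('v::real_vector \<Rightarrow> real) \<Rightarrow> 'v \<Rightarrow> 'v \<Rightarrow> real" where
 "tilt Q v x = (INF s\<in>{0..}. Q (x + s *\<^sub>R v) - s * Q v)"

lemma sublin_scaleR: assumes "sublin Q" "0 < r" shows "Q (r *\<^sub>R x) = r * Q x"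
proof -
 have "Q ((1/r) *\<^sub>R r *\<^sub>R x) \<le> (1/r) * Q (r *\<^sub>R x)" using assms unfolding sublin_def by (metis divide_pos_pos zero_less_one)
 then have "r * Q x \<le> Q (r *\<^sub>R x)" using assms by (simp add: field_simps)
 then show ?thesis using assms unfolding sublin_def by (simp add: order_antisym)
qed

lemma sublin_zero: assumes "sublin Q" shows "Q 0 = 0" using sublin_scaleR[OF assms, of 2 0] by simp

lemma sublin_scaleR0: assumes "sublin Q" "0 \<le> r" shows "Q (r *\<^sub>R x) = r * Q x" using assms sublin_scaleR[of Q r] sublin_zero by (cases "r = 0") auto

lemma sublin_neg: assumes "sublin Q" shows "- Q (- x) \<le> Q x"
proof -
 have "Q (x + - x) \<le> Q x + Q (- x)" using assms unfolding sublin_def by blast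
 then show ?thesis using sublin_zero[OF assms] by simp
qed

lemma tilt_lower: assumes "sublin Q" "0 \<le> s" shows "- Q (- x) \<le> Q (x + s *\<^sub>R v) - s * Q v"
proof -
 have "Q ((x + s *\<^sub>R v) + (- x)) \<le> Q (x + s *\<^sub>R v) + Q (- x)" using assms unfolding sublin_def by blast
 then show ?thesis using sublin_scaleR0[OF assms] by simp
qed

lemma tilt_bdd: assumes "sublin Q" shows "bdd_below ((\<lambda>s. Q (x + s *\<^sub>R v) - s * Q v) ` {0..})"
 by (rule bdd_belowI2[of _ "- Q (- x)"]) (use tilt_lower[OF assms] in auto)

lemma tilt_le: assumes "sublin Q" "0 \<le> s" shows "tilt Q v x \<le> Q (x + s *\<^sub>R v) - s * Q v"
 unfolding tilt_def by (rule cINF_lower[OF tilt_bdd[OF assms(1)]]) (use assms in simp)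

lemma tilt_approx: assumes "tilt Q v x < t" obtains s where "0 \<le> s" "Q (x + s *\<^sub>R v) - s * Q v < t"
 using cInf_lessD[of "(\<lambda>s. Q (x + s *\<^sub>R v) - s * Q v) ` {0..}" t] assms unfolding tilt_def by auto

lemma tilt_le_self: "sublin Q \<Longrightarrow> tilt Q v x \<le> Q x" using tilt_le[of Q 0 v x] by simp

lemma tilt_neg: "sublin Q \<Longrightarrow> tilt Q v (- v) \<le> - Q v" using tilt_le[of Q 1 v "- v"] by (simp add: sublin_zero)

lemma sublin_tilt: assumes Q: "sublin Q" shows "sublin (tilt Q v)" unfolding sublin_def
proof (intro conjI allI impI)
 fix x y
 show "tilt Q v (x + y) \<le> tilt Q v x + tilt Q v y"
 proof (rule field_le_epsilon)
  fix e :: real assume "0 < e"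
  then have "tilt Q v x < tilt Q v x + e/2" "tilt Q v y < tilt Q v y + e/2" by auto
  then obtain s t where st: "0 \<le> s" "Q (x + s *\<^sub>R v) - s * Q v < tilt Q v x + e/2"
   "0 \<le> t" "Q (y + t *\<^sub>R v) - t * Q v < tilt Q v y + e/2" by (metis tilt_approx)
  have "tilt Q v (x + y) \<le> Q ((x + y) + (s + t) *\<^sub>R v) - (s + t) * Q v" using st by (intro tilt_le Q) auto
  also have "(x + y) + (s + t) *\<^sub>R v = (x + s *\<^sub>R v) + (y + t *\<^sub>R v)" by (simp add: algebra_simps)
  also have "Q \<dots> \<le> Q (x + s *\<^sub>R v) + Q (y + t *\<^sub>R v)" using Q unfolding sublin_def by blast
  finally show "tilt Q v (x + y) \<le> tilt Q v x + tilt Q v y + e" using st by (simp add: algebra_simps)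
 qed
next
 fix r :: real and x assume r: "0 < r"
 show "tilt Q v (r *\<^sub>R x) \<le> r * tilt Q v x"
 proof (rule field_le_epsilon)
  fix e :: real assume "0 < e"
  then have "tilt Q v x < tilt Q v x + e/r" using r by simp
  then obtain s where st: "0 \<le> s" "Q (x + s *\<^sub>R v) - s * Q v < tilt Q v x + e/r" by (metis tilt_approx)
  have "tilt Q v (r *\<^sub>R x) \<le> Q (r *\<^sub>R x + (r * s) *\<^sub>R v) - (r * s) * Q v" using st r by (intro tilt_le Q) auto
  also have "r *\<^sub>R x + (r * s) *\<^sub>R v = r *\<^sub>R (x + s *\<^sub>R v)" by (simp add: algebra_simps)
  also have "Q \<dots> - (r * s) * Q v = r * (Q (x + s *\<^sub>R v) - s * Q v)" by (subst sublin_scaleR[OF Q r]) (simp add: right_diff_distrib)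
  also have "\<dots> \<le> r * (tilt Q v x + e/r)" using st r by (intro mult_left_mono) auto
  finally show "tilt Q v (r *\<^sub>R x) \<le> r * tilt Q v x + e" using r by (simp add: distrib_left)
 qed
qed

text \<open>Sublinear minorants of \<open>P\<close> whose linear minorants form a face of those of \<open>P\<close>. Tilting
 passes to the subface where \<open>v\<close> is maximal, so a minimal one is linear and extreme.\<close>

definition facial :: "('v::real_vector \<Rightarrow> real) \<Rightarrow> ('v \<Rightarrow> real) \<Rightarrow> bool" where
 "facial P Q \<longleftrightarrow> sublin Q \<and> (\<forall>x. Q x \<le> P x) \<and>
   (\<forall>g1 g2. linear g1 \<and> linear g2 \<and> (\<forall>x. g1 x \<le> P x) \<and> (\<forall>x. g2 x \<le> P x) \<and>
    (\<forall>x. g1 x + g2 x \<le> 2 * Q x) \<longrightarrow> (\<forall>x. g1 x \<le> Q x \<and> g2 x \<le> Q x))"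

text \<open>If the mean of g1 and g2 lies below the tilt, both must take the value Q v at v. For
  such a functional g (x + s v) - s Q v = g x, so g lies below each term of the infimum.\<close>

lemma facial_tilt: assumes "facial P Q" shows "facial P (tilt Q v)"
proof -
 have Q: "sublin Q" "\<And>x. Q x \<le> P x" using assms by (auto simp: facial_def)
 show ?thesis unfolding facial_def
 proof (intro conjI allI impI sublin_tilt Q)
  show "tilt Q v x \<le> P x" for x using tilt_le_self[OF Q(1), of v x] Q(2)[of x] by linarith
  fix g1 g2 :: "'a \<Rightarrow> real" and x
  assume A: "linear g1 \<and> linear g2 \<and> (\<forall>x. g1 x \<le> P x) \<and> (\<forall>x. g2 x \<le> P x) \<and> (\<forall>x. g1 x + g2 x \<le> 2 * tilt Q v x)"
  interpret g1: linear g1 using A by simp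
  interpret g2: linear g2 using A by simp
  have "\<forall>x. g1 x + g2 x \<le> 2 * Q x"
  proof
   fix x show "g1 x + g2 x \<le> 2 * Q x" using A tilt_le_self[OF Q(1), of v x] by (metis (no_types) add_mono mult_2 order_trans)
  qed
  then have le: "g1 y \<le> Q y" "g2 y \<le> Q y" for y using assms A unfolding facial_def by blast+
  have "g1 (- v) + g2 (- v) \<le> 2 * - Q v" using A tilt_neg[OF Q(1), of v] by (smt (verit))
  then have v: "g1 v = Q v" "g2 v = Q v" using le[of v] by (simp_all add: g1.neg g2.neg)
  show "g1 x \<le> tilt Q v x" unfolding tilt_def by (rule cINF_greatest) (use le[of "x + _ *\<^sub>R v"] v in \<open>auto simp: g1.add g1.scaleR le_diff_eq\<close>)
  show "g2 x \<le> tilt Q v x" unfolding tilt_def by (rule cINF_greatest) (use le[of "x + _ *\<^sub>R v"] v in \<open>auto simp: g2.add g2.scaleR le_diff_eq\<close>)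
 qed
qed

lemma facial_Inf:
 assumes C: "C \<noteq> {}" "\<And>Q. Q \<in> C \<Longrightarrow> facial P Q" "\<And>Q R. Q \<in> C \<Longrightarrow> R \<in> C \<Longrightarrow> Q \<le> R \<or> R \<le> Q"
 shows "facial P (\<lambda>x. INF Q\<in>C. Q x)" "\<And>Q x. Q \<in> C \<Longrightarrow> (INF Q\<in>C. Q x) \<le> Q x"
proof -
 have sub: "sublin Q" "Q x \<le> P x" if "Q \<in> C" for Q x using C(2)[OF that] by (auto simp: facial_def)
 have bdd: "bdd_below ((\<lambda>Q. Q x) ` C)" for x by (rule bdd_belowI2[of _ "- P (- x)"]) (use sub sublin_neg in \<open>smt (verit)\<close>)
 show low: "(INF Q\<in>C. Q x) \<le> Q x" if "Q \<in> C" for Q x by (rule cINF_lower[OF bdd that])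
 have ap: "\<exists>Q\<in>C. Q x < t" if "(INF Q\<in>C. Q x) < t" for x t using cInf_lessD[of "(\<lambda>Q. Q x) ` C" t] that C(1) by auto
 show "facial P (\<lambda>x. INF Q\<in>C. Q x)" unfolding facial_def
 proof (intro conjI allI impI)
  obtain Q0 where "Q0 \<in> C" using C(1) by blast
  then show "(INF Q\<in>C. Q x) \<le> P x" for x using low sub by (meson order_trans)
  show "sublin (\<lambda>x. INF Q\<in>C. Q x)" unfolding sublin_def
  proof (intro conjI allI impI)
   fix x y
   show "(INF Q\<in>C. Q (x + y)) \<le> (INF Q\<in>C. Q x) + (INF Q\<in>C. Q y)"
   proof (rule field_le_epsilon)
   fix e :: real assume "0 < e"
   then obtain Q R where QR: "Q \<in> C" "Q x < (INF Q\<in>C. Q x) + e/2" "R \<in> C" "R y < (INF Q\<in>C. Q y) + e/2"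
    using ap[of x "(INF Q\<in>C. Q x) + e/2"] ap[of y "(INF Q\<in>C. Q y) + e/2"] by auto
   \<comment> \<open>The chain contains one S below both near-minimisers; this makes the pointwise
     infimum subadditive.\<close>
   obtain S where S: "S \<in> C" "S \<le> Q" "S \<le> R" using C(3)[OF QR(1,3)] QR by blast
   have "(INF Q\<in>C. Q (x + y)) \<le> S x + S y" using low[OF S(1), of "x + y"] sub(1)[OF S(1)] unfolding sublin_def by (meson order_trans)
   then show "(INF Q\<in>C. Q (x + y)) \<le> (INF Q\<in>C. Q x) + (INF Q\<in>C. Q y) + e" using le_funD[OF S(2), of x] le_funD[OF S(3), of y] QR by linarith
   qed
  next
   fix r :: real and x assume r0: "0 < r"
   show "(INF Q\<in>C. Q (r *\<^sub>R x)) \<le> r * (INF Q\<in>C. Q x)"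
   proof (rule field_le_epsilon)
   fix e :: real assume "0 < e"
   with r0 have r: "0 < r" "0 < e" by auto
   then obtain Q where Q: "Q \<in> C" "Q x < (INF Q\<in>C. Q x) + e/r" using ap[of x "(INF Q\<in>C. Q x) + e/r"] by auto
   have "(INF Q\<in>C. Q (r *\<^sub>R x)) \<le> r * Q x" using low[OF Q(1), of "r *\<^sub>R x"] sub(1)[OF Q(1)] r unfolding sublin_def by (meson order_trans)
   also have "\<dots> \<le> r * ((INF Q\<in>C. Q x) + e/r)" using Q r by (intro mult_left_mono) auto
   finally show "(INF Q\<in>C. Q (r *\<^sub>R x)) \<le> r * (INF Q\<in>C. Q x) + e" using r by (simp add: distrib_left)
   qed
  qed
  fix g1 g2 :: "'a \<Rightarrow> real" and x
  assume A: "linear g1 \<and> linear g2 \<and> (\<forall>x. g1 x \<le> P x) \<and> (\<forall>x. g2 x \<le> P x) \<and> (\<forall>x. g1 x + g2 x \<le> 2 * (INF Q\<in>C. Q x))"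
  have "g1 x \<le> Q x \<and> g2 x \<le> Q x" if "Q \<in> C" for Q
  proof -
   have "\<forall>x. g1 x + g2 x \<le> 2 * Q x" using A low[OF that] by (smt (verit))
   then show ?thesis using C(2)[OF that] A unfolding facial_def by blast
  qed
  then show "g1 x \<le> (INF Q\<in>C. Q x)" "g2 x \<le> (INF Q\<in>C. Q x)" using C(1) by (auto intro!: cINF_greatest)
 qed
qed

text \<open>A Krein-Milman statement that needs no topology on functionals: Zorn's lemma acts on the
  sublinear majorants that describe faces.\<close>

theorem extreme_functional:
 fixes P :: "'v::real_vector \<Rightarrow> real"
 assumes P: "sublin P"
 obtains f where "linear f" "\<And>x. f x \<le> P x" "f v = P v"
  "\<And>g1 g2. linear g1 \<Longrightarrow> linear g2 \<Longrightarrow> (\<And>x. g1 x \<le> P x) \<Longrightarrow> (\<And>x. g2 x \<le> P x) \<Longrightarrow>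
   (\<And>x. g1 x + g2 x = 2 * f x) \<Longrightarrow> g1 = f"
proof -
 \<comment> \<open>The condition at -v is inherited by every smaller functional, and for the final
   linear one it means that P v is attained at v.\<close>
 define F where "F = {Q. facial P Q \<and> Q (- v) \<le> - P v}"
 define ge where "ge = (\<lambda>Q R :: 'v \<Rightarrow> real. R \<le> Q)"
 have "facial P P" using P unfolding facial_def by auto
 then have F0: "tilt P v \<in> F" using facial_tilt tilt_neg[OF P] by (auto simp: F_def)
 have po: "partial_order_on F (relation_of ge F)" unfolding ge_def by (rule partial_order_on_relation_ofI) auto
 have "\<exists>u\<in>F. \<forall>a\<in>C. ge a u" if "C \<in> Chains (relation_of ge F)" for C
 proof (cases "C = {}")
  case True then show ?thesis using F0 by auto
 next
  case False
  have C: "Q \<in> F" "R \<in> C \<Longrightarrow> Q \<le> R \<or> R \<le> Q" if "Q \<in> C" for Q R using \<open>C \<in> _\<close> that unfolding Chains_def relation_of_def ge_def by blast+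
  have f: "facial P Q" if "Q \<in> C" for Q using C(1)[OF that] by (simp add: F_def)
  have "(INF Q\<in>C. Q (- v)) \<le> - P v"
  proof -
   obtain Q where "Q \<in> C" using False by blast
   then show ?thesis using facial_Inf(2)[OF False f C(2), of Q "- v"] C(1)[of Q] by (force simp: F_def)
  qed
  then have "(\<lambda>x. INF Q\<in>C. Q x) \<in> F" using facial_Inf(1)[OF False f C(2)] by (simp add: F_def)
  moreover have "\<forall>a\<in>C. ge a (\<lambda>x. INF Q\<in>C. Q x)" using facial_Inf(2)[OF False f C(2)] by (auto simp: ge_def le_fun_def)
  ultimately show ?thesis by blast
 qed
 then obtain f where f: "f \<in> F" "\<And>Q. Q \<in> F \<Longrightarrow> Q \<le> f \<Longrightarrow> Q = f" using predicate_Zorn[OF po] unfolding ge_def by metis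
 have fs: "sublin f" "\<And>x. f x \<le> P x" "f (- v) \<le> - P v" using f by (auto simp: F_def facial_def)
 \<comment> \<open>By minimality f equals its own tilt in every direction w, so
   \<open>tilt_neg\<close> gives f (- w) \<le> - f w; together with sublinearity f becomes odd,
   hence linear.\<close>
 have neg: "f (- w) = - f w" for w
 proof -
  have "tilt f w (- v) \<le> - P v" using tilt_le_self[OF fs(1), of w "- v"] fs(3) by linarith
  then have "tilt f w \<in> F" using f(1) facial_tilt by (auto simp: F_def)
  moreover have "tilt f w \<le> f" using tilt_le_self[OF fs(1)] by (simp add: le_fun_def)
  ultimately have "tilt f w = f" by (rule f(2))
  then have "f (- w) \<le> - f w" using tilt_neg[OF fs(1), of w] by simp
  then show ?thesis using sublin_neg[OF fs(1), of w] by linarith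
 qed
 have lin: "linear f"
 proof (rule linearI)
  fix x y
  have "f (- x + - y) \<le> f (- x) + f (- y)" "f (x + y) \<le> f x + f y" using fs(1) unfolding sublin_def by blast+
  then show "f (x + y) = f x + f y" using neg[of "x + y"] by (simp add: neg)
 next
  fix r x
  show "f (r *\<^sub>R x) = r *\<^sub>R f x"
   using sublin_scaleR0[OF fs(1), of r x] sublin_scaleR0[OF fs(1), of "- r" x] neg[of "r *\<^sub>R x"] by (cases "0 \<le> r") auto
 qed
 show ?thesis
 proof (rule that[OF lin fs(2)])
  show "f v = P v" using fs(3) fs(2)[of v] neg[of v] by linarith
  fix g1 g2 assume g: "linear g1" "linear g2" "\<And>x. g1 x \<le> P x" "\<And>x. g2 x \<le> P x" "\<And>x. g1 x + g2 x = 2 * f x"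
  have "\<forall>x. g1 x + g2 x \<le> 2 * f x" using g by simp
  then have le: "g1 x \<le> f x" for x using f(1) g(1-4) unfolding F_def facial_def by blast
  show "g1 = f"
  proof
   fix x show "g1 x = f x" using le[of x] le[of "- x"] neg[of x] linear_neg[OF g(1), of x] by simp
  qed
 qed
qed

section \<open>Inner products on carrier sets and orthogonal projection\<close>

text \<open>Definiteness is left out so that the GNS form of a state and the form l - M at a top
  eigenvalue are covered. Vector space laws are not assumed either: identities between vectors are
  replaced by equality of inner products, as in \<open>nm_cong\<close>.\<close>

locale semi_ip =
 fixes V :: "'v set" and add :: "'v \<Rightarrow> 'v \<Rightarrow> 'v" and sm :: "complex \<Rightarrow> 'v \<Rightarrow> 'v" and ip :: "'v \<Rightarrow> 'v \<Rightarrow> complex"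
 assumes add_cl [simp]: "x \<in> V \<Longrightarrow> y \<in> V \<Longrightarrow> add x y \<in> V"
  and sm_cl [simp]: "x \<in> V \<Longrightarrow> sm c x \<in> V"
  and ip_add [simp]: "x \<in> V \<Longrightarrow> y \<in> V \<Longrightarrow> w \<in> V \<Longrightarrow> ip (add x y) w = ip x w + ip y w"
  and ip_sm [simp]: "x \<in> V \<Longrightarrow> y \<in> V \<Longrightarrow> ip (sm c x) y = c * ip x y"
  and ip_cnj: "x \<in> V \<Longrightarrow> y \<in> V \<Longrightarrow> ip y x = cnj (ip x y)"
  and ip_pos: "x \<in> V \<Longrightarrow> 0 \<le> Re (ip x x)"
begin

definition nm :: "'v \<Rightarrow> real" where "nm x = sqrt (Re (ip x x))"
definition sub :: "'v \<Rightarrow> 'v \<Rightarrow> 'v" where "sub x y = add x (sm (-1) y)"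

lemma sub_cl [simp]: "x \<in> V \<Longrightarrow> y \<in> V \<Longrightarrow> sub x y \<in> V" by (simp add: sub_def)

lemma ip_sub [simp]: "x \<in> V \<Longrightarrow> y \<in> V \<Longrightarrow> w \<in> V \<Longrightarrow> ip (sub x y) w = ip x w - ip y w" by (simp add: sub_def)

lemma ip_add2 [simp]: "x \<in> V \<Longrightarrow> y \<in> V \<Longrightarrow> w \<in> V \<Longrightarrow> ip w (add x y) = ip w x + ip w y" by (metis add_cl complex_cnj_add ip_add ip_cnj)

lemma ip_sm2 [simp]: "x \<in> V \<Longrightarrow> y \<in> V \<Longrightarrow> ip x (sm c y) = cnj c * ip x y" by (metis sm_cl complex_cnj_mult ip_sm ip_cnj)

lemma ip_sub2 [simp]: "x \<in> V \<Longrightarrow> y \<in> V \<Longrightarrow> w \<in> V \<Longrightarrow> ip w (sub x y) = ip w x - ip w y" by (simp add: sub_def)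

lemma ip_im: "x \<in> V \<Longrightarrow> Im (ip x x) = 0" using arg_cong[OF ip_cnj[of x x], of Im] by simp

lemma nm_nonneg [simp]: "x \<in> V \<Longrightarrow> 0 \<le> nm x" by (simp add: nm_def ip_pos)

lemma nm_sq: "x \<in> V \<Longrightarrow> (nm x)\<^sup>2 = Re (ip x x)" by (simp add: nm_def ip_pos)

lemma ip_self: "x \<in> V \<Longrightarrow> ip x x = of_real ((nm x)\<^sup>2)" by (simp add: nm_sq complex_eq_iff ip_im)

lemma nm_sq_add: "x \<in> V \<Longrightarrow> y \<in> V \<Longrightarrow> (nm (add x y))\<^sup>2 = (nm x)\<^sup>2 + (nm y)\<^sup>2 + 2 * Re (ip x y)" using ip_cnj[of x y] by (simp add: nm_sq)

lemma nm_sq_sub: "x \<in> V \<Longrightarrow> y \<in> V \<Longrightarrow> (nm (sub x y))\<^sup>2 = (nm x)\<^sup>2 + (nm y)\<^sup>2 - 2 * Re (ip x y)" using ip_cnj[of x y] by (simp add: nm_sq)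

lemma nm_sm: assumes "x \<in> V" shows "nm (sm c x) = cmod c * nm x"
proof -
 have "ip (sm c x) (sm c x) = of_real ((cmod c)\<^sup>2) * ip x x" using assms unfolding complex_norm_square by simp
 then show ?thesis unfolding nm_def by (simp add: real_sqrt_mult)
qed

text \<open>The squared norm of x - t b y with b = \<open>ip x y\<close> is a quadratic in the real
  number t that stays nonnegative.\<close>

lemma Cauchy_Schwarz: assumes xy: "x \<in> V" "y \<in> V" shows "cmod (ip x y) \<le> nm x * nm y"
proof -
 define b where "b = ip x y"
 have q: "0 \<le> (nm x)\<^sup>2 - 2 * t * (cmod b)\<^sup>2 + t\<^sup>2 * (cmod b)\<^sup>2 * (nm y)\<^sup>2" for t :: real
 proof -
  let ?c = "- of_real t * b"
  have 1: "Re (ip x (sm ?c y)) = - t * (cmod b)\<^sup>2"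
  proof -
   have "ip x (sm ?c y) = - of_real t * (b * cnj b)" using xy by (simp add: b_def)
   then show ?thesis by (simp add: complex_norm_square[symmetric])
  qed
  have 2: "(nm (sm ?c y))\<^sup>2 = t\<^sup>2 * (cmod b)\<^sup>2 * (nm y)\<^sup>2" using xy by (simp add: nm_sm norm_mult power_mult_distrib)
  have "(nm x)\<^sup>2 - 2 * t * (cmod b)\<^sup>2 + t\<^sup>2 * (cmod b)\<^sup>2 * (nm y)\<^sup>2 = (nm (add x (sm ?c y)))\<^sup>2"
   using nm_sq_add[of x "sm ?c y"] xy unfolding 1 2 by simp
  then show ?thesis by (metis zero_le_power2)
 qed
 have "(cmod b)\<^sup>2 \<le> (nm x * nm y)\<^sup>2"
 proof (cases "nm y = 0")
  case True
  have "(cmod b)\<^sup>2 = 0"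
  proof (rule ccontr)
   assume "(cmod b)\<^sup>2 \<noteq> 0"
   then have b: "0 < (cmod b)\<^sup>2" by simp
   \<comment> \<open>With \<open>nm y = 0\<close> the quadratic is affine in t, and this t would
     make it negative.\<close>
   have "0 \<le> (nm x)\<^sup>2 - 2 * ((nm x)\<^sup>2 / (cmod b)\<^sup>2 + 1) * (cmod b)\<^sup>2" using q[of "(nm x)\<^sup>2 / (cmod b)\<^sup>2 + 1"] True by simp
   then have "0 \<le> - (nm x)\<^sup>2 - 2 * (cmod b)\<^sup>2" using b by (simp add: distrib_right distrib_left)
   then show False using b by (smt (verit) zero_le_power2)
  qed
  then show ?thesis by simp
 next
  case False
  then have y: "0 < (nm y)\<^sup>2" by simp
  have "(1 / N)\<^sup>2 * B * N = B / N" if "0 < N" for N B :: real using that by (simp add: power2_eq_square)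
  from this[OF y] have "0 \<le> (nm x)\<^sup>2 - (cmod b)\<^sup>2 / (nm y)\<^sup>2" using q[of "1 / (nm y)\<^sup>2"] by simp
  then show ?thesis using y by (simp add: power_mult_distrib field_simps)
 qed
 then show ?thesis using xy unfolding b_def by (simp add: abs_le_square_iff[symmetric])
qed

lemma nm_tri: assumes xy: "x \<in> V" "y \<in> V" shows "nm (add x y) \<le> nm x + nm y"
proof -
 have "Re (ip x y) \<le> nm x * nm y" using Cauchy_Schwarz[OF xy] complex_Re_le_cmod[of "ip x y"] by linarith
 then have "(nm (add x y))\<^sup>2 \<le> (nm x + nm y)\<^sup>2" using nm_sq_add[OF xy] by (simp add: power2_sum)
 then show ?thesis using xy by (simp add: abs_le_square_iff[symmetric])
qed

lemma nm_cong: "x \<in> V \<Longrightarrow> y \<in> V \<Longrightarrow> ip x x = ip y y \<Longrightarrow> nm x = nm y" by (simp add: nm_def)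

lemma nm_sub_comm: assumes "x \<in> V" "y \<in> V" shows "nm (sub x y) = nm (sub y x)" using assms by (intro nm_cong) auto

lemma nm_sub_tri: assumes "x \<in> V" "y \<in> V" "w \<in> V" shows "nm (sub x w) \<le> nm (sub x y) + nm (sub y w)"
proof -
 have "nm (sub x w) = nm (add (sub x y) (sub y w))" using assms by (intro nm_cong) (auto simp: algebra_simps)
 then show ?thesis using nm_tri[of "sub x y" "sub y w"] assms by simp
qed

lemma nm_tri_sub: assumes "x \<in> V" "y \<in> V" shows "nm x \<le> nm y + nm (sub x y)"
proof -
 have "nm x = nm (add y (sub x y))" using assms by (intro nm_cong) (auto simp: algebra_simps)
 then show ?thesis using nm_tri[of y "sub x y"] assms by simp
qed

lemma ip_tendsto:
 assumes "\<And>k. s k \<in> V" "l \<in> V" "w \<in> V" "(\<lambda>k. nm (sub (s k) l)) \<longlonglongrightarrow> 0"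
 shows "(\<lambda>k. ip (s k) w) \<longlonglongrightarrow> ip l w"
proof -
 have "(\<lambda>k. ip (s k) w - ip l w) \<longlonglongrightarrow> 0"
 proof (rule Lim_null_comparison)
  show "\<forall>\<^sub>F k in sequentially. norm (ip (s k) w - ip l w) \<le> nm (sub (s k) l) * nm w"
   using Cauchy_Schwarz[of "sub (s _) l" w] assms by (auto intro!: always_eventually)
  show "(\<lambda>k. nm (sub (s k) l) * nm w) \<longlonglongrightarrow> 0" using tendsto_mult_left_zero[OF assms(4)] .
 qed
 then show ?thesis by (simp add: LIM_zero_iff)
qed

end

locale hilb =
 fixes H :: "'h hilb"
 assumes hilb: "hilbert_space H"
begin

abbreviation "HC \<equiv> hs_carrier H"

sublocale semi_ip "HC" "hs_add H" "hs_smul H" "hs_inner H"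
proof -
 let ?V = "HC"
 have 1: "\<forall>x\<in>?V. \<forall>y\<in>?V. hs_add H x y \<in> ?V" "\<forall>c. \<forall>x\<in>?V. hs_smul H c x \<in> ?V"
  "\<forall>x\<in>?V. \<forall>y\<in>?V. \<forall>w\<in>?V. hs_inner H (hs_add H x y) w = hs_inner H x w + hs_inner H y w"
  "\<forall>c. \<forall>x\<in>?V. \<forall>y\<in>?V. hs_inner H (hs_smul H c x) y = c * hs_inner H x y"
  "\<forall>x\<in>?V. \<forall>y\<in>?V. hs_inner H y x = cnj (hs_inner H x y)"
  "\<forall>x\<in>?V. Im (hs_inner H x x) = 0 \<and> Re (hs_inner H x x) \<ge> 0"
  using hilb unfolding hilbert_space_def complex_vs_def Let_def by - (elim conjE, assumption)+
 show "semi_ip ?V (hs_add H) (hs_smul H) (hs_inner H)"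
 proof
  fix x y assume "x \<in> ?V" "y \<in> ?V"
  then show "hs_inner H y x = cnj (hs_inner H x y)" by (rule 1(5)[rule_format])
 qed (simp_all add: 1(1-4,6))
qed

lemma nm_eq [simp]: "nm = hs_norm H" by (rule ext) (simp add: nm_def hs_norm_def)

lemma zero_cl [simp]: "hs_zero H \<in> HC" using hilb unfolding hilbert_space_def complex_vs_def Let_def by blast

lemma vs: "complex_vs (HC) (hs_zero H) (hs_add H) (hs_smul H)" using hilb unfolding hilbert_space_def Let_def by blast

lemma ip_definite: "x \<in> HC \<Longrightarrow> hs_inner H x x = 0 \<Longrightarrow> x = hs_zero H" using hilb unfolding hilbert_space_def Let_def by blast

lemma sub_eq_zero: assumes "x \<in> HC" "y \<in> HC" "sub x y = hs_zero H" shows "x = y"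
proof -
 have "hs_add H (hs_add H x (hs_smul H (-1) y)) y = hs_add H x (hs_add H y (hs_smul H (-1) y))"
  using vs assms(1,2) unfolding complex_vs_def by (smt (verit))
 then show ?thesis using vs assms unfolding complex_vs_def sub_def by metis
qed

lemma ip_eqI:
 assumes "x \<in> HC" "y \<in> HC" "\<And>w. w \<in> HC \<Longrightarrow> hs_inner H x w = hs_inner H y w"
 shows "x = y" by (rule sub_eq_zero) (use assms in \<open>auto intro!: ip_definite\<close>)

lemma ip_zero [simp]: "w \<in> HC \<Longrightarrow> hs_inner H (hs_zero H) w = 0"
proof -
 assume w: "w \<in> HC"
 have "hs_add H (hs_zero H) (hs_zero H) = hs_zero H" using vs unfolding complex_vs_def by blast
 then show ?thesis using ip_add[OF zero_cl zero_cl w] by simp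
qed

lemma ip_zero2 [simp]: "w \<in> HC \<Longrightarrow> hs_inner H w (hs_zero H) = 0" by (metis ip_zero ip_cnj zero_cl complex_cnj_zero)

lemma nm_zero_iff: "x \<in> HC \<Longrightarrow> hs_norm H x = 0 \<longleftrightarrow> x = hs_zero H" using ip_self[of x] ip_definite[of x] by (auto simp: hs_norm_def)

lemma complete:
 assumes "\<And>k. s k \<in> HC" "\<And>e. 0 < e \<Longrightarrow> \<exists>N. \<forall>m\<ge>N. \<forall>k\<ge>N. hs_norm H (sub (s m) (s k)) < e"
 obtains l where "l \<in> HC" "(\<lambda>k. hs_norm H (sub (s k) l)) \<longlonglongrightarrow> 0" using hilb assms unfolding hilbert_space_def Let_def complete_on_def sub_def by blast

lemma closed_subspaceD:
 assumes "closed_subspace H K"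
 shows "K \<subseteq> HC" "hs_zero H \<in> K" "x \<in> K \<Longrightarrow> y \<in> K \<Longrightarrow> hs_add H x y \<in> K" "x \<in> K \<Longrightarrow> hs_smul H c x \<in> K"
  "x \<in> K \<Longrightarrow> y \<in> K \<Longrightarrow> sub x y \<in> K"
  "(\<And>k. s k \<in> K) \<Longrightarrow> l \<in> HC \<Longrightarrow> (\<lambda>k. hs_norm H (sub (s k) l)) \<longlonglongrightarrow> 0 \<Longrightarrow> l \<in> K" using assms unfolding closed_subspace_def sub_def by blast+

text \<open>Midpoints of a minimising sequence stay in K, so the parallelogram law makes the
  sequence Cauchy; its limit is nearest to x, and varying it within K gives orthogonality.\<close>

theorem projection:
 assumes K: "closed_subspace H K" and x: "x \<in> HC"
 obtains k where "k \<in> K" "\<And>w. w \<in> K \<Longrightarrow> hs_inner H (sub x k) w = 0"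
proof -
 note KD = closed_subspaceD[OF K]
 have KV: "\<And>k. k \<in> K \<Longrightarrow> k \<in> HC" using KD(1) by blast
 define D where "D = (\<lambda>k. (hs_norm H (sub x k))\<^sup>2)"
 define d where "d = (INF k\<in>K. D k)"
 have low: "d \<le> D k" if "k \<in> K" for k unfolding d_def by (rule cINF_lower) (auto simp: D_def that intro: bdd_belowI2[of _ 0])
 have "\<exists>k\<in>K. D k < d + 1 / real (Suc m)" for m
 proof -
  have "Inf (D ` K) < d + 1 / real (Suc m)" unfolding d_def by simp
  then show ?thesis using cInf_lessD[of "D ` K"] KD(2) by auto
 qed
 then obtain s where s: "\<And>m. s m \<in> K" "\<And>m. D (s m) < d + 1 / real (Suc m)" by metis
 have sV [simp]: "s m \<in> HC" for m using s(1) KV by blast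
 have par: "(hs_norm H (sub (s m) (s j)))\<^sup>2 \<le> 2 / real (Suc m) + 2 / real (Suc j)" for m j
 proof -
  let ?c = "hs_smul H (1/2) (hs_add H (s m) (s j))"
  have "?c \<in> K" by (intro KD(3,4) s)
  then have "d \<le> D ?c" by (rule low)
  moreover have "(hs_norm H (sub (s m) (s j)))\<^sup>2 = 2 * D (s m) + 2 * D (s j) - 4 * D ?c"
   unfolding D_def nm_eq[symmetric] using x ip_cnj[of x "s m"] ip_cnj[of x "s j"] ip_cnj[of "s m" "s j"]
   by (simp add: nm_sq field_simps del: nm_eq)
  ultimately show ?thesis using s(2)[of m] s(2)[of j] by simp
 qed
 have cau: "\<exists>N. \<forall>m\<ge>N. \<forall>k\<ge>N. hs_norm H (sub (s m) (s k)) < e" if e: "0 < e" for e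
 proof -
  obtain N :: nat where N: "4 / e\<^sup>2 < real N" using reals_Archimedean2 by blast
  have N': "4 < e\<^sup>2 * real N" using N e by (simp add: divide_less_eq mult.commute)
  have N0: "0 < real N" using N' e by (smt (verit) mult_nonneg_nonpos zero_le_power2)
  have sm: "2 / real (Suc m) < e\<^sup>2 / 2" if "N \<le> m" for m
  proof -
   have "2 / real (Suc m) \<le> 2 / real N" using that N0 by (intro divide_left_mono) auto
   also have "\<dots> < e\<^sup>2 / 2" using N' N0 by (simp add: field_simps)
   finally show ?thesis .
  qed
  have "hs_norm H (sub (s m) (s k)) < e" if "N \<le> m" "N \<le> k" for m k
  proof -
   have "(hs_norm H (sub (s m) (s k)))\<^sup>2 < e\<^sup>2" using par[of m k] sm[OF that(1)] sm[OF that(2)] by linarith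
   then show ?thesis using e by (simp add: power_less_imp_less_base)
  qed
  then show ?thesis by blast
 qed
 obtain l where l: "l \<in> HC" "(\<lambda>k. hs_norm H (sub (s k) l)) \<longlonglongrightarrow> 0" using complete[of s] cau sV by metis
 have lK: "l \<in> K" by (rule KD(6)[of s]) (use l s in auto)
 have Dl: "D l \<le> d"
 proof (rule LIMSEQ_le)
  let ?u = "\<lambda>m. (sqrt (d + 1 / real (Suc m)) + hs_norm H (sub (s m) l))\<^sup>2"
  have "(\<lambda>m. 1 / real (Suc m)) \<longlonglongrightarrow> 0" using LIMSEQ_inverse_real_of_nat by (simp add: inverse_eq_divide)
  then have "?u \<longlonglongrightarrow> (sqrt (d + 0) + 0)\<^sup>2" by (intro tendsto_intros l)
  moreover have "0 \<le> d" unfolding d_def by (rule cINF_greatest) (use KD(2) in \<open>auto simp: D_def\<close>)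
  ultimately show "?u \<longlonglongrightarrow> d" by simp
  show "(\<lambda>m. D l) \<longlonglongrightarrow> D l" by simp
  have "D l \<le> ?u m" for m
  proof -
   have "hs_norm H (sub x (s m)) \<le> sqrt (d + 1 / real (Suc m))" using s(2)[of m] unfolding D_def by (simp add: real_le_rsqrt)
   then have "hs_norm H (sub x l) \<le> sqrt (d + 1 / real (Suc m)) + hs_norm H (sub (s m) l)"
    using nm_sub_tri[OF x sV l(1), of m] by (simp del: of_nat_Suc)
   then show ?thesis unfolding D_def using nm_nonneg[of "sub x l"] x l(1) by (intro power_mono) auto
  qed
  then show "\<exists>N. \<forall>n\<ge>N. D l \<le> ?u n" by blast
 qed
 have "hs_inner H (sub x l) w = 0" if w: "w \<in> K" for w
 proof (rule ccontr)
  assume nz: "hs_inner H (sub x l) w \<noteq> 0"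
  define b where "b = hs_inner H (sub x l) w"
  have V: "sub x l \<in> HC" "w \<in> HC" using x l KV w by auto
  have w0: "0 < (hs_norm H w)\<^sup>2"
  proof -
   have "w \<noteq> hs_zero H" using nz V by auto
   then show ?thesis using nm_zero_iff[of w] V by simp
  qed
  \<comment> \<open>The optimal multiple of w: moving l by it lowers the squared distance by |b|^2 /
    |w|^2, which the minimality of l forbids.\<close>
  define c where "c = b / of_real ((hs_norm H w)\<^sup>2)"
  have "hs_add H l (hs_smul H c w) \<in> K" by (intro KD(3,4) lK w)
  then have "d \<le> D (hs_add H l (hs_smul H c w))" by (rule low)
  also have "\<dots> = (nm (sub (sub x l) (hs_smul H c w)))\<^sup>2" unfolding D_def nm_eq[symmetric] using x l(1) V
   by (simp add: nm_sq algebra_simps del: nm_eq)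
  also have "\<dots> = D l + (cmod c)\<^sup>2 * (hs_norm H w)\<^sup>2 - 2 * Re (cnj c * b)"
   using V by (subst nm_sq_sub) (auto simp: D_def nm_sm power_mult_distrib b_def simp flip: nm_eq)
  also have "Re (cnj c * b) = (cmod b)\<^sup>2 / (hs_norm H w)\<^sup>2" by (simp add: c_def mult.commute flip: complex_norm_square of_real_power)
  also have "(cmod c)\<^sup>2 * (hs_norm H w)\<^sup>2 = (cmod b)\<^sup>2 / (hs_norm H w)\<^sup>2"
  proof -
   have "cmod c = cmod b / (hs_norm H w)\<^sup>2" unfolding c_def norm_divide norm_of_real by simp
   then show ?thesis using w0 by (simp add: power2_eq_square)
  qed
  finally have "(cmod b)\<^sup>2 / (hs_norm H w)\<^sup>2 \<le> 0" using Dl by simp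
  then show False using w0 nz unfolding b_def[symmetric] by (simp add: divide_le_0_iff)
 qed
 then show ?thesis using that lK by blast
qed

end

section \<open>Completion of a space with a semidefinite inner product\<close>

locale pre_hilb = semi_ip "UNIV :: 'v set" add sm ip
 for add :: "'v \<Rightarrow> 'v \<Rightarrow> 'v" and sm ip
begin

definition qC :: "(nat \<Rightarrow> 'v) \<Rightarrow> bool" where
 "qC s \<longleftrightarrow> (\<forall>e>0. \<exists>N. \<forall>m\<ge>N. \<forall>k\<ge>N. nm (sub (s m) (s k)) < e)"

text \<open>Points of the completion are the functionals \<open>w \<mapsto> lim \<langle>s k, w\<rangle>\<close> of Cauchy sequences \<open>s\<close>.\<close>

definition emb :: "(nat \<Rightarrow> 'v) \<Rightarrow> 'v \<Rightarrow> complex" where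
 "emb s w = lim (\<lambda>k. ip (s k) w)"

text \<open>Any representing Cauchy sequences would do; \<open>cinner_lim\<close> shows that the
  choice does not affect the limit.\<close>

definition cinner :: "('v \<Rightarrow> complex) \<Rightarrow> ('v \<Rightarrow> complex) \<Rightarrow> complex" where
 "cinner g h = lim (\<lambda>k. ip ((SOME s. qC s \<and> emb s = g) k) ((SOME t. qC t \<and> emb t = h) k))"

definition compl :: "('v \<Rightarrow> complex) hilb" where
 "compl = \<lparr> hs_carrier = {emb s | s. qC s}, hs_zero = (\<lambda>_. 0), hs_add = (\<lambda>g h w. g w + h w),
   hs_smul = (\<lambda>c h w. c * h w), hs_inner = cinner \<rparr>"

lemma qC_const: "qC (\<lambda>_. w)"
proof -
 have "nm (sub w w) = 0" by (simp add: nm_def)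
 then show ?thesis by (simp add: qC_def)
qed

lemma qC_bounded: assumes "qC s" obtains M where "0 \<le> M" "\<And>k. nm (s k) \<le> M"
proof -
 obtain N where N: "\<And>k. k \<ge> N \<Longrightarrow> nm (sub (s k) (s N)) < 1" using assms unfolding qC_def by (meson order_refl zero_less_one)
 define M where "M = nm (s N) + 1 + (\<Sum>i<N. nm (s i))"
 have S: "0 \<le> (\<Sum>i<N. nm (s i))" by (rule sum_nonneg) simp
 have "nm (s k) \<le> M" for k
 proof (cases "k < N")
  case True
  then have "nm (s k) \<le> (\<Sum>i<N. nm (s i))" by (intro member_le_sum) auto
  moreover have "0 \<le> nm (s N)" by simp
  ultimately show ?thesis unfolding M_def by linarith
 next
  case False
  then show ?thesis using N[of k] nm_tri_sub[of "s k" "s N"] S unfolding M_def by simp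
 qed
 moreover have "0 \<le> M" unfolding M_def using S by (simp add: add_nonneg_nonneg)
 ultimately show ?thesis using that by blast
qed

lemma ip_diff_bound:
 assumes "nm a \<le> M" "nm d \<le> M'" shows "cmod (ip a b - ip c d) \<le> M * nm (sub b d) + nm (sub a c) * M'"
proof -
 have "ip a b - ip c d = ip a (sub b d) + ip (sub a c) d" by simp
 then have "cmod (ip a b - ip c d) \<le> cmod (ip a (sub b d)) + cmod (ip (sub a c) d)" by (metis norm_triangle_ineq)
 also have "\<dots> \<le> nm a * nm (sub b d) + nm (sub a c) * nm d" by (intro add_mono Cauchy_Schwarz) auto
 also have "\<dots> \<le> M * nm (sub b d) + nm (sub a c) * M'" using assms by (intro add_mono mult_right_mono mult_left_mono) auto
 finally show ?thesis .
qed

lemma ip_convergent: assumes "qC s" "qC t" shows "convergent (\<lambda>k. ip (s k) (t k))"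
proof -
 obtain M where M: "0 \<le> M" "\<And>k. nm (s k) \<le> M" using qC_bounded[OF assms(1)] by blast
 obtain L where L: "0 \<le> L" "\<And>k. nm (t k) \<le> L" using qC_bounded[OF assms(2)] by blast
 have "Cauchy (\<lambda>k. ip (s k) (t k))"
 proof (rule CauchyI)
  fix e :: real assume e: "0 < e"
  define f where "f = e / (M + L + 1)"
  have f: "0 < f" using e M L by (simp add: f_def)
  obtain N1 where N1: "\<And>m k. N1 \<le> m \<Longrightarrow> N1 \<le> k \<Longrightarrow> nm (sub (s m) (s k)) < f" using assms(1) f unfolding qC_def by meson
  obtain N2 where N2: "\<And>m k. N2 \<le> m \<Longrightarrow> N2 \<le> k \<Longrightarrow> nm (sub (t m) (t k)) < f" using assms(2) f unfolding qC_def by meson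
  have "cmod (ip (s m) (t m) - ip (s k) (t k)) < e" if mk: "max N1 N2 \<le> m" "max N1 N2 \<le> k" for m k
  proof -
   have "cmod (ip (s m) (t m) - ip (s k) (t k)) \<le> M * nm (sub (t m) (t k)) + nm (sub (s m) (s k)) * L" by (rule ip_diff_bound) (use M L in auto)
   also have "\<dots> \<le> M * f + f * L" using N1[of m k] N2[of m k] mk M L by (intro add_mono mult_left_mono mult_right_mono) auto
   also have "\<dots> < (M + L + 1) * f" using f by (simp add: algebra_simps)
   also have "\<dots> = e" using M L by (simp add: f_def)
   finally show ?thesis .
  qed
  then show "\<exists>N. \<forall>m\<ge>N. \<forall>n\<ge>N. cmod (ip (s m) (t m) - ip (s n) (t n)) < e" by blast
 qed
 then show ?thesis by (simp add: Cauchy_convergent_iff)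
qed

lemma emb_lim: "qC s \<Longrightarrow> (\<lambda>k. ip (s k) w) \<longlonglongrightarrow> emb s w" using ip_convergent[OF _ qC_const[of w]] unfolding emb_def by (simp add: convergent_LIMSEQ_iff)

lemma emb_eqI: "qC s \<Longrightarrow> (\<And>w. (\<lambda>k. ip (s k) w) \<longlonglongrightarrow> h w) \<Longrightarrow> emb s = h" by (rule ext) (metis emb_lim LIMSEQ_unique)

text \<open>Splits the square of the norm of s k into its product with a fixed late term s N1 and a
  product with s k - s N1. Two Cauchy sequences with the same functional therefore differ by a null
  sequence, which makes \<open>cinner\<close> well defined and also performs the quotient by null
  vectors.\<close>

lemma emb_zero_nm: assumes s: "qC s" "\<And>w. emb s w = 0" shows "(\<lambda>k. nm (s k)) \<longlonglongrightarrow> 0"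
proof -
 obtain M where M: "0 \<le> M" "\<And>k. nm (s k) \<le> M" using qC_bounded[OF s(1)] by blast
 have "(\<lambda>k. (nm (s k))\<^sup>2) \<longlonglongrightarrow> 0"
 proof (rule LIMSEQ_I)
  fix e :: real assume e: "0 < e"
  define f where "f = e / 2 / (M + 1)"
  have f: "0 < f" "M * f < e / 2"
  proof -
   show f0: "0 < f" using e M by (simp add: f_def)
   have "M + 1 \<noteq> 0" using M(1) by linarith
   then have "(M + 1) * f = e / 2" unfolding f_def by (metis nonzero_mult_div_cancel_left times_divide_eq_right)
   then show "M * f < e / 2" using f0 by (simp add: distrib_right)
  qed
  obtain N1 where N1: "\<And>m k. N1 \<le> m \<Longrightarrow> N1 \<le> k \<Longrightarrow> nm (sub (s m) (s k)) < f" using s(1) f unfolding qC_def by meson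
  have "(\<lambda>k. ip (s k) (s N1)) \<longlonglongrightarrow> 0" using emb_lim[OF s(1), of "s N1"] s(2) by simp
  then obtain N2 where N2: "\<And>k. N2 \<le> k \<Longrightarrow> cmod (ip (s k) (s N1)) < e / 2" using LIMSEQ_D[of _ 0 "e/2"] e by auto
  have "norm ((nm (s k))\<^sup>2 - 0) < e" if k: "max N1 N2 \<le> k" for k
  proof -
   have "ip (s k) (s k) = ip (s k) (s N1) + ip (s k) (sub (s k) (s N1))" by simp
   then have "cmod (ip (s k) (s k)) \<le> cmod (ip (s k) (s N1)) + nm (s k) * nm (sub (s k) (s N1))"
    using Cauchy_Schwarz[of "s k" "sub (s k) (s N1)"] by (smt (verit) UNIV_I norm_triangle_ineq)
   also have "\<dots> \<le> cmod (ip (s k) (s N1)) + M * f" using N1[of k N1] k M by (intro add_mono mult_mono) auto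
   also have "\<dots> < e" using N2[of k] k f by simp
   finally show ?thesis by (simp add: ip_self norm_power)
  qed
  then show "\<exists>N. \<forall>k\<ge>N. norm ((nm (s k))\<^sup>2 - 0) < e" by blast
 qed
 then have "(\<lambda>k. sqrt ((nm (s k))\<^sup>2)) \<longlonglongrightarrow> sqrt 0" by (rule tendsto_real_sqrt)
 then show ?thesis by simp
qed

lemma qC_add: assumes "qC s" "qC t" shows "qC (\<lambda>k. add (s k) (t k))" unfolding qC_def
proof (intro allI impI)
 fix e :: real assume "0 < e"
 then have e: "0 < e / 2" by simp
 obtain N1 where N1: "\<And>m k. N1 \<le> m \<Longrightarrow> N1 \<le> k \<Longrightarrow> nm (sub (s m) (s k)) < e/2" using assms(1) e unfolding qC_def by meson
 obtain N2 where N2: "\<And>m k. N2 \<le> m \<Longrightarrow> N2 \<le> k \<Longrightarrow> nm (sub (t m) (t k)) < e/2" using assms(2) e unfolding qC_def by meson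
 have "nm (sub (add (s m) (t m)) (add (s k) (t k))) < e" if mk: "max N1 N2 \<le> m" "max N1 N2 \<le> k" for m k
 proof -
  have "nm (sub (add (s m) (t m)) (add (s k) (t k))) = nm (add (sub (s m) (s k)) (sub (t m) (t k)))" by (rule nm_cong) (auto simp: algebra_simps)
  also have "\<dots> < e" using nm_tri[of "sub (s m) (s k)" "sub (t m) (t k)"] N1[of m k] N2[of m k] mk by auto
  finally show ?thesis .
 qed
 then show "\<exists>N. \<forall>m\<ge>N. \<forall>k\<ge>N. nm (sub (add (s m) (t m)) (add (s k) (t k))) < e" by blast
qed

lemma qC_map:
 assumes "qC s" "\<And>x y. nm (sub (g x) (g y)) \<le> C * nm (sub x y)" shows "qC (\<lambda>k. g (s k))" unfolding qC_def
proof (intro allI impI)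
 fix e :: real assume "0 < e"
 define f where "f = e / (\<bar>C\<bar> + 1)"
 have f: "0 < f" "\<bar>C\<bar> * f < e"
 proof -
  show f0: "0 < f" using \<open>0 < e\<close> by (simp add: f_def add_nonneg_pos)
  have "(\<bar>C\<bar> + 1) * f = e" by (simp add: f_def add_nonneg_pos)
  then show "\<bar>C\<bar> * f < e" using f0 by (simp add: distrib_right)
 qed
 obtain N where N: "\<And>m k. N \<le> m \<Longrightarrow> N \<le> k \<Longrightarrow> nm (sub (s m) (s k)) < f" using assms(1) f unfolding qC_def by meson
 have "nm (sub (g (s m)) (g (s k))) < e" if "N \<le> m" "N \<le> k" for m k
 proof -
  have "nm (sub (g (s m)) (g (s k))) \<le> C * nm (sub (s m) (s k))" by (rule assms)
  also have "\<dots> \<le> \<bar>C\<bar> * f" using N[OF that] by (intro mult_mono) auto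
  finally show ?thesis using f by simp
 qed
 then show "\<exists>N. \<forall>m\<ge>N. \<forall>k\<ge>N. nm (sub (g (s m)) (g (s k))) < e" by blast
qed

lemma qC_sm: assumes "qC s" shows "qC (\<lambda>k. sm c (s k))"
proof (rule qC_map[OF assms])
 fix x y
 have "nm (sub (sm c x) (sm c y)) = nm (sm c (sub x y))" by (rule nm_cong) (auto simp: algebra_simps)
 then show "nm (sub (sm c x) (sm c y)) \<le> cmod c * nm (sub x y)" by (simp add: nm_sm)
qed

lemma emb_add: "qC s \<Longrightarrow> qC t \<Longrightarrow> emb (\<lambda>k. add (s k) (t k)) = (\<lambda>w. emb s w + emb t w)" by (rule emb_eqI[OF qC_add]) (auto intro!: tendsto_add emb_lim)

lemma emb_sm: "qC s \<Longrightarrow> emb (\<lambda>k. sm c (s k)) = (\<lambda>w. c * emb s w)" by (rule emb_eqI[OF qC_sm]) (auto intro!: tendsto_mult emb_lim)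

lemma qC_sub: "qC s \<Longrightarrow> qC t \<Longrightarrow> qC (\<lambda>k. sub (s k) (t k))" unfolding sub_def by (intro qC_add qC_sm)

lemma emb_sub: "qC s \<Longrightarrow> qC t \<Longrightarrow> emb (\<lambda>k. sub (s k) (t k)) = (\<lambda>w. emb s w - emb t w)" unfolding sub_def by (simp add: emb_add qC_sm emb_sm)

lemma cinner_lim: assumes s: "qC s" and t: "qC t" shows "(\<lambda>k. ip (s k) (t k)) \<longlonglongrightarrow> cinner (emb s) (emb t)"
proof -
 define s' where "s' = (SOME s'. qC s' \<and> emb s' = emb s)"
 define t' where "t' = (SOME t'. qC t' \<and> emb t' = emb t)"
 have s': "qC s'" "emb s' = emb s" using someI[of "\<lambda>s'. qC s' \<and> emb s' = emb s" s] s by (auto simp: s'_def)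
 have t': "qC t'" "emb t' = emb t" using someI[of "\<lambda>s'. qC s' \<and> emb s' = emb t" t] t by (auto simp: t'_def)
 have lim: "(\<lambda>k. ip (s' k) (t' k)) \<longlonglongrightarrow> cinner (emb s) (emb t)"
  using ip_convergent[OF s'(1) t'(1)] unfolding cinner_def s'_def t'_def by (simp add: convergent_LIMSEQ_iff)
 have ds: "(\<lambda>k. nm (sub (s k) (s' k))) \<longlonglongrightarrow> 0" "(\<lambda>k. nm (sub (t k) (t' k))) \<longlonglongrightarrow> 0" using s s' t t' by (auto intro!: emb_zero_nm qC_sub simp: emb_sub)
 obtain M where M: "0 \<le> M" "\<And>k. nm (s k) \<le> M" using qC_bounded[OF s(1)] by blast
 obtain L where L: "0 \<le> L" "\<And>k. nm (t' k) \<le> L" using qC_bounded[OF t'(1)] by blast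
 have "(\<lambda>k. ip (s k) (t k) - ip (s' k) (t' k)) \<longlonglongrightarrow> 0"
 proof (rule Lim_null_comparison)
  show "\<forall>\<^sub>F k in sequentially. norm (ip (s k) (t k) - ip (s' k) (t' k)) \<le> M * nm (sub (t k) (t' k)) + nm (sub (s k) (s' k)) * L"
   by (intro always_eventually allI ip_diff_bound M L)
  show "(\<lambda>k. M * nm (sub (t k) (t' k)) + nm (sub (s k) (s' k)) * L) \<longlonglongrightarrow> 0"
   using tendsto_add[OF tendsto_mult_left[OF ds(2), of M] tendsto_mult_right[OF ds(1), of L]] by simp
 qed
 from tendsto_add[OF this lim] show ?thesis by simp
qed

lemma compl_sel [simp]: "hs_zero compl = (\<lambda>_. 0)" "hs_add compl g h = (\<lambda>w. g w + h w)" "hs_smul compl c h = (\<lambda>w. c * h w)"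
 "hs_inner compl = cinner" by (simp_all add: compl_def)

abbreviation "cV \<equiv> hs_carrier compl"
abbreviation "cnm \<equiv> hs_norm compl"

lemma emb_compl [intro]: "qC s \<Longrightarrow> emb s \<in> cV" by (auto simp: compl_def)

lemma compl_cases: assumes "h \<in> cV" obtains s where "qC s" "h = emb s" using assms by (auto simp: compl_def)

lemma semi_ip_compl: "semi_ip (cV) (hs_add compl) (hs_smul compl) (hs_inner compl)"
proof
 fix g h k c assume g: "g \<in> cV"
 obtain s where s: "qC s" "g = emb s" using compl_cases[OF g] by blast
 show "hs_smul compl c g \<in> cV" using s by (auto simp: emb_sm[symmetric] qC_sm)
 have "(\<lambda>k. Re (ip (s k) (s k))) \<longlonglongrightarrow> Re (cinner g g)" unfolding s by (intro tendsto_Re cinner_lim s)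
 then show "0 \<le> Re (hs_inner compl g g)" by (simp add: LIMSEQ_le_const ip_pos)
 assume h: "h \<in> cV"
 obtain t where t: "qC t" "h = emb t" using compl_cases[OF h] by blast
 show "hs_add compl g h \<in> cV" using s t by (auto simp: emb_add[symmetric] qC_add)
 have "(\<lambda>k. ip (sm c (s k)) (t k)) \<longlonglongrightarrow> cinner (emb (\<lambda>k. sm c (s k))) (emb t)" by (intro cinner_lim qC_sm s t)
 moreover have "(\<lambda>k. ip (sm c (s k)) (t k)) \<longlonglongrightarrow> c * cinner (emb s) (emb t)" by simp (intro tendsto_mult tendsto_const cinner_lim s t)
 ultimately show "hs_inner compl (hs_smul compl c g) h = c * hs_inner compl g h" using LIMSEQ_unique by (auto simp: s t emb_sm)
 have "(\<lambda>k. ip (t k) (s k)) \<longlonglongrightarrow> cinner (emb t) (emb s)" by (intro cinner_lim s t)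
 moreover have "(\<lambda>k. ip (t k) (s k)) \<longlonglongrightarrow> cnj (cinner (emb s) (emb t))" by (subst ip_cnj) (auto intro!: tendsto_cnj cinner_lim s t)
 ultimately show "hs_inner compl h g = cnj (hs_inner compl g h)" using LIMSEQ_unique by (auto simp: s t)
 assume k: "k \<in> cV"
 obtain u where u: "qC u" "k = emb u" using compl_cases[OF k] by blast
 have "(\<lambda>k. ip (add (s k) (t k)) (u k)) \<longlonglongrightarrow> cinner (emb (\<lambda>k. add (s k) (t k))) (emb u)" by (intro cinner_lim qC_add s t u)
 moreover have "(\<lambda>k. ip (add (s k) (t k)) (u k)) \<longlonglongrightarrow> cinner (emb s) (emb u) + cinner (emb t) (emb u)" by simp (intro tendsto_add cinner_lim s t u)
 ultimately show "hs_inner compl (hs_add compl g h) k = hs_inner compl g k + hs_inner compl h k" using LIMSEQ_unique by (auto simp: s t u emb_add)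
qed

interpretation C: semi_ip "cV" "hs_add compl" "hs_smul compl" "hs_inner compl" by (rule semi_ip_compl)

lemma C_nm: "C.nm = cnm" by (rule ext) (simp only: C.nm_def hs_norm_def)

lemma nm_cinner [simp]: "semi_ip.nm cinner = cnm" using C_nm by simp

lemma C_sub: "C.sub g h = (\<lambda>w. g w - h w)" by (rule ext) (simp add: C.sub_def)

lemma norm_emb_lim: "qC s \<Longrightarrow> (\<lambda>k. nm (s k)) \<longlonglongrightarrow> cnm (emb s)" unfolding nm_def hs_norm_def by (auto intro!: tendsto_real_sqrt tendsto_Re cinner_lim)

lemma norm_const: "cnm (emb (\<lambda>_. w)) = nm w" using norm_emb_lim[OF qC_const, of w] LIMSEQ_unique tendsto_const by blast

lemma emb_approx: assumes s: "qC s" "0 < e" shows "\<exists>w. cnm (C.sub (emb s) (emb (\<lambda>_. w))) < e"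
proof -
 obtain N where N: "\<And>m k. N \<le> m \<Longrightarrow> N \<le> k \<Longrightarrow> nm (sub (s m) (s k)) < e/2" using s unfolding qC_def by (meson half_gt_zero)
 have "(\<lambda>k. nm (sub (s k) (s N))) \<longlonglongrightarrow> cnm (C.sub (emb s) (emb (\<lambda>_. s N)))"
  unfolding C_sub emb_sub[OF s(1) qC_const, symmetric] by (intro norm_emb_lim qC_sub s qC_const)
 then have "cnm (C.sub (emb s) (emb (\<lambda>_. s N))) \<le> e/2" by (rule LIMSEQ_le_const2) (use N in \<open>auto intro!: exI[of _ N] less_imp_le\<close>)
 then show ?thesis using s(2) by (intro exI[of _ "s N"]) linarith
qed

lemma dense: "h \<in> cV \<Longrightarrow> 0 < e \<Longrightarrow> \<exists>w. cnm (C.sub h (emb (\<lambda>_. w))) < e" by (metis compl_cases emb_approx)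

lemma const_in [simp]: "emb (\<lambda>_. w) \<in> cV" by (intro emb_compl qC_const)

theorem hilbert_space_compl: "hilbert_space compl" unfolding hilbert_space_def Let_def
proof (intro conjI)
 have "emb (\<lambda>_. sub w w) = (\<lambda>_. 0)" for w using emb_sub[OF qC_const qC_const, of w w] by simp
 then have z: "(\<lambda>_. 0) \<in> cV" by (metis const_in)
 have cl: "(\<lambda>w. g w + h w) \<in> cV" "(\<lambda>w. c * g w) \<in> cV"
  if "g \<in> cV" "h \<in> cV" for g h c using C.add_cl[OF that] C.sm_cl[OF that(1), of c] by simp_all
 show "complex_vs (cV) (hs_zero compl) (hs_add compl) (hs_smul compl)" unfolding complex_vs_def by (auto simp: z cl algebra_simps)
 show "\<forall>x\<in>cV. \<forall>y\<in>cV. \<forall>w\<in>cV. hs_inner compl (hs_add compl x y) w = hs_inner compl x w + hs_inner compl y w" by (intro ballI C.ip_add)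
 show "\<forall>c. \<forall>x\<in>cV. \<forall>y\<in>cV. hs_inner compl (hs_smul compl c x) y = c * hs_inner compl x y" by (intro allI ballI C.ip_sm)
 show "\<forall>x\<in>cV. \<forall>y\<in>cV. hs_inner compl y x = cnj (hs_inner compl x y)" by (intro ballI C.ip_cnj)
 show "\<forall>x\<in>cV. Im (hs_inner compl x x) = 0 \<and> 0 \<le> Re (hs_inner compl x x)" by (intro ballI conjI C.ip_im C.ip_pos)
 show "\<forall>x\<in>cV. hs_inner compl x x = 0 \<longrightarrow> x = hs_zero compl"
 proof (intro ballI impI)
  fix x assume x: "x \<in> cV" "hs_inner compl x x = 0"
  obtain s where s: "qC s" "x = emb s" using compl_cases[OF x(1)] by blast
  have "(\<lambda>k. nm (s k)) \<longlonglongrightarrow> 0" using norm_emb_lim[OF s(1)] x(2) by (simp add: s hs_norm_def)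
  have "(\<lambda>k. ip (s k) w) \<longlonglongrightarrow> 0" for w
  proof (rule Lim_null_comparison)
   show "\<forall>\<^sub>F k in sequentially. norm (ip (s k) w) \<le> nm (s k) * nm w" by (intro always_eventually allI Cauchy_Schwarz) auto
   show "(\<lambda>k. nm (s k) * nm w) \<longlonglongrightarrow> 0" using tendsto_mult_left_zero[OF \<open>_ \<longlonglongrightarrow> 0\<close>] .
  qed
  then show "x = hs_zero compl" using emb_eqI[OF s(1)] s(2) by simp
 qed
 show "complete_on (cV) (hs_add compl) (hs_smul compl) (cnm)" unfolding complete_on_def C.sub_def[symmetric]
 proof (intro allI impI)
  fix h :: "nat \<Rightarrow> 'v \<Rightarrow> complex" assume A: "(\<forall>k. h k \<in> cV) \<and> (\<forall>e>0. \<exists>N. \<forall>m\<ge>N. \<forall>k\<ge>N. cnm (C.sub (h m) (h k)) < e)"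
  \<comment> \<open>Each h m is replaced by a constant class within distance 1 / (m + 1). The
    vectors chosen form a Cauchy sequence t in the original space, and its class is the
    limit.\<close>
  have "\<exists>w. cnm (C.sub (h m) (emb (\<lambda>_. w))) < 1 / real (Suc m)" for m by (rule dense) (use A in auto)
  then obtain t where t: "\<And>m. cnm (C.sub (h m) (emb (\<lambda>_. t m))) < 1 / real (Suc m)" by metis
  have sub_const: "C.sub (emb (\<lambda>_. a)) (emb (\<lambda>_. b)) = emb (\<lambda>_. sub a b)" for a b by (simp add: C_sub emb_sub qC_const)
  have small: "\<exists>N. \<forall>m\<ge>N. 1 / real (Suc m) < e" if "0 < e" for e :: real
   using that LIMSEQ_D[OF LIMSEQ_inverse_real_of_nat, of e] by (simp add: inverse_eq_divide)
  have qt: "qC t" unfolding qC_def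
  proof (intro allI impI)
   fix e :: real assume "0 < e"
   then have e: "0 < e / 3" by simp
   obtain N1 where N1: "\<And>m. N1 \<le> m \<Longrightarrow> 1 / real (Suc m) < e/3" using small[OF e] by blast
   obtain N2 where N2: "\<And>m k. N2 \<le> m \<Longrightarrow> N2 \<le> k \<Longrightarrow> cnm (C.sub (h m) (h k)) < e/3" using A e by meson
   have "nm (sub (t m) (t k)) < e" if mk: "max N1 N2 \<le> m" "max N1 N2 \<le> k" for m k
   proof -
    have hc: "h m \<in> cV" "h k \<in> cV" using A by auto
    have "nm (sub (t m) (t k)) = C.nm (C.sub (emb (\<lambda>_. t m)) (emb (\<lambda>_. t k)))" unfolding sub_const C_nm norm_const ..
    also have "\<dots> \<le> C.nm (C.sub (emb (\<lambda>_. t m)) (h m)) + C.nm (C.sub (h m) (emb (\<lambda>_. t k)))" by (rule C.nm_sub_tri) (use hc in auto)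
    also have "C.nm (C.sub (h m) (emb (\<lambda>_. t k))) \<le> C.nm (C.sub (h m) (h k)) + C.nm (C.sub (h k) (emb (\<lambda>_. t k)))"
     by (rule C.nm_sub_tri) (use hc in auto)
    also have "C.nm (C.sub (emb (\<lambda>_. t m)) (h m)) = C.nm (C.sub (h m) (emb (\<lambda>_. t m)))" by (rule C.nm_sub_comm) (use hc in auto)
    finally show ?thesis unfolding C_nm using t[of m] t[of k] N1[of m] N1[of k] N2[of m k] mk by linarith
   qed
   then show "\<exists>N. \<forall>m\<ge>N. \<forall>k\<ge>N. nm (sub (t m) (t k)) < e" by blast
  qed
  have "(\<lambda>k. cnm (C.sub (h k) (emb t))) \<longlonglongrightarrow> 0"
  proof (rule LIMSEQ_I)
   fix e :: real assume "0 < e"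
   then have e: "0 < e / 3" by simp
   obtain N1 where N1: "\<And>m. N1 \<le> m \<Longrightarrow> 1 / real (Suc m) < e/3" using small[OF e] by blast
   obtain N2 where N2: "\<And>m k. N2 \<le> m \<Longrightarrow> N2 \<le> k \<Longrightarrow> nm (sub (t m) (t k)) < e/3" using qt e unfolding qC_def by meson
   have "norm (cnm (C.sub (h k) (emb t)) - 0) < e" if k: "max N1 N2 \<le> k" for k
   proof -
    have hc: "h k \<in> cV" using A by auto
    have "(\<lambda>j. nm (sub (t k) (t j))) \<longlonglongrightarrow> C.nm (C.sub (emb (\<lambda>_. t k)) (emb t))"
     unfolding C_sub C_nm emb_sub[OF qC_const qt, symmetric] by (intro norm_emb_lim qC_sub qt qC_const)
    then have "C.nm (C.sub (emb (\<lambda>_. t k)) (emb t)) \<le> e/3" by (rule LIMSEQ_le_const2) (use N2 k in \<open>auto intro!: exI[of _ N2] less_imp_le\<close>)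
    moreover have "C.nm (C.sub (h k) (emb t)) \<le> C.nm (C.sub (h k) (emb (\<lambda>_. t k))) + C.nm (C.sub (emb (\<lambda>_. t k)) (emb t))"
     by (rule C.nm_sub_tri) (use hc qt in auto)
    moreover have "0 \<le> C.nm (C.sub (h k) (emb t))" using hc qt by (intro C.nm_nonneg C.sub_cl) auto
    ultimately show ?thesis unfolding C_nm using t[of k] N1[of k] k e by simp
   qed
   then show "\<exists>N. \<forall>k\<ge>N. norm (cnm (C.sub (h k) (emb t)) - 0) < e" by blast
  qed
  then show "\<exists>l\<in>cV. (\<lambda>k. cnm (C.sub (h k) l)) \<longlonglongrightarrow> 0" using qt by blast
 qed
qed

end

section \<open>The GNS representation of an extreme state\<close>

context cstar_seminorm
begin

definition csm :: "complex \<Rightarrow> 'w \<Rightarrow> 'w" where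
 "csm c w = Re c *\<^sub>R w + Im c *\<^sub>R (J * w)"

text \<open>Contractivity with respect to p forces r to vanish on elements of seminorm 0, so r
  behaves like a representation of the quotient although no quotient is formed.\<close>

definition srep :: "'h hilb \<Rightarrow> ('w \<Rightarrow> 'h \<Rightarrow> 'h) \<Rightarrow> bool" where
 "srep H r \<longleftrightarrow> (\<forall>a. \<forall>x\<in>hs_carrier H. r 1 x = x \<and> r a x \<in> hs_carrier H \<and> hs_norm H (r a x) \<le> p a * hs_norm H x \<and>
   (\<forall>b. r (a + b) x = hs_add H (r a x) (r b x) \<and> r (a * b) x = r a (r b x)) \<and>
   (\<forall>c. r (csm c a) x = hs_smul H c (r a x) \<and> r a (hs_smul H c x) = hs_smul H c (r a x)) \<and>
   (\<forall>y\<in>hs_carrier H. r a (hs_add H x y) = hs_add H (r a x) (r a y) \<and> hs_inner H (r a x) y = hs_inner H x (r (st a) y)))"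

definition sirred :: "'h hilb \<Rightarrow> ('w \<Rightarrow> 'h \<Rightarrow> 'h) \<Rightarrow> bool" where
 "sirred H r \<longleftrightarrow> (\<forall>K. closed_subspace H K \<and> (\<forall>a. \<forall>x\<in>K. r a x \<in> K) \<longrightarrow> K = {hs_zero H} \<or> K = hs_carrier H)"

end

text \<open>Extremality is assumed for midpoints only, the form in which
  \<open>extreme_functional\<close> delivers it.\<close>

locale pure_state = cstar_seminorm st J p for st :: "'w::real_algebra_1 \<Rightarrow> 'w" and J p +
 fixes f :: "'w \<Rightarrow> real"
 assumes state: "state f"
  and extreme: "linear g1 \<Longrightarrow> linear g2 \<Longrightarrow> (\<And>x. g1 x \<le> upper x) \<Longrightarrow> (\<And>x. g2 x \<le> upper x) \<Longrightarrow>
   (\<And>x. g1 x + g2 x = 2 * f x) \<Longrightarrow> g1 = f"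
begin

lemma f_linear: "linear f" using state by (simp add: state_def)

lemmas f_simps = linear_add[OF f_linear] linear_diff[OF f_linear] linear_scale[OF f_linear] linear_neg[OF f_linear]

text \<open>The complex linear functional with real part f, where \<open>J\<close> acts as the
  imaginary unit.\<close>

definition phi :: "'w \<Rightarrow> complex" where "phi w = Complex (f w) (- f (J * w))"

lemma Re_phi [simp]: "Re (phi w) = f w" by (simp add: phi_def)

lemma phi_add: "phi (x + y) = phi x + phi y" by (simp add: phi_def complex_eq_iff f_simps distrib_left)

lemma phi_scaleR: "phi (r *\<^sub>R x) = of_real r * phi x" by (simp add: phi_def complex_eq_iff f_simps)

lemma phi_J: "phi (J * x) = \<i> * phi x"
proof -
 have "J * (J * x) = - x" by (simp add: J_sq flip: mult.assoc)
 then show ?thesis by (simp add: phi_def complex_eq_iff f_simps)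
qed

lemma phi_csm: "phi (csm c x) = c * phi x" by (simp add: csm_def phi_add phi_scaleR phi_J complex_eq_iff)

lemma mult_csm: "y * csm c x = csm c (y * x)"
proof -
 have "y * (J * x) = J * (y * x)" by (metis J_comm mult.assoc)
 then show ?thesis by (simp add: csm_def distrib_left)
qed

lemma csm_mult: "csm c x * y = csm c (x * y)" by (simp add: csm_def distrib_right mult.assoc)

lemma phi_st: "phi (st w) = cnj (phi w)"
proof -
 have "f (J * st w) = - f (J * w)" using state_st[OF state, of "J * st w"] J_comm[of w] by (simp add: st_mult st_J f_simps)
 then show ?thesis by (simp add: phi_def complex_eq_iff state_st[OF state])
qed

sublocale pre_hilb "(+)" csm "\<lambda>x y. phi (st y * x)"
proof
 show "phi (st x * y) = cnj (phi (st y * x))" for x y using phi_st[of "st y * x"] by (simp add: st_mult)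
 show "0 \<le> Re (phi (st x * x))" for x using state_Pos[OF state Pos_star_mult, of x] by simp
qed (auto simp: distrib_left phi_add mult_csm phi_csm)

lemma sub_eq [simp]: "sub x y = x - y" by (simp add: sub_def csm_def)

lemma nm_f: "(nm x)\<^sup>2 = f (st x * x)" by (simp add: nm_sq)

text \<open>The order relation \<open>st a * a\<close> \<le> (p a)^2 survives conjugation by x, and
  f preserves it.\<close>

lemma nm_mult: "nm (a * x) \<le> p a * nm x"
proof -
 have "Pos (of_real ((p a)\<^sup>2) - st a * a)" by (rule Pos_diff) (simp_all add: st_mult p_cstar)
 then have "Pos (st x * (of_real ((p a)\<^sup>2) - st a * a) * x)" by (rule Pos_conj)
 then have "0 \<le> f (st x * (of_real ((p a)\<^sup>2) - st a * a) * x)" by (rule state_Pos[OF state])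
 also have "st x * (of_real ((p a)\<^sup>2) - st a * a) * x = (p a)\<^sup>2 *\<^sub>R (st x * x) - st (a * x) * (a * x)"
  by (simp add: algebra_simps st_mult of_real_def)
 finally have "(nm (a * x))\<^sup>2 \<le> (p a * nm x)\<^sup>2" by (simp add: nm_f f_simps power_mult_distrib)
 then show ?thesis by (simp add: abs_le_square_iff[symmetric] abs_mult)
qed

text \<open>Points of the completion are functionals of the second argument of the inner product.
  Moving a across that product turns it into \<open>st a\<close>.\<close>

definition rep :: "'w \<Rightarrow> ('w \<Rightarrow> complex) \<Rightarrow> 'w \<Rightarrow> complex" where
 "rep a h = (\<lambda>w. h (st a * w))"

lemma qC_mult: "qC s \<Longrightarrow> qC (\<lambda>k. a * s k)" by (rule qC_map[of s "\<lambda>x. a * x" "p a"]) (simp_all add: nm_mult right_diff_distrib[symmetric])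

lemma rep_emb: "qC s \<Longrightarrow> rep a (emb s) = emb (\<lambda>k. a * s k)" by (rule emb_eqI[symmetric, OF qC_mult])
   (use emb_lim[of s "st a * _"] in \<open>simp_all add: rep_def st_mult mult.assoc\<close>)

interpretation C: hilb compl by unfold_locales (rule hilbert_space_compl)

lemma C_sub': "C.sub g h = (\<lambda>w. g w - h w)" by (rule ext) (simp add: C.sub_def)

lemma compl_add: "h \<in> cV \<Longrightarrow> h (x + y) = h x + h y"
proof (elim compl_cases)
 fix s assume s: "qC s" "h = emb s"
 have "(\<lambda>k. phi (st x * s k) + phi (st y * s k)) \<longlonglongrightarrow> emb s x + emb s y" by (intro tendsto_add emb_lim s)
 then have "(\<lambda>k. phi (st (x + y) * s k)) \<longlonglongrightarrow> emb s x + emb s y" by (simp add: st_add distrib_right phi_add)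
 then show "h (x + y) = h x + h y" using emb_lim[OF s(1)] LIMSEQ_unique s(2) by blast
qed

lemma compl_csm: "h \<in> cV \<Longrightarrow> h (csm c x) = cnj c * h x"
proof (elim compl_cases)
 fix s assume s: "qC s" "h = emb s"
 have "(\<lambda>k. phi (st (csm c x) * s k)) \<longlonglongrightarrow> cnj c * emb s x" by (simp, intro tendsto_mult tendsto_const emb_lim s)
 then show "h (csm c x) = cnj c * h x" using emb_lim[OF s(1)] LIMSEQ_unique s(2) by blast
qed

lemma st_csm: "st (csm c x) = csm (cnj c) (st x)" using J_comm[of "st x"] by (simp add: csm_def st_add st_scaleR st_mult st_J)

lemma srep: "srep compl rep" unfolding srep_def
proof (intro allI ballI conjI)
 fix a x assume x: "x \<in> cV"
 obtain s where s: "qC s" "x = emb s" using compl_cases[OF x] by blast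
 show "rep 1 x = x" by (rule ext) (simp add: rep_def)
 show "rep a x \<in> cV" using s by (simp add: rep_emb emb_compl qC_mult)
 show "cnm (rep a x) \<le> p a * cnm x" unfolding s rep_emb[OF s(1)]
  by (rule LIMSEQ_le[OF norm_emb_lim[OF qC_mult[OF s(1)]] tendsto_mult[OF tendsto_const norm_emb_lim[OF s(1)]]]) (simp add: nm_mult)
 fix b c
 show "rep (a + b) x = hs_add compl (rep a x) (rep b x)" by (rule ext) (simp add: rep_def st_add distrib_right compl_add[OF x])
 show "rep (a * b) x = rep a (rep b x)" by (rule ext) (simp add: rep_def st_mult mult.assoc)
 show "rep (csm c a) x = hs_smul compl c (rep a x)" by (rule ext) (simp add: rep_def st_csm csm_mult compl_csm[OF x])
 show "rep a (hs_smul compl c x) = hs_smul compl c (rep a x)" by (rule ext) (simp add: rep_def)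
 fix y assume y: "y \<in> cV"
 obtain t where t: "qC t" "y = emb t" using compl_cases[OF y] by blast
 show "rep a (hs_add compl x y) = hs_add compl (rep a x) (rep a y)" by (rule ext) (simp add: rep_def)
 have "(\<lambda>k. phi (st (t k) * (a * s k))) \<longlonglongrightarrow> cinner (rep a x) y" unfolding s t rep_emb[OF s(1)] by (intro cinner_lim qC_mult s t)
 moreover have "(\<lambda>k. phi (st (st a * t k) * s k)) \<longlonglongrightarrow> cinner x (rep (st a) y)" unfolding s t rep_emb[OF t(1)] by (intro cinner_lim qC_mult s t)
 ultimately show "hs_inner compl (rep a x) y = hs_inner compl x (rep (st a) y)" using LIMSEQ_unique by (simp add: st_mult mult.assoc) blast
qed

lemmas rep = srep[unfolded srep_def, rule_format]

abbreviation cyc :: "'w \<Rightarrow> complex" where "cyc \<equiv> emb (\<lambda>_. 1)"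

lemma rep_cyc: "rep a cyc = emb (\<lambda>_. a)" by (simp add: rep_emb qC_const)

lemma rep_cyc_inner: "Re (cinner (rep a cyc) cyc) = f a"
proof -
 have "(\<lambda>k. phi (st 1 * a)) \<longlonglongrightarrow> cinner (emb (\<lambda>_. a)) cyc" by (intro cinner_lim qC_const)
 then have "cinner (emb (\<lambda>_. a)) cyc = phi a" by (simp add: LIMSEQ_const_iff)
 then show ?thesis by (simp add: rep_cyc)
qed

text \<open>This is cyclicity of \<open>cyc\<close>: vectors \<open>rep w cyc\<close> come
  arbitrarily close to u. Real parts suffice because the squared norm of u is real.\<close>

lemma ip_cyc_zero:
 assumes u: "u \<in> cV" "\<And>a. Re (cinner (rep a cyc) u) = 0" shows "u = hs_zero compl"
proof (rule ccontr)
 assume "u \<noteq> hs_zero compl"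
 then have n: "0 < cnm u" using C.nm_zero_iff[OF u(1)] C.nm_nonneg[OF u(1)] by simp
 obtain w where w: "cnm (C.sub u (emb (\<lambda>_. w))) < cnm u" using dense[OF u(1) n] by (auto simp: C_sub' C_sub)
 have "(cnm u)\<^sup>2 = Re (cinner u u)" using C.nm_sq[OF u(1)] by simp
 also have "cinner u u = cinner (C.sub u (emb (\<lambda>_. w))) u + cinner (emb (\<lambda>_. w)) u" using C.ip_sub[OF u(1) const_in u(1), of w] by simp
 also have "Re \<dots> = Re (cinner (C.sub u (emb (\<lambda>_. w))) u)" using u(2)[of w] by (simp add: rep_cyc)
 also have "\<dots> \<le> cmod (cinner (C.sub u (emb (\<lambda>_. w))) u)" by (rule complex_Re_le_cmod)
 also have "\<dots> \<le> cnm (C.sub u (emb (\<lambda>_. w))) * cnm u" using C.Cauchy_Schwarz[of "C.sub u (emb (\<lambda>_. w))" u] u by simp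
 also have "\<dots> < cnm u * cnm u" using w n by simp
 finally show False by (simp add: power2_eq_square)
qed

text \<open>Split the cyclic vector along an invariant subspace K as k + l. Cross terms vanish, so f
  is the sum of the vector functionals of k and l. Extremality makes the first a multiple of f, so k
  is a multiple of \<open>cyc\<close>, and unless k = 0 the cyclic vector lies in K.\<close>

theorem sirred: "sirred compl rep" unfolding sirred_def
proof (intro allI impI)
 fix K assume A: "closed_subspace compl K \<and> (\<forall>a. \<forall>x\<in>K. rep a x \<in> K)"
 note KD = C.closed_subspaceD[OF A[THEN conjunct1]]
 have inv: "\<And>a x. x \<in> K \<Longrightarrow> rep a x \<in> K" using A by blast
 have KV: "\<And>x. x \<in> K \<Longrightarrow> x \<in> cV" using KD by blast
 obtain k where k: "k \<in> K" "\<And>w. w \<in> K \<Longrightarrow> cinner (C.sub cyc k) w = 0" using C.projection[OF A[THEN conjunct1] const_in, of 1] by auto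
 define l where "l = C.sub cyc k"
 have V [simp]: "k \<in> cV" "l \<in> cV" using KV k by (auto simp: l_def)
 have repV [simp]: "\<And>a x. x \<in> cV \<Longrightarrow> rep a x \<in> cV" using rep by blast
 have lK: "cinner l w = 0" "cinner w l = 0" if "w \<in> K" for w using k(2)[OF that] C.ip_cnj[of l w] KV[OF that] by (auto simp: l_def[symmetric])
 have cyc: "cyc = hs_add compl k l" by (rule ext) (simp add: l_def C_sub')
 have adj: "cinner (rep a x) y = cinner x (rep (st a) y)" if "x \<in> cV" "y \<in> cV" for a x y using rep[OF that(1)] that by simp
 have rl: "cinner (rep a l) w = 0" if "w \<in> K" for a w using adj[of l w a] lK(1)[OF inv[OF that]] KV[OF that] by simp
 define g1 where "g1 = (\<lambda>a. Re (cinner (rep a k) k))"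
 define g2 where "g2 = (\<lambda>a. Re (cinner (rep a l) l))"
 have sum: "f a = g1 a + g2 a" for a
 proof -
  have "rep a cyc = hs_add compl (rep a k) (rep a l)" unfolding cyc using rep[OF V(1)] V(2) by blast
  then have "cinner (rep a cyc) cyc = cinner (hs_add compl (rep a k) (rep a l)) (hs_add compl k l)" by (simp only: cyc[symmetric])
  then have "f a = Re (cinner (hs_add compl (rep a k) (rep a l)) (hs_add compl k l))" using rep_cyc_inner[of a] by (simp only:)
  then show ?thesis using C.ip_add[of "rep a k" "rep a l"] C.ip_add2[of k l] lK(2)[OF inv[OF k(1)]] rl[OF k(1)]
   by (simp add: g1_def g2_def del: compl_sel(2))
 qed
 have csmR: "csm (of_real r) a = r *\<^sub>R a" for r a by (simp add: csm_def)
 have vstate: "state (\<lambda>a. Re (cinner (rep a x) x) / (cnm x)\<^sup>2)"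
  if x: "x \<in> cV" "x \<noteq> hs_zero compl" for x
 proof (rule stateI)
  have n: "0 < (cnm x)\<^sup>2" using C.nm_zero_iff[OF x(1)] x(2) by simp
  have r: "rep (a + b) x = hs_add compl (rep a x) (rep b x)" "rep (r *\<^sub>R a) x = hs_smul compl (of_real r) (rep a x)" for a b r
   using rep[OF x(1)] csmR by metis+
  show "linear (\<lambda>a. Re (cinner (rep a x) x) / (cnm x)\<^sup>2)" by (rule linearI; unfold r)
     (use C.ip_add[of "rep _ x" "rep _ x" x] C.ip_sm[of "rep _ x" x] x in \<open>simp_all add: add_divide_distrib del: compl_sel(2,3)\<close>)
  show "Re (cinner (rep (st a) x) x) / (cnm x)\<^sup>2 = Re (cinner (rep a x) x) / (cnm x)\<^sup>2" for a
   using adj[OF x(1) x(1), of "st a"] C.ip_cnj[of "rep a x" x] x by simp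
  have "rep 1 x = x" by (rule ext) (simp add: rep_def)
  moreover have "Re (cinner x x) = (cnm x)\<^sup>2" using C.nm_sq[OF x(1)] by simp
  ultimately show "Re (cinner (rep 1 x) x) / (cnm x)\<^sup>2 = 1" using n by (simp only: divide_self_if) simp
  have "cinner (rep (st a * a) x) x = cinner (rep a x) (rep a x)" for a using adj[of "rep a x" x "st a"] rep[OF x(1)] x by simp
  then show "0 \<le> Re (cinner (rep (st a * a) x) x) / (cnm x)\<^sup>2" for a using C.ip_pos[of "rep a x"] x by simp
  show "\<bar>Re (cinner (rep a x) x) / (cnm x)\<^sup>2\<bar> \<le> 1 * p a" for a
  proof -
   have "\<bar>Re (cinner (rep a x) x)\<bar> \<le> cmod (cinner (rep a x) x)" by (rule abs_Re_le_cmod)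
   also have "\<dots> \<le> cnm (rep a x) * cnm x" using C.Cauchy_Schwarz[of "rep a x" x] x by simp
   also have "\<dots> \<le> (p a * cnm x) * cnm x" using rep[OF x(1)] C.nm_nonneg[OF x(1)] by (intro mult_right_mono) auto
   finally show ?thesis using n by (simp add: power2_eq_square divide_le_eq mult.assoc)
  qed
 qed
 show "K = {hs_zero compl} \<or> K = cV"
 proof (cases "k = hs_zero compl")
  case True
  have "x = hs_zero compl" if "x \<in> K" for x
  proof (rule ip_cyc_zero)
   show "x \<in> cV" using KV that .
   show "Re (cinner (rep a cyc) x) = 0" for a
   proof -
    have "l = cyc" using True by (simp add: l_def C_sub')
    then show ?thesis using rl[OF that, of a] by simp
   qed
  qed
  then show ?thesis using KD(2) by blast
 next
  case k0: False
  have full: "K = cV" if "cyc \<in> K"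
  proof -
   have "h \<in> K" if h: "h \<in> cV" for h
   proof -
    have "\<exists>w. cnm (C.sub h (emb (\<lambda>_. w))) < 1 / real (Suc m)" for m using dense[OF h, of "1 / real (Suc m)"] by (simp add: C_sub C_sub')
    then obtain w where w: "\<And>m. cnm (C.sub h (emb (\<lambda>_. w m))) < 1 / real (Suc m)" by metis
    have "(\<lambda>m. cnm (C.sub (emb (\<lambda>_. w m)) h)) \<longlonglongrightarrow> 0"
    proof (rule Lim_null_comparison)
     have "norm (cnm (C.sub (emb (\<lambda>_. w m)) h)) \<le> inverse (real (Suc m))" for m
     proof -
      have "cnm (C.sub (emb (\<lambda>_. w m)) h) = cnm (C.sub h (emb (\<lambda>_. w m)))" using C.nm_sub_comm[OF const_in h] by (simp only: C.nm_eq)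
      moreover have "0 \<le> cnm (C.sub h (emb (\<lambda>_. w m)))" using C.nm_nonneg[OF C.sub_cl[OF h const_in]] by (simp only: C.nm_eq)
      ultimately show ?thesis using w[of m] by (simp only: inverse_eq_divide real_norm_def abs_of_nonneg less_imp_le)
     qed
     then show "\<forall>\<^sub>F m in sequentially. norm (cnm (C.sub (emb (\<lambda>_. w m)) h)) \<le> inverse (real (Suc m))" by (intro always_eventually allI)
    qed (rule LIMSEQ_inverse_real_of_nat)
    moreover have "emb (\<lambda>_. w m) \<in> K" for m using inv[OF \<open>cyc \<in> K\<close>, of "w m"] by (simp only: rep_cyc)
    ultimately show "h \<in> K" by (intro KD(6)[OF _ h])
   qed
   then show ?thesis using KD(1) by blast
  qed
  show ?thesis
  proof (cases "l = hs_zero compl")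
   case True
   then have "cyc = k" using cyc by simp
   then show ?thesis using full k by simp
  next
   case l0: False
   define al where "al = (cnm k)\<^sup>2"
   define be where "be = (cnm l)\<^sup>2"
   have pos: "0 < al" "0 < be" using k0 l0 C.nm_zero_iff by (auto simp: al_def be_def)
   define G1 where "G1 = (\<lambda>a. g1 a / al)"
   define G2 where "G2 = (\<lambda>a. g2 a / be)"
   have G: "state G1" "state G2" unfolding G1_def G2_def g1_def g2_def al_def be_def by (intro vstate V k0 l0)+
   have f: "f a = al * G1 a + be * G2 a" for a using sum pos by (simp add: G1_def G2_def)
   have ab: "al + be = 1" using f[of 1] state_one[OF G(1)] state_one[OF G(2)] state_one[OF state] by simp
   have le: "f x \<le> upper x" "G1 x \<le> upper x" "G2 x \<le> upper x" for x using G state by (auto simp: state_def)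
   have lin: "linear G1" "linear G2" using G by (auto simp: state_def)
   \<comment> \<open>The convex combination f = al G1 + be G2 has to be recast as a midpoint. The
     functionals (1 - al) f + al G1 and al^2 G1 + (1 + al) be G2 are minorants of
     \<open>upper\<close> with midpoint f; equality of the first with f gives G1 = f.\<close>
   have "(\<lambda>a. (1 - al) * f a + al * G1 a) = f"
   proof (rule extreme)
    show "linear (\<lambda>a. (1 - al) * f a + al * G1 a)"
     by (rule linearI) (simp_all add: f_simps linear_add[OF lin(1)] linear_add[OF lin(2)] linear_scale[OF lin(1)] linear_scale[OF lin(2)] algebra_simps)
    show "linear (\<lambda>a. al * al * G1 a + (1 + al) * be * G2 a)"
     by (rule linearI) (simp_all add: f_simps linear_add[OF lin(1)] linear_add[OF lin(2)] linear_scale[OF lin(1)] linear_scale[OF lin(2)] algebra_simps)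
    show "(1 - al) * f x + al * G1 x \<le> upper x" for x
    proof -
     have "(1 - al) * f x + al * G1 x \<le> (1 - al) * upper x + al * upper x" using le pos ab by (intro add_mono mult_left_mono) auto
     then show ?thesis by (simp add: algebra_simps)
    qed
    show "al * al * G1 x + (1 + al) * be * G2 x \<le> upper x" for x
    proof -
     have "al * al * G1 x + (1 + al) * be * G2 x \<le> al * al * upper x + (1 + al) * be * upper x"
      using le pos ab by (intro add_mono mult_left_mono) auto
     also have "\<dots> = (al * al + (1 + al) * be) * upper x" by (simp add: algebra_simps)
     also have "al * al + (1 + al) * be = (al + be) + al * (al + be) - al" by (simp add: algebra_simps)
     finally show ?thesis using ab by simp
    qed
    show "(1 - al) * f x + al * G1 x + (al * al * G1 x + (1 + al) * be * G2 x) = 2 * f x" for x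
    proof -
     have "al * G1 x + (al * al * G1 x + (1 + al) * be * G2 x) = (1 + al) * f x" unfolding f by (simp add: algebra_simps)
     then show ?thesis by (simp add: algebra_simps)
    qed
   qed
   then have "(1 - al) * f a + al * G1 a = f a" for a by (rule fun_cong)
   then have "al * G1 a = al * f a" for a by (simp add: algebra_simps)
   then have g1f: "g1 a = al * f a" for a using pos by (simp add: G1_def)
   \<comment> \<open>The vector functional of k is al f, so k and al times \<open>cyc\<close> have
     the same real inner products with every \<open>rep a cyc\<close>.\<close>
   define u where "u = C.sub k (hs_smul compl (of_real al) cyc)"
   have uV: "u \<in> cV" unfolding u_def by (intro C.sub_cl C.sm_cl V const_in)
   have "u = hs_zero compl"
   proof (rule ip_cyc_zero[OF uV])
    fix a
    have "rep a cyc = hs_add compl (rep a k) (rep a l)" unfolding cyc using rep[OF V(1)] V(2) by blast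
    then have "cinner (rep a cyc) k = cinner (rep a k) k" using C.ip_add[of "rep a k" "rep a l" k] rl[OF k(1), of a] by (simp del: compl_sel(2))
    then have "Re (cinner (rep a cyc) k) = al * f a" using g1f[of a] by (simp add: g1_def)
    moreover have "cinner (rep a cyc) u = cinner (rep a cyc) k - of_real al * cinner (rep a cyc) cyc"
     unfolding u_def using C.ip_sub2[of k "hs_smul compl (of_real al) cyc" "rep a cyc"] C.ip_sm2[of "rep a cyc" cyc "of_real al"] C.sm_cl[OF const_in, of "of_real al" 1]
     by (simp del: compl_sel(3))
    ultimately show "Re (cinner (rep a cyc) u) = 0" using rep_cyc_inner[of a] by simp
   qed
   then have "k = hs_smul compl (of_real al) cyc" unfolding u_def by (rule C.sub_eq_zero[rotated 2]) (intro C.sm_cl V const_in)+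
   then have "cyc = hs_smul compl (of_real (1/al)) k" using pos by simp
   then have "cyc \<in> K" using KD(4)[OF k(1)] by metis
   then show ?thesis using full by blast
  qed
 qed
qed

end

text \<open>The extreme state is chosen to attain \<open>upper\<close> at \<open>st a * a\<close>.
  Then the class of a has squared norm p (st a * a) = (p a)^2, so a attains its norm at the unit
  cyclic vector.\<close>

theorem (in cstar_seminorm) GNS:
 obtains H :: "('w \<Rightarrow> complex) hilb" and r x where
  "hilbert_space H" "srep H r" "sirred H r" "x \<in> hs_carrier H" "hs_norm H x = 1" "hs_norm H (r a x) = p a"
proof -
 let ?v = "st a * a"
 have "sublin upper" unfolding sublin_def using upper_add upper_scaleR_le by blast
 then obtain f where f: "linear f" "\<And>x. f x \<le> upper x" "f ?v = upper ?v"
  "\<And>g1 g2. linear g1 \<Longrightarrow> linear g2 \<Longrightarrow> (\<And>x. g1 x \<le> upper x) \<Longrightarrow> (\<And>x. g2 x \<le> upper x) \<Longrightarrow>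
   (\<And>x. g1 x + g2 x = 2 * f x) \<Longrightarrow> g1 = f" using extreme_functional[of upper ?v] by blast
 have st: "state f" using f by (simp add: state_def)
 interpret pure_state st J p f by unfold_locales (use st f(4) in blast)+
 have "upper ?v = p ?v" using p_le_upper[OF Pos_star_mult, of a] upper_le_p[of ?v] by (simp add: st_mult)
 then have "(nm a)\<^sup>2 = (p a)\<^sup>2" using nm_f[of a] f(3) by (simp add: p_cstar)
 then have "nm a = p a" by simp
 moreover have "nm 1 = 1"
 proof -
  have "(nm 1)\<^sup>2 = 1\<^sup>2" using nm_f[of 1] state_one[OF st] by simp
  then show ?thesis by (rule power2_eq_imp_eq) auto
 qed
 ultimately show ?thesis using that[OF hilbert_space_compl srep sirred const_in[of 1]] norm_const[of 1] norm_const[of a] rep_cyc[of a] by simp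
qed

section \<open>The free *-algebra over the letters of an algebra\<close>

text \<open>The free unital complex *-algebra on the letters \<open>'a\<close> is a total type, so it carries the type
 class structure that a C*-algebra given by a carrier set lacks; \<open>J_ft\<close> is the imaginary unit.\<close>

datatype 'a ft = Let_ft 'a | Add_ft "'a ft" "'a ft" | Mul_ft "'a ft" "'a ft" | Zero_ft | One_ft | Neg_ft "'a ft"
 | Sca_ft real "'a ft" | J_ft | Star_ft "'a ft"

inductive feq :: "'a ft \<Rightarrow> 'a ft \<Rightarrow> bool" where
 rfl: "feq x x"
| symm: "feq x y \<Longrightarrow> feq y x"
| trns: "feq x y \<Longrightarrow> feq y w \<Longrightarrow> feq x w"
| add_cong: "feq x x' \<Longrightarrow> feq y y' \<Longrightarrow> feq (Add_ft x y) (Add_ft x' y')"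
| mul_cong: "feq x x' \<Longrightarrow> feq y y' \<Longrightarrow> feq (Mul_ft x y) (Mul_ft x' y')"
| neg_cong: "feq x x' \<Longrightarrow> feq (Neg_ft x) (Neg_ft x')"
| sca_cong: "feq x x' \<Longrightarrow> feq (Sca_ft r x) (Sca_ft r x')"
| star_cong: "feq x x' \<Longrightarrow> feq (Star_ft x) (Star_ft x')"
| add_assoc: "feq (Add_ft (Add_ft x y) w) (Add_ft x (Add_ft y w))"
| add_comm: "feq (Add_ft x y) (Add_ft y x)"
| add_zero: "feq (Add_ft Zero_ft x) x"
| add_neg: "feq (Add_ft (Neg_ft x) x) Zero_ft"
| mul_assoc: "feq (Mul_ft (Mul_ft x y) w) (Mul_ft x (Mul_ft y w))"
| one_mul: "feq (Mul_ft One_ft x) x"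
| mul_one: "feq (Mul_ft x One_ft) x"
| distr: "feq (Mul_ft (Add_ft x y) w) (Add_ft (Mul_ft x w) (Mul_ft y w))"
| distl: "feq (Mul_ft x (Add_ft y w)) (Add_ft (Mul_ft x y) (Mul_ft x w))"
| sca_add: "feq (Sca_ft r (Add_ft x y)) (Add_ft (Sca_ft r x) (Sca_ft r y))"
| sca_add2: "feq (Sca_ft (r + s) x) (Add_ft (Sca_ft r x) (Sca_ft s x))"
| sca_sca: "feq (Sca_ft r (Sca_ft s x)) (Sca_ft (r * s) x)"
| sca_one: "feq (Sca_ft 1 x) x"
| sca_mul1: "feq (Mul_ft (Sca_ft r x) y) (Sca_ft r (Mul_ft x y))"
| sca_mul2: "feq (Mul_ft x (Sca_ft r y)) (Sca_ft r (Mul_ft x y))"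
| J_sq: "feq (Mul_ft J_ft J_ft) (Neg_ft One_ft)"
| J_comm: "feq (Mul_ft J_ft x) (Mul_ft x J_ft)"
| star_add: "feq (Star_ft (Add_ft x y)) (Add_ft (Star_ft x) (Star_ft y))"
| star_mul: "feq (Star_ft (Mul_ft x y)) (Mul_ft (Star_ft y) (Star_ft x))"
| star_star: "feq (Star_ft (Star_ft x)) x"
| star_sca: "feq (Star_ft (Sca_ft r x)) (Sca_ft r (Star_ft x))"
| star_J: "feq (Star_ft J_ft) (Neg_ft J_ft)"

quotient_type 'a fs = "'a ft" / feq by (rule equivpI) (auto simp: reflp_def symp_def transp_def intro: feq.rfl feq.symm feq.trns)

text \<open>A complex-valued model of all relations in \<open>feq\<close>, sending letters to 0. It
  serves to show that 0 and 1 stay distinct in the quotient.\<close>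

primrec char_ft :: "'a ft \<Rightarrow> complex" where
 "char_ft (Let_ft a) = 0"
| "char_ft (Add_ft x y) = char_ft x + char_ft y"
| "char_ft (Mul_ft x y) = char_ft x * char_ft y"
| "char_ft Zero_ft = 0"
| "char_ft One_ft = 1"
| "char_ft (Neg_ft x) = - char_ft x"
| "char_ft (Sca_ft r x) = of_real r * char_ft x"
| "char_ft J_ft = \<i>"
| "char_ft (Star_ft x) = cnj (char_ft x)"

lemma char_ft_feq: "feq x y \<Longrightarrow> char_ft x = char_ft y" by (induction rule: feq.induct) (auto simp: algebra_simps)

instantiation fs :: (type) real_algebra_1
begin

lift_definition zero_fs :: "'a fs" is Zero_ft .
lift_definition one_fs :: "'a fs" is One_ft .
lift_definition plus_fs :: "'a fs \<Rightarrow> 'a fs \<Rightarrow> 'a fs" is Add_ft by (rule feq.add_cong)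
lift_definition times_fs :: "'a fs \<Rightarrow> 'a fs \<Rightarrow> 'a fs" is Mul_ft by (rule feq.mul_cong)
lift_definition uminus_fs :: "'a fs \<Rightarrow> 'a fs" is Neg_ft by (rule feq.neg_cong)
lift_definition minus_fs :: "'a fs \<Rightarrow> 'a fs \<Rightarrow> 'a fs" is "\<lambda>x y. Add_ft x (Neg_ft y)" by (intro feq.add_cong feq.neg_cong)
lift_definition scaleR_fs :: "real \<Rightarrow> 'a fs \<Rightarrow> 'a fs" is Sca_ft by (rule feq.sca_cong)

instance
proof
 fix a b c :: "'a fs" and r s :: real
 show "a + b + c = a + (b + c)" by transfer (rule feq.add_assoc)
 show "a + b = b + a" by transfer (rule feq.add_comm)
 show "0 + a = a" by transfer (rule feq.add_zero)
 show "- a + a = 0" by transfer (rule feq.add_neg)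
 show "a - b = a + - b" by transfer (rule feq.rfl)
 show "a * b * c = a * (b * c)" by transfer (rule feq.mul_assoc)
 show "1 * a = a" by transfer (rule feq.one_mul)
 show "a * 1 = a" by transfer (rule feq.mul_one)
 show "(a + b) * c = a * c + b * c" by transfer (rule feq.distr)
 show "a * (b + c) = a * b + a * c" by transfer (rule feq.distl)
 show "(0 :: 'a fs) \<noteq> 1" by transfer (use char_ft_feq in fastforce)
 show "r *\<^sub>R (a + b) = r *\<^sub>R a + r *\<^sub>R b" by transfer (rule feq.sca_add)
 show "(r + s) *\<^sub>R a = r *\<^sub>R a + s *\<^sub>R a" by transfer (rule feq.sca_add2)
 show "r *\<^sub>R s *\<^sub>R a = (r * s) *\<^sub>R a" by transfer (rule feq.sca_sca)
 show "1 *\<^sub>R a = a" by transfer (rule feq.sca_one)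
 show "r *\<^sub>R a * b = r *\<^sub>R (a * b)" by transfer (rule feq.sca_mul1)
 show "a * r *\<^sub>R b = r *\<^sub>R (a * b)" by transfer (rule feq.sca_mul2)
qed

end

lift_definition star_fs :: "'a fs \<Rightarrow> 'a fs" is Star_ft by (rule feq.star_cong)
lift_definition J_fs :: "'a fs" is J_ft .
lift_definition let_fs :: "'a \<Rightarrow> 'a fs" is Let_ft .

lemma star_fs_simps:
 "star_fs (x + y) = star_fs x + star_fs y" "star_fs (x * y) = star_fs y * star_fs x" "star_fs (star_fs x) = x"
 "star_fs (r *\<^sub>R x) = r *\<^sub>R star_fs x" "star_fs J_fs = - J_fs" "J_fs * J_fs = (-1 :: 'a fs)" "J_fs * x = x * J_fs"
 by (transfer; rule feq.intros(26-30) feq.J_sq feq.J_comm)+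

lemma fs_cases: obtains t where "w = abs_fs t"
proof -
 have "\<exists>t. w = abs_fs t" by (induct w rule: fs.abs_induct) auto
 then show ?thesis using that by blast
qed

section \<open>The unitization of a C*-algebra and its representations\<close>

locale calg =
 fixes A :: "'a cstar_alg"
 assumes calg: "cstar_algebra A"
begin

abbreviation "V \<equiv> ca_carrier A"
abbreviation "z \<equiv> ca_zero A"
abbreviation "add \<equiv> ca_add A"
abbreviation "sm \<equiv> ca_smul A"
abbreviation "mu \<equiv> ca_mult A"
abbreviation "star \<equiv> ca_star A"
abbreviation "nr \<equiv> ca_norm A"

lemma vs: "complex_vs V z add sm" and isn: "is_norm_on V z add sm nr" and cpl: "complete_on V add sm nr"
 using calg unfolding cstar_algebra_def Let_def by blast+

lemma vs_simps [simp]: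
 "z \<in> V" "\<And>x y. x \<in> V \<Longrightarrow> y \<in> V \<Longrightarrow> add x y \<in> V" "\<And>c x. x \<in> V \<Longrightarrow> sm c x \<in> V"
 "\<And>x. x \<in> V \<Longrightarrow> add z x = x" "\<And>x. x \<in> V \<Longrightarrow> add x (sm (-1) x) = z"
 "\<And>a b x. x \<in> V \<Longrightarrow> sm a (sm b x) = sm (a * b) x" "\<And>x. x \<in> V \<Longrightarrow> sm 1 x = x"
 "\<And>a x y. x \<in> V \<Longrightarrow> y \<in> V \<Longrightarrow> sm a (add x y) = add (sm a x) (sm a y)" using vs unfolding complex_vs_def by (elim conjE; simp)+

lemma add_assoc: "x \<in> V \<Longrightarrow> y \<in> V \<Longrightarrow> w \<in> V \<Longrightarrow> add (add x y) w = add x (add y w)"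
 and add_comm: "x \<in> V \<Longrightarrow> y \<in> V \<Longrightarrow> add x y = add y x"
 and sm_add_left: "x \<in> V \<Longrightarrow> sm (a + b) x = add (sm a x) (sm b x)" using vs unfolding complex_vs_def by (elim conjE; blast)+

lemma add_lcomm: "x \<in> V \<Longrightarrow> y \<in> V \<Longrightarrow> w \<in> V \<Longrightarrow> add x (add y w) = add y (add x w)" by (metis add_assoc add_comm)

lemmas add_ac' = add_assoc add_comm add_lcomm

lemma add_z [simp]: "x \<in> V \<Longrightarrow> add x z = x" by (metis add_comm vs_simps(1,4))

lemma sm_0 [simp]: "x \<in> V \<Longrightarrow> sm 0 x = z" using sm_add_left[of x 1 "-1"] by simp

lemma sm_z [simp]: "sm c z = z" using vs_simps(6)[of z c 0] by simp

lemma alg_simps [simp]: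
 "\<And>x y. x \<in> V \<Longrightarrow> y \<in> V \<Longrightarrow> mu x y \<in> V"
 "\<And>x y w. x \<in> V \<Longrightarrow> y \<in> V \<Longrightarrow> w \<in> V \<Longrightarrow> mu (mu x y) w = mu x (mu y w)"
 "\<And>x y w. x \<in> V \<Longrightarrow> y \<in> V \<Longrightarrow> w \<in> V \<Longrightarrow> mu (add x y) w = add (mu x w) (mu y w)"
 "\<And>x y w. x \<in> V \<Longrightarrow> y \<in> V \<Longrightarrow> w \<in> V \<Longrightarrow> mu x (add y w) = add (mu x y) (mu x w)"
 "\<And>c x y. x \<in> V \<Longrightarrow> y \<in> V \<Longrightarrow> mu (sm c x) y = sm c (mu x y)"
 "\<And>c x y. x \<in> V \<Longrightarrow> y \<in> V \<Longrightarrow> mu x (sm c y) = sm c (mu x y)"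
 "\<And>x. x \<in> V \<Longrightarrow> star x \<in> V" "\<And>x. x \<in> V \<Longrightarrow> star (star x) = x"
 "\<And>x y. x \<in> V \<Longrightarrow> y \<in> V \<Longrightarrow> star (add x y) = add (star x) (star y)"
 "\<And>c x. x \<in> V \<Longrightarrow> star (sm c x) = sm (cnj c) (star x)"
 "\<And>x y. x \<in> V \<Longrightarrow> y \<in> V \<Longrightarrow> star (mu x y) = mu (star y) (star x)" using calg unfolding cstar_algebra_def Let_def by (elim conjE; simp)+

lemma nr_mult: "x \<in> V \<Longrightarrow> y \<in> V \<Longrightarrow> nr (mu x y) \<le> nr x * nr y"
 and nr_cstar: "x \<in> V \<Longrightarrow> nr (mu (star x) x) = (nr x)\<^sup>2" using calg unfolding cstar_algebra_def Let_def by (elim conjE; blast)+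

lemma nr_nonneg [simp]: "x \<in> V \<Longrightarrow> 0 \<le> nr x"
 and nr_zero_iff: "x \<in> V \<Longrightarrow> nr x = 0 \<longleftrightarrow> x = z"
 and nr_sm: "x \<in> V \<Longrightarrow> nr (sm c x) = cmod c * nr x"
 and nr_tri: "x \<in> V \<Longrightarrow> y \<in> V \<Longrightarrow> nr (add x y) \<le> nr x + nr y" using isn unfolding is_norm_on_def by blast+

lemma mu_z [simp]: "x \<in> V \<Longrightarrow> mu z x = z" "x \<in> V \<Longrightarrow> mu x z = z" using alg_simps(5)[of z x 0] alg_simps(6)[of x z 0] by simp_all

lemma star_z [simp]: "star z = z" using alg_simps(10)[of z 0] by simp

lemma nr_z [simp]: "nr z = 0" using nr_zero_iff[of z] by simp

lemma nr_star [simp]: assumes "x \<in> V" shows "nr (star x) = nr x"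
proof -
 have le: "nr x \<le> nr (star x)" if "x \<in> V" for x
 proof (cases "nr x = 0")
  case False
  then have "0 < nr x" using that nr_nonneg[OF that] by linarith
  moreover have "nr x * nr x \<le> nr (star x) * nr x" using nr_mult[of "star x" x] that by (simp add: nr_cstar power2_eq_square)
  ultimately show ?thesis by simp
 qed (use that in simp)
 show ?thesis using le[OF assms] le[of "star x"] assms by simp
qed

text \<open>The target is the unitization of \<open>A\<close>: a pair (a, c) stands for a + c 1,
  which explains the product rule. Letters outside the carrier are sent to zero, so that
  \<open>ev\<close> is total.\<close>

primrec ev :: "'a ft \<Rightarrow> 'a \<times> complex" where
 "ev (Let_ft a) = (if a \<in> V then a else z, 0)"
| "ev (Add_ft x y) = (add (fst (ev x)) (fst (ev y)), snd (ev x) + snd (ev y))"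
| "ev (Mul_ft x y) = (add (mu (fst (ev x)) (fst (ev y))) (add (sm (snd (ev y)) (fst (ev x))) (sm (snd (ev x)) (fst (ev y)))),
   snd (ev x) * snd (ev y))"
| "ev Zero_ft = (z, 0)"
| "ev One_ft = (z, 1)"
| "ev (Neg_ft x) = (sm (-1) (fst (ev x)), - snd (ev x))"
| "ev (Sca_ft r x) = (sm (of_real r) (fst (ev x)), of_real r * snd (ev x))"
| "ev J_ft = (z, \<i>)"
| "ev (Star_ft x) = (star (fst (ev x)), cnj (snd (ev x)))"

lemma ev_V [simp]: "fst (ev x) \<in> V" by (induction x) auto

lemma add_neg_left [simp]: "x \<in> V \<Longrightarrow> add (sm (-1) x) x = z" by (metis add_comm vs_simps(3,5))

lemma ev_feq: "feq x y \<Longrightarrow> ev x = ev y"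
proof (induction rule: feq.induct)
 case (trns x y w) then show ?case by simp
next
 case (mul_assoc x y w)
 then show ?case by (simp add: add_ac' mult_ac)
next
 case (distr x y w)
 then show ?case by (simp add: add_ac' algebra_simps sm_add_left)
next
 case (distl x y w)
 then show ?case by (simp add: add_ac' algebra_simps sm_add_left)
next
 case (star_mul x y)
 then show ?case by (simp add: add_ac')
next
 case (add_comm x y)
 then show ?case by (simp add: calg.add_comm[OF calg_axioms])
next
 case (sca_mul1 r x y)
 then show ?case by (simp add: mult_ac)
next
 case (sca_mul2 r x y)
 then show ?case by (simp add: mult_ac)
qed (simp_all add: calg.add_assoc[OF calg_axioms] sm_add_left distrib_left distrib_right)

definition evq :: "'a fs \<Rightarrow> 'a \<times> complex" where
 "evq w = ev (SOME t. abs_fs t = w)"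

lemma evq_abs: "evq (abs_fs t) = ev t"
proof -
 have "abs_fs (SOME t'. abs_fs t' = abs_fs t) = abs_fs t" by (rule someI) (rule refl)
 then show ?thesis unfolding evq_def by (simp add: fs.abs_eq_iff ev_feq)
qed

lemma evq_simps [simp]:
 "evq (let_fs a) = (if a \<in> V then a else z, 0)"
 "evq (x + y) = (add (fst (evq x)) (fst (evq y)), snd (evq x) + snd (evq y))"
 "evq (x * y) = (add (mu (fst (evq x)) (fst (evq y))) (add (sm (snd (evq y)) (fst (evq x))) (sm (snd (evq x)) (fst (evq y)))),
   snd (evq x) * snd (evq y))"
 "evq 0 = (z, 0)" "evq 1 = (z, 1)"
 "evq (- x) = (sm (-1) (fst (evq x)), - snd (evq x))"
 "evq (r *\<^sub>R x) = (sm (of_real r) (fst (evq x)), of_real r * snd (evq x))"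
 "evq J_fs = (z, \<i>)"
 "evq (star_fs x) = (star (fst (evq x)), cnj (snd (evq x)))"
proof -
 obtain s t where st: "x = abs_fs s" "y = abs_fs t" using fs_cases by metis
 show "evq (let_fs a) = (if a \<in> V then a else z, 0)"
 "evq (x + y) = (add (fst (evq x)) (fst (evq y)), snd (evq x) + snd (evq y))"
 "evq (x * y) = (add (mu (fst (evq x)) (fst (evq y))) (add (sm (snd (evq y)) (fst (evq x))) (sm (snd (evq x)) (fst (evq y)))),
   snd (evq x) * snd (evq y))"
 "evq 0 = (z, 0)" "evq 1 = (z, 1)"
 "evq (- x) = (sm (-1) (fst (evq x)), - snd (evq x))"
 "evq (r *\<^sub>R x) = (sm (of_real r) (fst (evq x)), of_real r * snd (evq x))"
 "evq J_fs = (z, \<i>)"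
 "evq (star_fs x) = (star (fst (evq x)), cnj (snd (evq x)))"
  unfolding st by (simp_all add: evq_abs let_fs.abs_eq plus_fs.abs_eq times_fs.abs_eq zero_fs_def one_fs_def
   uminus_fs.abs_eq scaleR_fs.abs_eq J_fs_def star_fs.abs_eq)
qed

lemma evq_V [simp]: "fst (evq w) \<in> V" by (cases w rule: fs_cases) (simp add: evq_abs)

lemma evq_diff [simp]: "evq (x - y) = (add (fst (evq x)) (sm (-1) (fst (evq y))), snd (evq x) - snd (evq y))" using evq_simps(2)[of x "- y"] by simp

definition lact :: "'a fs \<Rightarrow> 'a \<Rightarrow> 'a" where
 "lact w x = add (mu (fst (evq w)) x) (sm (snd (evq w)) x)"

lemma lact_V [simp]: "x \<in> V \<Longrightarrow> lact w x \<in> V" by (simp add: lact_def)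

text \<open>The usual norm of the unitization. On words it is a seminorm, with a null space even
  beyond the kernel of \<open>evq\<close> when \<open>A\<close> already has a unit.\<close>

definition pn :: "'a fs \<Rightarrow> real" where
 "pn w = (SUP x\<in>{x \<in> V. nr x \<le> 1}. nr (lact w x))"

lemma lact_bound0: "x \<in> V \<Longrightarrow> nr (lact w x) \<le> (nr (fst (evq w)) + cmod (snd (evq w))) * nr x"
 using nr_tri[of "mu (fst (evq w)) x" "sm (snd (evq w)) x"] nr_mult[of "fst (evq w)" x] by (simp add: lact_def nr_sm distrib_right)

lemma lact_bdd: "bdd_above ((\<lambda>x. nr (lact w x)) ` {x \<in> V. nr x \<le> 1})"
proof (rule bdd_aboveI2)
 fix x assume "x \<in> {x \<in> V. nr x \<le> 1}"
 then show "nr (lact w x) \<le> nr (fst (evq w)) + cmod (snd (evq w))"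
  using lact_bound0[of x w] by (smt (verit) evq_V mem_Collect_eq mult_left_le norm_ge_zero nr_nonneg)
qed

lemma lact_sm: "x \<in> V \<Longrightarrow> lact w (sm c x) = sm c (lact w x)" by (simp add: lact_def mult_ac)

lemma pn_nonneg: "0 \<le> pn w" unfolding pn_def by (rule order_trans[OF _ cSUP_upper[OF _ lact_bdd, of z]]) auto

lemma lact_le: assumes "x \<in> V" shows "nr (lact w x) \<le> pn w * nr x"
proof (cases "x = z")
 case True then show ?thesis by (simp add: lact_def)
next
 case False
 then have n: "0 < nr x" using assms nr_zero_iff[OF assms] nr_nonneg[OF assms] by linarith
 let ?y = "sm (of_real (1 / nr x)) x"
 have "nr ?y \<le> 1" using n assms by (simp add: nr_sm norm_divide)
 then have "nr (lact w ?y) \<le> pn w" unfolding pn_def using assms by (intro cSUP_upper lact_bdd) auto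
 then have "(1 / nr x) * nr (lact w x) \<le> pn w" using n assms by (simp add: lact_sm nr_sm norm_divide)
 then show ?thesis using n by (simp add: field_simps)
qed

lemma pn_le: "(\<And>x. x \<in> V \<Longrightarrow> nr x \<le> 1 \<Longrightarrow> nr (lact w x) \<le> C) \<Longrightarrow> pn w \<le> C" unfolding pn_def by (rule cSUP_least) (auto intro!: exI[of _ z])

lemma lact_add: "x \<in> V \<Longrightarrow> lact (u + w) x = add (lact u x) (lact w x)" by (simp add: lact_def sm_add_left add_ac')

lemma lact_mult: "x \<in> V \<Longrightarrow> lact (u * w) x = lact u (lact w x)" by (simp add: lact_def add_ac' mult_ac)

lemma lact_scaleR: "x \<in> V \<Longrightarrow> lact (r *\<^sub>R w) x = sm (of_real r) (lact w x)" by (simp add: lact_def)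

lemma lact_star: "x \<in> V \<Longrightarrow> y \<in> V \<Longrightarrow> mu (star (lact w x)) y = mu (star x) (lact (star_fs w) y)" by (simp add: lact_def)

lemma pn_mult: "pn (u * w) \<le> pn u * pn w"
proof (rule pn_le)
 fix x assume x: "x \<in> V" "nr x \<le> 1"
 have "nr (lact (u * w) x) \<le> pn u * nr (lact w x)" using x by (simp add: lact_mult lact_le)
 also have "nr (lact w x) \<le> pn w" using lact_le[OF x(1), of w] x pn_nonneg[of w] by (smt (verit) mult_left_le)
 finally show "nr (lact (u * w) x) \<le> pn u * pn w" using pn_nonneg[of u] by (simp add: mult_left_mono)
qed

text \<open>For x in the unit ball the C*-identity of \<open>A\<close> expresses the squared norm of
  w x as the norm of \<open>star x\<close> times (w* w) x, where w* is the adjoint of w.\<close>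

lemma pn_sq_le: "(pn w)\<^sup>2 \<le> pn (star_fs w * w)"
proof -
 have "pn w \<le> sqrt (pn (star_fs w * w))"
 proof (rule pn_le)
  fix x assume x: "x \<in> V" "nr x \<le> 1"
  have "(nr (lact w x))\<^sup>2 = nr (mu (star (lact w x)) (lact w x))" using x by (simp add: nr_cstar)
  also have "\<dots> = nr (mu (star x) (lact (star_fs w * w) x))" using x by (simp add: lact_star lact_mult)
  also have "\<dots> \<le> nr (star x) * nr (lact (star_fs w * w) x)" using x by (intro nr_mult) auto
  also have "\<dots> \<le> 1 * (pn (star_fs w * w) * 1)" using x pn_nonneg by (intro mult_mono order_trans[OF lact_le] mult_left_mono) auto
  finally show "nr (lact w x) \<le> sqrt (pn (star_fs w * w))" using x by (intro real_le_rsqrt) simp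
 qed
 then have "(pn w)\<^sup>2 \<le> (sqrt (pn (star_fs w * w)))\<^sup>2" using pn_nonneg by (intro power_mono)
 then show ?thesis using pn_nonneg by simp
qed

text \<open>The lower bound comes from the test vector \<open>star a\<close>. Elements of
  \<open>A\<close> thus keep their norm inside the unitization.\<close>

lemma pn_letter: assumes "a \<in> V" shows "evq w = (a, 0) \<Longrightarrow> pn w = nr a"
proof -
 assume w: "evq w = (a, 0)"
 have l: "lact w x = mu a x" if "x \<in> V" for x using that assms by (simp add: lact_def w)
 show ?thesis
 proof (rule antisym)
  show "pn w \<le> nr a"
  proof (rule pn_le)
   fix x assume x: "x \<in> V" "nr x \<le> 1"
   show "nr (lact w x) \<le> nr a" unfolding l[OF x(1)] by (rule order_trans[OF nr_mult]) (use x assms in \<open>auto intro: mult_left_le\<close>)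
  qed
  show "nr a \<le> pn w"
  proof (cases "a = z")
   case True then show ?thesis using pn_nonneg[of w] by simp
  next
   case False
   then have n: "0 < nr a" using assms nr_zero_iff[OF assms] nr_nonneg[OF assms] by linarith
   have "nr (lact w (star a)) = nr a * nr a" using nr_cstar[of "star a"] assms by (simp add: l power2_eq_square)
   then show ?thesis using lact_le[of "star a" w] assms n by simp
  qed
 qed
qed

lemma pn_eq0: assumes "evq u = evq v" shows "pn (u - v) = 0"
proof -
 have "evq (u - v) = (z, 0)" using assms by simp
 then show ?thesis using pn_letter[of z "u - v"] by simp
qed

lemma pn_zeroD: "pn w = 0 \<Longrightarrow> snd (evq w) = 0 \<Longrightarrow> fst (evq w) = z"
 using pn_letter[of "fst (evq w)" w] nr_zero_iff[of "fst (evq w)"] by (metis evq_V prod.collapse)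

lemma eq_of_diff_zero: "x \<in> V \<Longrightarrow> y \<in> V \<Longrightarrow> add x (sm (-1) y) = z \<Longrightarrow> x = y" by (metis add_assoc add_comm add_z vs_simps(3,5))

lemma cstar_seminorm: assumes "V \<noteq> {z}" shows "cstar_seminorm star_fs J_fs pn"
proof
 fix x y :: "'a fs" and r
 show "pn (x + y) \<le> pn x + pn y"
 proof (rule pn_le)
  fix w assume w: "w \<in> V" "nr w \<le> 1"
  have "nr (lact x w) \<le> pn x" "nr (lact y w) \<le> pn y" unfolding pn_def using w by (auto intro!: cSUP_upper lact_bdd)
  then show "nr (lact (x + y) w) \<le> pn x + pn y" using nr_tri[of "lact x w" "lact y w"] w by (simp add: lact_add)
 qed
 have le: "pn (r *\<^sub>R x) \<le> \<bar>r\<bar> * pn x" for r and x :: "'a fs"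
 proof (rule pn_le)
  fix w assume w: "w \<in> V" "nr w \<le> 1"
  have "nr (lact x w) \<le> pn x" unfolding pn_def using w by (auto intro!: cSUP_upper lact_bdd)
  then show "nr (lact (r *\<^sub>R x) w) \<le> \<bar>r\<bar> * pn x" using w by (simp add: lact_scaleR nr_sm mult_left_mono)
 qed
 show "pn (r *\<^sub>R x) = \<bar>r\<bar> * pn x"
 proof (cases "r = 0")
  case True then show ?thesis using le[of 0 x] pn_nonneg[of "0 :: 'a fs"] by simp
 next
  case False
  have "pn ((1/r) *\<^sub>R r *\<^sub>R x) \<le> \<bar>1/r\<bar> * pn (r *\<^sub>R x)" by (rule le)
  then show ?thesis using le[of r x] False by (simp add: field_simps)
 qed
 have st: "pn x \<le> pn (star_fs x)" for x :: "'a fs"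
 proof (cases "pn x = 0")
  case True then show ?thesis using pn_nonneg by simp
 next
  case False
  then have "pn x * pn x \<le> pn (star_fs x) * pn x" using pn_sq_le[of x] pn_mult[of "star_fs x" x] by (simp add: power2_eq_square)
  then show ?thesis using False pn_nonneg[of x] by simp
 qed
 have "pn (star_fs x) = pn x" using st[of x] st[of "star_fs x"] by (simp add: star_fs_simps(3))
 then show "pn (star_fs x * x) = (pn x)\<^sup>2" using pn_sq_le[of x] pn_mult[of "star_fs x" x] by (simp add: power2_eq_square)
 \<comment> \<open>A nonzero element on which 1 acts as the identity is needed for pn 1 = 1; this is
   where the zero algebra is excluded.\<close>
 obtain a where a: "a \<in> V" "a \<noteq> z" using assms vs_simps(1) by blast
 have l1: "lact 1 x = x" if "x \<in> V" for x using that by (simp add: lact_def)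
 have "0 < nr a" using a nr_zero_iff[OF a(1)] nr_nonneg[OF a(1)] by linarith
 then have "1 \<le> pn 1" using lact_le[OF a(1), of 1] l1[OF a(1)] by simp
 moreover have "pn 1 \<le> 1" by (rule pn_le) (simp add: l1)
 ultimately show "pn 1 = 1" by simp
qed (rule star_fs_simps pn_mult)+

end

lemma is_repD:
 assumes "is_rep A H \<pi>" "a \<in> ca_carrier A" "x \<in> hs_carrier H"
 shows "\<pi> a x \<in> hs_carrier H"
  "y \<in> hs_carrier H \<Longrightarrow> \<pi> a (hs_add H x y) = hs_add H (\<pi> a x) (\<pi> a y)"
  "\<pi> a (hs_smul H c x) = hs_smul H c (\<pi> a x)"
  "b \<in> ca_carrier A \<Longrightarrow> \<pi> (ca_add A a b) x = hs_add H (\<pi> a x) (\<pi> b x)"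
  "b \<in> ca_carrier A \<Longrightarrow> \<pi> (ca_mult A a b) x = \<pi> a (\<pi> b x)"
  "\<pi> (ca_smul A c a) x = hs_smul H c (\<pi> a x)"
  "y \<in> hs_carrier H \<Longrightarrow> hs_inner H (\<pi> a x) y = hs_inner H x (\<pi> (ca_star A a) y)" using assms unfolding is_rep_def by blast+

context calg
begin

theorem exists_irrep:
 assumes a: "a \<in> V" "a \<noteq> z"
 obtains H :: "('a fs \<Rightarrow> complex) hilb" and \<pi> x where
  "hilbert_space H" "nonzero_irreducible_rep A H \<pi>" "x \<in> hs_carrier H" "hs_norm H x = 1" "hs_norm H (\<pi> a x) = nr a"
proof -
 interpret S: cstar_seminorm star_fs J_fs pn by (rule cstar_seminorm) (use a in auto)
 have pn_let: "pn (let_fs b) = nr b" if "b \<in> V" for b using pn_letter[OF that, of "let_fs b"] that by simp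
 obtain H :: "('a fs \<Rightarrow> complex) hilb" and r x where
  H: "hilbert_space H" "S.srep H r" "S.sirred H r" "x \<in> hs_carrier H" "hs_norm H x = 1" "hs_norm H (r (let_fs a) x) = pn (let_fs a)" by (rule S.GNS)
 interpret hilb H by unfold_locales (rule H)
 note rep = H(2)[unfolded S.srep_def, rule_format]
 \<comment> \<open>Words with the same image in the unitization differ by a word of seminorm 0,
   which r annihilates. Hence letters are compatible with the operations of
   \<open>A\<close>.\<close>
 have req: "r u h = r v h" if h: "h \<in> hs_carrier H" and e: "evq u = evq v" for u v h
 proof -
  have "hs_norm H (r (u - v) h) \<le> 0" using rep[OF h] pn_eq0[OF e] by (metis mult_zero_left)
  moreover have V: "r (u - v) h \<in> hs_carrier H" "r v h \<in> hs_carrier H" using rep[OF h] by blast+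
  ultimately have "r (u - v) h = hs_zero H" using nm_zero_iff[OF V(1)] nm_nonneg[OF V(1)] by simp
  moreover have "r (v + (u - v)) h = hs_add H (r v h) (r (u - v) h)" using rep[OF h] by blast
  moreover have "hs_add H (r v h) (hs_zero H) = r v h" using V by (intro ip_eqI) auto
  ultimately show ?thesis by simp
 qed
 have ev_csm: "evq (S.csm c w) = (sm c (fst (evq w)), c * snd (evq w))" for c w
 proof -
  have "add (sm (of_real (Re c)) b) (sm (of_real (Im c) * \<i>) b) = sm c b" if "b \<in> V" for b
   using sm_add_left[OF that, of "of_real (Re c)" "of_real (Im c) * \<i>"] complex_eq[of c] by (simp add: mult.commute)
  moreover have "complex_of_real (Re c) * l + of_real (Im c) * (\<i> * l) = c * l" for l
   using complex_eq[of c] by (metis distrib_right mult.assoc mult.commute)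
  ultimately show ?thesis by (simp add: S.csm_def)
 qed
 define \<pi> where "\<pi> = (\<lambda>b. r (let_fs b))"
 have irr: "is_rep A H \<pi>" unfolding is_rep_def \<pi>_def
 proof (intro conjI ballI allI)
  fix a b c x y assume a: "a \<in> V" and x: "x \<in> hs_carrier H"
  show "r (let_fs a) x \<in> hs_carrier H" "r (let_fs a) (hs_smul H c x) = hs_smul H c (r (let_fs a) x)" using rep[OF x] by blast+
  show "r (let_fs (sm c a)) x = hs_smul H c (r (let_fs a) x)"
  proof -
   have "r (let_fs (sm c a)) x = r (S.csm c (let_fs a)) x" by (rule req[OF x]) (simp add: ev_csm a)
   then show ?thesis using rep[OF x] by simp
  qed
  show "r (let_fs (add a b)) x = hs_add H (r (let_fs a) x) (r (let_fs b) x)"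
    "r (let_fs (mu a b)) x = r (let_fs a) (r (let_fs b) x)" if b: "b \<in> V"
  proof -
   have "r (let_fs (add a b)) x = r (let_fs a + let_fs b) x" by (rule req[OF x]) (simp add: a b)
   then show "r (let_fs (add a b)) x = hs_add H (r (let_fs a) x) (r (let_fs b) x)" using rep[OF x] by simp
   have "r (let_fs (mu a b)) x = r (let_fs a * let_fs b) x" by (rule req[OF x]) (simp add: a b)
   then show "r (let_fs (mu a b)) x = r (let_fs a) (r (let_fs b) x)" using rep[OF x] by simp
  qed
  assume y: "y \<in> hs_carrier H"
  show "r (let_fs a) (hs_add H x y) = hs_add H (r (let_fs a) x) (r (let_fs a) y)" using rep[OF x] y by blast
  have "r (let_fs (star a)) y = r (star_fs (let_fs a)) y" by (rule req[OF y]) (simp add: a)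
  then show "hs_inner H (r (let_fs a) x) y = hs_inner H x (r (let_fs (star a)) y)" using rep[OF x] y by simp
 next
  fix a assume "a \<in> V"
  show "\<exists>C. \<forall>x\<in>hs_carrier H. hs_norm H (r (let_fs a) x) \<le> C * hs_norm H x" using rep by blast
 qed
 have na: "hs_norm H (\<pi> a x) = nr a" using H(6) pn_let[OF a(1)] by (simp add: \<pi>_def)
 have "0 < nr a" using a nr_zero_iff[OF a(1)] nr_nonneg[OF a(1)] by linarith
 then have nz: "\<pi> a x \<noteq> hs_zero H" using na nm_zero_iff[of "hs_zero H"] by auto
 have "K = {hs_zero H} \<or> K = hs_carrier H" if K: "closed_subspace H K" "\<And>a x. a \<in> V \<Longrightarrow> x \<in> K \<Longrightarrow> \<pi> a x \<in> K" for K
 proof -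
  \<comment> \<open>Every word acts as an element of \<open>A\<close> plus a scalar, so a subspace
    invariant under \<open>A\<close> is invariant under all words.\<close>
  have "r w x \<in> K" if x: "x \<in> K" for w x
  proof -
   have xV: "x \<in> hs_carrier H" using x closed_subspaceD(1)[OF K(1)] by blast
   let ?a = "fst (evq w)" and ?l = "snd (evq w)"
   have "r w x = r (let_fs ?a + S.csm ?l 1) x" by (rule req[OF xV]) (simp add: ev_csm)
   also have "\<dots> = hs_add H (\<pi> ?a x) (hs_smul H ?l x)" using rep[OF xV] by (simp add: \<pi>_def)
   finally show ?thesis using K(2)[of ?a x] x closed_subspaceD(3,4)[OF K(1)] by simp
  qed
  then show ?thesis using H(3) K(1) unfolding S.sirred_def by blast
 qed
 then have "nonzero_irreducible_rep A H \<pi>" unfolding nonzero_irreducible_rep_def using irr nz a(1) H(4) by blast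
 then show ?thesis using that H na by blast
qed

text \<open>The iteration \<open>y \<mapsto> (x + y\<^sup>2)/2\<close> converges to \<open>1 - sqrt (1 - x)\<close>, which lies in the algebra
 although the unit need not.\<close>

lemma one_minus_sqrt:
 assumes x: "x \<in> V" "star x = x" "nr x < 1"
 obtains y where "y \<in> V" "star y = y" "sm 2 y = add x (mu y y)"
proof (cases "V = {z}")
 case True then show ?thesis using that[of z] x by simp
next
 case False
 interpret S: cstar_seminorm star_fs J_fs pn by (rule cstar_seminorm[OF False])
 have pn_let: "pn (let_fs b) = nr b" if "b \<in> V" for b using pn_letter[OF that, of "let_fs b"] that by simp
 define X where "X = let_fs x"
 define Y where "Y = sqrt_iter X"
 have pX: "pn X \<le> nr x" "nr x \<le> 1" using pn_let x by (auto simp: X_def)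
 \<comment> \<open>The scalar part remains 0: the iterates never leave \<open>A\<close>.\<close>
 have sY: "snd (evq (Y m)) = 0" for m by (induction m) (simp_all add: Y_def X_def)
 define s where "s = (\<lambda>m. fst (evq (Y m)))"
 have sV [simp]: "s m \<in> V" for m by (simp add: s_def)
 have stY: "star (s m) = s m" for m by (induction m) (simp_all add: s_def Y_def X_def x[unfolded Y_def] sY[unfolded Y_def X_def])
 have diff: "nr (add (s m) (sm (-1) (s k))) = pn (Y m - Y k)" for m k by (rule pn_letter[symmetric]) (simp_all add: s_def sY)
 define r where "r = nr x"
 have r: "0 \<le> r" "r < 1" using x by (auto simp: r_def)
 have step: "pn (Y (Suc m) - Y m) \<le> r ^ Suc m" for m unfolding Y_def r_def by (rule S.p_sqrt_iter_step[OF pX])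
 have far: "pn (Y (m + j) - Y m) \<le> r ^ Suc m / (1 - r)" for m j
 proof -
  have "pn (Y (m + j) - Y m) \<le> (\<Sum>i<j. r ^ Suc (m + i))"
  proof (induction j)
   case (Suc j)
   have "Y (m + Suc j) - Y m = (Y (Suc (m + j)) - Y (m + j)) + (Y (m + j) - Y m)" by simp
   then have "pn (Y (m + Suc j) - Y m) \<le> pn (Y (Suc (m + j)) - Y (m + j)) + pn (Y (m + j) - Y m)" by (metis S.p_tri)
   then show ?case using Suc step[of "m + j"] by simp
  qed simp
  also have "\<dots> = r ^ Suc m * (\<Sum>i<j. r ^ i)" by (simp add: sum_distrib_left power_add mult_ac)
  also have "(\<Sum>i<j. r ^ i) \<le> 1 / (1 - r)" using r by (simp add: sum_gp_strict divide_right_mono)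
  finally show ?thesis using r by (simp add: mult_left_mono)
 qed
 have lim0: "(\<lambda>m. r ^ Suc m / (1 - r)) \<longlonglongrightarrow> 0" using r by (intro tendsto_divide_zero LIMSEQ_Suc LIMSEQ_realpow_zero)
 have "\<exists>N. \<forall>m\<ge>N. \<forall>k\<ge>N. nr (add (s m) (sm (-1) (s k))) < e" if e: "0 < e" for e
 proof -
  obtain N where N: "\<And>m. N \<le> m \<Longrightarrow> r ^ Suc m / (1 - r) < e" using order_tendstoD(2)[OF lim0 e] by (auto simp: eventually_sequentially)
  have "nr (add (s m) (sm (-1) (s k))) < e" if "N \<le> m" "N \<le> k" for m k
  proof (cases "k \<le> m")
   case True
   then show ?thesis using far[of k "m - k"] N[OF that(2)] by (simp add: diff)
  next
   case False
   then show ?thesis using far[of m "k - m"] N[OF that(1)] S.p_commute[of "Y m"] by (simp add: diff)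
  qed
  then show ?thesis by blast
 qed
 then obtain l where l: "l \<in> V" "(\<lambda>k. nr (add (s k) (sm (-1) l))) \<longlonglongrightarrow> 0" using cpl sV unfolding complete_on_def by blast
 define L where "L = let_fs l"
 have nrL: "nr (add (s k) (sm (-1) l)) = pn (Y k - L)" for k by (rule pn_letter[symmetric]) (simp_all add: s_def sY L_def l)
 have lim: "(\<lambda>k. pn (Y k - L)) \<longlonglongrightarrow> 0" using l(2) by (simp add: nrL)
 \<comment> \<open>The recursion passes to the limit because the defect of L is bounded by distances
   between the iterates and L.\<close>
 have "pn (2 *\<^sub>R L - (X + L * L)) \<le> 0"
 proof (rule LIMSEQ_le_const)
  show "(\<lambda>k. 2 * pn (Y (Suc k) - L) + (pn L * pn (Y k - L) + pn (Y k - L) * 1)) \<longlonglongrightarrow> 0"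
   using tendsto_add[OF tendsto_mult_left[OF LIMSEQ_Suc[OF lim], of 2] tendsto_add[OF tendsto_mult_left[OF lim, of "pn L"] tendsto_mult_right[OF lim, of 1]]]
   by simp
  have "pn (2 *\<^sub>R L - (X + L * L)) \<le> 2 * pn (Y (Suc k) - L) + (pn L * pn (Y k - L) + pn (Y k - L) * 1)" for k
  proof -
   have "2 *\<^sub>R Y (Suc k) = X + Y k * Y k" by (simp add: Y_def)
   then have "2 *\<^sub>R L - (X + L * L) = 2 *\<^sub>R (L - Y (Suc k)) + (L * (Y k - L) + (Y k - L) * Y k)" by (simp add: algebra_simps)
   then have "pn (2 *\<^sub>R L - (X + L * L)) \<le> pn (2 *\<^sub>R (L - Y (Suc k))) + (pn (L * (Y k - L)) + pn ((Y k - L) * Y k))"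
    using S.p_tri[of "2 *\<^sub>R (L - Y (Suc k))" "L * (Y k - L) + (Y k - L) * Y k"] S.p_tri[of "L * (Y k - L)" "(Y k - L) * Y k"] by simp
   moreover have "pn (Y k) \<le> 1" unfolding Y_def using S.p_sqrt_iter[OF pX] pX(2) by (rule order_trans)
   ultimately show ?thesis
    using S.p_mult[of L "Y k - L"] S.p_mult[of "Y k - L" "Y k"] mult_left_mono[of "pn (Y k)" 1 "pn (Y k - L)"] S.p_commute[of L "Y (Suc k)"]
    by (simp add: S.p_scaleR)
  qed
  then show "\<exists>N. \<forall>n\<ge>N. pn (2 *\<^sub>R L - (X + L * L)) \<le> 2 * pn (Y (Suc n) - L) + (pn L * pn (Y n - L) + pn (Y n - L) * 1)" by blast
 qed
 then have "pn (2 *\<^sub>R L - (X + L * L)) = 0" using S.p_nonneg by (simp add: order_antisym)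
 then have "fst (evq (2 *\<^sub>R L - (X + L * L))) = z" by (rule pn_zeroD) (simp add: L_def X_def)
 then have "add (sm 2 l) (sm (-1) (add x (mu l l))) = z" by (simp add: L_def X_def l x)
 then have 1: "sm 2 l = add x (mu l l)" by (rule eq_of_diff_zero[rotated 2]) (use l x in auto)
 have cancel: "add (add a (sm (-1) b)) (add b c) = add a c" if "a \<in> V" "b \<in> V" "c \<in> V" for a b c
  using that by (metis add_assoc add_neg_left vs_simps(2-4))
 have "nr (add (star l) (sm (-1) l)) \<le> 0"
 proof (rule LIMSEQ_le_const)
  show "(\<lambda>k. pn (Y k - L) + pn (Y k - L)) \<longlonglongrightarrow> 0" using tendsto_add[OF lim lim] by simp
  have "nr (add (star l) (sm (-1) l)) \<le> pn (Y k - L) + pn (Y k - L)" for k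
  proof -
   have "add (star l) (sm (-1) l) = add (star (add l (sm (-1) (s k)))) (add (s k) (sm (-1) l))" using l by (simp add: cancel stY)
   also have "nr \<dots> \<le> nr (star (add l (sm (-1) (s k)))) + nr (add (s k) (sm (-1) l))" using l by (intro nr_tri) auto
   also have "nr (star (add l (sm (-1) (s k)))) = pn (L - Y k)" using l by (subst nr_star) (auto intro!: pn_letter[symmetric] simp: L_def s_def sY)
   finally show ?thesis using nrL S.p_commute[of L "Y k"] by simp
  qed
  then show "\<exists>N. \<forall>n\<ge>N. nr (add (star l) (sm (-1) l)) \<le> pn (Y n - L) + pn (Y n - L)" by blast
 qed
 moreover have D: "add (star l) (sm (-1) l) \<in> V" using l by simp
 ultimately have "add (star l) (sm (-1) l) = z" using nr_zero_iff[OF D] nr_nonneg[OF D] by linarith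
 then have "star l = l" by (rule eq_of_diff_zero[rotated 2]) (use l in auto)
 then show ?thesis using that l(1) 1 by blast
qed

text \<open>\<open>is_rep\<close> provides only some bound for each operator. For s >
  \<open>nr a\<close> put c = a / s and b = \<open>mu (star c) c\<close>, and let y = 1 - sqrt (1 -
  b). The identity (1 - y)^2 = 1 - b turns |x|^2 - |\<pi> c x|^2 into the squared norm of \<pi> y x
  - x.\<close>

theorem rep_contractive:
 assumes H: "hilbert_space H" and rep: "is_rep A H \<pi>" and a: "a \<in> V" and x: "x \<in> hs_carrier H"
 shows "hs_norm H (\<pi> a x) \<le> nr a * hs_norm H x"
proof -
 interpret hilb H by unfold_locales (rule H)
 note R = is_repD[OF rep]
 have "hs_norm H (\<pi> a x) \<le> s * hs_norm H x" if s: "nr a < s" for s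
 proof -
  have s0: "0 < s" using s nr_nonneg[OF a] by linarith
  define c where "c = sm (of_real (1/s)) a"
  have c: "c \<in> V" by (simp add: c_def a)
  have nc: "nr c < 1" using s s0 a by (simp add: c_def nr_sm norm_divide)
  define b where "b = mu (star c) c"
  have b: "b \<in> V" "star b = b" using c by (simp_all add: b_def)
  have "nr b < 1" using nc c by (simp add: b_def nr_cstar abs_square_less_1)
  then obtain y where y: "y \<in> V" "star y = y" "sm 2 y = add b (mu y y)" using one_minus_sqrt b by metis
  define u where "u = \<pi> y x"
  have uV: "u \<in> hs_carrier H" "\<pi> c x \<in> hs_carrier H" "\<pi> b x \<in> hs_carrier H" "\<pi> y u \<in> hs_carrier H" using R(1) x y c b by (auto simp: u_def)
  have "hs_smul H 2 u = hs_add H (\<pi> b x) (\<pi> y u)"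
   using R(4)[OF b(1) x, of "mu y y"] R(5)[OF y(1) x y(1)] R(6)[OF y(1) x, of 2] y by (simp add: u_def)
  then have "hs_inner H (hs_smul H 2 u) x = hs_inner H (hs_add H (\<pi> b x) (\<pi> y u)) x" by simp
  then have 1: "2 * hs_inner H u x = hs_inner H (\<pi> b x) x + hs_inner H (\<pi> y u) x" using uV x by simp
  have 2: "hs_inner H (\<pi> y u) x = hs_inner H u u" using R(7)[OF y(1) uV(1) x] y by (simp add: u_def)
  have 3: "hs_inner H (\<pi> b x) x = hs_inner H (\<pi> c x) (\<pi> c x)" using R(7)[of "star c" "\<pi> c x" x] R(5)[of "star c" x c] c x uV by (simp add: b_def)
  have "(hs_norm H (\<pi> c x))\<^sup>2 = 2 * Re (hs_inner H u x) - (hs_norm H u)\<^sup>2"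
   using arg_cong[OF 1, of Re] nm_sq[OF uV(1)] nm_sq[OF uV(2)] by (simp add: 2 3)
  also have "\<dots> = (hs_norm H x)\<^sup>2 - (hs_norm H (sub u x))\<^sup>2" using nm_sq_sub[OF uV(1) x] by simp
  also have "\<dots> \<le> (hs_norm H x)\<^sup>2" by simp
  finally have le: "hs_norm H (\<pi> c x) \<le> hs_norm H x" using nm_nonneg[OF x] by (simp add: abs_le_square_iff[symmetric])
  have "\<pi> c x = hs_smul H (of_real (1/s)) (\<pi> a x)" using R(6)[OF a x] by (simp add: c_def)
  then have "hs_norm H (\<pi> c x) = (1/s) * hs_norm H (\<pi> a x)" using nm_sm[OF R(1)[OF a x], of "of_real (1/s)"] s0 by (simp add: norm_divide)
  then have "hs_norm H (\<pi> a x) = s * hs_norm H (\<pi> c x)" using s0 by simp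
  then show ?thesis using mult_left_mono[OF le, of s] s0 by simp
 qed
 then have "hs_norm H (\<pi> a x) \<le> (nr a + e) * hs_norm H x" if "0 < e" for e using that by simp
 then have "hs_norm H (\<pi> a x) \<le> nr a * hs_norm H x + d" if "0 < d" for d
 proof -
  have n: "0 \<le> hs_norm H x" using nm_nonneg[OF x] by simp
  have "hs_norm H (\<pi> a x) \<le> (nr a + d / (hs_norm H x + 1)) * hs_norm H x" using that n by (intro \<open>\<And>e. 0 < e \<Longrightarrow> _\<close>) simp
  also have "\<dots> = nr a * hs_norm H x + d * (hs_norm H x / (hs_norm H x + 1))" by (simp add: distrib_right)
  also have "\<dots> \<le> nr a * hs_norm H x + d * 1" using that n by (intro add_left_mono mult_left_mono) auto
  finally show ?thesis by simp
 qed
 then show ?thesis by (rule field_le_epsilon)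
qed

end

section \<open>Transport of Hilbert spaces between types\<close>

text \<open>Homogeneity quantifies over Hilbert spaces on a single type, so a space living elsewhere
  is copied along an injection before the hypothesis can be used.\<close>

definition hilb_image :: "('h \<Rightarrow> 'k) \<Rightarrow> 'h hilb \<Rightarrow> 'k hilb" where
 "hilb_image t H = (let i = inv_into (hs_carrier H) t in
   \<lparr> hs_carrier = t ` hs_carrier H, hs_zero = t (hs_zero H), hs_add = (\<lambda>u v. t (hs_add H (i u) (i v))),
    hs_smul = (\<lambda>c u. t (hs_smul H c (i u))), hs_inner = (\<lambda>u v. hs_inner H (i u) (i v)) \<rparr>)"

locale hilb_inj = hilb H for H :: "'h hilb" +
 fixes t :: "'h \<Rightarrow> 'k"
 assumes inj: "inj_on t (hs_carrier H)"
begin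

abbreviation "i \<equiv> inv_into (HC) t"
abbreviation "L \<equiv> hilb_image t H"

lemma i_t [simp]: "x \<in> HC \<Longrightarrow> i (t x) = x" using inj by simp

lemma image_sel [simp]: "hs_carrier L = t ` HC" "hs_zero L = t (hs_zero H)"
 "hs_add L u v = t (hs_add H (i u) (i v))" "hs_smul L c u = t (hs_smul H c (i u))" "hs_inner L u v = hs_inner H (i u) (i v)"
 by (simp_all add: hilb_image_def Let_def)

lemma image_norm [simp]: "hs_norm L u = hs_norm H (i u)" by (simp add: hs_norm_def)

lemma hilbert_space_image: "hilbert_space L"
proof -
 let ?V = "HC"
 have c: "hs_zero H \<in> ?V" "\<forall>x\<in>?V. \<forall>y\<in>?V. hs_add H x y \<in> ?V" "\<forall>c. \<forall>x\<in>?V. hs_smul H c x \<in> ?V"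
  "\<forall>x\<in>?V. \<forall>y\<in>?V. \<forall>w\<in>?V. hs_add H (hs_add H x y) w = hs_add H x (hs_add H y w)"
  "\<forall>x\<in>?V. \<forall>y\<in>?V. hs_add H x y = hs_add H y x" "\<forall>x\<in>?V. hs_add H (hs_zero H) x = x"
  "\<forall>x\<in>?V. hs_add H x (hs_smul H (-1) x) = hs_zero H" "\<forall>a b. \<forall>x\<in>?V. hs_smul H a (hs_smul H b x) = hs_smul H (a * b) x"
  "\<forall>x\<in>?V. hs_smul H 1 x = x" "\<forall>a. \<forall>x\<in>?V. \<forall>y\<in>?V. hs_smul H a (hs_add H x y) = hs_add H (hs_smul H a x) (hs_smul H a y)"
  "\<forall>a b. \<forall>x\<in>?V. hs_smul H (a + b) x = hs_add H (hs_smul H a x) (hs_smul H b x)" using vs unfolding complex_vs_def by - (elim conjE, assumption)+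
 have "complex_vs (hs_carrier L) (hs_zero L) (hs_add L) (hs_smul L)"
  unfolding complex_vs_def by (auto simp: c(1-4,6-11) intro!: arg_cong[where f=t] c(5)[rule_format])
 moreover have "complete_on (hs_carrier L) (hs_add L) (hs_smul L) (hs_norm L)" unfolding complete_on_def
 proof (intro allI impI)
  fix s :: "nat \<Rightarrow> 'k" assume A: "(\<forall>k. s k \<in> hs_carrier L) \<and> (\<forall>e>0. \<exists>N. \<forall>m\<ge>N. \<forall>k\<ge>N. hs_norm L (hs_add L (s m) (hs_smul L (- 1) (s k))) < e)"
  have sV: "i (s k) \<in> HC" "t (i (s k)) = s k" for k using A by (auto simp: inv_into_into f_inv_into_f)
  obtain l where l: "l \<in> HC" "(\<lambda>k. hs_norm H (sub (i (s k)) l)) \<longlonglongrightarrow> 0" by (rule complete[of "\<lambda>k. i (s k)"]) (use A sV in \<open>auto simp: sub_def\<close>)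
  then show "\<exists>l\<in>hs_carrier L. (\<lambda>k. hs_norm L (hs_add L (s k) (hs_smul L (- 1) l))) \<longlonglongrightarrow> 0" using sV by (intro bexI[of _ "t l"]) (auto simp: sub_def)
 qed
 ultimately show ?thesis unfolding hilbert_space_def Let_def
 proof (intro conjI)
  show "\<forall>x\<in>hs_carrier L. \<forall>y\<in>hs_carrier L. hs_inner L y x = cnj (hs_inner L x y)"
  proof (intro ballI)
   fix x y assume "x \<in> hs_carrier L" "y \<in> hs_carrier L"
   then have "i x \<in> HC" "i y \<in> HC" by (auto simp: inv_into_into)
   then have "hs_inner H (i y) (i x) = cnj (hs_inner H (i x) (i y))" by (rule ip_cnj)
   then show "hs_inner L y x = cnj (hs_inner L x y)" by simp
  qed
 qed (auto simp: ip_im ip_pos dest: ip_definite)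
qed

lemma irrep_image:
 assumes "nonzero_irreducible_rep A H \<pi>" and star [simp]: "\<And>a. a \<in> ca_carrier A \<Longrightarrow> ca_star A a \<in> ca_carrier A"
 shows "nonzero_irreducible_rep A L (\<lambda>a u. t (\<pi> a (i u)))"
proof -
 have rep: "is_rep A H \<pi>" and nz: "\<exists>a\<in>ca_carrier A. \<exists>x\<in>HC. \<pi> a x \<noteq> hs_zero H"
  and irr: "\<And>K. closed_subspace H K \<Longrightarrow> (\<forall>a\<in>ca_carrier A. \<forall>x\<in>K. \<pi> a x \<in> K) \<Longrightarrow> K = {hs_zero H} \<or> K = HC"
  using assms(1) unfolding nonzero_irreducible_rep_def by blast+
 note R [simp] = is_repD[OF rep]
 have bd: "\<exists>C. \<forall>x\<in>HC. hs_norm H (\<pi> a x) \<le> C * hs_norm H x" if "a \<in> ca_carrier A" for a using rep that unfolding is_rep_def by blast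
 have "is_rep A L (\<lambda>a u. t (\<pi> a (i u)))" unfolding is_rep_def using bd by auto
 moreover have "\<exists>a\<in>ca_carrier A. \<exists>x\<in>hs_carrier L. t (\<pi> a (i x)) \<noteq> hs_zero L"
 proof -
  obtain a x where a: "a \<in> ca_carrier A" "x \<in> HC" "\<pi> a x \<noteq> hs_zero H" using nz by blast
  have "t (\<pi> a x) \<noteq> t (hs_zero H)" using a inj R(1)[OF a(1,2)] by (metis inj_on_contraD zero_cl)
  then show ?thesis using a by (intro bexI[of _ a] bexI[of _ "t x"]) auto
 qed
 moreover have "K = {hs_zero L} \<or> K = hs_carrier L"
  if K: "closed_subspace L K" "\<forall>a\<in>ca_carrier A. \<forall>x\<in>K. t (\<pi> a (i x)) \<in> K" for K
 proof -
  define K' where "K' = i ` K"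
  have KL: "K \<subseteq> t ` HC" using K(1) by (simp add: closed_subspace_def)
  have ti: "t (i x) = x" "i x \<in> HC" if "x \<in> K" for x using KL that by (auto simp: f_inv_into_f inv_into_into)
  have mem: "x \<in> K' \<longleftrightarrow> x \<in> HC \<and> t x \<in> K" for x unfolding K'_def using ti by (auto simp: image_iff) (metis i_t)
  have "closed_subspace H K'" unfolding closed_subspace_def
  proof (intro conjI allI impI ballI)
   show "K' \<subseteq> HC" using mem by blast
   show "hs_zero H \<in> K'" using K(1) unfolding mem closed_subspace_def by simp
   have KA: "hs_add L x y \<in> K" "hs_smul L c x \<in> K" if "x \<in> K" "y \<in> K" for x y c using K(1) that unfolding closed_subspace_def by blast+
   show "hs_add H x y \<in> K'" if "x \<in> K'" "y \<in> K'" for x y using KA(1)[of "t x" "t y"] that by (simp add: mem)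
   show "hs_smul H c x \<in> K'" if "x \<in> K'" for c x using KA(2)[of "t x" "t x" c] that by (simp add: mem)
   fix s l assume A: "(\<forall>k. s k \<in> K') \<and> l \<in> HC \<and> (\<lambda>k. hs_norm H (hs_add H (s k) (hs_smul H (- 1) l))) \<longlonglongrightarrow> 0"
   then have s: "s k \<in> HC" "t (s k) \<in> K" for k using mem by auto
   have "t l \<in> K"
   proof (rule K(1)[unfolded closed_subspace_def, THEN conjunct2, THEN conjunct2, THEN conjunct2, THEN conjunct2, rule_format])
    show "(\<forall>k. t (s k) \<in> K) \<and> t l \<in> hs_carrier L \<and> (\<lambda>k. hs_norm L (hs_add L (t (s k)) (hs_smul L (- 1) (t l)))) \<longlonglongrightarrow> 0" using A s by simp
   qed
   then show "l \<in> K'" using A mem by blast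
  qed
  moreover have "\<forall>a\<in>ca_carrier A. \<forall>x\<in>K'. \<pi> a x \<in> K'"
  proof (intro ballI)
   fix a x assume a: "a \<in> ca_carrier A" and "x \<in> K'"
   then have x: "x \<in> HC" "t x \<in> K" using mem by auto
   then have "t (\<pi> a (i (t x))) \<in> K" using K(2) a by blast
   then show "\<pi> a x \<in> K'" using x R(1)[OF a x(1)] mem by simp
  qed
  ultimately have "K' = {hs_zero H} \<or> K' = HC" by (rule irr)
  moreover have "K = t ` K'" unfolding K'_def using ti by (auto simp: image_iff)
  ultimately show ?thesis by auto
 qed
 ultimately show ?thesis unfolding nonzero_irreducible_rep_def by blast
qed

lemma dim_image: assumes "hs_has_dim L n" shows "hs_has_dim H n"
proof -
 obtain b where b: "\<forall>i<n. b i \<in> hs_carrier L" "\<forall>c. hs_lincomb L c b n = hs_zero L \<longrightarrow> (\<forall>i<n. c i = 0)"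
  "\<forall>x\<in>hs_carrier L. \<exists>c. x = hs_lincomb L c b n" using assms unfolding hs_has_dim_def by blast
 have bV: "i (b k) \<in> HC" if "k < n" for k using b(1) that by (auto simp: inv_into_into)
 have V: "hs_lincomb H c (i \<circ> b) m \<in> HC" if "m \<le> n" for c m using that bV by (induction m) auto
 have lc: "hs_lincomb L c b m = t (hs_lincomb H c (i \<circ> b) m)" if "m \<le> n" for c m using that
 proof (induction m)
  case (Suc m)
  then show ?case using V[of m c] bV[of m] by (simp add: o_def)
 qed simp
 show ?thesis unfolding hs_has_dim_def
 proof (intro exI[of _ "i \<circ> b"] conjI allI impI ballI)
  fix c k assume "hs_lincomb H c (i \<circ> b) n = hs_zero H" "k < n"
  then show "c k = 0" using b(2) lc[of n c] by simp
 next
  fix x assume x: "x \<in> HC"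
  then obtain c where "t x = hs_lincomb L c b n" using b(3) by auto
  then have "x = hs_lincomb H c (i \<circ> b) n" using lc[of n c] V[of n c] x inj by (simp add: inj_on_eq_iff)
  then show "\<exists>c. x = hs_lincomb H c (i \<circ> b) n" by blast
 qed (use bV in auto)
qed

end

text \<open>An irreducible representation on \<open>H\<close> embeds \<open>H\<close> into the functions on \<open>A\<close> through the
 coefficients \<open>x \<mapsto> \<langle>h, \<pi> x \<xi>\<rangle>\<close>, so it suffices to test homogeneity on that type.\<close>

theorem (in calg) n_homogeneous_any:
 assumes hom: "n_homogeneous TYPE('a \<Rightarrow> complex) n A"
  and H: "hilbert_space (H :: 'h hilb)" and irr: "nonzero_irreducible_rep A H \<pi>"
 shows "hs_has_dim H n"
proof -
 interpret hilb H by unfold_locales (rule H)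
 have rep: "is_rep A H \<pi>" using irr by (simp add: nonzero_irreducible_rep_def)
 note R = is_repD[OF rep]
 obtain a0 v where a0: "a0 \<in> V" "v \<in> hs_carrier H" "\<pi> a0 v \<noteq> hs_zero H" using irr unfolding nonzero_irreducible_rep_def by blast
 \<comment> \<open>The orthogonal complement of the orbit of v. It is invariant and does not contain
   \<pi> a0 v, hence it is zero, and the coefficients against the orbit determine a vector.\<close>
 define K where "K = {h \<in> hs_carrier H. \<forall>a\<in>V. hs_inner H h (\<pi> a v) = 0}"
 have "closed_subspace H K" unfolding closed_subspace_def sub_def[symmetric]
 proof (intro conjI allI impI)
  fix s l assume A: "(\<forall>k. s k \<in> K) \<and> l \<in> hs_carrier H \<and> (\<lambda>k. hs_norm H (sub (s k) l)) \<longlonglongrightarrow> 0"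
  have "hs_inner H l (\<pi> a v) = 0" if "a \<in> V" for a
  proof (rule LIMSEQ_unique)
   show "(\<lambda>k. hs_inner H (s k) (\<pi> a v)) \<longlonglongrightarrow> hs_inner H l (\<pi> a v)" using A R(1)[OF that a0(2)] by (intro ip_tendsto) (auto simp: K_def)
   show "(\<lambda>k. hs_inner H (s k) (\<pi> a v)) \<longlonglongrightarrow> 0" using A that by (simp add: K_def)
  qed
  then show "l \<in> K" using A by (simp add: K_def)
 qed (use R(1)[OF _ a0(2)] in \<open>auto simp: K_def\<close>)
 moreover have "\<pi> b h \<in> K" if b: "b \<in> V" and h: "h \<in> K" for b h
 proof -
  have "hs_inner H (\<pi> b h) (\<pi> a v) = 0" if a: "a \<in> V" for a
  proof -
   have "hs_inner H (\<pi> b h) (\<pi> a v) = hs_inner H h (\<pi> (star b) (\<pi> a v))" using R(7)[OF b] h R(1)[OF a a0(2)] by (simp add: K_def)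
   also have "\<pi> (star b) (\<pi> a v) = \<pi> (mu (star b) a) v" using R(5)[of "star b" v a] a b a0 by simp
   finally show ?thesis using h a b by (simp add: K_def)
  qed
  then show ?thesis using R(1)[OF b] h by (simp add: K_def)
 qed
 ultimately have "K = {hs_zero H} \<or> K = hs_carrier H" using irr unfolding nonzero_irreducible_rep_def by blast
 moreover have "K \<noteq> hs_carrier H"
 proof
  assume "K = hs_carrier H"
  then have "\<pi> a0 v \<in> K" using R(1)[OF a0(1,2)] by simp
  then have "hs_inner H (\<pi> a0 v) (\<pi> a0 v) = 0" using a0 by (simp add: K_def)
  then show False using ip_definite R(1)[OF a0(1,2)] a0(3) by blast
 qed
 ultimately have K0: "K = {hs_zero H}" by simp
 define t where "t = (\<lambda>h x. if x \<in> V then hs_inner H h (\<pi> x v) else 0)"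
 have "inj_on t (hs_carrier H)"
 proof (rule inj_onI)
  fix g h assume gh: "g \<in> hs_carrier H" "h \<in> hs_carrier H" "t g = t h"
  have "hs_inner H g (\<pi> a v) = hs_inner H h (\<pi> a v)" if "a \<in> V" for a using fun_cong[OF gh(3), of a] that by (simp add: t_def)
  then have "sub g h \<in> K" using gh R(1)[OF _ a0(2)] by (simp add: K_def)
  then show "g = h" using K0 gh sub_eq_zero by blast
 qed
 then interpret hilb_inj H t by unfold_locales
 have "hs_has_dim (hilb_image t H) n" using hom hilbert_space_image irrep_image[OF irr alg_simps(7)] unfolding n_homogeneous_def by blast
 then show ?thesis by (rule dim_image)
qed

section \<open>Matrices, operator norm and the spectral theorem\<close>

definition cip :: "complex^'n \<Rightarrow> complex^'n \<Rightarrow> complex" where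
 "cip u v = (\<Sum>i\<in>UNIV. u $ i * cnj (v $ i))"

lemma cip_add_left: "cip (u + v) w = cip u w + cip v w"
 and cip_add_right: "cip w (u + v) = cip w u + cip w v"
 and cip_diff_left: "cip (u - v) w = cip u w - cip v w"
 and cip_diff_right: "cip w (u - v) = cip w u - cip w v"
 and cip_scale_left: "cip (c *s u) w = c * cip u w"
 and cip_scale_right: "cip w (c *s u) = cnj c * cip w u" by (simp_all add: cip_def sum.distrib sum_subtractf algebra_simps sum_distrib_left)

lemmas cip_simps = cip_add_left cip_add_right cip_diff_left cip_diff_right cip_scale_left cip_scale_right

lemma cip_zero [simp]: "cip 0 w = 0" "cip w 0 = 0" by (simp_all add: cip_def)

lemma cip_cnj: "cip v u = cnj (cip u v)" by (simp add: cip_def mult.commute)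

lemma cip_self: "cip u u = of_real ((norm u)\<^sup>2)"
 by (simp add: cip_def norm_vec_def L2_set_def sum_nonneg complex_norm_square[symmetric] del: of_real_power)

lemma cip_axis: "cip u (axis k 1) = u $ k" by (simp add: cip_def axis_def if_distrib cong: if_cong)

lemma cip_mult_left: "cip (M *v u) v = cip u (mat_adj M *v v)"
proof -
 have "cip (M *v u) v = (\<Sum>i\<in>UNIV. \<Sum>j\<in>UNIV. M $ i $ j * u $ j * cnj (v $ i))" by (simp add: cip_def matrix_vector_mult_def sum_distrib_right)
 also have "\<dots> = (\<Sum>j\<in>UNIV. \<Sum>i\<in>UNIV. M $ i $ j * u $ j * cnj (v $ i))" by (rule sum.swap)
 finally show ?thesis by (simp add: cip_def matrix_vector_mult_def mat_adj_def sum_distrib_left algebra_simps)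
qed

lemma mat_adj_simps [simp]:
 "mat_adj (mat_adj M) = M" "mat_adj (M + N) = mat_adj M + mat_adj N" "mat_adj (M - N) = mat_adj M - mat_adj N"
 "mat_adj (mat_scale c M) = mat_scale (cnj c) (mat_adj M)" "mat_adj 0 = 0" "mat_adj (mat 1) = mat 1"
 by (auto simp: mat_adj_def mat_scale_def vec_eq_iff mat_def)

lemma mat_adj_mult [simp]: "mat_adj (M ** N) = mat_adj N ** mat_adj M" by (auto simp: mat_adj_def matrix_matrix_mult_def vec_eq_iff mult.commute)

lemma mat_scale_mult [simp]: "mat_scale c M ** N = mat_scale c (M ** N)" "M ** mat_scale c N = mat_scale c (M ** N)"
 by (auto simp: mat_scale_def matrix_matrix_mult_def vec_eq_iff sum_distrib_left algebra_simps)

lemma mat_scale_simps [simp]: "mat_scale c (mat_scale d M) = mat_scale (c * d) M" "mat_scale 1 M = M" "mat_scale c 0 = 0"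
  "mat_scale 0 M = 0" "mat_scale (-1) M = - M" by (auto simp: mat_scale_def vec_eq_iff)

lemma mat_scale_add: "mat_scale c (M + N) = mat_scale c M + mat_scale c N" "mat_scale (c + d) M = mat_scale c M + mat_scale d M"
 by (auto simp: mat_scale_def vec_eq_iff algebra_simps)

lemma mat_scale_vec: "mat_scale c M *v v = c *s (M *v v)"
 by (auto simp: mat_scale_def matrix_vector_mult_def vec_eq_iff sum_distrib_left algebra_simps)

lemma mat_vec: "mat c *v v = c *s v" by (auto simp: matrix_vector_mult_def mat_def vec_eq_iff if_distrib if_distribR cong: if_cong)

lemma mat_mult_scale: "mat c ** M = mat_scale c M" "M ** mat c = mat_scale c M"
 by (auto simp: matrix_matrix_mult_def mat_def mat_scale_def vec_eq_iff if_distrib if_distribR mult.commute cong: if_cong)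

lemma mat_scale_one: "mat_scale c (mat 1) = mat c" by (auto simp: mat_scale_def mat_def vec_eq_iff)

lemma matrix_diff_mult: "(M - N) ** P = M ** P - N ** (P :: complex^'n^'n)" "P ** (M - N) = P ** M - P ** N"
 by (auto simp: matrix_matrix_mult_def vec_eq_iff sum_subtractf algebra_simps)

lemma scaleR_vec: "r *\<^sub>R v = of_real r *s (v :: complex^'n)" by (simp add: vec_eq_iff) (simp add: scaleR_conv_of_real)

lemma norm_scale: "norm (c *s (v :: complex^'n)) = cmod c * norm v"
proof -
 have "complex_of_real ((norm (c *s v))\<^sup>2) = of_real ((cmod c * norm v)\<^sup>2)"
 proof -
  have "cip (c *s v) (c *s v) = (c * cnj c) * cip v v" by (simp add: cip_scale_left cip_scale_right)
  then show ?thesis by (simp only: cip_self complex_norm_square[symmetric] of_real_mult[symmetric] power_mult_distrib)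
 qed
 then have "(norm (c *s v))\<^sup>2 = (cmod c * norm v)\<^sup>2" by (simp only: of_real_eq_iff)
 then show ?thesis by (rule power2_eq_imp_eq) auto
qed

lemma bounded_linear_mat [simp]: "bounded_linear (\<lambda>v::complex^'n. (M :: complex^'n^'m) *v v)" unfolding linear_conv_bounded_linear[symmetric]
 by (rule linearI) (simp_all add: matrix_vector_right_distrib scaleR_vec vec.scale)

lemma norm_mat_vec: "norm (M *v v) \<le> mat_opnorm M * norm v" unfolding mat_opnorm_def by (rule onorm) simp

lemma mat_opnorm_le: "0 \<le> C \<Longrightarrow> (\<And>v. norm (M *v v) \<le> C * norm v) \<Longrightarrow> mat_opnorm M \<le> C" unfolding mat_opnorm_def by (rule onorm_bound)

lemma mat_opnorm_nonneg [simp]: "0 \<le> mat_opnorm M" unfolding mat_opnorm_def by (rule onorm_pos_le) simp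

lemma mat_opnorm_zero [simp]: "mat_opnorm 0 = 0" by (simp add: mat_opnorm_def onorm_zero)

lemma mat_opnorm_triangle: "mat_opnorm (M + N) \<le> mat_opnorm M + mat_opnorm N"
 by (rule mat_opnorm_le) (auto simp: matrix_vector_mult_add_rdistrib distrib_right intro!: order_trans[OF norm_triangle_ineq] add_mono norm_mat_vec)

lemma mat_opnorm_mult: "mat_opnorm (M ** N) \<le> mat_opnorm M * mat_opnorm N"
proof (rule mat_opnorm_le)
 fix v
 have "norm (M *v (N *v v)) \<le> mat_opnorm M * (mat_opnorm N * norm v)"
  by (rule order_trans[OF norm_mat_vec]) (intro mult_left_mono norm_mat_vec mat_opnorm_nonneg)
 then show "norm (M ** N *v v) \<le> mat_opnorm M * mat_opnorm N * norm v" by (simp add: matrix_vector_mul_assoc mult.assoc)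
qed simp

lemma mat_opnorm_scale [simp]: "mat_opnorm (mat_scale c M) = cmod c * mat_opnorm M"
proof (rule antisym)
 show le: "mat_opnorm (mat_scale c M) \<le> cmod c * mat_opnorm M" for c and M :: "complex^'n^'n"
  by (rule mat_opnorm_le) (auto simp: mat_scale_vec norm_scale mult.assoc intro!: mult_left_mono norm_mat_vec)
 show "cmod c * mat_opnorm M \<le> mat_opnorm (mat_scale c M)"
 proof (cases "c = 0")
  case False
  then show ?thesis using le[of "1/c" "mat_scale c M"] by (simp add: norm_divide field_simps)
 qed simp
qed

lemma mat_opnorm_minus [simp]: "mat_opnorm (- M) = mat_opnorm M" using mat_opnorm_scale[of "-1" M] by (simp del: mat_opnorm_scale)

lemma mat_opnorm_diff: "mat_opnorm (M - N) \<le> mat_opnorm M + mat_opnorm N" using mat_opnorm_triangle[of M "- N"] by simp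

lemma mat_opnorm_commute: "mat_opnorm (M - N) = mat_opnorm (N - M)" by (metis mat_opnorm_minus minus_diff_eq)

lemma cip_bound:
 fixes u v :: "complex^'n"
 shows "cmod (cip u v) \<le> norm u * norm v"
proof -
 interpret semi_ip "UNIV :: (complex^'n) set" "(+)" "(*s)" cip by unfold_locales (auto simp: cip_simps cip_self intro: cip_cnj)
 have "nm w = norm w" for w :: "complex^'n" by (simp add: nm_def cip_self)
 then show ?thesis using Cauchy_Schwarz[of u v] by simp
qed

lemma mat_opnorm_sq_le: "(mat_opnorm M)\<^sup>2 \<le> mat_opnorm (mat_adj M ** M)"
proof -
 have "mat_opnorm M \<le> sqrt (mat_opnorm (mat_adj M ** M))"
 proof (rule mat_opnorm_le)
  fix v
  have "(norm (M *v v))\<^sup>2 = Re (cip (M *v v) (M *v v))" by (simp add: cip_self)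
  also have "cip (M *v v) (M *v v) = cip v (mat_adj M ** M *v v)" by (simp add: cip_mult_left matrix_vector_mul_assoc)
  also have "Re \<dots> \<le> norm v * norm (mat_adj M ** M *v v)" using complex_Re_le_cmod cip_bound by (rule order_trans)
  also have "\<dots> \<le> norm v * (mat_opnorm (mat_adj M ** M) * norm v)" by (intro mult_left_mono norm_mat_vec) simp
  also have "\<dots> = (sqrt (mat_opnorm (mat_adj M ** M)) * norm v)\<^sup>2" by (simp add: power_mult_distrib power2_eq_square mult_ac)
  finally show "norm (M *v v) \<le> sqrt (mat_opnorm (mat_adj M ** M)) * norm v" by (rule power2_le_imp_le) simp
 qed simp
 then have "(mat_opnorm M)\<^sup>2 \<le> (sqrt (mat_opnorm (mat_adj M ** M)))\<^sup>2" by (intro power_mono) auto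
 then show ?thesis by simp
qed

lemma mat_opnorm_adj [simp]: "mat_opnorm (mat_adj M) = mat_opnorm M"
proof -
 have "mat_opnorm M \<le> mat_opnorm (mat_adj M)" for M :: "complex^'n^'n"
 proof (cases "mat_opnorm M = 0")
  case False
  have "mat_opnorm M * mat_opnorm M \<le> mat_opnorm (mat_adj M) * mat_opnorm M"
   using mat_opnorm_sq_le[of M] mat_opnorm_mult[of "mat_adj M" M] by (simp add: power2_eq_square)
  then show ?thesis using False mat_opnorm_nonneg[of M] by (simp add: mult_le_cancel_right)
 qed simp
 from this[of M] this[of "mat_adj M"] show ?thesis by simp
qed

lemma mat_opnorm_cstar: "mat_opnorm (mat_adj M ** M) = (mat_opnorm M)\<^sup>2"
 using mat_opnorm_sq_le[of M] mat_opnorm_mult[of "mat_adj M" M] by (simp add: power2_eq_square)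

lemma norm_axis1: "norm (axis i 1 :: complex^'n) = 1"
proof -
 have "cip (axis i 1 :: complex^'n) (axis i 1) = 1" unfolding cip_axis by (simp add: axis_def)
 then have "(norm (axis i 1 :: complex^'n))\<^sup>2 = 1" unfolding cip_self by (simp only: of_real_eq_1_iff)
 then show ?thesis by (simp add: power2_eq_1_iff)
qed

lemma entry_le_opnorm: "cmod (M $ i $ j) \<le> mat_opnorm M"
proof -
 have "M $ i $ j = cip (M *v axis j 1) (axis i 1)" unfolding cip_axis by (simp add: matrix_vector_mult_def axis_def if_distrib cong: if_cong)
 then have "cmod (M $ i $ j) \<le> norm (M *v axis j 1) * norm (axis i (1::complex))" by (metis cip_bound)
 also have "\<dots> \<le> mat_opnorm M" using norm_mat_vec[of M "axis j 1"] by (simp add: norm_axis1)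
 finally show ?thesis .
qed

text \<open>The topology on matrices comes from the Euclidean norm, the C*-norm is the operator
  norm. With \<open>opnorm_le_norm\<close> the two are equivalent; the constants are crude counts of
  entries.\<close>

lemma norm_le_opnorm: "norm M \<le> (real CARD('n))\<^sup>2 * mat_opnorm (M :: complex^'n^'n)"
proof -
 have "norm M \<le> (\<Sum>i\<in>UNIV. norm (M $ i))" unfolding norm_vec_def by (rule L2_set_le_sum) simp
 also have "\<dots> \<le> (\<Sum>i::'n\<in>UNIV. \<Sum>j::'n\<in>UNIV. mat_opnorm M)"
 proof (rule sum_mono)
  fix i :: 'n
  have "norm (M $ i) \<le> (\<Sum>j\<in>UNIV. norm (M $ i $ j))" unfolding norm_vec_def[of "M $ i"] by (rule L2_set_le_sum) simp
  also have "\<dots> \<le> (\<Sum>j::'n\<in>UNIV. mat_opnorm M)" by (intro sum_mono entry_le_opnorm)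
  finally show "norm (M $ i) \<le> (\<Sum>j::'n\<in>UNIV. mat_opnorm M)" .
 qed
 finally show ?thesis by (simp add: power2_eq_square mult.assoc)
qed

lemma norm_mat_vec_le: "norm ((M :: complex^'n^'n) *v v) \<le> real CARD('n) * norm M * norm v"
proof -
 have "norm (M *v v) \<le> (\<Sum>i\<in>UNIV. norm ((M *v v) $ i))" unfolding norm_vec_def[of "M *v v"] by (rule L2_set_le_sum) simp
 also have "\<dots> \<le> (\<Sum>i::'n\<in>UNIV. norm M * norm v)"
 proof (rule sum_mono)
  fix i :: 'n
  define w where "w = (\<chi> j. cnj (M $ i $ j))"
  have "(M *v v) $ i = cip v w" by (simp add: w_def cip_def matrix_vector_mult_def mult.commute)
  moreover have "norm w = norm (M $ i)" by (simp add: w_def norm_vec_def)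
  moreover have "norm (M $ i) \<le> norm M" by (rule Finite_Cartesian_Product.norm_nth_le)
  ultimately show "norm ((M *v v) $ i) \<le> norm M * norm v"
   using cip_bound[of v w] mult_right_mono[of "norm (M $ i)" "norm M" "norm v"] by (simp add: mult.commute)
 qed
 finally show ?thesis by (simp add: mult.assoc)
qed

lemma opnorm_le_norm: "mat_opnorm (M :: complex^'n^'n) \<le> real CARD('n) * norm M" by (rule mat_opnorm_le) (auto intro: norm_mat_vec_le)

lemma continuous_on_opnorm [continuous_intros]:
 assumes "continuous_on S f" shows "continuous_on S (\<lambda>x. mat_opnorm (f x :: complex^'n^'n))"
proof -
 have "continuous_on UNIV (mat_opnorm :: complex^'n^'n \<Rightarrow> real)" unfolding continuous_on_iff
 proof (intro ballI allI impI)
  fix M and e :: real assume e: "0 < e"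
  have "dist (mat_opnorm N) (mat_opnorm M) < e" if "dist N M < e / real CARD('n)" for N :: "complex^'n^'n"
  proof -
   have "mat_opnorm N \<le> mat_opnorm M + mat_opnorm (N - M)" "mat_opnorm M \<le> mat_opnorm N + mat_opnorm (M - N)"
    using mat_opnorm_triangle[of M "N - M"] mat_opnorm_triangle[of N "M - N"] by auto
   moreover have "mat_opnorm (N - M) < e" using opnorm_le_norm[of "N - M"] that by (simp add: dist_norm less_divide_eq mult.commute)
   ultimately show ?thesis using mat_opnorm_commute[of M N] by (simp add: dist_real_def)
  qed
  then show "\<exists>d>0. \<forall>N\<in>UNIV. dist N M < d \<longrightarrow> dist (mat_opnorm N) (mat_opnorm M) < e" using e by (intro exI[of _ "e / real CARD('n)"]) auto
 qed
 from continuous_on_compose2[OF this assms] show ?thesis by simp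
qed

lemma continuous_on_matmul [continuous_intros]:
 "continuous_on S f \<Longrightarrow> continuous_on S g \<Longrightarrow> continuous_on S (\<lambda>x. f x ** (g x :: complex^'n^'n))"
 unfolding matrix_matrix_mult_def by (intro continuous_intros)

lemma continuous_on_mat_adj [continuous_intros]:
 "continuous_on S f \<Longrightarrow> continuous_on S (\<lambda>x. mat_adj (f x))" unfolding mat_adj_def by (intro continuous_intros)

lemma continuous_on_mat_scale [continuous_intros]:
 "continuous_on S c \<Longrightarrow> continuous_on S f \<Longrightarrow> continuous_on S (\<lambda>x. mat_scale (c x) (f x))" unfolding mat_scale_def by (intro continuous_intros)

lemma unitary_norm: assumes "unitary_mat U" shows "norm (U *v v) = norm v"
proof -
 have "cip (U *v v) (U *v v) = cip v v" using assms by (simp add: cip_mult_left matrix_vector_mul_assoc unitary_mat_def)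
 then have "(norm (U *v v))\<^sup>2 = (norm v)\<^sup>2" by (simp only: cip_self of_real_eq_iff)
 then show ?thesis by simp
qed

lemma unitary_adj [simp]: "unitary_mat (mat_adj U) = unitary_mat U" by (auto simp: unitary_mat_def)

lemma unitary_mult: "unitary_mat U \<Longrightarrow> unitary_mat V \<Longrightarrow> unitary_mat (U ** V)"
 unfolding unitary_mat_def by (metis mat_adj_mult matrix_mul_assoc matrix_mul_rid)

lemma unitary_one [simp]: "unitary_mat (mat 1)" by (simp add: unitary_mat_def)

lemma unitary_opnorm_le: "unitary_mat U \<Longrightarrow> mat_opnorm U \<le> 1" by (rule mat_opnorm_le) (auto simp: unitary_norm)

lemma unitary_conj_opnorm: assumes U: "unitary_mat U" shows "mat_opnorm (U ** M ** mat_adj U) = mat_opnorm M"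
proof -
 have le: "mat_opnorm (U ** M ** mat_adj U) \<le> mat_opnorm M" if "unitary_mat U" for U M :: "complex^'n^'n"
 proof (rule mat_opnorm_le)
  fix v
  have "norm (U *v (M *v (mat_adj U *v v))) \<le> mat_opnorm M * norm v" using norm_mat_vec[of M "mat_adj U *v v"] that by (simp add: unitary_norm)
  then show "norm (U ** M ** mat_adj U *v v) \<le> mat_opnorm M * norm v" by (simp add: matrix_vector_mul_assoc matrix_mul_assoc)
 qed simp
 have "mat_adj U ** (U ** M ** mat_adj U) ** mat_adj (mat_adj U) = M"
  using U unfolding unitary_mat_def by (metis mat_adj_simps(1) matrix_mul_assoc matrix_mul_lid matrix_mul_rid)
 then show ?thesis using le[OF U, of M] le[of "mat_adj U" "U ** M ** mat_adj U"] U by simp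
qed

lemma compact_unitary: "compact {U :: complex^'n^'n. unitary_mat U}"
proof (rule compact_eq_bounded_closed[THEN iffD2, OF conjI])
 have "norm U \<le> (real CARD('n))\<^sup>2 * 1" if "unitary_mat U" for U :: "complex^'n^'n"
  by (rule order_trans[OF norm_le_opnorm]) (intro mult_left_mono unitary_opnorm_le that; simp)
 then show "bounded {U :: complex^'n^'n. unitary_mat U}" by (auto intro!: boundedI)
 show "closed {U :: complex^'n^'n. unitary_mat U}" unfolding unitary_mat_def by (intro closed_Collect_conj closed_Collect_eq continuous_intros)
qed

text \<open>One criterion for two uses: subspaces of C^n and the space of matrices.\<close>

lemma hilbert_space_normed:
 fixes ip :: "'b::banach \<Rightarrow> 'b \<Rightarrow> complex"
 assumes S: "closed S" "0 \<in> S" "\<And>x y. x \<in> S \<Longrightarrow> y \<in> S \<Longrightarrow> x + y \<in> S" "\<And>c x. x \<in> S \<Longrightarrow> sm c x \<in> S"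
  and sm: "\<And>a b x. sm a (sm b x) = sm (a * b) x" "\<And>x. sm 1 x = x" "\<And>x. sm (-1) x = - x"
   "\<And>a x y. sm a (x + y) = sm a x + sm a y" "\<And>a b x. sm (a + b) x = sm a x + sm b x"
  and ip: "\<And>x y w. ip (x + y) w = ip x w + ip y w" "\<And>c x y. ip (sm c x) y = c * ip x y" "\<And>x y. ip y x = cnj (ip x y)"
   "\<And>x. ip x x = of_real ((norm x)\<^sup>2)"
 defines "H \<equiv> \<lparr> hs_carrier = S, hs_zero = 0, hs_add = (+), hs_smul = sm, hs_inner = ip \<rparr>"
 shows "hilbert_space H" "hs_norm H = norm"
proof -
 show n: "hs_norm H = norm" by (rule ext) (simp add: hs_norm_def H_def ip(4))
 have "complex_vs S 0 (+) sm" unfolding complex_vs_def using S by (auto simp: sm algebra_simps)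
 moreover have "complete_on S (+) sm norm" unfolding complete_on_def
 proof (intro allI impI)
  fix s :: "nat \<Rightarrow> 'b" assume A: "(\<forall>k. s k \<in> S) \<and> (\<forall>e>0. \<exists>N. \<forall>m\<ge>N. \<forall>k\<ge>N. norm (s m + sm (- 1) (s k)) < e)"
  then have "Cauchy s" by (intro CauchyI) (auto simp: sm)
  moreover have "complete S" using S(1) by (simp add: complete_eq_closed)
  ultimately obtain l where l: "l \<in> S" "s \<longlonglongrightarrow> l" using A unfolding complete_def by blast
  then have "(\<lambda>k. norm (s k + sm (- 1) l)) \<longlonglongrightarrow> 0" by (simp add: sm) (simp add: LIM_zero tendsto_norm_zero)
  then show "\<exists>l\<in>S. (\<lambda>k. norm (s k + sm (- 1) l)) \<longlonglongrightarrow> 0" using l by blast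
 qed
 ultimately show "hilbert_space H" unfolding hilbert_space_def Let_def n
 proof (intro conjI)
  show "\<forall>x\<in>hs_carrier H. \<forall>y\<in>hs_carrier H. hs_inner H y x = cnj (hs_inner H x y)" unfolding H_def by (auto intro: ip(3))
 qed (simp_all add: H_def ip(1,2,4))
qed

definition subh :: "(complex^'n) set \<Rightarrow> (complex^'n) hilb" where
 "subh S = \<lparr> hs_carrier = S, hs_zero = 0, hs_add = (+), hs_smul = (*s), hs_inner = cip \<rparr>"

lemma subh_sel [simp]: "hs_carrier (subh S) = S" "hs_zero (subh S) = 0" "hs_add (subh S) = (+)" "hs_smul (subh S) = (*s)" "hs_inner (subh S) = cip"
 by (simp_all add: subh_def)

lemma vec_subspace_real: "vec.subspace S \<Longrightarrow> subspace (S :: (complex^'n) set)"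
 unfolding subspace_def by (auto simp: vec.subspace_0 vec.subspace_add scaleR_vec vec.subspace_scale)

lemma subh_hilb: assumes "vec.subspace S" shows "hilbert_space (subh S)" "hs_norm (subh S) = norm" unfolding subh_def
 by (rule hilbert_space_normed; (rule cip_cnj | use assms in \<open>simp add: vec.subspace_0 vec.subspace_add vec.subspace_scale cip_simps cip_self
   vec.scale_right_distrib vec.scale_left_distrib closed_subspace vec_subspace_real mult.assoc vector_smult_assoc\<close>))+

text \<open>The Frobenius inner product; it supplies the orthogonal projection in
  \<open>Burnside\<close>.\<close>

definition math :: "(complex^'n^'n) set \<Rightarrow> (complex^'n^'n) hilb" where
 "math S = \<lparr> hs_carrier = S, hs_zero = 0, hs_add = (+), hs_smul = mat_scale, hs_inner = (\<lambda>M N. \<Sum>i\<in>UNIV. cip (M $ i) (N $ i)) \<rparr>"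

lemma math_sel [simp]: "hs_carrier (math S) = S" "hs_zero (math S) = 0" "hs_add (math S) = (+)" "hs_smul (math S) = mat_scale"
  "hs_inner (math S) M N = (\<Sum>i\<in>UNIV. cip (M $ i) (N $ i))" by (simp_all add: math_def)

lemma math_hilb: "hilbert_space (math UNIV)" "hs_norm (math UNIV) = norm"
proof -
 have sc: "mat_scale c M $ i = c *s (M $ i)" for c and M :: "complex^'n^'n" and i by (simp add: mat_scale_def vec_eq_iff)
 have n: "(\<Sum>i\<in>UNIV. cip (M $ i) (M $ i)) = of_real ((norm M)\<^sup>2)" for M :: "complex^'n^'n"
 proof -
  have "(norm M)\<^sup>2 = (\<Sum>i\<in>UNIV. (norm (M $ i))\<^sup>2)" by (simp add: norm_vec_def[of M] L2_set_def sum_nonneg)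
  then show ?thesis by (simp only: cip_self of_real_sum)
 qed
 have c: "(\<Sum>i\<in>UNIV. cip (N $ i) (M $ i)) = cnj (\<Sum>i\<in>UNIV. cip (M $ i) (N $ i))" for M N :: "complex^'n^'n"
  unfolding cnj_sum by (intro sum.cong refl) (rule cip_cnj)
 show "hilbert_space (math UNIV :: (complex^'n^'n) hilb)" "hs_norm (math UNIV :: (complex^'n^'n) hilb) = norm" unfolding math_def
  by (rule hilbert_space_normed; (rule c | simp add: n sc cip_simps sum.distrib sum_distrib_left mat_scale_add)?)+
qed

text \<open>Stands in for a dimension count: fewer than CARD('n) linear equations, padded with a
  zero row, have a nonzero common solution. A square matrix without kernel would be invertible from
  both sides.\<close>

lemma zero_row_kernel: fixes M :: "complex^'n^'n" assumes "M $ k = 0" shows "\<exists>v. v \<noteq> 0 \<and> M *v v = 0"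
proof (rule ccontr)
 assume "\<not> ?thesis"
 then obtain B where "B ** M = mat 1" using matrix_left_invertible_ker[of M] by blast
 then have "M ** B = mat 1" using matrix_left_right_inverse by blast
 then have "(M ** B) $ k $ k = mat 1 $ k $ k" by simp
 then show False using assms by (simp add: matrix_matrix_mult_def mat_def)
qed

lemma continuous_on_cip [continuous_intros]:
 "continuous_on S f \<Longrightarrow> continuous_on S g \<Longrightarrow> continuous_on S (\<lambda>x. cip (f x) (g x))" unfolding cip_def by (intro continuous_intros)

text \<open>Let v maximise the quadratic form of M on the unit sphere of S, with maximum l. The form
  of l - M is positive semidefinite on S and vanishes at v, so Cauchy-Schwarz makes l v - M v
  orthogonal to S, and this vector lies in S.\<close>

lemma hermitian_eigenvector:
 fixes M :: "complex^'n^'n"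
 assumes S: "vec.subspace S" "S \<noteq> {0}" and M: "mat_adj M = M" and inv: "\<And>v. v \<in> S \<Longrightarrow> M *v v \<in> S"
 obtains v l where "v \<in> S" "norm v = 1" "M *v v = of_real l *s v"
proof -
 let ?C = "S \<inter> sphere 0 1"
 define f where "f = (\<lambda>v. Re (cip (M *v v) v))"
 note Sc = vec.subspace_0[OF S(1)] vec.subspace_add[OF S(1)] vec.subspace_scale[OF S(1)] vec.subspace_diff[OF S(1)]
 have unit: "(of_real (1 / norm u) :: complex) *s u \<in> ?C" if "u \<in> S" "u \<noteq> 0" for u using that Sc by (simp add: norm_scale norm_divide)
 obtain u where "u \<in> S" "u \<noteq> 0" using S(2) Sc(1) by blast
 then have c1: "?C \<noteq> {}" using unit by blast
 have c2: "compact ?C" by (intro closed_Int_compact closed_subspace vec_subspace_real S compact_sphere)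
 have c3: "continuous_on ?C f" unfolding f_def by (intro continuous_intros)
 obtain v where v: "v \<in> ?C" "\<And>w. w \<in> ?C \<Longrightarrow> f w \<le> f v" using continuous_attains_sup[OF c2 c1 c3] by auto
 define l where "l = f v"
 define G where "G = (\<lambda>u w. of_real l * cip u w - cip (M *v u) w)"
 have pos: "f u \<le> l * (norm u)\<^sup>2" if u: "u \<in> S" for u
 proof (cases "u = 0")
  case False
  let ?w = "(of_real (1 / norm u) :: complex) *s u"
  have "cip (M *v ?w) ?w = of_real ((1 / norm u)\<^sup>2) * cip (M *v u) u"
   by (simp only: vec.scale cip_scale_left cip_scale_right complex_cnj_complex_of_real power2_eq_square of_real_mult mult.assoc)
  then have "f ?w = (1 / norm u)\<^sup>2 * f u" by (simp add: f_def del: of_real_power)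
  then have "f u = (norm u)\<^sup>2 * f ?w" using False by (simp add: power_divide)
  moreover have "f ?w \<le> l" unfolding l_def by (rule v(2)[OF unit[OF u False]])
  ultimately show ?thesis using mult_left_mono[of "f ?w" l "(norm u)\<^sup>2"] by (simp add: mult.commute)
 qed (simp add: f_def)
 interpret semi_ip S "(+)" "(*s)" G
 proof
  show "G w u = cnj (G u w)" for u w using cip_mult_left[of M w u] M cip_cnj[of w u] cip_cnj[of "M *v u" w] by (simp add: G_def)
  show "0 \<le> Re (G u u)" if "u \<in> S" for u using pos[OF that] by (simp add: G_def f_def cip_self flip: of_real_power)
 qed (auto simp: G_def Sc cip_simps matrix_vector_right_distrib vec.scale algebra_simps)
 have "Re (G v v) = 0" using v(1) by (simp add: G_def f_def l_def cip_self)
 then have "nm v = 0" by (simp add: nm_def)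
 let ?w = "of_real l *s v - M *v v"
 have "?w \<in> S" using v(1) Sc inv by blast
 then have "cmod (G v ?w) \<le> 0" using Cauchy_Schwarz[of v ?w] v(1) \<open>nm v = 0\<close> by simp
 moreover have "G v ?w = cip ?w ?w" by (simp add: G_def cip_diff_left cip_scale_left)
 ultimately have "?w = 0" by (simp add: cip_self)
 then show ?thesis using that[of v l] v(1) by simp
qed

definition onb :: "('n \<Rightarrow> complex^'n) \<Rightarrow> bool" where
 "onb e \<longleftrightarrow> (\<forall>i j. cip (e i) (e j) = (if i = j then 1 else 0))"

definition cols :: "('n \<Rightarrow> complex^'n) \<Rightarrow> complex^'n^'n" where
 "cols e = (\<chi> a i. e i $ a)"

lemma cols_axis: "cols e *v axis i 1 = e i" by (simp add: cols_def matrix_vector_mult_def axis_def vec_eq_iff if_distrib cong: if_cong)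

lemma cols_mult: "N ** cols e = cols (\<lambda>i. N *v e i)" by (simp add: cols_def matrix_matrix_mult_def matrix_vector_mult_def vec_eq_iff)

lemma adj_cols_mult: "(mat_adj (cols e) ** M) $ i $ j = cip (M *v axis j 1) (e i)"
 by (simp add: cols_def matrix_matrix_mult_def mat_adj_def cip_def matrix_vector_mult_def axis_def if_distrib mult.commute cong: if_cong)

lemma onb_unitary: assumes "onb e" shows "unitary_mat (cols e)"
proof -
 have "mat_adj (cols e) ** cols e = mat 1" using assms by (simp add: vec_eq_iff adj_cols_mult cols_axis onb_def mat_def)
 then show ?thesis unfolding unitary_mat_def using matrix_left_right_inverse by blast
qed

text \<open>Induction over sets of indices: the next eigenvector is taken in the orthogonal
  complement of those already found, which M preserves.\<close>

lemma spectral_theorem: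
 fixes M :: "complex^'n^'n" assumes M: "mat_adj M = M"
 obtains e and l :: "'n \<Rightarrow> real" where "onb e" "\<And>i. M *v e i = of_real (l i) *s e i"
proof -
 have "\<exists>e (l :: 'n \<Rightarrow> real). (\<forall>i\<in>I. \<forall>j\<in>I. cip (e i) (e j) = (if i = j then 1 else 0)) \<and> (\<forall>i\<in>I. M *v e i = of_real (l i) *s e i)"
  if "finite I" for I :: "'n set" using that
 proof induction
  case (insert k I)
  then obtain e and l :: "'n \<Rightarrow> real" where e: "\<And>i j. i \<in> I \<Longrightarrow> j \<in> I \<Longrightarrow> cip (e i) (e j) = (if i = j then 1 else 0)"
   "\<And>i. i \<in> I \<Longrightarrow> M *v e i = of_real (l i) *s e i" by blast
  define S where "S = {v. \<forall>i\<in>I. cip v (e i) = 0}"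
  have "vec.subspace S" by (auto simp: S_def vec.subspace_def cip_simps)
  moreover have "S \<noteq> {0}"
  proof -
   \<comment> \<open>Row k vanishes because k is a new index, so the equations of orthogonality to
     the old eigenvectors have a nonzero solution.\<close>
   define B :: "complex^'n^'n" where "B = (\<chi> i j. if i \<in> I then cnj (e i $ j) else 0)"
   have "B $ k = 0" using insert by (simp add: B_def vec_eq_iff)
   then obtain v where v: "v \<noteq> 0" "B *v v = 0" using zero_row_kernel by blast
   have "cip v (e i) = (B *v v) $ i" if "i \<in> I" for i using that by (simp add: B_def matrix_vector_mult_def cip_def mult.commute)
   then have "v \<in> S" using v by (simp add: S_def)
   then show ?thesis using v(1) by blast
  qed
  moreover have "M *v v \<in> S" if "v \<in> S" for v using that by (simp add: S_def cip_mult_left M e cip_simps)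
  ultimately obtain v a where v: "v \<in> S" "norm v = 1" "M *v v = of_real a *s v" using hermitian_eigenvector[OF _ _ M] by metis
  have "cip v v = 1" using v by (simp add: cip_self)
  moreover have "cip (e i) v = 0" "cip v (e i) = 0" if "i \<in> I" for i using v(1) that cip_cnj[of "e i" v] by (auto simp: S_def)
  ultimately show ?case using v e insert(2) by (intro exI[of _ "e(k := v)"] exI[of _ "l(k := a)"]) auto
 qed (auto)
 from this[of UNIV] obtain e and l :: "'n \<Rightarrow> real" where "onb e" "\<And>i. M *v e i = of_real (l i) *s e i" unfolding onb_def by auto
 then show ?thesis using that by blast
qed

lemma eigen_opnorm:
 assumes e: "onb e" and N: "\<And>i. N *v e i = m i *s e i" and m: "\<And>i. cmod (m i) \<le> C" and C: "0 \<le> C"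
 shows "mat_opnorm N \<le> C"
proof (rule mat_opnorm_le[OF C])
 fix v
 note U = onb_unitary[OF e]
 define c where "c = mat_adj (cols e) *v v"
 have v: "v = cols e *v c" using U by (simp add: c_def matrix_vector_mul_assoc unitary_mat_def)
 define d where "d = (\<chi> i. m i * c $ i)"
 have "N *v v = cols e *v d" unfolding v matrix_vector_mul_assoc cols_mult N
  by (simp add: cols_def d_def matrix_vector_mult_def vec_eq_iff algebra_simps)
 then have "norm (N *v v) = norm d" using U by (simp add: unitary_norm)
 also have "\<dots> \<le> norm (of_real C *s c)" by (rule norm_le_componentwise_cart) (use m C in \<open>simp add: d_def norm_mult mult_right_mono\<close>)
 also have "\<dots> = C * norm v" using U C by (simp add: v norm_scale unitary_norm)
 finally show "norm (N *v v) \<le> C * norm v" .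
qed

lemma onb_mat_eqI: fixes M N :: "complex^'n^'n" assumes "onb e" "\<And>i. M *v e i = N *v e i" shows "M = N"
proof -
 have "M ** cols e = N ** cols e" by (simp add: cols_mult assms)
 then have "M ** (cols e ** mat_adj (cols e)) = N ** (cols e ** mat_adj (cols e))" by (simp add: matrix_mul_assoc)
 then show ?thesis using onb_unitary[OF assms(1)] by (simp add: unitary_mat_def)
qed

section \<open>Irreducible *-algebras of matrices\<close>

definition mat_irred :: "(complex^'n^'n) set \<Rightarrow> bool" where
 "mat_irred S \<longleftrightarrow> (\<forall>W. vec.subspace W \<and> (\<forall>b\<in>S. \<forall>w\<in>W. b *v w \<in> W) \<longrightarrow> W = {0} \<or> W = UNIV)"

lemma matrix_add_mult: "(M + N) ** P = M ** P + N ** (P :: complex^'n^'n)" by (auto simp: matrix_matrix_mult_def vec_eq_iff sum.distrib algebra_simps)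

text \<open>An eigenspace of a hermitian T is invariant under everything that commutes with T. For
  general T the set S is closed under adjoints, so the real and imaginary parts of T also commute
  with S.\<close>

lemma Schur:
 fixes T :: "complex^'n^'n"
 assumes S: "mat_irred S" "\<And>b. b \<in> S \<Longrightarrow> mat_adj b \<in> S" and T: "\<And>b. b \<in> S \<Longrightarrow> T ** b = b ** T"
 shows "\<exists>c. T = mat c"
proof -
 have herm: "\<exists>c. T = mat c" if T: "mat_adj T = T" "\<And>b. b \<in> S \<Longrightarrow> T ** b = b ** T" for T :: "complex^'n^'n"
 proof -
  have "(axis undefined 1 :: complex^'n) \<noteq> 0" by (simp add: axis_eq_0_iff)
  then have "(UNIV :: (complex^'n) set) \<noteq> {0}" by blast
  then obtain v l where v: "norm v = 1" "T *v v = of_real l *s v" using hermitian_eigenvector[OF vec.subspace_UNIV _ T(1)] by blast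
  define W where "W = {w. T *v w = of_real l *s w}"
  have "vec.subspace W" by (auto simp: W_def vec.subspace_def matrix_vector_right_distrib vec.scale vec.scale_right_distrib vec.scale_left_commute)
  moreover have "b *v w \<in> W" if "b \<in> S" "w \<in> W" for b w
  proof -
   have "T *v (b *v w) = b *v (T *v w)" by (simp add: matrix_vector_mul_assoc T(2)[OF that(1)])
   then show ?thesis using that(2) by (simp add: W_def vec.scale)
  qed
  ultimately have "W = {0} \<or> W = UNIV" using S(1) unfolding mat_irred_def by blast
  moreover have "v \<in> W" "v \<noteq> 0" using v by (auto simp: W_def)
  ultimately have "T *v w = mat (of_real l) *v w" for w unfolding mat_vec using W_def by blast
  then show ?thesis using matrix_eq by blast
 qed
 have comm: "mat_adj T ** b = b ** mat_adj T" if "b \<in> S" for b using T[OF S(2)[OF that]] by (metis mat_adj_mult mat_adj_simps(1))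
 obtain c where c: "T + mat_adj T = mat c" using herm[of "T + mat_adj T"] T comm by (auto simp: matrix_add_ldistrib matrix_add_mult add.commute)
 obtain d where d: "mat_scale \<i> (T - mat_adj T) = mat d"
 proof -
  have "mat_adj (mat_scale \<i> (T - mat_adj T)) = mat_scale \<i> (T - mat_adj T)" by (simp add: vec_eq_iff mat_scale_def mat_adj_def algebra_simps)
  then show ?thesis using herm[of "mat_scale \<i> (T - mat_adj T)"] T comm that by (auto simp: matrix_diff_mult)
 qed
 have "T = mat ((c - \<i> * d) / 2)"
 proof -
  have "mat_scale 2 T = mat c - mat_scale \<i> (mat d)" unfolding c[symmetric] d[symmetric] by (simp add: vec_eq_iff mat_scale_def)
  also have "\<dots> = mat (c - \<i> * d)" by (simp add: vec_eq_iff mat_def mat_scale_def)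
  finally have "mat_scale (1/2) (mat_scale 2 T) = mat_scale (1/2) (mat (c - \<i> * d))" by (simp only:)
  then have "T = mat_scale (1/2) (mat (c - \<i> * d))" unfolding mat_scale_simps by simp
  also have "\<dots> = mat ((c - \<i> * d) / 2)" by (simp add: vec_eq_iff mat_scale_def mat_def)
  finally show ?thesis .
 qed
 then show ?thesis by blast
qed

definition mun :: "'n \<Rightarrow> 'n \<Rightarrow> complex^'n^'n" where
 "mun i j = (\<chi> a b. if a = i \<and> b = j then 1 else 0)"

lemma mun_mult: "mun i j ** M = (\<chi> a b. if a = i then M $ j $ b else 0)" "M ** mun i j = (\<chi> a b. if b = j then M $ a $ i else 0)"
proof -
 have "(mun i j ** M) $ a $ b = (if a = i then M $ j $ b else 0)" for a b
 proof -
  have "(mun i j ** M) $ a $ b = (\<Sum>k\<in>UNIV. if k = j then (if a = i then M $ k $ b else 0) else 0)"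
   unfolding matrix_matrix_mult_def mun_def vec_lambda_beta by (rule sum.cong) auto
  then show ?thesis by simp
 qed
 moreover have "(M ** mun i j) $ a $ b = (if b = j then M $ a $ i else 0)" for a b
 proof -
  have "(M ** mun i j) $ a $ b = (\<Sum>k\<in>UNIV. if k = i then (if b = j then M $ a $ k else 0) else 0)"
   unfolding matrix_matrix_mult_def mun_def vec_lambda_beta by (rule sum.cong) auto
  then show ?thesis by simp
 qed
 ultimately show "mun i j ** M = (\<chi> a b. if a = i then M $ j $ b else 0)" "M ** mun i j = (\<chi> a b. if b = j then M $ a $ i else 0)"
  by (simp_all add: vec_eq_iff)
qed

lemma mun_mun: "mun i j ** mun k l = (if j = k then mun i l else 0)" unfolding mun_mult(1) by (auto simp: mun_def vec_eq_iff)

lemma mun_sandwich: "mun i k ** M ** mun l j = mat_scale (M $ k $ l) (mun i j)" unfolding mun_mult by (auto simp: mun_def mat_scale_def vec_eq_iff)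

lemma mun_adj [simp]: "mat_adj (mun i j) = mun j i" by (auto simp: mun_def mat_adj_def vec_eq_iff)

lemma mun_nz: "mun i j \<noteq> 0" by (auto simp: mun_def vec_eq_iff)

lemma mat_sum_mun: "M = (\<Sum>i\<in>UNIV. \<Sum>j\<in>UNIV. mat_scale (M $ i $ j) (mun i j))"
proof -
 have "(\<Sum>i\<in>UNIV. \<Sum>j\<in>UNIV. (mat_scale (M $ i $ j) (mun i j)) $ a $ b) = M $ a $ b" for a b
 proof -
  have "(\<Sum>j\<in>UNIV. (mat_scale (M $ i $ j) (mun i j)) $ a $ b) = (if i = a then M $ i $ b else 0)" for i
  proof -
   have "(\<Sum>j\<in>UNIV. (mat_scale (M $ i $ j) (mun i j)) $ a $ b) = (\<Sum>j\<in>UNIV. if j = b then (if i = a then M $ i $ j else 0) else 0)"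
    by (rule sum.cong) (auto simp: mat_scale_def mun_def)
   then show ?thesis by simp
  qed
  then show ?thesis by simp
 qed
 then show ?thesis by (simp add: vec_eq_iff sum_component)
qed

lemma sum_mun_diag: "(\<Sum>i\<in>UNIV. mun i i) = mat 1"
 by (simp add: vec_eq_iff mun_def mat_def) (auto simp: if_distrib intro!: sum.neutral trans[OF sum.mono_neutral_right[of UNIV "{_}"]])

text \<open>The orthogonal projection onto \<open>S\<close> in the space of matrices commutes with left multiplication by
 \<open>S\<close>, so by Schur's lemma it is right multiplication by some \<open>R\<close>; irreducibility forces \<open>R = 1\<close>.\<close>

theorem Burnside:
 fixes S :: "(complex^'n^'n) set"
 assumes irr: "mat_irred S" and adj: "\<And>b. b \<in> S \<Longrightarrow> mat_adj b \<in> S"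
  and add: "\<And>b c. b \<in> S \<Longrightarrow> c \<in> S \<Longrightarrow> b + c \<in> S" and sc: "\<And>k b. b \<in> S \<Longrightarrow> mat_scale k b \<in> S"
  and mult: "\<And>b c. b \<in> S \<Longrightarrow> c \<in> S \<Longrightarrow> b ** c \<in> S" and nz: "b0 \<in> S" "b0 \<noteq> 0"
 shows "S = UNIV"
proof -
 interpret hilb "math UNIV :: (complex^'n^'n) hilb" by unfold_locales (rule math_hilb)
 define ip :: "complex^'n^'n \<Rightarrow> complex^'n^'n \<Rightarrow> complex" where "ip = (\<lambda>M N. \<Sum>i\<in>UNIV. cip (M $ i) (N $ i))"
 have zero: "0 \<in> S" using sc[OF nz(1), of 0] by simp
 have "subspace S" unfolding subspace_def
 proof (intro conjI ballI allI)
  fix c M assume "M \<in> S"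
  then have "mat_scale (of_real c) M \<in> S" by (rule sc)
  moreover have "mat_scale (of_real c) M = c *\<^sub>R M" by (simp add: vec_eq_iff mat_scale_def) (simp add: scaleR_conv_of_real)
  ultimately show "c *\<^sub>R M \<in> S" by simp
 qed (use zero add in auto)
 then have clS: "closed S" by (rule closed_subspace)
 have subm: "sub M N = M - N" for M N unfolding sub_def by simp
 have subm2: "semi_ip.sub (+) mat_scale M N = M - N" for M N :: "complex^'n^'n" using subm by simp
 have "closed_subspace (math UNIV) S" unfolding closed_subspace_def sub_def[symmetric] subm
 proof (intro conjI allI impI ballI)
  fix s l assume A: "(\<forall>k. s k \<in> S) \<and> l \<in> hs_carrier (math UNIV) \<and> (\<lambda>k. hs_norm (math UNIV) (s k - l)) \<longlonglongrightarrow> 0"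
  then have "s \<longlonglongrightarrow> l" by (simp add: math_hilb(2) LIM_zero_cancel tendsto_norm_zero_iff)
  then show "l \<in> S" using clS A closed_sequentially by blast
 qed (use zero add sc in auto)
 then have "\<exists>k\<in>S. \<forall>w\<in>S. ip (X - k) w = 0" for X by (rule projection[of S X]) (auto simp: subm2 ip_def)
 then obtain P where P: "\<And>X. P X \<in> S" "\<And>X w. w \<in> S \<Longrightarrow> ip (X - P X) w = 0" by metis
 have ips: "ip (X + Y) w = ip X w + ip Y w" "ip (X - Y) w = ip X w - ip Y w" "ip (mat_scale c X) w = c * ip X w" for X Y w c
 proof -
  have "mat_scale c X $ i = c *s (X $ i)" for i by (simp add: mat_scale_def vec_eq_iff)
  then show "ip (mat_scale c X) w = c * ip X w" by (simp add: ip_def cip_scale_left sum_distrib_left)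
 qed (simp_all add: ip_def cip_simps sum.distrib sum_subtractf)
 have uniq: "P X = k" if k: "k \<in> S" "\<And>w. w \<in> S \<Longrightarrow> ip (X - k) w = 0" for X k
 proof -
  have d: "P X - k \<in> S" using add[OF P(1) sc[OF k(1)], of X "-1"] by simp
  have "ip (P X - k) (P X - k) = ip (X - k) (P X - k) - ip (X - P X) (P X - k)" by (simp add: ips)
  also have "\<dots> = 0" using k(2)[OF d] P(2)[OF d] by simp
  finally have "(\<Sum>i\<in>UNIV. (norm ((P X - k) $ i))\<^sup>2) = 0" unfolding ip_def cip_self of_real_sum[symmetric] by (simp only: of_real_eq_0_iff)
  then show ?thesis by (simp add: sum_nonneg_eq_0_iff vec_eq_iff)
 qed
 have ip_col: "ip M N = (\<Sum>a\<in>UNIV. cip (M *v axis a 1) (N *v axis a 1))" for M N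
 proof -
  have c: "(M *v axis a 1) $ i = M $ i $ a" for M :: "complex^'n^'n" and i a by (simp add: matrix_vector_mult_def axis_def if_distrib cong: if_cong)
  show ?thesis unfolding ip_def cip_def c by (rule sum.swap)
 qed
 have ip_adj: "ip (b ** X) Y = ip X (mat_adj b ** Y)" for b X Y unfolding ip_col matrix_vector_mul_assoc[symmetric] cip_mult_left ..
 have Padd: "P (X + Y) = P X + P Y" for X Y
 proof (rule uniq)
  have "X + Y - (P X + P Y) = (X - P X) + (Y - P Y)" by simp
  then show "ip (X + Y - (P X + P Y)) w = 0" if "w \<in> S" for w using P(2)[OF that] by (simp only: ips) simp
 qed (intro add P)
 have Psc: "P (mat_scale c X) = mat_scale c (P X)" for c X
 proof (rule uniq)
  have "mat_scale c X - mat_scale c (P X) = mat_scale c (X - P X)" by (simp add: mat_scale_def vec_eq_iff algebra_simps)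
  then show "ip (mat_scale c X - mat_scale c (P X)) w = 0" if "w \<in> S" for w using P(2)[OF that] by (simp only: ips) simp
 qed (intro sc P)
 have Pb: "P (b ** X) = b ** P X" if b: "b \<in> S" for b X
 proof (rule uniq)
  have "b ** X - b ** P X = b ** (X - P X)" by (simp add: matrix_diff_mult)
  then show "ip (b ** X - b ** P X) w = 0" if "w \<in> S" for w using P(2)[OF mult[OF adj[OF b] that]] by (simp only: ip_adj)
 qed (intro mult P b)
 have P0: "P 0 = 0" using Psc[of 0 0] by simp
 have Psum: "P (\<Sum>i\<in>I. f i) = (\<Sum>i\<in>I. P (f i))" if "finite I" for I :: "'n set" and f using that by induction (simp_all add: P0 Padd)
 \<comment> \<open>The coefficients of P, arranged so that j and l are fixed. Since P commutes with
   left multiplication by S, each \<open>T j l\<close> commutes with S and is scalar by Schur's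
   lemma.\<close>
 define T where "T = (\<lambda>j l. (\<chi> a c. P (mun c j) $ a $ l) :: complex^'n^'n)"
 have PT: "P X $ a $ l = (\<Sum>c\<in>UNIV. \<Sum>j\<in>UNIV. X $ c $ j * T j l $ a $ c)" for X a l
 proof -
  have "P X = (\<Sum>c\<in>UNIV. \<Sum>j\<in>UNIV. mat_scale (X $ c $ j) (P (mun c j)))" by (subst mat_sum_mun[of X]) (simp only: Psum Psc finite)
  then show ?thesis by (simp add: sum_component T_def mat_scale_def)
 qed
 have "T j l ** b = b ** T j l" if b: "b \<in> S" for j l b
 proof -
  have "(T j l ** b) $ a $ c = (b ** T j l) $ a $ c" for a c
  proof -
   have "(b ** T j l) $ a $ c = P (b ** mun c j) $ a $ l" unfolding Pb[OF b] by (simp add: T_def matrix_matrix_mult_def)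
   also have "\<dots> = (\<Sum>d\<in>UNIV. \<Sum>i\<in>UNIV. (if i = j then b $ d $ c * T i l $ a $ d else 0))" unfolding PT mun_mult by (intro sum.cong refl) auto
   also have "\<dots> = (T j l ** b) $ a $ c" by (simp add: matrix_matrix_mult_def mult.commute)
   finally show ?thesis by simp
  qed
  then show ?thesis by (simp add: vec_eq_iff)
 qed
 then have "\<exists>c. T j l = mat c" for j l by (intro Schur[OF irr adj])
 then obtain r where r: "\<And>j l. T j l = mat (r j l)" by metis
 define R where "R = (\<chi> j l. r j l)"
 have PR: "P X = X ** R" for X
 proof -
  have "P X $ a $ l = (X ** R) $ a $ l" for a l
  proof -
   have "P X $ a $ l = (\<Sum>c\<in>UNIV. if c = a then (\<Sum>j\<in>UNIV. X $ c $ j * r j l) else 0)" unfolding PT r by (intro sum.cong refl) (auto simp: mat_def)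
   then show ?thesis by (simp add: matrix_matrix_mult_def R_def)
  qed
  then show ?thesis by (simp add: vec_eq_iff)
 qed
 \<comment> \<open>P fixes S, so S annihilates the range of 1 - R. The common kernel W of S is
   invariant and not everything, hence zero.\<close>
 have bR: "b ** (mat 1 - R) = 0" if "b \<in> S" for b
 proof -
  have "P b = b" using uniq[of b b] that by (simp add: ip_def)
  then show ?thesis using PR[of b] by (simp add: matrix_diff_mult)
 qed
 define W where "W = {v. \<forall>b\<in>S. b *v v = 0}"
 have "vec.subspace W" by (auto simp: W_def vec.subspace_def matrix_vector_right_distrib vec.scale)
 moreover have "b *v w \<in> W" if "b \<in> S" "w \<in> W" for b w using that mult by (auto simp: W_def matrix_vector_mul_assoc)
 ultimately have "W = {0} \<or> W = UNIV" using irr unfolding mat_irred_def by blast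
 moreover have "W \<noteq> UNIV"
 proof
  assume "W = UNIV"
  then have "b0 *v v = 0 *v v" for v using nz(1) unfolding W_def by auto
  then have "b0 = 0" using matrix_eq by blast
  then show False using nz by simp
 qed
 ultimately have W0: "W = {0}" by blast
 have "(mat 1 - R) *v v = 0 *v v" for v
 proof -
  have "(mat 1 - R) *v v \<in> W" using bR by (simp add: W_def matrix_vector_mul_assoc)
  then show ?thesis using W0 by simp
 qed
 then have "mat 1 - R = 0" using matrix_eq by blast
 then have "R = mat 1" by simp
 then have "P X = X" for X using PR[of X] by (simp only: matrix_mul_rid)
 then show ?thesis using P(1) by (metis UNIV_eq_I)
qed

section \<open>Orthonormal bases of finite-dimensional Hilbert spaces\<close>

context hilb
begin

definition honb :: "('n::finite \<Rightarrow> 'h) \<Rightarrow> bool" where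
 "honb b \<longleftrightarrow> (\<forall>i. b i \<in> HC) \<and> (\<forall>i j. hs_inner H (b i) (b j) = (if i = j then 1 else 0)) \<and>
   (\<forall>x\<in>HC. (\<forall>i. hs_inner H x (b i) = 0) \<longrightarrow> x = hs_zero H)"

lemma honbD: assumes "honb b"
 shows "b i \<in> HC" "hs_inner H (b i) (b j) = (if i = j then 1 else 0)"
  "x \<in> HC \<Longrightarrow> (\<And>i. hs_inner H x (b i) = 0) \<Longrightarrow> x = hs_zero H" using assms unfolding honb_def by blast+

lemma fin_comb:
 assumes "finite I" "\<And>i. i \<in> I \<Longrightarrow> b i \<in> HC"
 shows "\<exists>s\<in>HC. \<forall>w\<in>HC. hs_inner H s w = (\<Sum>i\<in>I. c i * hs_inner H (b i) w)" using assms
proof induction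
 case (insert k I)
 then obtain s where s: "s \<in> HC" "\<And>w. w \<in> HC \<Longrightarrow> hs_inner H s w = (\<Sum>i\<in>I. c i * hs_inner H (b i) w)" by auto
 then show ?case using insert by (intro bexI[of _ "hs_add H (hs_smul H (c k) (b k)) s"]) auto
qed (auto intro!: bexI[of _ "hs_zero H"])

lemma Parseval:
 assumes b: "honb b" and x: "x \<in> HC" and y: "y \<in> HC"
 shows "hs_inner H x y = (\<Sum>i\<in>UNIV. hs_inner H x (b i) * hs_inner H (b i) y)"
proof -
 obtain s where s: "s \<in> HC" "\<And>w. w \<in> HC \<Longrightarrow> hs_inner H s w = (\<Sum>i\<in>UNIV. hs_inner H x (b i) * hs_inner H (b i) w)"
  using fin_comb[of UNIV b "\<lambda>i. hs_inner H x (b i)"] honbD(1)[OF b] by auto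
 have "sub x s = hs_zero H"
 proof (rule honbD(3)[OF b])
  fix j show "hs_inner H (sub x s) (b j) = 0" using x s(1) by (simp add: s(2) honbD(1,2)[OF b] if_distrib cong: if_cong)
 qed (use x s in simp)
 then have "x = s" using sub_eq_zero x s by blast
 then show ?thesis using s y by blast
qed

lemma lincomb_in: "(\<And>k. k < m \<Longrightarrow> b k \<in> HC) \<Longrightarrow> hs_lincomb H c b m \<in> HC" by (induction m) auto

lemma ip_lincomb: "(\<And>k. k < m \<Longrightarrow> b k \<in> HC) \<Longrightarrow> w \<in> HC \<Longrightarrow>
  hs_inner H (hs_lincomb H c b m) w = (\<Sum>k<m. c k * hs_inner H (b k) w)" by (induction m) (auto simp: lincomb_in)

lemma lincomb_cong: "(\<And>k. k < m \<Longrightarrow> c k = d k) \<Longrightarrow> hs_lincomb H c b m = hs_lincomb H d b m" by (induction m) auto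

text \<open>\<open>hs_has_dim\<close> numbers a basis by natural numbers; matrices need the index
  type 'n. L is the coordinate map, described only through inner products.\<close>

lemma dim_coords:
 assumes "hs_has_dim H CARD('n::finite)"
 obtains B :: "'n::finite \<Rightarrow> 'h" and L :: "complex^'n::finite \<Rightarrow> 'h" where
  "\<And>i. B i \<in> HC" "\<And>c. L c \<in> HC"
  "\<And>c w. w \<in> HC \<Longrightarrow> hs_inner H (L c) w = (\<Sum>i\<in>UNIV. c $ i * hs_inner H (B i) w)"
  "\<And>x. x \<in> HC \<Longrightarrow> \<exists>c. x = L c" "\<And>c. L c = hs_zero H \<Longrightarrow> c = 0"
proof -
 let ?n = "CARD('n)"
 obtain b where b: "\<And>i. i < ?n \<Longrightarrow> b i \<in> HC" "\<And>c. hs_lincomb H c b ?n = hs_zero H \<Longrightarrow> (\<forall>i<?n. c i = 0)"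
  "\<And>x. x \<in> HC \<Longrightarrow> \<exists>c. x = hs_lincomb H c b ?n" using assms unfolding hs_has_dim_def by blast
 obtain g :: "'n \<Rightarrow> nat" where g: "bij_betw g UNIV {..<?n}" using ex_bij_betw_finite_nat[of "UNIV :: 'n set"] by (auto simp: atLeast0LessThan)
 have gl: "g i < ?n" for i using g by (auto simp: bij_betw_def)
 have gi: "inv g (g i) = i" for i using g by (simp add: bij_betw_def)
 define L where "L = (\<lambda>c::complex^'n. hs_lincomb H (\<lambda>k. c $ inv g k) b ?n)"
 show ?thesis
 proof (rule that[of "\<lambda>i. b (g i)" L])
  show "b (g i) \<in> HC" for i using b(1) gl by blast
  show "L c \<in> HC" for c unfolding L_def by (intro lincomb_in b)
  show "hs_inner H (L c) w = (\<Sum>i\<in>UNIV. c $ i * hs_inner H (b (g i)) w)" if "w \<in> HC" for c w unfolding L_def using that b(1)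
   by (simp add: ip_lincomb sum.reindex_bij_betw[OF g, symmetric, of "\<lambda>k. c $ inv g k * hs_inner H (b k) w"] gi)
  show "\<exists>c. x = L c" if x: "x \<in> HC" for x
  proof -
   obtain c where c: "x = hs_lincomb H c b ?n" using b(3)[OF x] by blast
   have "inv g k = (SOME i. g i = k)" for k by (simp add: inv_def)
   have "g (inv g k) = k" if "k < ?n" for k using g that by (metis bij_betw_def f_inv_into_f lessThan_iff)
   then have "x = L (\<chi> i. c (g i))" unfolding c L_def by (intro lincomb_cong) simp
   then show ?thesis by blast
  qed
  show "c = 0" if "L c = hs_zero H" for c
  proof -
   have "c $ i = 0" for i using b(2)[OF that[unfolded L_def]] gl[of i] gi[of i] by (metis)
   then show ?thesis by (simp add: vec_eq_iff)
  qed
 qed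
qed

lemma honb_dim: assumes b: "honb (b :: 'n::finite \<Rightarrow> 'h)" shows "hs_has_dim H CARD('n)"
proof -
 let ?n = "CARD('n)"
 obtain g :: "'n \<Rightarrow> nat" where g: "bij_betw g UNIV {..<?n}" using ex_bij_betw_finite_nat[of "UNIV :: 'n set"] by (auto simp: atLeast0LessThan)
 have gi: "inv g (g i) = i" for i using g by (simp add: bij_betw_def)
 have gg: "g (inv g k) = k" if "k < ?n" for k using g that by (metis bij_betw_def f_inv_into_f lessThan_iff)
 define bn where "bn = (\<lambda>k. b (inv g k))"
 have V: "bn k \<in> HC" for k using honbD(1)[OF b] by (simp add: bn_def)
 have ip: "hs_inner H (hs_lincomb H c bn ?n) (b i) = c (g i)" for c i
 proof -
  have "hs_inner H (hs_lincomb H c bn ?n) (b i) = (\<Sum>k<?n. c k * hs_inner H (bn k) (b i))" by (rule ip_lincomb) (auto simp: V honbD(1)[OF b])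
  also have "\<dots> = (\<Sum>j\<in>UNIV. c (g j) * hs_inner H (bn (g j)) (b i))" by (rule sum.reindex_bij_betw[OF g, symmetric])
  also have "\<dots> = (\<Sum>j\<in>UNIV. c (g j) * hs_inner H (b j) (b i))" by (simp add: bn_def gi)
  finally show ?thesis by (simp add: honbD(2)[OF b] if_distrib cong: if_cong)
 qed
 show ?thesis unfolding hs_has_dim_def
 proof (intro exI[of _ bn] conjI allI impI ballI)
  fix c k assume "hs_lincomb H c bn ?n = hs_zero H" "k < ?n"
  then show "c k = 0" using ip[of c "inv g k"] gg[of k] honbD(1)[OF b] by simp
 next
  fix x assume x: "x \<in> HC"
  define c where "c = (\<lambda>k. hs_inner H x (bn k))"
  have lV: "hs_lincomb H c bn ?n \<in> HC" by (intro lincomb_in V)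
  have "sub x (hs_lincomb H c bn ?n) = hs_zero H"
  proof (rule honbD(3)[OF b])
   fix i show "hs_inner H (sub x (hs_lincomb H c bn ?n)) (b i) = 0" using x lV by (simp add: ip honbD(1)[OF b]) (simp add: c_def bn_def gi)
  qed (use x lV in simp)
  then show "\<exists>c. x = hs_lincomb H c bn ?n" using sub_eq_zero[OF x lV] by blast
 qed (rule V)
qed

text \<open>Unit vectors are added one by one, each found by \<open>zero_row_kernel\<close>
  orthogonal to the previous ones. The full family is total because its coordinate matrix has a
  one-sided, hence two-sided, inverse.\<close>

lemma exists_honb:
 assumes "hs_has_dim H CARD('n::finite)" obtains b :: "'n::finite \<Rightarrow> 'h" where "honb b"
proof -
 obtain B :: "'n \<Rightarrow> 'h" and L :: "complex^'n \<Rightarrow> 'h" where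
  B: "\<And>i. B i \<in> HC" "\<And>c. L c \<in> HC"
  "\<And>c w. w \<in> HC \<Longrightarrow> hs_inner H (L c) w = (\<Sum>i\<in>UNIV. c $ i * hs_inner H (B i) w)"
  "\<And>x. x \<in> HC \<Longrightarrow> \<exists>c. x = L c" "\<And>c. L c = hs_zero H \<Longrightarrow> c = 0" by (rule dim_coords[OF assms]) blast
 have "\<exists>b :: 'n \<Rightarrow> 'h. \<forall>i\<in>I. b i \<in> HC \<and> (\<forall>j\<in>I. hs_inner H (b i) (b j) = (if i = j then 1 else 0))"
  if "finite I" for I :: "'n set" using that
 proof induction
  case (insert k I)
  then obtain b :: "'n \<Rightarrow> 'h" where b: "\<And>i. i \<in> I \<Longrightarrow> b i \<in> HC"
   "\<And>i j. i \<in> I \<Longrightarrow> j \<in> I \<Longrightarrow> hs_inner H (b i) (b j) = (if i = j then 1 else 0)" by blast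
  define M :: "complex^'n^'n" where "M = (\<chi> i j. if i \<in> I then hs_inner H (B j) (b i) else 0)"
  have "M $ k = 0" using insert by (simp add: M_def vec_eq_iff)
  then obtain c where c: "c \<noteq> 0" "M *v c = 0" using zero_row_kernel by blast
  define v where "v = L c"
  have v: "v \<in> HC" "v \<noteq> hs_zero H" using B c by (auto simp: v_def)
  have "hs_inner H v (b i) = (M *v c) $ i" if "i \<in> I" for i using that B b by (simp add: v_def M_def matrix_vector_mult_def mult.commute)
  then have vb: "hs_inner H v (b i) = 0" if "i \<in> I" for i using c that by simp
  have nv: "hs_norm H v \<noteq> 0" using nm_zero_iff v by blast
  define u where "u = hs_smul H (of_real (1 / hs_norm H v)) v"
  have u: "u \<in> HC" using v by (simp add: u_def)
  have uu: "hs_inner H u u = 1" using v nv ip_self[of v] by (simp add: u_def power2_eq_square)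
  have ub: "hs_inner H u (b i) = 0" "hs_inner H (b i) u = 0" if "i \<in> I" for i
   using vb[OF that] v b(1)[OF that] ip_cnj[of u "b i"] u by (auto simp: u_def)
  show ?case
  proof (intro exI[of _ "b(k := u)"] ballI conjI)
   fix i j assume i: "i \<in> insert k I"
   show "(b(k := u)) i \<in> HC" using i u b(1) by auto
   assume j: "j \<in> insert k I"
   show "hs_inner H ((b(k := u)) i) ((b(k := u)) j) = (if i = j then 1 else 0)"
    using i j b(2)[of i j] uu ub(1)[of j] ub(2)[of i] insert(2) by (cases "i = k"; cases "j = k") simp_all
  qed
 qed auto
 from this[of UNIV, OF finite] obtain b :: "'n \<Rightarrow> 'h" where
  b0: "\<forall>i\<in>UNIV. b i \<in> HC \<and> (\<forall>j\<in>UNIV. hs_inner H (b i) (b j) = (if i = j then 1 else 0))" by (elim exE)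
 have b: "b i \<in> HC" "hs_inner H (b i) (b j) = (if i = j then 1 else 0)" for i j
  using conjunct1[OF bspec[OF b0 UNIV_I]] bspec[OF conjunct2[OF bspec[OF b0 UNIV_I]] UNIV_I] .
 have "\<forall>k. \<exists>c. b k = L c" using B(4)[OF b(1)] by (rule allI)
 from choice[OF this] obtain d where d0: "\<forall>k. b k = L (d k)" by (elim exE)
 have d: "b k = L (d k)" for k using d0 by (rule spec)
 define M :: "complex^'n^'n" where "M = (\<chi> i j. hs_inner H (B j) (b i))"
 have Mc: "(M *v c) $ i = hs_inner H (L c) (b i)" for c i using B b by (simp add: M_def matrix_vector_mult_def mult.commute)
 have "M ** cols d = mat 1"
 proof -
  have "(M ** cols d) $ i $ k = (M *v d k) $ i" for i k by (simp add: matrix_matrix_mult_def matrix_vector_mult_def cols_def)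
  then show ?thesis using b(2) d by (simp add: vec_eq_iff Mc mat_def)
 qed
 then have inv: "cols d ** M = mat 1" using matrix_left_right_inverse by blast
 have "honb b" unfolding honb_def
 proof (intro conjI allI ballI impI b)
  fix x assume x: "x \<in> HC" "\<forall>i. hs_inner H x (b i) = 0"
  obtain c where c: "x = L c" using B(4) x by blast
  have "M *v c = 0" using x(2) by (simp add: vec_eq_iff Mc c)
  then have "c = 0" using inv by (metis matrix_vector_mul_assoc matrix_vector_mul_lid matrix_vector_mult_0_right)
  show "x = hs_zero H" by (rule ip_eqI) (use x B(3)[of _ c] \<open>c = 0\<close> c in auto)
 qed
 then show ?thesis using that by blast
qed

end

section \<open>Homomorphisms into matrices\<close>

context calg
begin

definition mhom :: "('a \<Rightarrow> complex^'n^'n) \<Rightarrow> bool" where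
 "mhom r \<longleftrightarrow> (\<forall>x\<in>V. \<forall>y\<in>V. r (add x y) = r x + r y \<and> r (mu x y) = r x ** r y) \<and>
   (\<forall>x\<in>V. r (star x) = mat_adj (r x) \<and> (\<forall>c. r (sm c x) = mat_scale c (r x)))"

lemma mhomD: assumes "mhom r" "x \<in> V"
 shows "y \<in> V \<Longrightarrow> r (add x y) = r x + r y" "y \<in> V \<Longrightarrow> r (mu x y) = r x ** r y"
  "r (star x) = mat_adj (r x)" "r (sm c x) = mat_scale c (r x)" using assms unfolding mhom_def by blast+

lemma mhom_z: "mhom r \<Longrightarrow> r z = 0" using mhomD(4)[of r z 0] by simp

lemma mhom_is_rep:
 assumes r: "mhom r" and S: "vec.subspace S" and inv: "\<And>a v. a \<in> V \<Longrightarrow> v \<in> S \<Longrightarrow> r a *v v \<in> S"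
 shows "is_rep A (subh S) (\<lambda>a v. r a *v v)" unfolding is_rep_def subh_hilb(2)[OF S]
proof (intro conjI ballI allI)
 fix a assume a: "a \<in> V"
 show "\<exists>C. \<forall>x\<in>hs_carrier (subh S). norm (r a *v x) \<le> C * norm x" using norm_mat_vec by blast
qed (use inv mhomD[OF r] in \<open>auto simp: matrix_vector_right_distrib vec.scale matrix_vector_mult_add_rdistrib
  matrix_vector_mul_assoc mat_scale_vec cip_mult_left\<close>)

lemma mhom_contractive: assumes r: "mhom r" and a: "a \<in> V" shows "mat_opnorm (r a) \<le> nr a"
proof (rule mat_opnorm_le)
 fix v
 show "norm (r a *v v) \<le> nr a * norm v" using rep_contractive[OF subh_hilb(1)[OF vec.subspace_UNIV] mhom_is_rep[OF r vec.subspace_UNIV] a, of v]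
  by (simp add: subh_hilb(2)[OF vec.subspace_UNIV])
qed (use a in simp)

lemma honb_mhom:
 assumes H: "hilbert_space H" and rep: "is_rep A H \<pi>" and b: "hilb.honb H (b :: 'n::finite \<Rightarrow> 'h)"
 defines "r \<equiv> \<lambda>a. (\<chi> k i. hs_inner H (\<pi> a (b i)) (b k)) :: complex^'n::finite^'n::finite"
 shows "mhom r" "a \<in> V \<Longrightarrow> x \<in> hs_carrier H \<Longrightarrow> norm (r a *v (\<chi> i. hs_inner H x (b i))) = hs_norm H (\<pi> a x)"
  "x \<in> hs_carrier H \<Longrightarrow> norm ((\<chi> i. hs_inner H x (b i)) :: complex^'n::finite) = hs_norm H x"
proof -
 interpret hilb H by unfold_locales (rule H)
 note R = is_repD[OF rep] and bD = honbD[OF b]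
 have Vb: "\<pi> a (b i) \<in> hs_carrier H" if "a \<in> V" for a i using R(1)[OF that bD(1)] .
 have act: "(\<Sum>i\<in>UNIV. hs_inner H (\<pi> a (b i)) (b k) * hs_inner H x (b i)) = hs_inner H (\<pi> a x) (b k)"
  if a: "a \<in> V" and x: "x \<in> hs_carrier H" for a x k
 proof -
  have "hs_inner H (\<pi> a x) (b k) = hs_inner H x (\<pi> (star a) (b k))" by (rule R(7)[OF a x bD(1)])
  also have "\<dots> = (\<Sum>i\<in>UNIV. hs_inner H x (b i) * hs_inner H (b i) (\<pi> (star a) (b k)))" by (rule Parseval[OF b x]) (use a Vb in simp)
  also have "\<dots> = (\<Sum>i\<in>UNIV. hs_inner H x (b i) * hs_inner H (\<pi> a (b i)) (b k))" using R(7)[OF a bD(1) bD(1)] by simp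
  finally show ?thesis by (simp add: mult.commute)
 qed
 show "mhom r" unfolding mhom_def
 proof (intro conjI ballI allI)
  fix x y c assume x: "x \<in> V"
  show "r (sm c x) = mat_scale c (r x)" using R(6)[OF x bD(1)] Vb[OF x] bD(1) by (simp add: r_def mat_scale_def vec_eq_iff)
  have "hs_inner H (\<pi> (star x) (b i)) (b k) = cnj (hs_inner H (\<pi> x (b k)) (b i))" for i k
   using R(7)[OF x bD(1) bD(1), of k i] ip_cnj[of "b k" "\<pi> (star x) (b i)"] Vb x bD(1) by simp
  then show "r (star x) = mat_adj (r x)" by (simp add: r_def mat_adj_def vec_eq_iff)
  assume y: "y \<in> V"
  show "r (add x y) = r x + r y" using R(4)[OF x bD(1) y] Vb[OF x] Vb[OF y] bD(1) by (simp add: r_def vec_eq_iff)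
  show "r (mu x y) = r x ** r y" using R(5)[OF x bD(1) y] act[OF x Vb[OF y]] by (simp add: r_def vec_eq_iff matrix_matrix_mult_def)
 qed
 show n: "norm ((\<chi> i. hs_inner H x (b i)) :: complex^'n) = hs_norm H x" if x: "x \<in> hs_carrier H" for x
 proof -
  have "cip (\<chi> i. hs_inner H x (b i)) (\<chi> i. hs_inner H x (b i)) = hs_inner H x x" using Parseval[OF b x x] ip_cnj[OF x bD(1)] by (simp add: cip_def)
  then have "complex_of_real ((norm ((\<chi> i. hs_inner H x (b i)) :: complex^'n))\<^sup>2) = of_real ((hs_norm H x)\<^sup>2)"
   using ip_self[OF x] by (simp only: cip_self nm_eq)
  then have "(norm ((\<chi> i. hs_inner H x (b i)) :: complex^'n))\<^sup>2 = (hs_norm H x)\<^sup>2" by (simp only: of_real_eq_iff)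
  then show ?thesis by (rule power2_eq_imp_eq) (use nm_nonneg[OF x] in simp_all)
 qed
 show "norm (r a *v (\<chi> i. hs_inner H x (b i))) = hs_norm H (\<pi> a x)" if a: "a \<in> V" and x: "x \<in> hs_carrier H"
 proof -
  have "r a *v (\<chi> i. hs_inner H x (b i)) = (\<chi> k. hs_inner H (\<pi> a x) (b k))" using act[OF a x] by (simp add: r_def matrix_vector_mult_def)
  then show ?thesis using n[OF R(1)[OF a x]] by simp
 qed
qed

text \<open>Homogeneity turns the norm-attaining irreducible representation, on a space not known
  beforehand, into matrices of the fixed size CARD('n).\<close>

theorem exists_mhom:
 assumes hom: "n_homogeneous TYPE('a \<Rightarrow> complex) CARD('n::finite) A" and a: "a \<in> V"
 obtains r :: "'a \<Rightarrow> complex^'n::finite^'n::finite" where "mhom r" "mat_opnorm (r a) = nr a"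
proof (cases "a = z")
 case True
 have "mhom (\<lambda>_. 0 :: complex^'n^'n)" by (simp add: mhom_def)
 then show ?thesis using that True by auto
next
 case False
 obtain H :: "('a fs \<Rightarrow> complex) hilb" and \<pi> x where
  H: "hilbert_space H" "nonzero_irreducible_rep A H \<pi>" "x \<in> hs_carrier H" "hs_norm H x = 1" "hs_norm H (\<pi> a x) = nr a"
  by (rule exists_irrep[OF a False])
 interpret hilb H by unfold_locales (rule H)
 obtain b :: "'n \<Rightarrow> 'a fs \<Rightarrow> complex" where b: "honb b" by (rule exists_honb[OF n_homogeneous_any[OF hom H(1,2)]])
 have rep: "is_rep A H \<pi>" using H(2) by (simp add: nonzero_irreducible_rep_def)
 let ?r = "\<lambda>a. (\<chi> k i. hs_inner H (\<pi> a (b i)) (b k)) :: complex^'n^'n"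
 note m = honb_mhom[OF H(1) rep b]
 have "nr a \<le> mat_opnorm (?r a)" using norm_mat_vec[of "?r a" "\<chi> i. hs_inner H x (b i)"] m(2)[OF a H(3)] m(3)[OF H(3)] H(4,5) by simp
 then have "mat_opnorm (?r a) = nr a" using mhom_contractive[OF m(1) a] by simp
 then show ?thesis using that m(1) by blast
qed

end

lemma cols_sum: "cols e *v c = (\<Sum>i\<in>UNIV. c $ i *s e i)" by (simp add: cols_def matrix_vector_mult_def vec_eq_iff sum_component mult.commute)

lemma orth_split:
 assumes S: "vec.subspace S" and K: "vec.subspace K" "K \<subseteq> S" and v: "v \<in> S"
 obtains k where "k \<in> K" "v - k \<in> S" "\<And>w. w \<in> K \<Longrightarrow> cip (v - k) w = 0"
proof -
 interpret hilb "subh S" by unfold_locales (rule subh_hilb[OF S])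
 have "closed_subspace (subh S) K" unfolding closed_subspace_def subh_hilb(2)[OF S]
 proof (intro conjI allI impI)
  fix s l assume A: "(\<forall>k. s k \<in> K) \<and> l \<in> hs_carrier (subh S) \<and>
    (\<lambda>k. norm (hs_add (subh S) (s k) (hs_smul (subh S) (- 1) l))) \<longlonglongrightarrow> 0"
  then have "s \<longlonglongrightarrow> l" by (simp add: LIM_zero_cancel tendsto_norm_zero_iff)
  moreover have "closed K" by (intro closed_subspace vec_subspace_real K)
  ultimately show "l \<in> K" using A closed_sequentially by blast
 qed (use K in \<open>auto simp: vec.subspace_0 vec.subspace_add vec.subspace_scale\<close>)
 moreover have "semi_ip.sub (+) (*s) v k = v - k" for v k :: "complex^'a" using sub_def[of v k] by simp
 ultimately show ?thesis using projection[of K v] v that K(2) vec.subspace_diff[OF S v] by (metis subh_sel(1,5) subh_sel(3,4) subsetD)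
qed

context calg
begin

text \<open>Among the invariant subspaces on which r acts nontrivially, one of least dimension is
  irreducible. Homogeneity gives it dimension CARD('n), so every such subspace is the whole
  space.\<close>

lemma mhom_nonzero_subspace:
 fixes r :: "'a \<Rightarrow> complex^'n^'n"
 assumes hom: "n_homogeneous TYPE('a \<Rightarrow> complex) CARD('n) A" and r: "mhom r"
  and W: "vec.subspace W" "\<And>a v. a \<in> V \<Longrightarrow> v \<in> W \<Longrightarrow> r a *v v \<in> W" "\<exists>a\<in>V. \<exists>v\<in>W. r a *v v \<noteq> 0"
 shows "W = UNIV"
proof -
 define good where "good = (\<lambda>W. vec.subspace W \<and> (\<forall>a\<in>V. \<forall>v\<in>W. r a *v v \<in> W) \<and> (\<exists>a\<in>V. \<exists>v\<in>W. r a *v v \<noteq> 0))"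
 have "good W" using W by (auto simp: good_def)
 then obtain S where S: "good S" "\<And>W. good W \<Longrightarrow> vec.dim S \<le> vec.dim W" using ex_has_least_nat[of good W vec.dim] by blast
 have Ssub: "vec.subspace S" and Sinv: "\<And>a v. a \<in> V \<Longrightarrow> v \<in> S \<Longrightarrow> r a *v v \<in> S" using S(1) by (auto simp: good_def)
 have min: "W = S" if "good W" "W \<subseteq> S" for W using vec.subspace_dim_equal[of W S] that S(2)[of W] Ssub by (auto simp: good_def)
 have "nonzero_irreducible_rep A (subh S) (\<lambda>a v. r a *v v)" unfolding nonzero_irreducible_rep_def
 proof (intro conjI allI impI)
  show "is_rep A (subh S) (\<lambda>a v. r a *v v)" by (rule mhom_is_rep[OF r Ssub Sinv])
  show "\<exists>a\<in>V. \<exists>x\<in>hs_carrier (subh S). r a *v x \<noteq> hs_zero (subh S)" using S(1) by (auto simp: good_def)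
  fix K assume A: "closed_subspace (subh S) K \<and> (\<forall>a\<in>V. \<forall>x\<in>K. r a *v x \<in> K)"
  then have K: "vec.subspace K" "K \<subseteq> S" "\<And>a x. a \<in> V \<Longrightarrow> x \<in> K \<Longrightarrow> r a *v x \<in> K" by (auto simp: closed_subspace_def vec.subspace_def)
  have "K = S \<or> K = {0}"
  proof (cases "good K")
   case True then show ?thesis using min K by blast
  next
   case False
   \<comment> \<open>Once r kills K, the complement of K in S still carries a nontrivial action. By
     minimality it equals S, which leaves K = 0.\<close>
   then have K0: "r a *v k = 0" if "a \<in> V" "k \<in> K" for a k using K that by (auto simp: good_def)
   define K' where "K' = {v \<in> S. \<forall>w\<in>K. cip v w = 0}"
   have "good K'" unfolding good_def
   proof (intro conjI ballI)
    show "vec.subspace K'" using Ssub by (auto simp: K'_def vec.subspace_def cip_simps)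
    show "r a *v v \<in> K'" if "a \<in> V" "v \<in> K'" for a v using that Sinv K(3)[of "star a"] mhomD(3)[OF r that(1)] by (auto simp: K'_def cip_mult_left)
    obtain a v where av: "a \<in> V" "v \<in> S" "r a *v v \<noteq> 0" using S(1) by (auto simp: good_def)
    obtain k where k: "k \<in> K" "v - k \<in> S" "\<And>w. w \<in> K \<Longrightarrow> cip (v - k) w = 0" by (rule orth_split[OF Ssub K(1,2) av(2)]) blast
    have "r a *v (v - k) \<noteq> 0" using av K0[OF av(1) k(1)] by (simp add: matrix_vector_mult_diff_distrib)
    then show "\<exists>a\<in>V. \<exists>v\<in>K'. r a *v v \<noteq> 0" using av(1) k by (auto simp: K'_def)
   qed
   then have "K' = S" by (rule min) (auto simp: K'_def)
   have "k = 0" if "k \<in> K" for k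
   proof -
    have "cip k k = 0" using \<open>K' = S\<close> K(2) that by (auto simp: K'_def)
    then show ?thesis by (simp add: cip_self)
   qed
   then show ?thesis using vec.subspace_0[OF K(1)] by blast
  qed
  then show "K = {hs_zero (subh S)} \<or> K = hs_carrier (subh S)" by auto
 qed
 then have dim: "hs_has_dim (subh S) CARD('n)" by (rule n_homogeneous_any[OF hom subh_hilb(1)[OF Ssub]])
 interpret hilb "subh S" by unfold_locales (rule subh_hilb[OF Ssub])
 obtain b :: "'n \<Rightarrow> complex^'n" where b: "honb b" by (rule exists_honb[OF dim])
 have bS: "b i \<in> S" for i using honbD(1)[OF b] by simp
 have "onb b" using honbD(2)[OF b] by (simp add: onb_def)
 then have U: "unitary_mat (cols b)" by (rule onb_unitary)
 have "v \<in> S" for v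
 proof -
  have "v = cols b *v (mat_adj (cols b) *v v)" using U by (simp add: matrix_vector_mul_assoc unitary_mat_def)
  also have "\<dots> \<in> S" unfolding cols_sum by (intro vec.subspace_sum Ssub vec.subspace_scale bS)
  finally show ?thesis .
 qed
 then have "S = UNIV" by blast
 then show ?thesis using S(2)[OF \<open>good W\<close>] vec.subspace_dim_equal[OF W(1) vec.subspace_UNIV] by simp
qed

text \<open>An invariant subspace is everything by \<open>mhom_nonzero_subspace\<close>, or r kills
  it and then its complement is everything. The image is therefore irreducible and Burnside's
  theorem applies.\<close>

theorem mhom_surj:
 fixes r :: "'a \<Rightarrow> complex^'n^'n"
 assumes hom: "n_homogeneous TYPE('a \<Rightarrow> complex) CARD('n) A" and r: "mhom r" and nz: "a0 \<in> V" "r a0 \<noteq> 0"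
 shows "r ` V = UNIV"
proof -
 note D = mhomD[OF r]
 obtain v0 where v0: "r a0 *v v0 \<noteq> 0" using nz(2) matrix_eq[of "r a0" 0] by auto
 have "mat_irred (r ` V)" unfolding mat_irred_def
 proof (intro allI impI)
  fix W assume A: "vec.subspace W \<and> (\<forall>b\<in>r ` V. \<forall>w\<in>W. b *v w \<in> W)"
  show "W = {0} \<or> W = UNIV"
  proof (cases "\<exists>a\<in>V. \<exists>v\<in>W. r a *v v \<noteq> 0")
   case True
   then show ?thesis using mhom_nonzero_subspace[OF hom r, of W] A by blast
  next
   case False
   define W' where "W' = {v. \<forall>w\<in>W. cip v w = 0}"
   have "W' = UNIV"
   proof (rule mhom_nonzero_subspace[OF hom r])
    show "vec.subspace W'" by (auto simp: W'_def vec.subspace_def cip_simps)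
    show "r a *v v \<in> W'" if a: "a \<in> V" and v: "v \<in> W'" for a v
    proof -
     have "mat_adj (r a) *v w \<in> W" if "w \<in> W" for w using A D(3)[OF a] alg_simps(7)[OF a] that by (metis imageI)
     then show ?thesis using v by (auto simp: W'_def cip_mult_left)
    qed
    obtain k where k: "k \<in> W" "\<And>w. w \<in> W \<Longrightarrow> cip (v0 - k) w = 0" using orth_split[of UNIV W v0] A by (metis UNIV_I subset_UNIV vec.subspace_UNIV)
    have "r a0 *v (v0 - k) \<noteq> 0" using v0 False nz(1) k(1) by (auto simp: matrix_vector_mult_diff_distrib)
    then show "\<exists>a\<in>V. \<exists>v\<in>W'. r a *v v \<noteq> 0" using nz(1) k by (auto simp: W'_def)
   qed
   then have "k = 0" if "k \<in> W" for k
   proof -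
    have "k \<in> W'" using \<open>W' = UNIV\<close> by simp
    then have "cip k k = 0" using that by (simp add: W'_def)
    then show ?thesis by (simp add: cip_self)
   qed
   then show ?thesis using A vec.subspace_0 by blast
  qed
 qed
 then show ?thesis
 proof (rule Burnside)
  show "mat_adj b \<in> r ` V" if "b \<in> r ` V" for b using that D(3) by (force simp flip: D(3))
  show "b + c \<in> r ` V" if "b \<in> r ` V" "c \<in> r ` V" for b c using that by (force simp flip: D(1))
  show "mat_scale k b \<in> r ` V" if "b \<in> r ` V" for k b using that by (force simp flip: D(4))
  show "b ** c \<in> r ` V" if "b \<in> r ` V" "c \<in> r ` V" for b c using that by (force simp flip: D(2))
  show "r a0 \<in> r ` V" "r a0 \<noteq> 0" using nz by auto
 qed
qed

text \<open>An irreducible representation that factors through the full matrix algebra is the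
  standard one. Lifts of the matrix units are used: with a unit vector v in the range of the first
  diagonal unit, the vectors e_i1 v form an orthonormal basis in which \<pi> has the matrices of
  s.\<close>

theorem matrix_units:
 fixes s :: "'a \<Rightarrow> complex^'n^'n"
 assumes s: "mhom s" "s ` V = UNIV" and H: "hilbert_space H" and irr: "nonzero_irreducible_rep A H \<pi>"
  and ker: "\<And>a x. a \<in> V \<Longrightarrow> s a = 0 \<Longrightarrow> x \<in> hs_carrier H \<Longrightarrow> \<pi> a x = hs_zero H"
 obtains b :: "'n \<Rightarrow> 'h" where "hilb.honb H b" "\<And>a i k. a \<in> V \<Longrightarrow> hs_inner H (\<pi> a (b i)) (b k) = s a $ k $ i"
proof -
 interpret hilb H by unfold_locales (rule H)
 have rep: "is_rep A H \<pi>" using irr by (simp add: nonzero_irreducible_rep_def)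
 note R = is_repD[OF rep] and D = mhomD[OF s(1)]
 have eq: "\<pi> a x = \<pi> b x" if ab: "a \<in> V" "b \<in> V" "s a = s b" and x: "x \<in> hs_carrier H" for a b x
 proof -
  have "\<pi> (add a (sm (-1) b)) x = hs_zero H" by (rule ker) (use ab x in \<open>simp_all add: D\<close>)
  then have "sub (\<pi> a x) (\<pi> b x) = hs_zero H" using R(4)[OF ab(1) x, of "sm (-1) b"] R(6)[OF ab(2) x] ab by (simp add: sub_def)
  then show ?thesis using sub_eq_zero R(1)[OF _ x] ab by blast
 qed
 have "\<exists>a. a \<in> V \<and> s a = M" for M using s(2) by (metis UNIV_I imageE)
 then have "\<forall>i j. \<exists>a. a \<in> V \<and> s a = mun i j" by blast
 then obtain e where e: "\<And>i j. e i j \<in> V" "\<And>i j. s (e i j) = mun i j" by metis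
 define o1 where "o1 = (undefined :: 'n)"
 have "\<exists>w\<in>hs_carrier H. \<pi> (e o1 o1) w \<noteq> hs_zero H"
 proof (rule ccontr)
  assume A: "\<not> ?thesis"
  \<comment> \<open>Matrices having a lift that acts as zero. If the unit at o1 acts as zero, I
    contains every diagonal unit and so the identity, which makes \<pi> vanish.\<close>
  define I where "I = {M. \<exists>a\<in>V. s a = M \<and> (\<forall>x\<in>hs_carrier H. \<pi> a x = hs_zero H)}"
  have z2: "hs_add H (hs_zero H) (hs_zero H) = hs_zero H" using vs unfolding complex_vs_def by blast
  have Iadd: "M + N \<in> I" if MN: "M \<in> I" "N \<in> I" for M N
  proof -
   obtain a b where ab: "a \<in> V" "s a = M" "\<And>x. x \<in> hs_carrier H \<Longrightarrow> \<pi> a x = hs_zero H"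
    "b \<in> V" "s b = N" "\<And>x. x \<in> hs_carrier H \<Longrightarrow> \<pi> b x = hs_zero H" using MN unfolding I_def by blast
   have "\<pi> (add a b) x = hs_zero H" if "x \<in> hs_carrier H" for x using R(4)[OF ab(1) that ab(4)] ab(3,6) that z2 by simp
   then show ?thesis unfolding I_def using ab D(1)[OF ab(1,4)] by (auto intro!: bexI[of _ "add a b"])
  qed
  have I0: "0 \<in> I" unfolding I_def using ker[of z] mhom_z[OF s(1)] by (auto intro!: bexI[of _ z])
  have munI: "mun i i \<in> I" for i
  proof -
   let ?a = "mu (e i o1) (mu (e o1 o1) (e o1 i))"
   have "s ?a = mun i i" using e by (simp add: D mun_mun)
   moreover have "\<pi> ?a x = hs_zero H" if x: "x \<in> hs_carrier H" for x
   proof -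
    have "\<pi> ?a x = \<pi> (e i o1) (\<pi> (e o1 o1) (\<pi> (e o1 i) x))" using R(5) R(1) e x by simp
    also have "\<pi> (e o1 o1) (\<pi> (e o1 i) x) = hs_zero H" using A R(1)[OF e(1) x] by blast
    also have "\<pi> (e i o1) (hs_zero H) = hs_zero H"
     using R(3)[OF e(1) zero_cl, of i o1 0] vs R(1)[OF e(1) zero_cl] ip_eqI[of "hs_smul H 0 (hs_zero H)" "hs_zero H"]
      ip_eqI[of "hs_smul H 0 (\<pi> (e i o1) (hs_zero H))" "hs_zero H"] by simp
    finally show ?thesis .
   qed
   ultimately show ?thesis unfolding I_def using e by (auto intro!: bexI[of _ ?a])
  qed
  have "(\<Sum>i\<in>F. mun i i) \<in> I" if "finite F" for F using that by induction (auto intro: I0 Iadd munI)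
  then have "mat 1 \<in> I" using sum_mun_diag by (metis finite)
  then obtain u where u: "u \<in> V" "s u = mat 1" "\<And>x. x \<in> hs_carrier H \<Longrightarrow> \<pi> u x = hs_zero H" unfolding I_def by blast
  have "\<pi> b x = hs_zero H" if b: "b \<in> V" and x: "x \<in> hs_carrier H" for b x
  proof -
   have "\<pi> b x = \<pi> (mu u b) x" by (rule eq) (use u b x in \<open>simp_all add: D\<close>)
   then show ?thesis using R(5)[OF u(1) x b] u(3)[OF R(1)[OF b x]] by simp
  qed
  then show False using irr unfolding nonzero_irreducible_rep_def by blast
 qed
 then obtain w where w: "w \<in> hs_carrier H" "\<pi> (e o1 o1) w \<noteq> hs_zero H" by blast
 define u where "u = \<pi> (e o1 o1) w"
 have u: "u \<in> hs_carrier H" "u \<noteq> hs_zero H" using w R(1)[OF e(1)] by (auto simp: u_def)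
 have nu: "hs_norm H u \<noteq> 0" using nm_zero_iff u by blast
 define v where "v = hs_smul H (of_real (1 / hs_norm H u)) u"
 have v: "v \<in> hs_carrier H" using u by (simp add: v_def)
 have vv: "hs_inner H v v = 1" using u nu ip_self[of u] by (simp add: v_def power2_eq_square)
 have "\<pi> (e o1 o1) u = u"
 proof -
  have "\<pi> (e o1 o1) u = \<pi> (mu (e o1 o1) (e o1 o1)) w" using R(5)[OF e(1) w(1) e(1)] by (simp add: u_def)
  also have "\<dots> = u" unfolding u_def by (rule eq) (use e w in \<open>simp_all add: D mun_mun\<close>)
  finally show ?thesis .
 qed
 then have ev: "\<pi> (e o1 o1) v = v" using R(3)[OF e(1) u(1)] by (simp add: v_def)
 have key: "hs_inner H (\<pi> a v) v = c" if a: "a \<in> V" "s a = mat_scale c (mun o1 o1)" for a c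
 proof -
  have "\<pi> a v = \<pi> (sm c (e o1 o1)) v" by (rule eq) (use a e v in \<open>simp_all add: D\<close>)
  then have "\<pi> a v = hs_smul H c v" using R(6)[OF e(1) v] ev by simp
  then show ?thesis using v vv by simp
 qed
 define b where "b = (\<lambda>i. \<pi> (e i o1) v)"
 have bV: "b i \<in> hs_carrier H" for i unfolding b_def by (rule R(1)[OF e(1) v])
 have mat: "hs_inner H (\<pi> a (b i)) (b k) = s a $ k $ i" if a: "a \<in> V" for a i k
 proof -
  have aV: "mu (e k o1) a \<in> V" "mu a (e i o1) \<in> V" "star (e k o1) \<in> V" using a e by auto
  have "\<pi> a (b i) = \<pi> (mu a (e i o1)) v" unfolding b_def by (rule R(5)[OF a v e(1), symmetric])
  then have "hs_inner H (\<pi> a (b i)) (b k) = hs_inner H (\<pi> (star (e k o1)) (\<pi> (mu a (e i o1)) v)) v"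
   unfolding b_def using R(7)[OF aV(3) R(1)[OF aV(2) v] v] e by simp
  also have "\<pi> (star (e k o1)) (\<pi> (mu a (e i o1)) v) = \<pi> (mu (star (e k o1)) (mu a (e i o1))) v" by (rule R(5)[OF aV(3) v aV(2), symmetric])
  also have "hs_inner H \<dots> v = s a $ k $ i" by (rule key) (use a e in \<open>simp_all add: D matrix_mul_assoc mun_sandwich\<close>)
  finally show ?thesis .
 qed
 obtain one where one: "one \<in> V" "s one = mat 1" using s(2) by (metis UNIV_I imageE)
 have oneb: "\<pi> one (b i) = b i" for i
 proof -
  have "\<pi> one (b i) = \<pi> (mu one (e i o1)) v" unfolding b_def by (rule R(5)[OF one(1) v e(1), symmetric])
  also have "\<dots> = b i" unfolding b_def by (rule eq) (use e one v in \<open>simp_all add: D\<close>)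
  finally show ?thesis .
 qed
 have orth: "hs_inner H (b i) (b k) = (if i = k then 1 else 0)" for i k using mat[OF one(1), of i k] by (simp add: oneb one mat_def)
 \<comment> \<open>The complement of all \<pi> a (b i) is invariant and misses b o1, so it is zero.
   It remains to see that these vectors lie in the span of b.\<close>
 define K where "K = {x \<in> hs_carrier H. \<forall>a\<in>V. \<forall>i. hs_inner H x (\<pi> a (b i)) = 0}"
 have Vab: "\<pi> a (b i) \<in> hs_carrier H" if "a \<in> V" for a i by (rule R(1)[OF that bV])
 have "closed_subspace H K" unfolding closed_subspace_def sub_def[symmetric]
 proof (intro conjI allI impI)
  fix t l assume A: "(\<forall>k. t k \<in> K) \<and> l \<in> hs_carrier H \<and> (\<lambda>k. hs_norm H (sub (t k) l)) \<longlonglongrightarrow> 0"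
  have "hs_inner H l (\<pi> a (b i)) = 0" if "a \<in> V" for a i
  proof (rule LIMSEQ_unique)
   show "(\<lambda>k. hs_inner H (t k) (\<pi> a (b i))) \<longlonglongrightarrow> hs_inner H l (\<pi> a (b i))" using A Vab[OF that] by (intro ip_tendsto) (auto simp: K_def)
   show "(\<lambda>k. hs_inner H (t k) (\<pi> a (b i))) \<longlonglongrightarrow> 0" using A that by (simp add: K_def)
  qed
  then show "l \<in> K" using A by (simp add: K_def)
 qed (use Vab in \<open>auto simp: K_def\<close>)
 moreover have "\<pi> c h \<in> K" if c: "c \<in> V" and h: "h \<in> K" for c h
 proof -
  have "hs_inner H (\<pi> c h) (\<pi> a (b i)) = 0" if a: "a \<in> V" for a i
  proof -
   have "hs_inner H (\<pi> c h) (\<pi> a (b i)) = hs_inner H h (\<pi> (star c) (\<pi> a (b i)))" using R(7)[OF c] h Vab[OF a] by (simp add: K_def)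
   also have "\<pi> (star c) (\<pi> a (b i)) = \<pi> (mu (star c) a) (b i)" using R(5)[of "star c" "b i" a] a c bV by simp
   finally show ?thesis using h a c by (simp add: K_def)
  qed
  then show ?thesis using R(1)[OF c] h by (simp add: K_def)
 qed
 ultimately have K: "K = {hs_zero H} \<or> K = hs_carrier H" using irr unfolding nonzero_irreducible_rep_def by blast
 have "b o1 \<notin> K" using orth[of o1 o1] one(1) oneb[of o1] by (auto simp: K_def) (metis zero_neq_one)
 then have K0: "K = {hs_zero H}" using K bV by blast
 have "x = hs_zero H" if x: "x \<in> hs_carrier H" "\<And>i. hs_inner H x (b i) = 0" for x
 proof -
  have "hs_inner H x (\<pi> a (b i)) = 0" if a: "a \<in> V" for a i
  proof -
   \<comment> \<open>The combination of basis vectors predicted by column i of s a. Both it and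
     \<pi> a (b i) turn out orthogonal to their difference y, so y = 0.\<close>
   obtain t where t: "t \<in> hs_carrier H" "\<And>w. w \<in> hs_carrier H \<Longrightarrow> hs_inner H t w = (\<Sum>k\<in>UNIV. s a $ k $ i * hs_inner H (b k) w)"
    using fin_comb[of UNIV b "\<lambda>k. s a $ k $ i"] bV by auto
   let ?p = "\<pi> a (b i)"
   define y where "y = sub ?p t"
   have pV: "?p \<in> hs_carrier H" and yV: "y \<in> hs_carrier H" using Vab[OF a] t(1) by (auto simp: y_def)
   have tb: "hs_inner H t (b k) = s a $ k $ i" for k unfolding t(2)[OF bV] orth by (simp add: if_distrib cong: if_cong)
   have "hs_inner H y (b k) = 0" for k using mat[OF a] tb bV pV t(1) by (simp add: y_def)
   then have "hs_inner H (b k) y = 0" for k using ip_cnj[OF yV bV] by simp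
   then have 1: "hs_inner H t y = 0" using t(2)[OF yV] by simp
   have "hs_inner H ?p ?p = hs_inner H (\<pi> (mu (star a) a) (b i)) (b i)"
    using R(7)[OF a bV pV] ip_cnj[OF pV pV] R(5)[of "star a" "b i" a] R(7)[of "star a" "?p" "b i"] a bV pV by simp
   also have "\<dots> = (\<Sum>k\<in>UNIV. s a $ k $ i * cnj (s a $ k $ i))" using a by (simp add: mat D matrix_matrix_mult_def mat_adj_def mult.commute)
   also have "\<dots> = hs_inner H t ?p" unfolding t(2)[OF pV] using ip_cnj[OF pV bV] mat[OF a] by simp
   finally have "hs_inner H ?p ?p = hs_inner H t ?p" .
   then have "hs_inner H ?p y = 0" using 1 ip_cnj[OF yV pV] ip_cnj[OF pV t(1)] pV t(1) by (simp add: y_def)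
   then have "hs_inner H y y = 0" using 1 pV t(1) yV by (subst y_def) simp
   then have "y = hs_zero H" by (rule ip_definite[OF yV])
   then have "?p = t" using sub_eq_zero[OF pV t(1)] by (simp add: y_def)
   then have "hs_inner H (\<pi> a (b i)) x = 0" using t(2)[OF x(1)] x(2) ip_cnj[OF x(1) bV] by simp
   then show ?thesis using ip_cnj[OF Vab[OF a] x(1), of i] by simp
  qed
  then have "x \<in> K" using x(1) by (simp add: K_def)
  then show ?thesis using K0 by blast
 qed
 then have "honb b" unfolding honb_def using bV orth by blast
 then show ?thesis using that mat by blast
qed

lemma mhom_surj_irrep:
 fixes r :: "'a \<Rightarrow> complex^'n^'n"
 assumes r: "mhom r" "r ` V = UNIV"
 shows "nonzero_irreducible_rep A (subh UNIV) (\<lambda>a v. r a *v v)" unfolding nonzero_irreducible_rep_def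
proof (intro conjI allI impI)
 show "is_rep A (subh UNIV) (\<lambda>a v. r a *v v)" by (rule mhom_is_rep[OF r(1) vec.subspace_UNIV]) auto
 have ex: "\<exists>a\<in>V. r a = M" for M using r(2) by (metis UNIV_I imageE)
 have ax: "(axis undefined 1 :: complex^'n) \<noteq> 0" by (simp add: axis_eq_0_iff)
 then show "\<exists>a\<in>V. \<exists>x\<in>hs_carrier (subh UNIV). r a *v x \<noteq> hs_zero (subh UNIV)"
  using ex[of "mat 1"] by (metis UNIV_I matrix_vector_mul_lid subh_sel(1,2))
 fix K assume A: "closed_subspace (subh UNIV) K \<and> (\<forall>a\<in>V. \<forall>x\<in>K. r a *v x \<in> K)"
 then have inv: "M *v x \<in> K" if "x \<in> K" for M x using ex[of M] that by blast
 have "x \<in> K" if k: "k \<in> K" "k \<noteq> 0" for k x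
 proof -
  obtain i where i: "k $ i \<noteq> 0" using k(2) by (auto simp: vec_eq_iff)
  define M where "M = (\<chi> a b. if b = i then x $ a / k $ i else 0)"
  have "M *v k = x" using i by (simp add: M_def matrix_vector_mult_def vec_eq_iff if_distrib if_distribR cong: if_cong)
  then show ?thesis using inv[OF k(1), of M] by (simp only:)
 qed
 then have "K = UNIV" if "\<exists>k\<in>K. k \<noteq> 0" using that by blast
 moreover have "0 \<in> K" using A by (simp add: closed_subspace_def)
 ultimately show "K = {hs_zero (subh UNIV)} \<or> K = hs_carrier (subh UNIV)" unfolding subh_sel by (cases "\<exists>k\<in>K. k \<noteq> 0") auto
qed

text \<open>The representation r factors through s, so \<open>matrix_units\<close> yields an
  orthonormal basis in which r has the matrices of s; its vectors are the columns of U.\<close>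

theorem mhom_unitary_equiv:
 fixes r s :: "'a \<Rightarrow> complex^'n^'n"
 assumes s: "mhom s" "s ` V = UNIV" and r: "mhom r" "r ` V = UNIV" and ker: "\<And>a. a \<in> V \<Longrightarrow> s a = 0 \<Longrightarrow> r a = 0"
 obtains U where "unitary_mat U" "\<And>a. a \<in> V \<Longrightarrow> r a = U ** s a ** mat_adj U"
proof -
 note U0 = vec.subspace_UNIV
 interpret hilb "subh (UNIV :: (complex^'n) set)" by unfold_locales (rule subh_hilb[OF U0])
 obtain b :: "'n \<Rightarrow> complex^'n" where b: "honb b" "\<And>a i k. a \<in> V \<Longrightarrow> hs_inner (subh UNIV) (r a *v b i) (b k) = s a $ k $ i"
  by (rule matrix_units[OF s subh_hilb(1)[OF U0] mhom_surj_irrep[OF r]]) (use ker in auto)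
 have "onb b" using honbD(2)[OF b(1)] by (simp add: onb_def)
 then have U: "unitary_mat (cols b)" by (rule onb_unitary)
 have "mat_adj (cols b) ** (r a ** cols b) = s a" if "a \<in> V" for a
  using b(2)[OF that] by (simp add: vec_eq_iff adj_cols_mult matrix_vector_mul_assoc[symmetric] cols_axis)
 then have "r a = cols b ** s a ** mat_adj (cols b)" if "a \<in> V" for a
  using that U unfolding unitary_mat_def by (metis matrix_mul_assoc matrix_mul_lid matrix_mul_rid)
 then show ?thesis using that U by blast
qed

text \<open>The image under r of the kernel of s is an ideal with a nonzero matrix. Sandwiching that
  matrix between matrix units produces every diagonal unit, and these sum to the identity.\<close>

lemma mhom_separate:
 fixes r s :: "'a \<Rightarrow> complex^'n^'n"
 assumes r: "mhom r" "r ` V = UNIV" and s: "mhom s" and a: "a \<in> V" "s a = 0" "r a \<noteq> 0"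
 obtains c where "c \<in> V" "s c = 0" "r c = mat 1"
proof -
 note D = mhomD[OF r(1)] and E = mhomD[OF s]
 have "\<exists>a. a \<in> V \<and> r a = M" for M using r(2) by (metis UNIV_I imageE)
 then have "\<forall>i j. \<exists>a. a \<in> V \<and> r a = mun i j" by blast
 then obtain e where e: "\<And>i j. e i j \<in> V" "\<And>i j. r (e i j) = mun i j" by metis
 obtain k l where kl: "r a $ k $ l \<noteq> 0" using a(3) by (auto simp: vec_eq_iff)
 have "\<exists>c\<in>V. s c = 0 \<and> r c = (\<Sum>i\<in>F. mun i i)" if "finite F" for F using that
 proof induction
  case empty show ?case using mhom_z r s by (auto intro!: bexI[of _ z])
 next
  case (insert i F)
  then obtain c where c: "c \<in> V" "s c = 0" "r c = (\<Sum>i\<in>F. mun i i)" by blast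
  let ?d = "sm (1 / r a $ k $ l) (mu (mu (e i k) a) (e l i))"
  have "s ?d = 0" "r ?d = mun i i" using a e kl by (simp_all add: D E mun_sandwich matrix_mul_assoc)
  then show ?case using insert c a e by (intro bexI[of _ "add ?d c"]) (simp_all add: D E)
 qed
 from this[of UNIV] show ?thesis using that sum_mun_diag by (metis finite)
qed

end

section \<open>Spectral calculus for hermitian matrices\<close>

lemma continuous_on_eval [continuous_intros]: "continuous_on S (\<lambda>r :: 'a \<Rightarrow> 'b::topological_space. r a)"
 by (rule continuous_on_subset[OF continuous_on_product_coordinates]) simp

lemma onb_cip_eqI: assumes "onb e" "\<And>j. cip u (e j) = cip v (e j)" shows "u = v"
proof -
 have "(mat_adj (cols e) *v w) $ j = cip w (e j)" for w j by (simp add: mat_adj_def cols_def matrix_vector_mult_def cip_def mult.commute)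
 then have "mat_adj (cols e) *v u = mat_adj (cols e) *v v" using assms(2) by (simp add: vec_eq_iff)
 then have "cols e ** mat_adj (cols e) *v u = cols e ** mat_adj (cols e) *v v" by (metis matrix_vector_mul_assoc)
 then show ?thesis using onb_unitary[OF assms(1)] by (simp add: unitary_mat_def)
qed

lemma onb_herm: assumes e: "onb e" and P: "\<And>i. P *v e i = of_real (m i) *s e i" shows "mat_adj P = P"
proof (rule onb_mat_eqI[OF e], rule onb_cip_eqI[OF e])
 fix i j
 show "cip (mat_adj P *v e i) (e j) = cip (P *v e i) (e j)" using e by (simp add: cip_mult_left P cip_simps onb_def)
qed

lemma onb_norm: "onb e \<Longrightarrow> norm (e i) = 1"
 using cip_self[of "e i"] by (simp add: onb_def power2_eq_1_iff flip: of_real_power) (smt (verit) norm_ge_zero)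

lemma onb_nz: "onb e \<Longrightarrow> e i \<noteq> 0" using onb_norm[of e i] by auto

lemma eigenvalue_bound: assumes "onb e" "M *v e i = of_real l *s e i" shows "\<bar>l\<bar> \<le> mat_opnorm M"
 using norm_mat_vec[of M "e i"] assms(2) onb_norm[OF assms(1), of i] by (simp add: norm_scale)

text \<open>The relation N = g(M), tested on all eigenvectors with real eigenvalue. As a relation it
  passes to sums, products and limits without a choice of eigenbasis; for hermitian M it determines
  N.\<close>

definition spec_map :: "(real \<Rightarrow> real) \<Rightarrow> complex^'n^'n \<Rightarrow> complex^'n^'n \<Rightarrow> bool" where
 "spec_map g M N \<longleftrightarrow> (\<forall>v l. M *v v = of_real l *s v \<longrightarrow> N *v v = of_real (g l) *s v)"

lemma spec_mapD: "spec_map g M N \<Longrightarrow> M *v v = of_real l *s v \<Longrightarrow> N *v v = of_real (g l) *s v" by (simp add: spec_map_def)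

lemma spec_map_herm: assumes "mat_adj M = M" "spec_map g M N" shows "mat_adj N = N"
proof -
 obtain e and l :: "_ \<Rightarrow> real" where e: "onb e" "\<And>i. M *v e i = of_real (l i) *s e i" by (rule spectral_theorem[OF assms(1)]) blast
 show ?thesis by (rule onb_herm[OF e(1), of _ "\<lambda>i. g (l i)"]) (use e(2) assms(2) in \<open>auto simp: spec_map_def\<close>)
qed

lemma spec_map_bound:
 assumes M: "mat_adj M = M" "spec_map g M N" and g: "\<And>t. \<bar>t\<bar> \<le> mat_opnorm M \<Longrightarrow> \<bar>g t\<bar> \<le> C" and C: "0 \<le> C"
 shows "mat_opnorm N \<le> C"
proof -
 obtain e and l :: "_ \<Rightarrow> real" where e: "onb e" "\<And>i. M *v e i = of_real (l i) *s e i" by (rule spectral_theorem[OF M(1)]) blast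
 show ?thesis
 proof (rule eigen_opnorm[OF e(1) _ _ C])
  show "N *v e i = of_real (g (l i)) *s e i" for i using e(2) M(2) by (auto simp: spec_map_def)
  show "cmod (of_real (g (l i))) \<le> C" for i using g eigenvalue_bound[OF e] by simp
 qed
qed

lemma spec_map_zero:
 assumes "mat_adj M = M" "spec_map g M N" "\<And>t. \<bar>t\<bar> \<le> mat_opnorm M \<Longrightarrow> g t = 0" shows "N = 0"
proof -
 have "mat_opnorm N \<le> 0" by (rule spec_map_bound[OF assms(1,2)]) (use assms(3) in auto)
 then have "norm (N *v v) \<le> 0" for v by (intro order_trans[OF norm_mat_vec]) (simp add: mult_nonpos_nonneg)
 then have "N *v v = 0 *v v" for v by simp
 then show ?thesis using matrix_eq by blast
qed

lemma spec_map_scalar: "spec_map g (mat (of_real c)) N \<Longrightarrow> N = mat (of_real (g c))" unfolding spec_map_def matrix_eq mat_vec by blast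

lemma spec_map_one: "spec_map g (mat 1) N \<Longrightarrow> N = mat (of_real (g 1))" using spec_map_scalar[of g 1 N] by simp

lemma spec_map_proj:
 assumes M: "mat_adj M = M" "M ** M = M" and g: "spec_map g M N" "g 0 = 0" "g 1 = 1" shows "N = M"
proof -
 obtain e and l :: "_ \<Rightarrow> real" where e: "onb e" "\<And>i. M *v e i = of_real (l i) *s e i" by (rule spectral_theorem[OF M(1)]) blast
 show ?thesis
 proof (rule onb_mat_eqI[OF e(1)])
  fix i
  have "M ** M *v e i = of_real (l i) *s (of_real (l i) *s e i)" by (simp add: e(2) vec.scale flip: matrix_vector_mul_assoc)
  then have "of_real (l i * l i) *s e i = of_real (l i) *s e i" using M(2) e(2) by (simp add: vector_smult_assoc)
  then have "complex_of_real (l i * l i) = of_real (l i)" using onb_nz[OF e(1), of i] by (simp only: vec.scale_cancel_right) simp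
  then have "l i * l i = l i" by (simp only: of_real_eq_iff)
  then have "l i = 0 \<or> l i = 1" by simp
  then have "g (l i) = l i" using g by auto
  then show "N *v e i = M *v e i" using spec_mapD[OF g(1) e(2)[of i]] e(2)[of i] by simp
 qed
qed

lemma cip_herm_form_pos:
 assumes "onb e" "\<And>i. M *v e i = of_real (m i) *s e i" "\<And>i. 0 \<le> m i" shows "0 \<le> Re (cip (M *v v) v)"
proof -
 define c where "c = mat_adj (cols e) *v v"
 note U = onb_unitary[OF assms(1)]
 have v: "v = cols e *v c" using U by (simp add: c_def matrix_vector_mul_assoc unitary_mat_def)
 define d where "d = (\<chi> i. of_real (m i) * c $ i)"
 have "M *v v = cols e *v d" unfolding v matrix_vector_mul_assoc cols_mult assms(2)
  by (simp add: cols_def d_def matrix_vector_mult_def vec_eq_iff algebra_simps)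
 then have "cip (M *v v) v = cip d c" using U by (simp add: v cip_mult_left matrix_vector_mul_assoc unitary_mat_def)
 also have "\<dots> = of_real (\<Sum>i\<in>UNIV. m i * (cmod (c $ i))\<^sup>2)" by (simp add: cip_def d_def complex_norm_square mult.assoc del: of_real_power)
 finally show ?thesis using assms(3) by (simp add: sum_nonneg)
qed

lemma spec_map_pos:
 assumes "mat_adj M = M" "spec_map g M N" "\<And>t. 0 \<le> g t" shows "0 \<le> Re (cip (N *v v) v)"
proof -
 obtain e and l :: "_ \<Rightarrow> real" where e: "onb e" "\<And>i. M *v e i = of_real (l i) *s e i" by (rule spectral_theorem[OF assms(1)]) blast
 show ?thesis by (rule cip_herm_form_pos[OF e(1), of _ "\<lambda>i. g (l i)"]) (use e(2) assms in \<open>auto simp: spec_map_def\<close>)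
qed

text \<open>Near a rank one projection the spectral projection for \<open>t \<ge> 5/8\<close> has rank at most one.\<close>

lemma near_rank_one:
 fixes M :: "complex^'n^'n"
 assumes M: "mat_adj M = M" and near: "mat_opnorm (M - mun k k) < 1/4"
  and g: "spec_map g M P" "\<And>t. t \<le> 3/8 \<Longrightarrow> g t = 0" "\<And>t. 5/8 \<le> t \<Longrightarrow> g t = 1"
  and B: "mat_adj B = B" "\<And>v. 0 \<le> Re (cip (B *v v) v)"
 shows "\<exists>b::real. 0 \<le> b \<and> P ** B ** P = mat_scale (of_real b) P"
proof -
 obtain e and l :: "'n \<Rightarrow> real" where e: "onb e" "\<And>i. M *v e i = of_real (l i) *s e i" by (rule spectral_theorem[OF M]) blast
 have E: "mun k k *v v = v $ k *s axis k 1" for v :: "complex^'n"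
  by (simp add: vec_eq_iff mun_def matrix_vector_mult_def axis_def if_distrib if_distribR cong: if_cong)
 \<comment> \<open>For a unit eigenvector with eigenvalue l, applying l - \<open>mun k k\<close>
   multiplies each coordinate by at least min l (1 - l) in modulus. Strictly between 3/8 and 5/8 the
   result has norm at least 3/8, beyond the allowed 1/4.\<close>
 have gap: "l i \<le> 3/8 \<or> 5/8 \<le> l i" for i
 proof (rule ccontr)
  assume "\<not> ?thesis"
  then have l: "3/8 < l i" "l i < 5/8" by auto
  let ?u = "e i"
  have "norm ((M - mun k k) *v ?u) \<le> mat_opnorm (M - mun k k)" using norm_mat_vec[of "M - mun k k" ?u] onb_norm[OF e(1)] by simp
  then have n: "norm (of_real (l i) *s ?u - ?u $ k *s axis k 1) < 1/4" using near by (simp add: matrix_vector_mult_diff_rdistrib e(2) E)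
  define w where "w = of_real (l i) *s ?u - ?u $ k *s (axis k 1 :: complex^'n)"
  have wj: "cmod (w $ j) \<ge> 3/8 * cmod (?u $ j)" for j
  proof (cases "j = k")
   case True
   have "w $ j = - (of_real (1 - l i) * ?u $ k)" using True by (simp add: w_def axis_def algebra_simps)
   then have "cmod (w $ j) = (1 - l i) * cmod (?u $ j)" using l True by (simp only: norm_minus_cancel norm_mult norm_of_real)
   then show ?thesis using l mult_right_mono[of "3/8" "1 - l i" "cmod (?u $ j)"] by simp
  next
   case False
   then have "cmod (w $ j) = l i * cmod (?u $ j)" using l by (simp add: w_def axis_def norm_mult)
   then show ?thesis using l mult_right_mono[of "3/8" "l i" "cmod (?u $ j)"] by simp
  qed
  have "norm ((3/8 :: complex) *s ?u) \<le> norm w" by (rule norm_le_componentwise_cart) (use wj in \<open>simp add: norm_mult norm_divide\<close>)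
  then have "3/8 \<le> norm w" using onb_norm[OF e(1), of i] by (simp add: norm_scale)
  then show False using n by (simp add: w_def)
 qed
 have P: "P *v e i = (if 5/8 \<le> l i then e i else 0)" for i using spec_mapD[OF g(1) e(2)[of i]] gap[of i] g(2)[of "l i"] g(3)[of "l i"] by auto
 \<comment> \<open>Two such eigenvectors have a nonzero combination with vanishing coordinate k. The
   unit \<open>mun k k\<close> kills it while M stretches it by at least 5/8, against a distance
   below 1/4.\<close>
 have one: "i = j" if ij: "5/8 \<le> l i" "5/8 \<le> l j" for i j
 proof (rule ccontr)
  assume "i \<noteq> j"
  obtain a b where ab: "a * e i $ k + b * e j $ k = 0" "a \<noteq> 0 \<or> b \<noteq> 0"
  proof (cases "e i $ k = 0")
   case True then show ?thesis using that[of 1 0] by simp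
  next
   case False then show ?thesis using that[of "e j $ k" "- e i $ k"] by simp
  qed
  let ?w = "a *s e i + b *s e j"
  have nsq: "(norm (c *s e i + d *s e j))\<^sup>2 = (cmod c)\<^sup>2 + (cmod d)\<^sup>2" for c d
  proof -
   have "cip (c *s e i + d *s e j) (c *s e i + d *s e j) = c * cnj c + d * cnj d" using e(1) \<open>i \<noteq> j\<close> by (simp add: cip_simps onb_def)
   then have "complex_of_real ((norm (c *s e i + d *s e j))\<^sup>2) = of_real ((cmod c)\<^sup>2 + (cmod d)\<^sup>2)"
    by (simp only: cip_self complex_norm_square of_real_add)
   then show ?thesis by (simp only: of_real_eq_iff)
  qed
  have "(M - mun k k) *v ?w = (of_real (l i) * a) *s e i + (of_real (l j) * b) *s e j"
  proof -
   have "(M - mun k k) *v ?w = (of_real (l i) * a) *s e i + (of_real (l j) * b) *s e j - (?w $ k) *s axis k 1"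
    unfolding matrix_vector_mult_diff_rdistrib E by (simp add: matrix_vector_right_distrib vec.scale e(2) vector_smult_assoc mult.commute)
   then show ?thesis using ab(1) by simp
  qed
  then have "(norm ((M - mun k k) *v ?w))\<^sup>2 = (l i)\<^sup>2 * (cmod a)\<^sup>2 + (l j)\<^sup>2 * (cmod b)\<^sup>2" by (simp add: nsq norm_mult power_mult_distrib)
  also have "\<dots> \<ge> (5/8)\<^sup>2 * (cmod a)\<^sup>2 + (5/8)\<^sup>2 * (cmod b)\<^sup>2" using ij by (intro add_mono mult_right_mono power_mono) auto
  finally have 1: "(5/8 * norm ?w)\<^sup>2 \<le> (norm ((M - mun k k) *v ?w))\<^sup>2" unfolding power_mult_distrib nsq distrib_left .
  have "5/8 * norm ?w \<le> norm ((M - mun k k) *v ?w)" by (rule power2_le_imp_le[OF 1]) simp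
  also have "\<dots> \<le> 1/4 * norm ?w" by (rule order_trans[OF norm_mat_vec]) (use near in \<open>intro mult_right_mono; simp\<close>)
  finally have "norm ?w \<le> 0" by simp
  then have "(cmod a)\<^sup>2 + (cmod b)\<^sup>2 = 0" using nsq[of a b] by simp
  then have "(cmod a)\<^sup>2 = 0" "(cmod b)\<^sup>2 = 0" by (smt (verit) zero_le_power2)+
  then show False using ab(2) by simp
 qed
 show ?thesis
 proof (cases "\<exists>i. 5/8 \<le> l i")
  case False
  then have "P = 0" by (intro onb_mat_eqI[OF e(1)]) (simp add: P)
  then show ?thesis by (intro exI[of _ 0]) simp
 next
  case True
  then obtain i where i: "5/8 \<le> l i" by blast
  \<comment> \<open>P is the projection onto the line of e i, so compressing B to it gives the
    scalar of the quadratic form at e i.\<close>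
  have Pi: "P *v v = cip v (e i) *s e i" for v
  proof -
   define Q :: "complex^'n^'n" where "Q = (\<chi> a b. e i $ a * cnj (e i $ b))"
   have Q: "Q *v v = cip v (e i) *s e i" for v
    by (simp add: Q_def vec_eq_iff matrix_vector_mult_def cip_def sum_distrib_left sum_distrib_right algebra_simps)
   have "P = Q"
   proof (rule onb_mat_eqI[OF e(1)])
    fix j show "P *v e j = Q *v e j" using one[OF i, of j] i e(1) by (cases "i = j") (auto simp: P Q onb_def)
   qed
   then show ?thesis using Q by simp
  qed
  define b where "b = Re (cip (B *v e i) (e i))"
  have "cip (B *v e i) (e i) = cnj (cip (B *v e i) (e i))" using cip_mult_left[of B "e i" "e i"] B(1) cip_cnj[of "e i" "B *v e i"] by simp
  then have "Im (cip (B *v e i) (e i)) = - Im (cip (B *v e i) (e i))" by (metis cnj.simps(2))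
  then have "Im (cip (B *v e i) (e i)) = 0" by simp
  then have bb: "cip (B *v e i) (e i) = of_real b" by (simp add: b_def complex_eq_iff)
  have "P ** B ** P *v v = mat_scale (of_real b) P *v v" for v
   by (simp add: Pi mat_scale_vec vec.scale cip_simps bb vector_smult_assoc mult.commute flip: matrix_vector_mul_assoc)
  then have "P ** B ** P = mat_scale (of_real b) P" using matrix_eq by blast
  then show ?thesis using B(2)[of "e i"] by (auto simp: b_def)
 qed
qed

text \<open>All eigenvalues of M exceed 1/2, where g is the reciprocal.\<close>

lemma spec_map_inv:
 assumes M: "mat_adj M = M" and near: "mat_opnorm (M - mat 1) < 1/2"
  and g: "spec_map g M N" "\<And>t. 1/2 \<le> t \<Longrightarrow> g t = 1 / t"
 shows "M ** N = mat 1"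
proof -
 obtain e and l :: "_ \<Rightarrow> real" where e: "onb e" "\<And>i. M *v e i = of_real (l i) *s e i" by (rule spectral_theorem[OF M]) blast
 show ?thesis
 proof (rule onb_mat_eqI[OF e(1)])
  fix i
  have "(M - mat 1) *v e i = of_real (l i - 1) *s e i" by (simp add: matrix_vector_mult_diff_rdistrib e(2) vec.scale_left_diff_distrib)
  then have "\<bar>l i - 1\<bar> < 1/2" using eigenvalue_bound[OF e(1), of "M - mat 1" i "l i - 1"] near by simp
  then have l: "1/2 \<le> l i" by linarith
  have "N *v e i = of_real (1 / l i) *s e i" using spec_mapD[OF g(1) e(2)[of i]] g(2)[OF l] by simp
  then show "M ** N *v e i = mat 1 *v e i" using l by (simp add: vec.scale e(2) vector_smult_assoc flip: matrix_vector_mul_assoc)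
 qed
qed

lemma limit_opnorm_le:
 fixes X :: "nat \<Rightarrow> complex^'n^'n"
 assumes "X \<longlonglongrightarrow> L" "\<And>k. N \<le> k \<Longrightarrow> mat_opnorm (X k - M) \<le> e" shows "mat_opnorm (L - M) \<le> e"
proof (rule LIMSEQ_le_const2)
 have "continuous_on UNIV (\<lambda>Y. mat_opnorm (Y - M :: complex^'n^'n))" by (intro continuous_intros)
 then have "isCont (\<lambda>Y. mat_opnorm (Y - M)) L" by (simp add: continuous_on_eq_continuous_at)
 then show "(\<lambda>k. mat_opnorm (X k - M)) \<longlonglongrightarrow> mat_opnorm (L - M)" using assms(1) by (rule isCont_tendsto_compose)
qed (use assms(2) in blast)

lemma unitary_conj: "unitary_mat U \<Longrightarrow> (U ** M ** mat_adj U) ** (U ** N ** mat_adj U) = U ** (M ** N) ** mat_adj U"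
 unfolding unitary_mat_def by (metis matrix_mul_assoc matrix_mul_rid)

section \<open>Functional calculus and the spectrum of a homogeneous algebra\<close>

locale nhom = calg A for A :: "'a cstar_alg" +
 fixes n_type :: "'n::finite itself"
 assumes hom: "n_homogeneous TYPE('a \<Rightarrow> complex) CARD('n) A"
begin

abbreviation mh :: "('a \<Rightarrow> complex^'n^'n) \<Rightarrow> bool" where "mh \<equiv> mhom"

lemma nr_attained: assumes "a \<in> V" obtains r where "mh r" "mat_opnorm (r a) = nr a" using exists_mhom[OF hom assms] by blast

lemma mh_faithful: assumes "a \<in> V" "b \<in> V" "\<And>r. mh r \<Longrightarrow> r a = r b" shows "a = b"
proof -
 obtain r where r: "mh r" "mat_opnorm (r (add a (sm (-1) b))) = nr (add a (sm (-1) b))"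
  by (rule nr_attained[of "add a (sm (-1) b)"]) (use assms in auto)
 have "r (add a (sm (-1) b)) = 0" using mhomD[OF r(1)] assms r(1) by simp
 then have "add a (sm (-1) b) = z" using r(2) nr_zero_iff[of "add a (sm (-1) b)"] assms by simp
 then show ?thesis by (rule eq_of_diff_zero[OF assms(1,2)])
qed

lemma fin_sum:
 assumes "finite I" "\<And>i. i \<in> I \<Longrightarrow> f i \<in> V"
 shows "\<exists>s\<in>V. \<forall>r. mh r \<longrightarrow> r s = (\<Sum>i\<in>I. r (f i))" using assms
proof induction
 case empty show ?case using mhom_z by (auto intro!: bexI[of _ z])
next
 case (insert i I)
 then obtain s where s: "s \<in> V" "\<And>r. mh r \<Longrightarrow> r s = (\<Sum>i\<in>I. r (f i))" by auto
 then show ?case using insert by (intro bexI[of _ "add (f i) s"]) (auto simp: mhomD(1))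
qed

text \<open>Functional calculus in \<open>A\<close>, checked in the image of every homomorphism into
  matrices; by \<open>mh_faithful\<close> this determines b.\<close>

definition fcal :: "(real \<Rightarrow> real) \<Rightarrow> 'a \<Rightarrow> 'a \<Rightarrow> bool" where
 "fcal g a b \<longleftrightarrow> b \<in> V \<and> (\<forall>r. mh r \<longrightarrow> spec_map g (r a) (r b))"

text \<open>The constant term is subtracted because \<open>A\<close> may have no unit.\<close>

lemma fcal_polynomial:
 assumes a: "a \<in> V" and q: "real_polynomial_function q"
 shows "\<exists>b. fcal (\<lambda>t. q t - q 0) a b" using q
proof induction
 case (linear f)
 then interpret bounded_linear f .
 have f1: "f t - f 0 = f 1 * t" for t using scaleR[of t 1] zero by simp
 have "fcal (\<lambda>t. f t - f 0) a (sm (of_real (f 1)) a)" unfolding fcal_def spec_map_def f1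
 proof (intro conjI allI impI)
  fix r v l assume r: "mh r" and e: "r a *v v = of_real l *s v"
  show "r (sm (of_real (f 1)) a) *v v = of_real (f 1 * l) *s v" unfolding mhomD(4)[OF r a] mat_scale_vec e vector_smult_assoc of_real_mult ..
 qed (use a in simp)
 then show ?case by blast
next
 case (const c)
 have "fcal (\<lambda>t. c - c) a z" by (auto simp: fcal_def spec_map_def mhom_z)
 then show ?case by blast
next
 case (add f g)
 then obtain b c where bc: "fcal (\<lambda>t. f t - f 0) a b" "fcal (\<lambda>t. g t - g 0) a c" by blast
 then have V: "b \<in> V" "c \<in> V" by (auto simp: fcal_def)
 have "fcal (\<lambda>t. f t + g t - (f 0 + g 0)) a (add b c)" unfolding fcal_def spec_map_def
 proof (intro conjI allI impI)
  fix r v l assume r: "mh r" and e: "r a *v v = of_real l *s v"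
  have "r b *v v = of_real (f l - f 0) *s v" "r c *v v = of_real (g l - g 0) *s v" using bc r e unfolding fcal_def spec_map_def by blast+
  then show "r (calg.add A b c) *v v = of_real (f l + g l - (f 0 + g 0)) *s v" unfolding mhomD(1)[OF r V] matrix_vector_mult_add_rdistrib
   by (simp only: \<open>r b *v v = _\<close> \<open>r c *v v = _\<close> vec.scale_left_distrib[symmetric] of_real_add[symmetric]) (simp add: algebra_simps)
 qed (use V in simp)
 then show ?case by blast
next
 case (mult f g)
 then obtain b c where bc: "fcal (\<lambda>t. f t - f 0) a b" "fcal (\<lambda>t. g t - g 0) a c" by blast
 then have V: "b \<in> V" "c \<in> V" by (auto simp: fcal_def)
 \<comment> \<open>The function f g - f(0) g(0) written in terms of f - f(0) and g - g(0), the two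
   that are realised in \<open>A\<close>.\<close>
 let ?d = "add (mu b c) (add (sm (of_real (f 0)) c) (sm (of_real (g 0)) b))"
 have "fcal (\<lambda>t. f t * g t - f 0 * g 0) a ?d" unfolding fcal_def spec_map_def
 proof (intro conjI allI impI)
  fix r v l assume r: "mh r" and e: "r a *v v = of_real l *s v"
  have bv: "r b *v v = of_real (f l - f 0) *s v" "r c *v v = of_real (g l - g 0) *s v" using bc r e unfolding fcal_def spec_map_def by blast+
  have "r ?d *v v = of_real ((f l - f 0) * (g l - g 0)) *s v + (of_real (f 0 * (g l - g 0)) *s v + of_real (g 0 * (f l - f 0)) *s v)"
  proof -
   have "r ?d = r b ** r c + (mat_scale (of_real (f 0)) (r c) + mat_scale (of_real (g 0)) (r b))" using V r by (simp add: mhomD(1,2,4))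
   then show ?thesis unfolding matrix_vector_mul_assoc[symmetric]
    by (simp only: matrix_vector_mult_add_rdistrib mat_scale_vec matrix_vector_mul_assoc[symmetric] bv vec.scale vector_smult_assoc of_real_mult mult.commute)
  qed
  also have "\<dots> = of_real (f l * g l - f 0 * g 0) *s v"
   unfolding vec.scale_left_distrib[symmetric] of_real_add[symmetric] by (simp add: algebra_simps)
  finally show "r ?d *v v = of_real (f l * g l - f 0 * g 0) *s v" .
 qed (use V in simp)
 then show ?case by blast
qed

lemma mh_herm: "mh r \<Longrightarrow> a \<in> V \<Longrightarrow> star a = a \<Longrightarrow> mat_adj (r a) = r a" using mhomD(3)[of r a] by simp

text \<open>Every norm in \<open>A\<close> is attained by some homomorphism, so an estimate uniform
  over all of them is an estimate in the norm of \<open>A\<close>, which is complete.\<close>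

lemma limit_ex:
 assumes s: "\<And>k. s k \<in> V" and cau: "\<And>e. 0 < e \<Longrightarrow> \<exists>N. \<forall>m\<ge>N. \<forall>k\<ge>N. \<forall>r. mh r \<longrightarrow> mat_opnorm (r (s m) - r (s k)) \<le> e"
 obtains l where "l \<in> V" "\<And>r. mh r \<Longrightarrow> (\<lambda>k. r (s k)) \<longlonglongrightarrow> r l"
proof -
 have dr: "r (add a (sm (-1) b)) = r a - r b" if "mh r" "a \<in> V" "b \<in> V" for r a b using that by (simp add: mhomD(1,4))
 have "\<exists>N. \<forall>m\<ge>N. \<forall>k\<ge>N. nr (add (s m) (sm (-1) (s k))) < e" if e: "0 < e" for e
 proof -
  obtain N where N: "\<And>m k r. N \<le> m \<Longrightarrow> N \<le> k \<Longrightarrow> mh r \<Longrightarrow> mat_opnorm (r (s m) - r (s k)) \<le> e/2" using cau[of "e/2"] e by auto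
  have "nr (add (s m) (sm (-1) (s k))) < e" if mk: "N \<le> m" "N \<le> k" for m k
  proof -
   obtain r where r: "mh r" "mat_opnorm (r (add (s m) (sm (-1) (s k)))) = nr (add (s m) (sm (-1) (s k)))"
    by (rule nr_attained[of "add (s m) (sm (-1) (s k))"]) (use s in auto)
   then show ?thesis using N[OF mk r(1)] dr[OF r(1) s s] e by simp
  qed
  then show ?thesis by blast
 qed
 then obtain l where l: "l \<in> V" "(\<lambda>k. nr (add (s k) (sm (-1) l))) \<longlonglongrightarrow> 0" using cpl s unfolding complete_on_def by blast
 have "(\<lambda>k. r (s k)) \<longlonglongrightarrow> r l" if r: "mh r" for r
 proof -
  have "(\<lambda>k. r (s k) - r l) \<longlonglongrightarrow> 0"
  proof (rule Lim_null_comparison)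
   show "\<forall>\<^sub>F k in sequentially. norm (r (s k) - r l) \<le> (real CARD('n))\<^sup>2 * nr (add (s k) (sm (-1) l))"
   proof (intro always_eventually allI)
    fix k
    have "mat_opnorm (r (s k) - r l) \<le> nr (add (s k) (sm (-1) l))"
     using mhom_contractive[OF r, of "add (s k) (sm (-1) l)"] dr[OF r s l(1)] s l by simp
    then show "norm (r (s k) - r l) \<le> (real CARD('n))\<^sup>2 * nr (add (s k) (sm (-1) l))"
     by (intro order_trans[OF norm_le_opnorm] mult_left_mono) auto
   qed
   show "(\<lambda>k. (real CARD('n))\<^sup>2 * nr (add (s k) (sm (-1) l))) \<longlonglongrightarrow> 0" using tendsto_mult_left[OF l(2), of "(real CARD('n))\<^sup>2"] by simp
  qed
  then show ?thesis by (simp add: LIM_zero_iff)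
 qed
 then show ?thesis using that l(1) by blast
qed

text \<open>Weierstrass approximation on the interval of radius \<open>nr a\<close>, which holds the
  eigenvalues of every r a by contractivity. Correcting the polynomials to vanish at 0 at most
  doubles the error.\<close>

theorem fcal_ex:
 assumes a: "a \<in> V" "star a = a" and g: "continuous_on UNIV g" "g 0 = 0"
 obtains b where "b \<in> V" "star b = b" "\<And>r. mh r \<Longrightarrow> spec_map g (r a) (r b)"
proof -
 define S where "S = {- nr a .. nr a}"
 have S0: "0 \<in> S" using a by (simp add: S_def)
 have "\<exists>q. real_polynomial_function q \<and> (\<forall>t\<in>S. \<bar>g t - q t\<bar> < 1 / real (Suc k))" for k
  by (rule Stone_Weierstrass_real_polynomial_function[of S g "1 / real (Suc k)"]) (auto simp: S_def intro: continuous_on_subset[OF g(1)])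
 then obtain q where q: "\<And>k. real_polynomial_function (q k)" "\<And>k t. t \<in> S \<Longrightarrow> \<bar>g t - q k t\<bar> < 1 / real (Suc k)" by metis
 define h where "h = (\<lambda>k t. q k t - q k 0)"
 have h: "\<bar>g t - h k t\<bar> < 2 / real (Suc k)" if "t \<in> S" for k t using q(2)[OF that, of k] q(2)[OF S0, of k] g(2) by (simp add: h_def)
 have "\<exists>b. fcal (h k) a b" for k unfolding h_def by (rule fcal_polynomial[OF a(1) q(1)])
 then obtain s where s: "\<And>k. fcal (h k) a (s k)" by metis
 have sV: "s k \<in> V" and sp: "mh r \<Longrightarrow> spec_map (h k) (r a) (r (s k))" for k r using s by (auto simp: fcal_def)
 have tS: "t \<in> S" if "mh r" "\<bar>t\<bar> \<le> mat_opnorm (r a)" for r t using mhom_contractive[OF that(1) a(1)] that(2) by (simp add: S_def abs_le_iff)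
 obtain b where b: "b \<in> V" "\<And>r. mh r \<Longrightarrow> (\<lambda>k. r (s k)) \<longlonglongrightarrow> r b"
 proof (rule limit_ex[of s])
  fix e :: real assume e: "0 < e"
  obtain N :: nat where N: "4 / e < real N" using reals_Archimedean2 by blast
  have N0: "0 < real N" using N e by (smt (verit) divide_pos_pos)
  have sm: "2 / real (Suc m) \<le> e / 2" if "N \<le> m" for m
  proof -
   have "2 / real (Suc m) \<le> 2 / real N" using that N0 by (intro divide_left_mono) auto
   also have "\<dots> \<le> e / 2" using N N0 e by (simp add: field_simps)
   finally show ?thesis .
  qed
  have "mat_opnorm (r (s m) - r (s k)) \<le> e" if mk: "N \<le> m" "N \<le> k" and r: "mh r" for m k r
  proof (rule spec_map_bound[of "r a" "\<lambda>t. h m t - h k t"])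
   show "spec_map (\<lambda>t. h m t - h k t) (r a) (r (s m) - r (s k))" unfolding spec_map_def
   proof (intro allI impI)
    fix v l assume e: "r a *v v = of_real l *s v"
    show "(r (s m) - r (s k)) *v v = of_real (h m l - h k l) *s v" using spec_mapD[OF sp[OF r] e, of m] spec_mapD[OF sp[OF r] e, of k]
     by (simp add: matrix_vector_mult_diff_rdistrib vec.scale_left_diff_distrib)
   qed
   show "\<bar>h m t - h k t\<bar> \<le> e" if "\<bar>t\<bar> \<le> mat_opnorm (r a)" for t
    using h[OF tS[OF r that], of m] h[OF tS[OF r that], of k] sm[OF mk(1)] sm[OF mk(2)] by linarith
  qed (use mh_herm r a e in auto)
  then show "\<exists>N. \<forall>m\<ge>N. \<forall>k\<ge>N. \<forall>r. mh r \<longrightarrow> mat_opnorm (r (s m) - r (s k)) \<le> e" by blast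
 qed (use sV in auto)
 have spec: "spec_map g (r a) (r b)" if r: "mh r" for r unfolding spec_map_def
 proof (intro allI impI)
  fix v l assume e: "r a *v v = of_real l *s v"
  show "r b *v v = of_real (g l) *s v"
  proof (cases "v = 0")
   case False
   have "norm (r a *v v) \<le> mat_opnorm (r a) * norm v" by (rule norm_mat_vec)
   then have "\<bar>l\<bar> \<le> mat_opnorm (r a)" using False unfolding e norm_scale by simp
   then have lS: "l \<in> S" by (rule tS[OF r])
   have "(\<lambda>k. h k l) \<longlonglongrightarrow> g l"
   proof -
    have "(\<lambda>k. h k l - g l) \<longlonglongrightarrow> 0"
    proof (rule Lim_null_comparison)
     show "\<forall>\<^sub>F k in sequentially. norm (h k l - g l) \<le> 2 * inverse (real (Suc k))"
      using h[OF lS] by (intro always_eventually allI) (simp add: abs_minus_commute less_imp_le divide_inverse del: of_nat_Suc)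
     show "(\<lambda>k. 2 * inverse (real (Suc k))) \<longlonglongrightarrow> 0" using tendsto_mult_left[OF LIMSEQ_inverse_real_of_nat, of 2] by simp
    qed
    then show ?thesis by (simp add: LIM_zero_iff)
   qed
   then have 1: "(\<lambda>k. (of_real (h k l) *s v) $ i) \<longlonglongrightarrow> (of_real (g l) *s v) $ i" for i by (simp add: tendsto_intros)
   have "(\<lambda>k. (r (s k) *v v) $ i) \<longlonglongrightarrow> (r b *v v) $ i" for i unfolding matrix_vector_mult_def vec_lambda_beta by (intro tendsto_intros b(2) r)
   moreover have "r (s k) *v v = of_real (h k l) *s v" for k using sp[OF r, of k] e by (simp add: spec_map_def)
   ultimately have "(r b *v v) $ i = (of_real (g l) *s v) $ i" for i using LIMSEQ_unique[OF _ 1[of i]] by simp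
   then show ?thesis by (simp add: vec_eq_iff)
  qed simp
 qed
 moreover have "star b = b"
 proof (rule mh_faithful)
  fix r assume r: "mh r"
  show "r (star b) = r b" using spec_map_herm[OF mh_herm[OF r a] spec[OF r]] mhomD(3)[OF r b(1)] by simp
 qed (use b in auto)
 ultimately show ?thesis using that b(1) by blast
qed

text \<open>Fixing the value 0 outside the carrier makes a homomorphism one definite function, so
  that the product topology on all functions can be used.\<close>

definition HM :: "('a \<Rightarrow> complex^'n^'n) set" where
 "HM = {r. mh r \<and> (\<forall>x. x \<notin> V \<longrightarrow> r x = 0)}"

definition XS :: "('a \<Rightarrow> complex^'n^'n) set" where
 "XS = {r \<in> HM. \<exists>a\<in>V. r a \<noteq> 0}"

definition uact :: "complex^'n^'n \<Rightarrow> ('a \<Rightarrow> complex^'n^'n) \<Rightarrow> 'a \<Rightarrow> complex^'n^'n" where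
 "uact U r = (\<lambda>a. U ** r a ** mat_adj U)"

lemma HM_mh: "r \<in> HM \<Longrightarrow> mh r" by (simp add: HM_def)

lemma XS_HM: "r \<in> XS \<Longrightarrow> r \<in> HM" by (simp add: XS_def)

lemma XS_surj: "r \<in> XS \<Longrightarrow> r ` V = UNIV" using mhom_surj[OF hom HM_mh] by (auto simp: XS_def)

lemma mh_XS: assumes "mh r" "a0 \<in> V" "r a0 \<noteq> 0"
 shows "(\<lambda>x. if x \<in> V then r x else 0) \<in> XS" using assms by (auto simp: XS_def HM_def mhom_def)

text \<open>Tychonoff: contractivity confines each coordinate to a ball, and the algebraic
  identities are closed conditions.\<close>

lemma compact_HM: "compact HM"
proof -
 define R where "R = (\<lambda>a. if a \<in> V then (real CARD('n))\<^sup>2 * nr a else 0)"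
 let ?B = "PiE UNIV (\<lambda>a. cball (0::complex^'n^'n) (R a))"
 have "compactin (product_topology (\<lambda>_. euclidean) UNIV) ?B" unfolding compactin_PiE by simp
 then have "compact ?B" by (simp add: euclidean_product_topology)
 moreover have "closed HM" unfolding HM_def mhom_def Ball_def
  by (intro closed_Collect_conj closed_Collect_all closed_Collect_imp closed_Collect_eq continuous_intros open_Collect_const)
 ultimately have "compact (?B \<inter> HM)" by (rule compact_Int_closed)
 moreover have "HM \<subseteq> ?B"
 proof
  fix r assume r: "r \<in> HM"
  have "norm (r a) \<le> R a" for a
  proof (cases "a \<in> V")
   case True
   have "norm (r a) \<le> (real CARD('n))\<^sup>2 * mat_opnorm (r a)" by (rule norm_le_opnorm)
   also have "\<dots> \<le> R a" using mhom_contractive[OF HM_mh[OF r] True] True by (simp add: R_def mult_left_mono)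
   finally show ?thesis .
  qed (use r in \<open>simp add: HM_def R_def\<close>)
  then show "r \<in> ?B" by auto
 qed
 ultimately show ?thesis by (simp add: inf.absorb2)
qed

lemma uact_HM: assumes U: "unitary_mat U" and r: "r \<in> HM" shows "uact U r \<in> HM"
proof -
 note D = mhomD[OF HM_mh[OF r]]
 have "mh (uact U r)" unfolding mhom_def uact_def
 proof (intro conjI ballI allI)
  fix x y assume xy: "x \<in> V" "y \<in> V"
  show "U ** r (mu x y) ** mat_adj U = U ** r x ** mat_adj U ** (U ** r y ** mat_adj U)" unfolding unitary_conj[OF U] D(2)[OF xy] ..
 qed (simp_all add: D matrix_add_ldistrib matrix_add_mult mat_adj_mult matrix_mul_assoc mat_mult_scale)
 then show ?thesis using r by (simp add: HM_def uact_def)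
qed

lemma uact_mult: "uact (U ** W) r = uact U (uact W r)" by (simp add: uact_def matrix_mul_assoc)

lemma uact_one [simp]: "uact (mat 1) r = r" by (simp add: uact_def)

lemma uact_inv: "unitary_mat U \<Longrightarrow> uact (mat_adj U) (uact U r) = r" "unitary_mat U \<Longrightarrow> uact U (uact (mat_adj U) r) = r"
 unfolding uact_mult[symmetric] unitary_mat_def by auto

lemma uact_XS: assumes U: "unitary_mat U" and r: "r \<in> XS" shows "uact U r \<in> XS"
proof -
 obtain a where a: "a \<in> V" "r a \<noteq> 0" using r by (auto simp: XS_def)
 have "uact U r a \<noteq> 0"
 proof
  assume "uact U r a = 0"
  then have "uact (mat_adj U) (uact U r) a = 0" by (simp add: uact_def)
  then show False using uact_inv(1)[OF U] a by simp
 qed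
 then show ?thesis using uact_HM[OF U XS_HM[OF r]] a by (auto simp: XS_def)
qed

end

section \<open>Central bump elements and the partition of unity\<close>

lemma mat_adj_sum: "mat_adj (\<Sum>i\<in>I. f i) = (\<Sum>i\<in>I. mat_adj (f i))" by (induction I rule: infinite_finite_induct) simp_all

lemma mat_scale_sum: "mat_scale c (\<Sum>i\<in>I. f i) = (\<Sum>i\<in>I. mat_scale c (f i))" by (induction I rule: infinite_finite_induct) (simp_all add: mat_scale_add)

lemma mat_scale_zero_left [simp]: "mat_scale 0 M = 0" by (simp add: mat_scale_def vec_eq_iff)

lemma mat_scale_sum_left: "mat_scale (\<Sum>i\<in>I. f i) M = (\<Sum>i\<in>I. mat_scale (f i) M)"
 by (induction I rule: infinite_finite_induct) (simp_all add: mat_scale_add)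

lemma mat_opnorm_sum: "mat_opnorm (\<Sum>i\<in>I. f i) \<le> (\<Sum>i\<in>I. mat_opnorm (f i))"
proof (induction I rule: infinite_finite_induct)
 case (insert i I)
 then show ?case using mat_opnorm_triangle[of "f i" "\<Sum>i\<in>I. f i"] by simp
qed simp_all

lemma unitary_conj_cancel: "unitary_mat U \<Longrightarrow> mat_adj U ** (U ** M ** mat_adj U) ** U = M"
 unfolding unitary_mat_def by (metis matrix_mul_assoc matrix_mul_rid matrix_mul_lid)

lemma unitary_conj_swap: assumes U: "unitary_mat U" and e: "U ** M ** mat_adj U = N" shows "M = mat_adj U ** N ** U"
 using unitary_conj_cancel[OF U, of M] e by simp

lemma unitary_scalar: "unitary_mat U \<Longrightarrow> mat_adj U ** mat c ** U = mat c" by (simp add: unitary_mat_def mat_mult_scale mat_scale_one)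

lemma commute_scalar: assumes "\<And>M. U ** M = M ** (U :: complex^'n^'n)" shows "\<exists>c. U = mat c"
proof -
 have "U $ a $ i = (if a = i then U $ j $ j else 0)" for a i j
 proof -
  have "(U ** mun i j) $ a $ j = (mun i j ** U) $ a $ j" using assms by simp
  then show ?thesis by (simp add: mun_mult)
 qed
 then have "U = mat (U $ o' $ o')" for o' by (simp add: vec_eq_iff mat_def)
 then show ?thesis by blast
qed

lemma cont_cut_inverse: "continuous_on UNIV (\<lambda>t::real. t / (max t (1/2))\<^sup>2)"
proof (intro continuous_intros ballI)
 fix t :: real
 have "0 < max t (1/2)" by (simp add: less_max_iff_disj)
 then show "(max t (1/2))\<^sup>2 \<noteq> 0" by simp
qed

lemma Hausdorff_fun: "Hausdorff_space (euclidean :: ('a \<Rightarrow> complex^'n^'n) topology)"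
 unfolding euclidean_product_topology[symmetric] Hausdorff_space_product_topology by simp

context nhom
begin

text \<open>Applies a function cut off to [-1, 1] to \<open>mu (star c) c\<close>. The result is
  bounded by 1 under every homomorphism, so products of such elements stay bounded.\<close>

lemma clip_ex:
 assumes r0: "mh r0" and c: "c \<in> V" "r0 c = mat 1"
 obtains d where "d \<in> V" "r0 d = mat 1" "\<And>r. mh r \<Longrightarrow> mat_opnorm (r d) \<le> 1" "\<And>r. mh r \<Longrightarrow> r c = 0 \<Longrightarrow> r d = 0"
proof -
 define g :: "real \<Rightarrow> real" where "g = (\<lambda>t. max (-1) (min 1 t))"
 define h where "h = mu (star c) c"
 have h: "h \<in> V" "star h = h" using c by (auto simp: h_def)
 obtain d where d: "d \<in> V" "\<And>r. mh r \<Longrightarrow> spec_map g (r h) (r d)" by (rule fcal_ex[OF h, of g]) (auto simp: g_def intro!: continuous_intros)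
 have rh: "r h = mat_adj (r c) ** r c" if "mh r" for r using that c by (simp add: h_def mhomD)
 have "r0 h = mat 1" using rh[OF r0] c by simp
 then have "r0 d = mat 1" using spec_map_one[of g "r0 d"] d(2)[OF r0] by (simp add: g_def)
 moreover have "mat_opnorm (r d) \<le> 1" if r: "mh r" for r by (rule spec_map_bound[OF mh_herm[OF r h] d(2)[OF r]]) (auto simp: g_def)
 moreover have "r d = 0" if r: "mh r" "r c = 0" for r
  by (rule spec_map_zero[OF mh_herm[OF r(1) h] d(2)[OF r(1)]]) (use rh[OF r(1)] r(2) in \<open>auto simp: g_def\<close>)
 ultimately show ?thesis using that d(1) by blast
qed

text \<open>Outside the orbit a nonzero s cannot vanish on the kernel of r0, or else
  \<open>mhom_unitary_equiv\<close> would make the two equivalent.\<close>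

lemma separate_orbit:
 assumes r0: "r0 \<in> XS" and s: "s \<in> HM" and ne: "\<And>U. unitary_mat U \<Longrightarrow> s \<noteq> uact U r0"
 obtains c where "c \<in> V" "r0 c = mat 1" "s c = 0"
proof -
 note D = mhomD[OF HM_mh[OF XS_HM[OF r0]]] and E = mhomD[OF HM_mh[OF s]]
 have "\<exists>e\<in>V. r0 e = mat 1" using XS_surj[OF r0] by (metis UNIV_I imageE)
 then obtain e where e: "e \<in> V" "r0 e = mat 1" by blast
 show ?thesis
 proof (cases "s \<in> XS")
  case False
  then show ?thesis using that[OF e] e s by (auto simp: XS_def)
 next
  case True
  have "\<exists>a\<in>V. r0 a = 0 \<and> s a \<noteq> 0"
  proof (rule ccontr)
   assume a: "\<not> ?thesis"
   obtain U where U: "unitary_mat U" "\<And>a. a \<in> V \<Longrightarrow> s a = U ** r0 a ** mat_adj U"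
    by (rule mhom_unitary_equiv[OF HM_mh[OF XS_HM[OF r0]] XS_surj[OF r0] HM_mh[OF s] XS_surj[OF True]]) (use a in auto)
   have "s = uact U r0"
   proof
    fix a show "s a = uact U r0 a" using U(2)[of a] s XS_HM[OF r0] by (cases "a \<in> V") (auto simp: HM_def uact_def)
   qed
   then show False using ne U(1) by blast
  qed
  then obtain a where a: "a \<in> V" "r0 a = 0" "s a \<noteq> 0" by blast
  obtain c where c: "c \<in> V" "r0 c = 0" "s c = mat 1" by (rule mhom_separate[OF HM_mh[OF s] XS_surj[OF True] HM_mh[OF XS_HM[OF r0]] a])
  \<comment> \<open>The element e - e c: r0 maps it to 1 - 0, and s to s e - s e.\<close>
  show ?thesis by (rule that[of "add e (sm (-1) (mu e c))"]) (use e c in \<open>simp_all add: D E\<close>)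
 qed
qed

text \<open>Each point of K has an element that is 1 at r0 and small near that point. The product
  over a finite cover is small on all of K, and a threshold then makes it exactly 0.\<close>

lemma cutoff:
 assumes r0: "r0 \<in> XS" and K: "compact K" "K \<subseteq> HM" and ne: "\<And>U. unitary_mat U \<Longrightarrow> uact U r0 \<notin> K"
 obtains b where "b \<in> V" "star b = b" "r0 b = mat 1" "\<And>r. r \<in> K \<Longrightarrow> r b = 0"
  "\<And>r v. mh r \<Longrightarrow> 0 \<le> Re (cip (r b *v v) v)"
proof -
 note m0 = HM_mh[OF XS_HM[OF r0]]
 have "\<exists>d. d \<in> V \<and> r0 d = mat 1 \<and> (\<forall>r. mh r \<longrightarrow> mat_opnorm (r d) \<le> 1) \<and> s d = 0" if s: "s \<in> K" for s
 proof -
  have sH: "s \<in> HM" using s K by blast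
  obtain c where c: "c \<in> V" "r0 c = mat 1" "s c = 0" by (rule separate_orbit[OF r0 sH]) (use ne s in auto)
  show ?thesis by (rule clip_ex[OF m0 c(1,2)]) (use c(3) HM_mh[OF sH] in blast)
 qed
 then obtain d where d: "\<And>s. s \<in> K \<Longrightarrow> d s \<in> V" "\<And>s. s \<in> K \<Longrightarrow> r0 (d s) = mat 1"
  "\<And>s r. s \<in> K \<Longrightarrow> mh r \<Longrightarrow> mat_opnorm (r (d s)) \<le> 1" "\<And>s. s \<in> K \<Longrightarrow> s (d s) = 0" by metis
 define O' where "O' = (\<lambda>s. {r :: 'a \<Rightarrow> complex^'n^'n. mat_opnorm (r (d s)) < 1/2})"
 have O': "open (O' s)" for s unfolding O'_def by (intro open_Collect_less continuous_intros)
 have cov: "K \<subseteq> (\<Union>s\<in>K. O' s)" using d(4) by (force simp: O'_def)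
 obtain F where F: "F \<subseteq> K" "finite F" "K \<subseteq> (\<Union>s\<in>F. O' s)" by (rule compactE_image[OF K(1) O' cov]) blast+
 have "\<exists>x\<in>V. r0 x = mat 1 \<and> (\<forall>r. mh r \<longrightarrow> mat_opnorm (r x) \<le> 1 \<and> ((\<exists>s\<in>F. r \<in> O' s) \<longrightarrow> mat_opnorm (r x) \<le> 1/2))" using F(2,1)
 proof induction
  case empty
  have "\<exists>e\<in>V. r0 e = mat 1" using XS_surj[OF r0] by (metis UNIV_I imageE)
  then obtain e where e: "e \<in> V" "r0 e = mat 1" by blast
  show ?case by (rule clip_ex[OF m0 e]) auto
 next
  case (insert s F)
  then obtain x where x: "x \<in> V" "r0 x = mat 1" "\<And>r. mh r \<Longrightarrow> mat_opnorm (r x) \<le> 1"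
   "\<And>r. mh r \<Longrightarrow> \<exists>s\<in>F. r \<in> O' s \<Longrightarrow> mat_opnorm (r x) \<le> 1/2" by auto
  have s: "s \<in> K" using insert by simp
  show ?case
  proof (intro bexI[of _ "mu (d s) x"] conjI allI impI)
   show "r0 (mu (d s) x) = mat 1" using x d(1,2)[OF s] by (simp add: mhomD(2)[OF m0])
   fix r assume r: "mh r"
   have le: "mat_opnorm (r (mu (d s) x)) \<le> mat_opnorm (r (d s)) * mat_opnorm (r x)"
    unfolding mhomD(2)[OF r d(1)[OF s] x(1)] by (rule mat_opnorm_mult)
   show "mat_opnorm (r (mu (d s) x)) \<le> 1" using le mult_mono[OF d(3)[OF s r] x(3)[OF r]] by simp
   assume ex: "\<exists>s\<in>insert s F. r \<in> O' s"
   show "mat_opnorm (r (mu (d s) x)) \<le> 1/2"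
   proof (cases "r \<in> O' s")
    case True
    then have "mat_opnorm (r (d s)) \<le> 1/2" by (simp add: O'_def)
    then show ?thesis using le mult_mono[of "mat_opnorm (r (d s))" "1/2" "mat_opnorm (r x)" 1] x(3)[OF r] by simp
   next
    case False
    then have "mat_opnorm (r x) \<le> 1/2" using x(4)[OF r] ex by blast
    then show ?thesis using le mult_mono[of "mat_opnorm (r (d s))" 1 "mat_opnorm (r x)" "1/2"] d(3)[OF s r] by simp
   qed
  qed (use x d(1)[OF s] in simp)
 qed
 then obtain x where x: "x \<in> V" "r0 x = mat 1" "\<And>r. mh r \<Longrightarrow> \<exists>s\<in>F. r \<in> O' s \<Longrightarrow> mat_opnorm (r x) \<le> 1/2" by blast
 define y where "y = mu (star x) x"
 have y: "y \<in> V" "star y = y" using x by (auto simp: y_def)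
 have ry: "r y = mat_adj (r x) ** r x" if "mh r" for r using that x by (simp add: y_def mhomD)
 \<comment> \<open>On K the norm of y is at most 1/4, where g vanishes; at r0 the value is the
   identity and g 1 = 1.\<close>
 define g :: "real \<Rightarrow> real" where "g = (\<lambda>t. max 0 (min 1 (2 * t - 1)))"
 obtain b where b: "b \<in> V" "star b = b" "\<And>r. mh r \<Longrightarrow> spec_map g (r y) (r b)"
  by (rule fcal_ex[OF y, of g]) (auto simp: g_def intro!: continuous_intros)
 show ?thesis
 proof (rule that[OF b(1,2)])
  show "r0 b = mat 1" using spec_map_one[of g "r0 b"] b(3)[OF m0] ry[OF m0] x by (simp add: g_def)
  fix r assume r: "r \<in> K"
  have rm: "mh r" using r K HM_mh by blast
  have "mat_opnorm (r x) \<le> 1/2" using x(3)[OF rm] F(3) r by blast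
  then have "(mat_opnorm (r x))\<^sup>2 \<le> (1/2)\<^sup>2" by (intro power_mono) auto
  then have "mat_opnorm (r y) \<le> 1/4" unfolding ry[OF rm] mat_opnorm_cstar by (simp add: power2_eq_square)
  then show "r b = 0" by (intro spec_map_zero[OF mh_herm[OF rm y] b(3)[OF rm]]) (auto simp: g_def)
 next
  fix r v assume r: "mh r"
  show "0 \<le> Re (cip (r b *v v) v)" by (rule spec_map_pos[OF mh_herm[OF r y] b(3)[OF r]]) (simp add: g_def)
 qed
qed

text \<open>Near r0 the element p is a projection of rank at most one, so p b p = t p with a scalar
  t. Spreading by the x i, lifts of the matrix units of column k, turns p b p into t w, where w is
  the sum of the conjugates of p and is close to 1. Dividing by w leaves the scalar t.\<close>

theorem central_bump:
 assumes r0: "r0 \<in> XS" and N: "open N" "r0 \<in> N"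
  and inv: "\<And>r U. r \<in> HM \<Longrightarrow> r \<in> N \<Longrightarrow> unitary_mat U \<Longrightarrow> uact U r \<in> N"
 obtains z \<beta> where "z \<in> V" "\<And>r. r \<in> HM \<Longrightarrow> r z = mat (of_real (\<beta> r)) \<and> 0 \<le> \<beta> r"
  "\<beta> r0 = 1" "\<And>r. r \<in> HM \<Longrightarrow> r \<notin> N \<Longrightarrow> \<beta> r = 0"
proof -
 obtain k :: 'n where True by blast
 have m0: "mh r0" by (rule HM_mh[OF XS_HM[OF r0]])
 note D = mhomD[OF m0]
 have ex: "\<exists>a. a \<in> V \<and> r0 a = M" for M using XS_surj[OF r0] by (metis UNIV_I imageE)
 then have "\<forall>i. \<exists>a. a \<in> V \<and> r0 a = mun i k" by blast
 then obtain x where x: "\<And>i. x i \<in> V" "\<And>i. r0 (x i) = mun i k" by metis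
 define c where "c = mu (star (x k)) (x k)"
 have c: "c \<in> V" "star c = c" "r0 c = mun k k" using x by (simp_all add: c_def D mun_mun)
 \<comment> \<open>Rises from 0 at 3/8 to 1 at 5/8, across the spectral gap of
   \<open>near_rank_one\<close>.\<close>
 define g1 :: "real \<Rightarrow> real" where "g1 = (\<lambda>t. max 0 (min 1 (4 * t - 3/2)))"
 obtain p where p: "p \<in> V" "star p = p" "\<And>r. mh r \<Longrightarrow> spec_map g1 (r c) (r p)"
  by (rule fcal_ex[OF c(1,2), of g1]) (auto simp: g1_def intro!: continuous_intros)
 have g1: "g1 0 = 0" "g1 1 = 1" "\<And>t. t \<le> 3/8 \<Longrightarrow> g1 t = 0" "\<And>t. 5/8 \<le> t \<Longrightarrow> g1 t = 1" by (auto simp: g1_def)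
 have p0: "r0 p = mun k k" by (rule spec_map_proj[OF _ _ p(3)[OF m0, unfolded c(3)] g1(1,2)]) (simp_all add: mun_mun)
 have conj_sum: "\<exists>s\<in>V. \<forall>r. mh r \<longrightarrow> r s = (\<Sum>i\<in>UNIV. r (x i) ** r y ** mat_adj (r (x i)))" if y: "y \<in> V" for y
 proof -
  obtain s where s: "s \<in> V" "\<And>r. mh r \<Longrightarrow> r s = (\<Sum>i\<in>UNIV. r (mu (mu (x i) y) (star (x i))))"
   using fin_sum[of UNIV "\<lambda>i. mu (mu (x i) y) (star (x i))"] x y by auto
  have "r s = (\<Sum>i\<in>UNIV. r (x i) ** r y ** mat_adj (r (x i)))" if r: "mh r" for r
   unfolding s(2)[OF r] using x y by (intro sum.cong refl) (simp add: mhomD[OF r] matrix_mul_assoc)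
  then show ?thesis using s(1) by blast
 qed
 have diag: "(\<Sum>i\<in>UNIV. r0 (x i) ** mun k k ** mat_adj (r0 (x i))) = mat 1" by (simp add: x mun_mun sum_mun_diag)
 obtain w where w: "w \<in> V" "\<And>r. mh r \<Longrightarrow> r w = (\<Sum>i\<in>UNIV. r (x i) ** r p ** mat_adj (r (x i)))" using conj_sum[OF p(1)] by blast
 have w0: "r0 w = mat 1" using w(2)[OF m0] diag by (simp add: p0)
 have wh: "star w = w"
 proof (rule mh_faithful)
  fix r assume r: "mh r"
  show "r (star w) = r w" using mh_herm[OF r p(1,2)] by (simp add: mhomD(3)[OF r w(1)] w(2)[OF r] mat_adj_sum matrix_mul_assoc)
 qed (use w in auto)
 \<comment> \<open>The reciprocal for t \<ge> 1/2, continued so as to vanish at 0 as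
   \<open>fcal_ex\<close> requires. So q inverts w wherever w is near the identity.\<close>
 define g3 :: "real \<Rightarrow> real" where "g3 = (\<lambda>t. t / (max t (1/2))\<^sup>2)"
 obtain q where q: "q \<in> V" "\<And>r. mh r \<Longrightarrow> spec_map g3 (r w) (r q)" by (rule fcal_ex[OF w(1) wh, of g3]) (auto simp: g3_def cont_cut_inverse)
 have g3: "g3 t = 1 / t" if "1/2 \<le> t" for t using that by (simp add: g3_def max_absorb1 power2_eq_square)
 define near where "near = (\<lambda>r :: 'a \<Rightarrow> complex^'n^'n. mat_opnorm (r c - mun k k) < 1/4 \<and> mat_opnorm (r w - mat 1) < 1/2)"
 \<comment> \<open>The condition \<open>near\<close> is not invariant under conjugation, so its
   saturation is taken. The value found at a conjugate is scalar and hence unchanged by moving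
   back.\<close>
 define N' where "N' = N \<inter> (\<Union>U\<in>Collect unitary_mat. {r. near (uact U r)})"
 have "open N'" unfolding N'_def near_def uact_def by (intro open_Int N(1) open_UN ballI open_Collect_conj open_Collect_less continuous_intros)
 have K: "compact (HM - N')" "HM - N' \<subseteq> HM" using compact_diff[OF compact_HM \<open>open N'\<close>] by auto
 have r0N: "uact U r0 \<in> N'" if U: "unitary_mat U" for U
 proof -
  have "near r0" by (simp add: near_def c w0)
  then have "near (uact (mat_adj U) (uact U r0))" by (simp add: uact_inv(1)[OF U])
  then show ?thesis using inv[OF XS_HM[OF r0] N(2) U] U unfolding N'_def by (metis (mono_tags, lifting) IntI UN_I mem_Collect_eq unitary_adj)
 qed
 obtain b where b: "b \<in> V" "star b = b" "r0 b = mat 1" "\<And>r. r \<in> HM - N' \<Longrightarrow> r b = 0"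
  "\<And>r v. mh r \<Longrightarrow> 0 \<le> Re (cip (r b *v v) v)" by (rule cutoff[OF r0 K]) (use r0N in blast)+
 obtain s where s: "s \<in> V" "\<And>r. mh r \<Longrightarrow> r s = (\<Sum>i\<in>UNIV. r (x i) ** (r p ** r b ** r p) ** mat_adj (r (x i)))"
 proof -
  have "r (mu (mu p b) p) = r p ** r b ** r p" if "mh r" for r using p(1) b(1) by (simp add: mhomD(2)[OF that] matrix_mul_assoc)
  then show ?thesis using conj_sum[of "mu (mu p b) p"] p(1) b(1) that by auto
 qed
 define y where "y = mu s q"
 have y: "y \<in> V" using s q by (simp add: y_def)
 have "\<exists>t. r y = mat (of_real t) \<and> 0 \<le> t \<and> (r \<notin> N' \<longrightarrow> t = 0)" if r: "r \<in> HM" for r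
 proof (cases "r \<in> N'")
  case False
  have "r b = 0" using b(4) r False by blast
  then have "r y = 0" using s(2)[OF HM_mh[OF r]] by (simp add: y_def mhomD(2)[OF HM_mh[OF r] s(1) q(1)])
  then show ?thesis using False by (intro exI[of _ 0]) simp
 next
  case True
  then obtain U where U: "unitary_mat U" "near (uact U r)" by (auto simp: N'_def)
  define r' where "r' = uact U r"
  have m: "mh r'" unfolding r'_def by (rule HM_mh[OF uact_HM[OF U(1) r]])
  have n: "mat_opnorm (r' c - mun k k) < 1/4" "mat_opnorm (r' w - mat 1) < 1/2" using U(2) by (auto simp: near_def r'_def)
  obtain t :: real where t: "0 \<le> t" "r' p ** r' b ** r' p = mat_scale (of_real t) (r' p)"
   using near_rank_one[OF mh_herm[OF m c(1,2)] n(1) p(3)[OF m] g1(3,4) mh_herm[OF m b(1,2)] b(5)[OF m]] by blast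
  have "r' s = mat_scale (of_real t) (r' w)" unfolding s(2)[OF m] w(2)[OF m] t(2) mat_scale_sum by simp
  then have "r' y = mat_scale (of_real t) (r' w ** r' q)" by (simp add: y_def mhomD(2)[OF m s(1) q(1)])
  also have "r' w ** r' q = mat 1" by (rule spec_map_inv[OF mh_herm[OF m w(1) wh] n(2) q(2)[OF m] g3])
  finally have "r' y = mat (of_real t)" by (simp add: mat_scale_one)
  then have "r y = mat_adj U ** mat (of_real t) ** U" by (intro unitary_conj_swap[OF U(1)]) (simp add: r'_def uact_def)
  then show ?thesis using unitary_scalar[OF U(1)] t(1) True by auto
 qed
 then obtain \<beta> where \<beta>: "\<And>r. r \<in> HM \<Longrightarrow> r y = mat (of_real (\<beta> r))" "\<And>r. r \<in> HM \<Longrightarrow> 0 \<le> \<beta> r"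
  "\<And>r. r \<in> HM \<Longrightarrow> r \<notin> N' \<Longrightarrow> \<beta> r = 0" by metis
 have "r0 q = mat 1" using spec_map_one[of g3 "r0 q"] q(2)[OF m0] by (simp add: w0 g3)
 moreover have "r0 s = mat 1" using s(2)[OF m0] diag by (simp add: p0 b mun_mun)
 ultimately have "mat (of_real (\<beta> r0)) = (mat 1 :: complex^'n^'n)" using \<beta>(1)[OF XS_HM[OF r0]] by (simp add: y_def D(2)[OF s(1) q(1)])
 then have "(mat (of_real (\<beta> r0)) :: complex^'n^'n) $ k $ k = (mat 1 :: complex^'n^'n) $ k $ k" by (rule arg_cong)
 then have "\<beta> r0 = 1" by (simp add: mat_def)
 then show ?thesis using that[OF y, of \<beta>] \<beta> by (auto simp: N'_def)
qed

lemma XS_open: obtains O' where "open O'" "XS = HM \<inter> O'"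
proof (rule that[of "\<Union>a\<in>V. {r. r a \<noteq> 0}"])
 show "open (\<Union>a\<in>V. {r :: 'a \<Rightarrow> complex^'n^'n. r a \<noteq> 0})" by (intro open_UN ballI open_Collect_neq continuous_intros)
qed (auto simp: XS_def)

lemma conj_diff: "U ** M ** W - U ** N ** W = U ** (M - N) ** (W :: complex^'n^'n)"
 using matrix_add_ldistrib[of U "M - N" N] by (simp add: matrix_add_mult)

text \<open>Around each s the function F is matched by an element a s of \<open>A\<close> on an
  invariant neighbourhood; finitely many central bumps z s glue these elements together and are
  normalised by functional calculus of their sum.\<close>

lemma uniform_approx:
 assumes F: "continuous_on XS F" "\<And>U r. r \<in> XS \<Longrightarrow> unitary_mat U \<Longrightarrow> F (uact U r) = U ** F r ** mat_adj U"
  and van: "\<And>e. 0 < e \<Longrightarrow> \<exists>K. compact K \<and> K \<subseteq> XS \<and> (\<forall>r\<in>XS - K. mat_opnorm (F r) < e)"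
  and e: "0 < e"
 shows "\<exists>a\<in>V. \<forall>r\<in>XS. mat_opnorm (r a - F r) \<le> e"
proof -
 obtain O' where O': "open O'" "XS = HM \<inter> O'" by (rule XS_open)
 obtain k :: 'n where True by blast
 obtain K where K: "compact K" "K \<subseteq> XS" "\<And>r. r \<in> XS \<Longrightarrow> r \<notin> K \<Longrightarrow> mat_opnorm (F r) < e/2" using van[of "e/2"] e by auto
 define P where "P = (\<lambda>s a z \<beta>. a \<in> V \<and> z \<in> V \<and> (\<forall>r\<in>HM. r z = mat (of_real (\<beta> r)) \<and> 0 \<le> \<beta> r) \<and> \<beta> s = (1::real) \<and>
  (\<forall>r\<in>XS. \<beta> r * mat_opnorm (r a - F r) \<le> \<beta> r * (e/2)))"
 have ex: "\<exists>t. P s (fst t) (fst (snd t)) (snd (snd t))" if s: "s \<in> XS" for s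
 proof -
  have "\<exists>a. a \<in> V \<and> s a = F s" using XS_surj[OF s] by (metis UNIV_I imageE)
  then obtain a where a: "a \<in> V" "s a = F s" by blast
  have "openin (top_of_set XS) (XS \<inter> (\<lambda>r. mat_opnorm (r a - F r)) -` {..<e/2})" by (intro continuous_openin_preimage_gen continuous_intros F(1))
  then obtain T where T: "open T" "XS \<inter> (\<lambda>r. mat_opnorm (r a - F r)) -` {..<e/2} = XS \<inter> T" unfolding openin_open by blast
  have mem: "r \<in> T \<inter> O' \<longleftrightarrow> r \<in> XS \<and> mat_opnorm (r a - F r) < e/2" if "r \<in> HM" for r using that T(2) O'(2) by blast
  have o: "open (T \<inter> O')" using T O' by blast
  have sN: "s \<in> T \<inter> O'" using mem[OF XS_HM[OF s]] s a e by simp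
  obtain z \<beta> where z: "z \<in> V" "\<And>r. r \<in> HM \<Longrightarrow> r z = mat (of_real (\<beta> r)) \<and> 0 \<le> \<beta> r"
   "\<beta> s = 1" "\<And>r. r \<in> HM \<Longrightarrow> r \<notin> T \<inter> O' \<Longrightarrow> \<beta> r = (0::real)"
  proof (rule central_bump[OF s o sN])
   fix r and U :: "complex^'n^'n" assume r: "r \<in> HM" "r \<in> T \<inter> O'" and U: "unitary_mat U"
   have X: "r \<in> XS" "mat_opnorm (r a - F r) < e/2" using mem[OF r(1)] r(2) by auto
   have "uact U r a - F (uact U r) = U ** (r a - F r) ** mat_adj U" unfolding F(2)[OF X(1) U] conj_diff[symmetric] by (simp add: uact_def)
   then show "uact U r \<in> T \<inter> O'" unfolding mem[OF uact_HM[OF U r(1)]] using uact_XS[OF U X(1)] X(2) by (simp add: unitary_conj_opnorm[OF U])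
  qed blast
  have "\<beta> r * mat_opnorm (r a - F r) \<le> \<beta> r * (e/2)" if r: "r \<in> XS" for r
  proof (cases "r \<in> T \<inter> O'")
   case True
   then have "mat_opnorm (r a - F r) < e/2" using mem[OF XS_HM[OF r]] by blast
   then show ?thesis using z(2)[OF XS_HM[OF r]] by (intro mult_left_mono) auto
  next
   case False
   then show ?thesis using z(4)[OF XS_HM[OF r]] by simp
  qed
  then have "P s a z \<beta>" using a(1) z unfolding P_def by blast
  then show ?thesis by (intro exI[of _ "(a, z, \<beta>)"]) simp
 qed
 have "\<forall>s\<in>XS. \<exists>t. P s (fst t) (fst (snd t)) (snd (snd t))" using ex by (rule ballI)
 from bchoice[OF this] obtain f where f: "\<And>s. s \<in> XS \<Longrightarrow> P s (fst (f s)) (fst (snd (f s))) (snd (snd (f s)))" by blast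
 define a z \<beta> where "a = (\<lambda>s. fst (f s))" and "z = (\<lambda>s. fst (snd (f s)))" and "\<beta> = (\<lambda>s. snd (snd (f s)))"
 have P: "P s (a s) (z s) (\<beta> s)" if "s \<in> XS" for s unfolding a_def z_def \<beta>_def by (rule f[OF that])
 have a: "\<And>s. s \<in> XS \<Longrightarrow> a s \<in> V" "\<And>s. s \<in> XS \<Longrightarrow> z s \<in> V"
  "\<And>s r. s \<in> XS \<Longrightarrow> r \<in> HM \<Longrightarrow> r (z s) = mat (of_real (\<beta> s r)) \<and> 0 \<le> \<beta> s r" "\<And>s. s \<in> XS \<Longrightarrow> \<beta> s s = (1::real)"
  "\<And>s r. s \<in> XS \<Longrightarrow> r \<in> XS \<Longrightarrow> \<beta> s r * mat_opnorm (r (a s) - F r) \<le> \<beta> s r * (e/2)" using P unfolding P_def by blast+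
 define Q where "Q = (\<lambda>s. {r :: 'a \<Rightarrow> complex^'n^'n. 1/2 < Re (r (z s) $ k $ k)})"
 have Q: "open (Q s)" for s unfolding Q_def by (intro open_Collect_less continuous_intros)
 have Qb: "r \<in> Q s \<longleftrightarrow> 1/2 < \<beta> s r" if "s \<in> XS" "r \<in> HM" for r s using a(3)[OF that] by (simp add: Q_def mat_def)
 have cov: "K \<subseteq> (\<Union>s\<in>K. Q s)"
 proof
  fix s assume "s \<in> K"
  then show "s \<in> (\<Union>s\<in>K. Q s)" using Qb[of s s] a(4)[of s] K(2) XS_HM by (intro UN_I[of s]) auto
 qed
 obtain I where I: "I \<subseteq> K" "finite I" "K \<subseteq> (\<Union>s\<in>I. Q s)" by (rule compactE_image[OF K(1) Q cov]) blast+
 have IX: "s \<in> XS" if "s \<in> I" for s using that I(1) K(2) by blast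
 define \<sigma> where "\<sigma> = (\<lambda>r. \<Sum>s\<in>I. \<beta> s r)"
 have \<sigma>0: "0 \<le> \<sigma> r" if "r \<in> HM" for r using a(3) IX that by (simp add: \<sigma>_def sum_nonneg)
 have \<sigma>K: "1/2 \<le> \<sigma> r" if r: "r \<in> K" for r
 proof -
  have rH: "r \<in> HM" using r K(2) XS_HM by blast
  obtain s where s: "s \<in> I" "r \<in> Q s" using I(3) r by blast
  have "\<beta> s r \<le> \<sigma> r" unfolding \<sigma>_def by (rule member_le_sum[OF s(1) _ I(2)]) (use a(3) IX rH in auto)
  then show ?thesis using Qb[OF IX[OF s(1)] rH] s(2) by linarith
 qed
 obtain w where w: "w \<in> V" "\<And>r. mh r \<Longrightarrow> r w = (\<Sum>s\<in>I. r (z s))" using fin_sum[OF I(2), of z] a(2) IX by blast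
 have wr: "r w = mat (of_real (\<sigma> r))" if r: "r \<in> HM" for r
 proof -
  have "r w = (\<Sum>s\<in>I. mat_scale (of_real (\<beta> s r)) (mat 1))"
   unfolding w(2)[OF HM_mh[OF r]] using a(3)[OF IX r] by (intro sum.cong) (auto simp: mat_scale_one)
  also have "\<dots> = mat_scale (of_real (\<sigma> r)) (mat 1)" by (simp only: \<sigma>_def of_real_sum mat_scale_sum_left)
  finally show ?thesis by (simp only: mat_scale_one)
 qed
 have wh: "star w = w"
 proof (rule mh_faithful)
  fix r assume r: "mh r"
  show "r (star w) = r w"
  proof (cases "\<exists>a\<in>V. r a \<noteq> 0")
   case True
   then have "(\<lambda>x. if x \<in> V then r x else 0) \<in> HM" using mh_XS[OF r] XS_HM by blast
   then have "r w = mat (of_real (\<sigma> (\<lambda>x. if x \<in> V then r x else 0)))" using wr w(1) by fastforce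
   then show ?thesis by (simp add: mhomD(3)[OF r w(1)]) (simp add: mat_adj_def mat_def vec_eq_iff)
  next
   case False
   then show ?thesis using w(1) by auto
  qed
 qed (use w in auto)
 \<comment> \<open>The sum w of the bumps is the scalar \<sigma> at each r. The function g is 1 /
   \<sigma> where \<sigma> \<ge> 1/2, in particular on K, and keeps g(\<sigma>) \<sigma> between 0
   and 1 elsewhere.\<close>
 define g :: "real \<Rightarrow> real" where "g = (\<lambda>t. t / (max t (1/2))\<^sup>2)"
 obtain h where h: "h \<in> V" "\<And>r. mh r \<Longrightarrow> spec_map g (r w) (r h)" by (rule fcal_ex[OF w(1) wh, of g]) (auto simp: g_def cont_cut_inverse)
 have hr: "r h = mat (of_real (g (\<sigma> r)))" if r: "r \<in> HM" for r by (rule spec_map_scalar) (use h(2)[OF HM_mh[OF r]] wr[OF r] in simp)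
 obtain t where t: "t \<in> V" "\<And>r. mh r \<Longrightarrow> r t = (\<Sum>s\<in>I. r (mu (z s) (a s)))" using fin_sum[OF I(2), of "\<lambda>s. mu (z s) (a s)"] a(1,2) IX by auto
 have "mat_opnorm (r (mu t h) - F r) \<le> e" if r: "r \<in> XS" for r
 proof -
  have rH: "r \<in> HM" by (rule XS_HM[OF r])
  note m = HM_mh[OF rH]
  define \<gamma> where "\<gamma> = g (\<sigma> r)"
  have \<gamma>: "0 \<le> \<gamma>" using \<sigma>0[OF rH] by (simp add: \<gamma>_def g_def)
  have \<lambda>: "0 \<le> \<gamma> * \<sigma> r" "\<gamma> * \<sigma> r \<le> 1" "1/2 \<le> \<sigma> r \<Longrightarrow> \<gamma> * \<sigma> r = 1"
  proof -
   show "0 \<le> \<gamma> * \<sigma> r" using \<gamma> \<sigma>0[OF rH] by simp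
   have "(\<sigma> r)\<^sup>2 \<le> (max (\<sigma> r) (1/2))\<^sup>2" using \<sigma>0[OF rH] by (intro power_mono) auto
   then show "\<gamma> * \<sigma> r \<le> 1" by (simp add: \<gamma>_def g_def power2_eq_square divide_le_eq)
   show "\<gamma> * \<sigma> r = 1" if "1/2 \<le> \<sigma> r" using that by (simp add: \<gamma>_def g_def max_absorb1 power2_eq_square)
  qed
  let ?m = "\<lambda>s. mat_scale (of_real (\<gamma> * \<beta> s r))"
  have 1: "r (mu t h) = (\<Sum>s\<in>I. ?m s (r (a s)))"
  proof -
   have "r (mu t h) = mat_scale (of_real \<gamma>) (\<Sum>s\<in>I. r (mu (z s) (a s)))"
    by (simp add: mhomD(2)[OF m t(1) h(1)] t(2)[OF m] hr[OF rH] mat_mult_scale \<gamma>_def)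
   also have "\<dots> = (\<Sum>s\<in>I. mat_scale (of_real \<gamma>) (r (mu (z s) (a s))))" by (rule mat_scale_sum)
   also have "\<dots> = (\<Sum>s\<in>I. ?m s (r (a s)))"
    using a(3)[OF IX rH] by (intro sum.cong refl) (simp add: mhomD(2)[OF m a(2)[OF IX] a(1)[OF IX]] mat_mult_scale)
   finally show ?thesis .
  qed
  have 2: "(\<Sum>s\<in>I. ?m s (F r)) = mat_scale (of_real (\<gamma> * \<sigma> r)) (F r)"
   by (simp only: mat_scale_sum_left[symmetric] of_real_sum[symmetric] \<sigma>_def sum_distrib_left[symmetric])
  \<comment> \<open>Local errors with total weight at most 1, plus a defect of normalisation that
    vanishes on K and meets only small values of F off K.\<close>
  have "r (mu t h) - F r = (\<Sum>s\<in>I. ?m s (r (a s) - F r)) + mat_scale (of_real (\<gamma> * \<sigma> r - 1)) (F r)"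
  proof -
   have "?m s (r (a s) - F r) = ?m s (r (a s)) - ?m s (F r)" for s by (simp add: mat_scale_def vec_eq_iff algebra_simps)
   then have "(\<Sum>s\<in>I. ?m s (r (a s) - F r)) = r (mu t h) - mat_scale (of_real (\<gamma> * \<sigma> r)) (F r)"
    unfolding 1 2[symmetric] by (simp only: sum_subtractf)
   then show ?thesis by (simp add: mat_scale_def vec_eq_iff algebra_simps)
  qed
  then have "mat_opnorm (r (mu t h) - F r) \<le> mat_opnorm (\<Sum>s\<in>I. ?m s (r (a s) - F r)) + \<bar>\<gamma> * \<sigma> r - 1\<bar> * mat_opnorm (F r)"
   using mat_opnorm_triangle[of "\<Sum>s\<in>I. ?m s (r (a s) - F r)" "mat_scale (of_real (\<gamma> * \<sigma> r - 1)) (F r)"] by (simp del: of_real_diff)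
  also have "mat_opnorm (\<Sum>s\<in>I. ?m s (r (a s) - F r)) \<le> (\<Sum>s\<in>I. \<gamma> * \<beta> s r * (e/2))"
  proof (rule order_trans[OF mat_opnorm_sum], rule sum_mono)
   fix s assume s: "s \<in> I"
   have "0 \<le> \<beta> s r" using a(3)[OF IX[OF s] rH] by blast
   then have "mat_opnorm (?m s (r (a s) - F r)) = \<gamma> * (\<beta> s r * mat_opnorm (r (a s) - F r))" using \<gamma> by (simp add: norm_mult)
   also have "\<dots> \<le> \<gamma> * (\<beta> s r * (e/2))" using a(5)[OF IX[OF s] r] \<gamma> by (rule mult_left_mono)
   finally show "mat_opnorm (?m s (r (a s) - F r)) \<le> \<gamma> * \<beta> s r * (e/2)" by (simp add: mult.assoc)
  qed
  also have "(\<Sum>s\<in>I. \<gamma> * \<beta> s r * (e/2)) = \<gamma> * \<sigma> r * (e/2)" by (simp only: sum_distrib_right[symmetric] sum_distrib_left[symmetric] \<sigma>_def)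
  also have "\<dots> \<le> 1 * (e/2)" using \<lambda>(2) e by (intro mult_right_mono) auto
  also have "\<bar>\<gamma> * \<sigma> r - 1\<bar> * mat_opnorm (F r) \<le> e/2"
  proof (cases "r \<in> K")
   case True
   then show ?thesis using \<lambda>(3)[OF \<sigma>K] e by simp
  next
   case False
   have "\<bar>\<gamma> * \<sigma> r - 1\<bar> * mat_opnorm (F r) \<le> 1 * mat_opnorm (F r)" using \<lambda>(1,2) by (intro mult_right_mono) auto
   then show ?thesis using K(3)[OF r False] by linarith
  qed
  finally show ?thesis by simp
 qed
 then show ?thesis using t(1) h(1) by (intro bexI[of _ "mu t h"]) auto
qed

end

lemma opnorm_null_tendsto:
 fixes f :: "nat \<Rightarrow> complex^'n^'n"
 assumes "\<And>k. mat_opnorm (f k - l) \<le> g k" "g \<longlonglongrightarrow> 0" shows "f \<longlonglongrightarrow> l"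
proof -
 have "(\<lambda>k. f k - l) \<longlonglongrightarrow> 0"
 proof (rule Lim_null_comparison)
  show "\<forall>\<^sub>F k in sequentially. norm (f k - l) \<le> (real CARD('n))\<^sup>2 * g k"
   using assms(1) by (intro always_eventually allI order_trans[OF norm_le_opnorm] mult_left_mono) auto
  show "(\<lambda>k. (real CARD('n))\<^sup>2 * g k) \<longlonglongrightarrow> 0" using tendsto_mult_left[OF assms(2), of "(real CARD('n))\<^sup>2"] by simp
 qed
 then show ?thesis by (simp add: LIM_zero_iff)
qed

lemma inverse_Suc_small: assumes "0 < (e::real)" obtains N where "\<And>k. N \<le> k \<Longrightarrow> inverse (real (Suc k)) < e"
proof -
 obtain N where N: "inverse (real (Suc N)) < e" using reals_Archimedean[OF assms] by blast
 have "inverse (real (Suc k)) < e" if "N \<le> k" for k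
 proof -
  have "inverse (real (Suc k)) \<le> inverse (real (Suc N))" using that by (intro le_imp_inverse_le) auto
  then show ?thesis using N by linarith
 qed
 then show ?thesis using that by blast
qed

context nhom
begin

text \<open>Approximants with errors 1 / (k + 1) on \<open>XS\<close> satisfy the hypothesis of
  \<open>limit_ex\<close>; a homomorphism is first normalised outside the carrier to become a point
  of \<open>XS\<close>.\<close>

lemma exact_preimage:
 assumes F: "continuous_on XS F" "\<And>U r. r \<in> XS \<Longrightarrow> unitary_mat U \<Longrightarrow> F (uact U r) = U ** F r ** mat_adj U"
  and van: "\<And>e. 0 < e \<Longrightarrow> \<exists>K. compact K \<and> K \<subseteq> XS \<and> (\<forall>r\<in>XS - K. mat_opnorm (F r) < e)"
 shows "\<exists>a\<in>V. \<forall>r\<in>XS. r a = F r"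
proof -
 have "\<exists>a\<in>V. \<forall>r\<in>XS. mat_opnorm (r a - F r) \<le> inverse (real (Suc k))" for k by (rule uniform_approx[OF F van]) auto
 then obtain s where s: "\<And>k. s k \<in> V" "\<And>k r. r \<in> XS \<Longrightarrow> mat_opnorm (r (s k) - F r) \<le> inverse (real (Suc k))" by metis
 obtain l where l: "l \<in> V" "\<And>r. mh r \<Longrightarrow> (\<lambda>k. r (s k)) \<longlonglongrightarrow> r l"
 proof (rule limit_ex[of s])
  fix e :: real assume e: "0 < e"
  obtain N where N: "\<And>k. N \<le> k \<Longrightarrow> inverse (real (Suc k)) < e/2" using inverse_Suc_small[of "e/2"] e by auto
  have "mat_opnorm (r (s m) - r (s k)) \<le> e" if mk: "N \<le> m" "N \<le> k" and r: "mh r" for m k r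
  proof (cases "\<exists>a\<in>V. r a \<noteq> 0")
   case True
   define r' where "r' = (\<lambda>x. if x \<in> V then r x else 0)"
   have X: "r' \<in> XS" using mh_XS[OF r] True unfolding r'_def by blast
   have "mat_opnorm (r' (s m) - r' (s k)) \<le> mat_opnorm (r' (s m) - F r') + mat_opnorm (r' (s k) - F r')"
    using mat_opnorm_diff[of "r' (s m) - F r'" "r' (s k) - F r'"] by simp
   also have "\<dots> \<le> e" using s(2)[OF X, of m] s(2)[OF X, of k] N[OF mk(1)] N[OF mk(2)] by linarith
   finally show ?thesis using s(1) by (simp add: r'_def)
  next
   case False
   then show ?thesis using s(1) e by auto
  qed
  then show "\<exists>N. \<forall>m\<ge>N. \<forall>k\<ge>N. \<forall>r. mh r \<longrightarrow> mat_opnorm (r (s m) - r (s k)) \<le> e" by blast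
 qed (use s in auto)
 have "r l = F r" if r: "r \<in> XS" for r
  by (rule LIMSEQ_unique[OF l(2)[OF HM_mh[OF XS_HM[OF r]]] opnorm_null_tendsto[OF s(2)[OF r] LIMSEQ_inverse_real_of_nat]])
 then show ?thesis using l(1) by blast
qed

lemma uact_free: assumes U: "unitary_mat U" and r: "r \<in> XS" and e: "uact U r = r" shows "\<exists>c. U = mat c"
proof (rule commute_scalar)
 fix M
 obtain a where a: "r a = M" using XS_surj[OF r] by (metis UNIV_I imageE)
 have "U ** M ** mat_adj U = M" using fun_cong[OF e, of a] a by (simp add: uact_def)
 then have "U ** M ** mat_adj U ** U = M ** U" by simp
 then show "U ** M = M ** U" using U by (simp add: unitary_mat_def flip: matrix_mul_assoc)
qed

lemma n_space_XS: "n_space (top_of_set XS) uact" unfolding n_space_def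
proof (intro conjI allI ballI impI)
 show "Hausdorff_space (top_of_set XS)" by (rule Hausdorff_space_subtopology[OF Hausdorff_fun])
 obtain O' where O': "open O'" "XS = HM \<inter> O'" by (rule XS_open)
 \<comment> \<open>\<open>XS\<close> is open in the compact Hausdorff space \<open>HM\<close>, whose
   other point is the zero map; hence it is locally compact.\<close>
 have "compact_space (top_of_set HM)" using compact_HM by (simp add: compact_space_subtopology)
 then have "locally_compact_space (subtopology (top_of_set HM) XS)"
  using O' by (intro locally_compact_space_open_subset compact_imp_locally_compact_space disjI1
    Hausdorff_space_subtopology[OF Hausdorff_fun]) (auto simp: openin_open)
 then show "locally_compact_space (top_of_set XS)" using O'(2) by (simp add: subtopology_subtopology inf.absorb2)
 show "uact U r \<in> topspace (top_of_set XS)" if "r \<in> topspace (top_of_set XS)" "unitary_mat U" for U r using that uact_XS by simp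
 show "uact (mat 1) r = r" for r by simp
 show "uact (U ** W) r = uact U (uact W r)" for U W r by (rule uact_mult)
 show "uact (mat c ** U) r = uact U r" if "cmod c = 1 \<and> unitary_mat U" for c U r
 proof -
  have c: "c * cnj c = 1" using that complex_norm_square[of c] by simp
  have "mat c ** U ** M ** mat_adj (mat c ** U) = mat_scale (c * cnj c) (U ** M ** mat_adj U)" for M
  proof -
   have "mat_adj (mat c ** U) = mat_scale (cnj c) (mat_adj U)" by (simp add: mat_mult_scale)
   then show ?thesis by (simp add: mat_mult_scale mult.commute)
  qed
  then show ?thesis by (simp add: uact_def c)
 qed
 have "continuous_on ({U. unitary_mat U} \<times> XS) (\<lambda>p. uact (fst p) (snd p))" unfolding uact_def
  by (intro continuous_on_coordinatewise_then_product continuous_intros continuous_on_compose2[OF continuous_on_eval[of UNIV] continuous_on_snd[OF continuous_on_id]]) auto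
 moreover have "uact (fst p) (snd p) \<in> XS" if "p \<in> {U. unitary_mat U} \<times> XS" for p using that uact_XS by auto
 ultimately show "continuous_map (prod_topology (top_of_set {U. unitary_mat U}) (top_of_set XS)) (top_of_set XS) (\<lambda>(U, x). uact U x)"
  by (auto simp: case_prod_unfold continuous_map_in_subtopology)
 show "\<exists>c. U = mat c" if "r \<in> topspace (top_of_set XS)" "unitary_mat U \<and> uact U r = r" for U r using uact_free that by simp
qed

definition ghat :: "'a \<Rightarrow> ('a \<Rightarrow> complex^'n^'n) \<Rightarrow> complex^'n^'n" where
 "ghat a = (\<lambda>r. if r \<in> XS then r a else 0)"

lemma ghat_CX: assumes a: "a \<in> V" shows "ghat a \<in> ca_carrier (CX (top_of_set XS) uact)" unfolding CX_def
proof (simp, intro conjI allI impI ballI)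
 show "continuous_on XS (ghat a)" by (rule iffD1[OF continuous_on_cong[OF refl] continuous_on_eval[of XS a]]) (simp add: ghat_def)
 fix e :: real assume e: "0 < e"
 \<comment> \<open>This part of \<open>HM\<close> is compact and avoids the zero map, which is
   exactly vanishing at infinity on \<open>XS\<close>.\<close>
 have "closed {r :: 'a \<Rightarrow> complex^'n^'n. e \<le> mat_opnorm (r a)}" by (intro closed_Collect_le continuous_intros)
 then have K: "compact (HM \<inter> {r. e \<le> mat_opnorm (r a)})" by (rule compact_Int_closed[OF compact_HM])
 moreover have "HM \<inter> {r. e \<le> mat_opnorm (r a)} \<subseteq> XS"
 proof
  fix r assume r: "r \<in> HM \<inter> {r. e \<le> mat_opnorm (r a)}"
  then have "r a \<noteq> 0" using e by auto
  then show "r \<in> XS" using r a by (auto simp: XS_def)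
 qed
 ultimately show "\<exists>K. compactin (top_of_set XS) K \<and> (\<forall>x\<in>XS - K. mat_opnorm (ghat a x) < e)"
  by (intro exI[of _ "HM \<inter> {r. e \<le> mat_opnorm (r a)}"]) (auto simp: compactin_subtopology ghat_def XS_HM not_le)
qed (use uact_XS in \<open>auto simp: ghat_def uact_def\<close>)

theorem nhom_iso: "cstar_iso A (CX (top_of_set XS) uact)" unfolding cstar_iso_def
proof (intro exI conjI)
 show "cstar_hom A (CX (top_of_set XS) uact) ghat" unfolding cstar_hom_def
 proof (intro conjI ballI allI)
  fix a assume a: "a \<in> V"
  show "ghat a \<in> ca_carrier (CX (top_of_set XS) uact)" by (rule ghat_CX[OF a])
  show "ghat (sm c a) = ca_smul (CX (top_of_set XS) uact) c (ghat a)" for c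
   using a by (auto simp: CX_def ghat_def fun_eq_iff mhomD(4)[OF HM_mh[OF XS_HM]])
  show "ghat (star a) = ca_star (CX (top_of_set XS) uact) (ghat a)" using a by (auto simp: CX_def ghat_def fun_eq_iff mhomD(3)[OF HM_mh[OF XS_HM]])
  fix b assume b: "b \<in> V"
  show "ghat (add a b) = ca_add (CX (top_of_set XS) uact) (ghat a) (ghat b)"
   using a b by (auto simp: CX_def ghat_def fun_eq_iff mhomD(1)[OF HM_mh[OF XS_HM]])
  show "ghat (mu a b) = ca_mult (CX (top_of_set XS) uact) (ghat a) (ghat b)"
   using a b by (auto simp: CX_def ghat_def fun_eq_iff mhomD(2)[OF HM_mh[OF XS_HM]])
 qed
 show "bij_betw ghat V (ca_carrier (CX (top_of_set XS) uact))" unfolding bij_betw_def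
 proof (intro conjI inj_onI subset_antisym subsetI)
  fix a b assume ab: "a \<in> V" "b \<in> V" "ghat a = ghat b"
  show "a = b"
  proof (rule mh_faithful[OF ab(1,2)])
   fix r assume r: "mh r"
   show "r a = r b"
   proof (cases "\<exists>a\<in>V. r a \<noteq> 0")
    case True
    define r' where "r' = (\<lambda>x. if x \<in> V then r x else 0)"
    have "r' \<in> XS" using mh_XS[OF r] True unfolding r'_def by blast
    then show ?thesis using fun_cong[OF ab(3), of r'] ab(1,2) by (simp add: ghat_def r'_def)
   next
    case False
    then show ?thesis using ab by auto
   qed
  qed
 next
  fix F assume "F \<in> ca_carrier (CX (top_of_set XS) uact)"
  then have F: "continuous_on XS F" "\<And>U r. r \<in> XS \<Longrightarrow> unitary_mat U \<Longrightarrow> F (uact U r) = U ** F r ** mat_adj U"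
   "\<And>e. 0 < e \<Longrightarrow> \<exists>K. compactin (top_of_set XS) K \<and> (\<forall>r\<in>XS - K. mat_opnorm (F r) < e)" "\<And>r. r \<notin> XS \<Longrightarrow> F r = 0" by (auto simp: CX_def)
  have "\<exists>a\<in>V. \<forall>r\<in>XS. r a = F r" by (rule exact_preimage[OF F(1,2)]) (use F(3) in \<open>auto simp: compactin_subtopology\<close>)
  then obtain a where a: "a \<in> V" "\<And>r. r \<in> XS \<Longrightarrow> r a = F r" by blast
  then have "F = ghat a" using F(4) by (auto simp: ghat_def fun_eq_iff)
  then show "F \<in> ghat ` V" using a(1) by blast
 next
  fix F assume "F \<in> ghat ` V"
  then show "F \<in> ca_carrier (CX (top_of_set XS) uact)" using ghat_CX by blast
 qed
qed

end

section \<open>The algebra of equivariant functions on an n-space\<close>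

lemma continuous_map_comp:
 assumes "continuous_map X euclidean f" "continuous_on UNIV h" shows "continuous_map X euclidean (\<lambda>x. h (f x))"
 using continuous_map_compose[OF assms(1), of euclidean h] assms(2) by (simp add: o_def)

lemma continuous_map_comp2:
 fixes h :: "'b::topological_space \<Rightarrow> 'c::topological_space \<Rightarrow> 'd::topological_space"
 assumes f: "continuous_map X euclidean f" and g: "continuous_map X euclidean g"
  and h: "continuous_on UNIV (\<lambda>p. h (fst p) (snd p))"
 shows "continuous_map X euclidean (\<lambda>x. h (f x) (g x))"
proof -
 have "continuous_map X (prod_topology euclidean euclidean) (\<lambda>x. (f x, g x))" by (intro continuous_intros f g)
 moreover have "prod_topology euclidean euclidean = (euclidean :: ('b \<times> 'c) topology)"
  using prod_topology_subtopology_eu[of "UNIV :: 'b set" "UNIV :: 'c set"] by simp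
 ultimately show ?thesis using continuous_map_comp[of X "\<lambda>x. (f x, g x)" "\<lambda>p. h (fst p) (snd p)"] h by simp
qed

lemma conj_add: "U ** (M + N) ** W = U ** M ** W + U ** N ** (W :: complex^'n^'n)" by (simp add: matrix_add_ldistrib matrix_add_mult)

locale nsp =
 fixes X :: "'x topology" and act :: "complex^'n^'n \<Rightarrow> 'x \<Rightarrow> 'x"
 assumes nsp: "n_space X act"
begin

lemmas nsp_conj = nsp[unfolded n_space_def]

lemma Hausdorff: "Hausdorff_space X" by (rule conjunct1[OF nsp_conj])
lemma lcomp: "locally_compact_space X" by (rule conjunct1[OF conjunct2[OF nsp_conj]])
lemma act_in: "x \<in> topspace X \<Longrightarrow> unitary_mat U \<Longrightarrow> act U x \<in> topspace X" using conjunct1[OF conjunct2[OF conjunct2[OF nsp_conj]]] by blast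
lemma act_one: "x \<in> topspace X \<Longrightarrow> act (mat 1) x = x" using conjunct1[OF conjunct2[OF conjunct2[OF conjunct2[OF nsp_conj]]]] by blast

lemma act_mult: "x \<in> topspace X \<Longrightarrow> unitary_mat U \<Longrightarrow> unitary_mat W \<Longrightarrow> act (U ** W) x = act U (act W x)"
 by (rule nsp_conj[THEN conjunct2, THEN conjunct2, THEN conjunct2, THEN conjunct2, THEN conjunct1, rule_format]) auto

lemma act_cont: "continuous_map (prod_topology (top_of_set {U. unitary_mat U}) X) X (\<lambda>(U, x). act U x)"
 by (rule nsp_conj[THEN conjunct2, THEN conjunct2, THEN conjunct2, THEN conjunct2, THEN conjunct2, THEN conjunct2, THEN conjunct1])

lemma act_free: "x \<in> topspace X \<Longrightarrow> unitary_mat U \<Longrightarrow> act U x = x \<Longrightarrow> \<exists>c. U = mat c"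
 by (rule nsp_conj[THEN conjunct2, THEN conjunct2, THEN conjunct2, THEN conjunct2, THEN conjunct2, THEN conjunct2, THEN conjunct2, rule_format]) auto

lemma act_inv: assumes "x \<in> topspace X" "unitary_mat U"
 shows "act (mat_adj U) (act U x) = x" "act U (act (mat_adj U) x) = x"
 using assms act_mult[of x "mat_adj U" U] act_mult[of x U "mat_adj U"] act_one[of x] by (auto simp: unitary_mat_def)

abbreviation "B \<equiv> CX X act"

definition nm :: "('x \<Rightarrow> complex^'n^'n) \<Rightarrow> real" where "nm = ca_norm B"

lemma CX_sel: "ca_zero B = (\<lambda>x. 0)" "ca_add B f g = (\<lambda>x. f x + g x)" "ca_smul B c f = (\<lambda>x. mat_scale c (f x))"
 "ca_mult B f g = (\<lambda>x. f x ** g x)" "ca_star B f = (\<lambda>x. mat_adj (f x))"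
 "ca_norm B = nm" by (simp_all add: CX_def nm_def)

lemma CX_I:
 assumes "continuous_map X euclidean f"
  "\<And>e. 0 < e \<Longrightarrow> \<exists>K. compactin X K \<and> (\<forall>x\<in>topspace X - K. mat_opnorm (f x) < e)"
  "\<And>U x. x \<in> topspace X \<Longrightarrow> unitary_mat U \<Longrightarrow> f (act U x) = U ** f x ** mat_adj U"
  "\<And>x. x \<notin> topspace X \<Longrightarrow> f x = 0"
 shows "f \<in> ca_carrier B" using assms unfolding CX_def by simp

lemma CX_D:
 assumes "f \<in> ca_carrier B"
 shows "continuous_map X euclidean f"
  "0 < e \<Longrightarrow> \<exists>K. compactin X K \<and> (\<forall>x\<in>topspace X - K. mat_opnorm (f x) < e)"
  "x \<in> topspace X \<Longrightarrow> unitary_mat U \<Longrightarrow> f (act U x) = U ** f x ** mat_adj U"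
  "x \<notin> topspace X \<Longrightarrow> f x = 0" using assms unfolding CX_def by simp_all

lemma CX_bounded: assumes f: "f \<in> ca_carrier B" shows "\<exists>b\<ge>0. \<forall>x. mat_opnorm (f x) \<le> b"
proof -
 obtain K where K: "compactin X K" "\<And>x. x \<in> topspace X \<Longrightarrow> x \<notin> K \<Longrightarrow> mat_opnorm (f x) < 1" using CX_D(2)[OF f, of 1] by auto
 have "continuous_map X euclideanreal (\<lambda>x. mat_opnorm (f x))" by (rule continuous_map_comp[OF CX_D(1)[OF f]]) (intro continuous_intros)
 from image_compactin[OF K(1) this] have "bounded ((\<lambda>x. mat_opnorm (f x)) ` K)" by (simp add: compact_imp_bounded)
 then obtain b where b: "\<And>x. x \<in> K \<Longrightarrow> \<bar>mat_opnorm (f x)\<bar> \<le> b" by (auto simp: bounded_iff)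
 have "mat_opnorm (f x) \<le> max b 1" for x using b[of x] K(2)[of x] CX_D(4)[OF f, of x] by (cases "x \<in> topspace X"; cases "x \<in> K") auto
 then show ?thesis by (intro exI[of _ "max b 1"]) auto
qed

lemma nm_ge: assumes f: "f \<in> ca_carrier B" shows "mat_opnorm (f x) \<le> nm f"
proof (cases "x \<in> topspace X")
 case True
 then have "nm f = (SUP x\<in>topspace X. mat_opnorm (f x))" by (auto simp: nm_def CX_def)
 then show ?thesis using CX_bounded[OF f] by (auto intro!: cSUP_upper True bdd_aboveI2)
next
 case False
 have "0 \<le> nm f"
 proof (cases "topspace X = {}")
  case False
  then obtain y where y: "y \<in> topspace X" by blast
  have "nm f = (SUP x\<in>topspace X. mat_opnorm (f x))" using y by (auto simp: nm_def CX_def)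
  then have "mat_opnorm (f y) \<le> nm f" using CX_bounded[OF f] by (auto intro!: cSUP_upper y bdd_aboveI2)
  then show ?thesis using mat_opnorm_nonneg[of "f y"] by linarith
 next
  case True
  then show ?thesis unfolding nm_def CX_def by simp
 qed
 then show ?thesis using CX_D(4)[OF f False] by simp
qed

lemma nm_le: assumes "0 \<le> b" "\<And>x. x \<in> topspace X \<Longrightarrow> mat_opnorm (f x) \<le> b" shows "nm f \<le> b" using assms by (auto simp: nm_def CX_def intro!: cSUP_least)

lemma nm_nonneg: "f \<in> ca_carrier B \<Longrightarrow> 0 \<le> nm f" using nm_ge[of f undefined] mat_opnorm_nonneg[of "f undefined"] by linarith

lemma CX_vanish_comp:
 assumes "compactin X K" "\<And>x. x \<in> topspace X \<Longrightarrow> x \<notin> K \<Longrightarrow> mat_opnorm (f x) < e"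
 shows "\<exists>K. compactin X K \<and> (\<forall>x\<in>topspace X - K. mat_opnorm (f x) < e)" using assms by blast

lemma CX_add: assumes f: "f \<in> ca_carrier B" and g: "g \<in> ca_carrier B" shows "(\<lambda>x. f x + g x) \<in> ca_carrier B"
proof (rule CX_I)
 show "continuous_map X euclidean (\<lambda>x. f x + g x)" by (rule continuous_map_comp2[OF CX_D(1)[OF f] CX_D(1)[OF g]]) (intro continuous_intros)
 fix e :: real assume e: "0 < e"
 obtain K where K: "compactin X K" "\<forall>x\<in>topspace X - K. mat_opnorm (f x) < e/2" using CX_D(2)[OF f, of "e/2"] e by auto
 obtain L where L: "compactin X L" "\<forall>x\<in>topspace X - L. mat_opnorm (g x) < e/2" using CX_D(2)[OF g, of "e/2"] e by auto
 show "\<exists>K. compactin X K \<and> (\<forall>x\<in>topspace X - K. mat_opnorm (f x + g x) < e)"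
 proof (rule CX_vanish_comp[OF compactin_Un[OF K(1) L(1)]])
  fix x assume "x \<in> topspace X" "x \<notin> K \<union> L"
  then have "mat_opnorm (f x) < e/2" "mat_opnorm (g x) < e/2" using K L by auto
  then show "mat_opnorm (f x + g x) < e" using mat_opnorm_triangle[of "f x" "g x"] by linarith
 qed
qed (simp_all add: CX_D(3,4)[OF f] CX_D(3,4)[OF g] conj_add)

text \<open>An invariant scalar factor preserves equivariance; \<open>cut_ex\<close> uses this to
  cut elements off.\<close>

lemma CX_scale:
 assumes f: "f \<in> ca_carrier B" and c: "continuous_map X euclidean c" "\<And>x. cmod (c x) \<le> b"
  and inv: "\<And>U x. x \<in> topspace X \<Longrightarrow> unitary_mat U \<Longrightarrow> c (act U x) = c x"
 shows "(\<lambda>x. mat_scale (c x) (f x)) \<in> ca_carrier B"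
proof (rule CX_I)
 show "continuous_map X euclidean (\<lambda>x. mat_scale (c x) (f x))" by (rule continuous_map_comp2[OF c(1) CX_D(1)[OF f]]) (intro continuous_intros)
 fix e :: real assume e: "0 < e"
 have b: "0 \<le> b" using c(2)[of undefined] norm_ge_zero[of "c undefined"] by linarith
 obtain K where K: "compactin X K" "\<forall>x\<in>topspace X - K. mat_opnorm (f x) < e/(b+1)" using CX_D(2)[OF f, of "e/(b+1)"] e b by auto
 show "\<exists>K. compactin X K \<and> (\<forall>x\<in>topspace X - K. mat_opnorm (mat_scale (c x) (f x)) < e)"
 proof (rule CX_vanish_comp[OF K(1)])
  fix x assume "x \<in> topspace X" "x \<notin> K"
  then have "mat_opnorm (f x) * (b + 1) < e" using K b by (auto simp: pos_less_divide_eq)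
  moreover have "cmod (c x) * mat_opnorm (f x) \<le> (b + 1) * mat_opnorm (f x)" using c(2)[of x] by (intro mult_right_mono) auto
  ultimately show "mat_opnorm (mat_scale (c x) (f x)) < e" by (simp add: mult.commute)
 qed
qed (simp_all add: CX_D(3,4)[OF f] inv)

lemma CX_mult: assumes f: "f \<in> ca_carrier B" and g: "g \<in> ca_carrier B" shows "(\<lambda>x. f x ** g x) \<in> ca_carrier B"
proof (rule CX_I)
 show "continuous_map X euclidean (\<lambda>x. f x ** g x)" by (rule continuous_map_comp2[OF CX_D(1)[OF f] CX_D(1)[OF g]]) (intro continuous_intros)
 fix e :: real assume e: "0 < e"
 note b = nm_nonneg[OF g]
 obtain K where K: "compactin X K" "\<forall>x\<in>topspace X - K. mat_opnorm (f x) < e/(nm g+1)" using CX_D(2)[OF f, of "e/(nm g+1)"] e b by auto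
 show "\<exists>K. compactin X K \<and> (\<forall>x\<in>topspace X - K. mat_opnorm (f x ** g x) < e)"
 proof (rule CX_vanish_comp[OF K(1)])
  fix x assume "x \<in> topspace X" "x \<notin> K"
  then have "mat_opnorm (f x) * (nm g + 1) < e" using K b by (auto simp: pos_less_divide_eq)
  moreover have "mat_opnorm (f x) * mat_opnorm (g x) \<le> mat_opnorm (f x) * (nm g + 1)" using nm_ge[OF g, of x] by (intro mult_left_mono) auto
  ultimately show "mat_opnorm (f x ** g x) < e" using mat_opnorm_mult[of "f x" "g x"] by linarith
 qed
next
 fix x and U :: "complex^'n^'n" assume "x \<in> topspace X" and U: "unitary_mat U"
 then show "f (act U x) ** g (act U x) = U ** (f x ** g x) ** mat_adj U"
  unfolding unitary_conj[OF U, symmetric] by (simp add: CX_D(3)[OF f] CX_D(3)[OF g])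
qed (simp_all add: CX_D(4)[OF f])

lemma CX_star: assumes f: "f \<in> ca_carrier B" shows "(\<lambda>x. mat_adj (f x)) \<in> ca_carrier B"
proof (rule CX_I)
 show "continuous_map X euclidean (\<lambda>x. mat_adj (f x))" by (rule continuous_map_comp[OF CX_D(1)[OF f]]) (intro continuous_intros)
qed (simp_all add: CX_D[OF f] matrix_mul_assoc)

lemma CX_zero: "(\<lambda>x. 0) \<in> ca_carrier B" by (rule CX_I) (auto intro!: exI[of _ "{}"])

lemma CX_smul: "f \<in> ca_carrier B \<Longrightarrow> (\<lambda>x. mat_scale c (f x)) \<in> ca_carrier B" by (rule CX_scale[of f "\<lambda>_. c" "cmod c"]) auto

lemma nm_diff: assumes "f \<in> ca_carrier B" "g \<in> ca_carrier B"
 shows "mat_opnorm (f x - g x) \<le> nm (\<lambda>x. f x + mat_scale (-1) (g x))"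
proof -
 have "f x + mat_scale (-1) (g x) = f x - g x" by (simp add: mat_scale_def vec_eq_iff)
 then show ?thesis using nm_ge[OF CX_add[OF assms(1) CX_smul[OF assms(2), of "-1"]], of x] by simp
qed

lemma CX_complete: "complete_on (ca_carrier B) (ca_add B) (ca_smul B) (ca_norm B)" unfolding complete_on_def CX_sel
proof (intro allI impI, elim conjE)
 fix s :: "nat \<Rightarrow> 'x \<Rightarrow> complex^'n^'n"
 assume s: "\<forall>k. s k \<in> ca_carrier B" and c: "\<forall>e>0. \<exists>N. \<forall>m\<ge>N. \<forall>k\<ge>N. nm (\<lambda>x. s m x + mat_scale (-1) (s k x)) < e"
 have u: "\<exists>N. \<forall>m\<ge>N. \<forall>k\<ge>N. \<forall>x. mat_opnorm (s m x - s k x) < e" if "0 < e" for e using c that nm_diff s by (meson le_less_trans)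
 have "Cauchy (\<lambda>k. s k x)" for x unfolding Cauchy_iff
 proof (intro allI impI)
  fix e :: real assume e: "0 < e"
  let ?c = "(real CARD('n))\<^sup>2"
  obtain N where N: "\<And>m k. N \<le> m \<Longrightarrow> N \<le> k \<Longrightarrow> mat_opnorm (s m x - s k x) < e / ?c" using u[of "e / ?c"] e by auto
  have "norm (s m x - s k x) < e" if "N \<le> m" "N \<le> k" for m k
   using norm_le_opnorm[of "s m x - s k x"] N[OF that] by (simp add: less_divide_eq mult.commute)
  then show "\<exists>N. \<forall>m\<ge>N. \<forall>k\<ge>N. norm (s m x - s k x) < e" by blast
 qed
 then have "\<forall>x. \<exists>l. (\<lambda>k. s k x) \<longlonglongrightarrow> l" by (simp add: Cauchy_convergent_iff convergent_def)
 then obtain l where l: "\<And>x. (\<lambda>k. s k x) \<longlonglongrightarrow> l x" by metis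
 have ul: "\<exists>N. \<forall>m\<ge>N. \<forall>x. mat_opnorm (s m x - l x) \<le> e" if e: "0 < e" for e
 proof -
  obtain N where N: "\<And>m k x. N \<le> m \<Longrightarrow> N \<le> k \<Longrightarrow> mat_opnorm (s k x - s m x) < e" using u[OF e] by blast
  have "mat_opnorm (l x - s m x) \<le> e" if "N \<le> m" for m x by (rule limit_opnorm_le[OF l]) (use N[OF that] in \<open>auto intro: less_imp_le\<close>)
  then show ?thesis by (auto simp: mat_opnorm_commute[of "s _ _"])
 qed
 have lB: "l \<in> ca_carrier B"
 proof (rule CX_I)
  have "continuous_map X Met_TC.mtopology l"
  proof (rule Met_TC.continuous_map_uniform_limit[of X s sequentially])
   show "\<forall>\<^sub>F k in sequentially. continuous_map X Met_TC.mtopology (s k)" using CX_D(1) s by (simp add: always_eventually)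
   fix e :: real assume e: "0 < e"
   let ?c = "(real CARD('n))\<^sup>2"
   obtain N where N: "\<And>m x. N \<le> m \<Longrightarrow> mat_opnorm (s m x - l x) \<le> e / (2 * ?c)" using ul[of "e / (2 * ?c)"] e by auto
   have "dist (s m x) (l x) < e" if "N \<le> m" for m x
   proof -
    have "norm (s m x - l x) \<le> ?c * (e / (2 * ?c))" by (rule order_trans[OF norm_le_opnorm mult_left_mono[OF N[OF that]]]) auto
    then show ?thesis using e by (simp add: dist_norm)
   qed
   then show "\<forall>\<^sub>F m in sequentially. \<forall>x\<in>topspace X. l x \<in> UNIV \<and> dist (s m x) (l x) < e" by (auto simp: eventually_sequentially)
  qed simp
  then show "continuous_map X euclidean l" by simp
  fix e :: real assume e: "0 < e"
  obtain N where N: "\<And>x. mat_opnorm (s N x - l x) \<le> e/2" using ul[of "e/2"] e by auto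
  obtain K where K: "compactin X K" "\<forall>x\<in>topspace X - K. mat_opnorm (s N x) < e/2" using CX_D(2)[of "s N" "e/2"] s e by auto
  show "\<exists>K. compactin X K \<and> (\<forall>x\<in>topspace X - K. mat_opnorm (l x) < e)"
  proof (rule CX_vanish_comp[OF K(1)])
   fix x assume "x \<in> topspace X" "x \<notin> K"
   then have "mat_opnorm (s N x) < e/2" using K by blast
   then show "mat_opnorm (l x) < e" using N[of x] mat_opnorm_diff[of "s N x" "s N x - l x"] by simp
  qed
 next
  fix x and U :: "complex^'n^'n" assume x: "x \<in> topspace X" and U: "unitary_mat U"
  have "(\<lambda>k. U ** s k x ** mat_adj U) \<longlonglongrightarrow> U ** l x ** mat_adj U"
  proof -
   have "continuous_on UNIV (\<lambda>M. U ** M ** mat_adj U)" by (intro continuous_intros)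
   then have "isCont (\<lambda>M. U ** M ** mat_adj U) (l x)" by (simp add: continuous_on_eq_continuous_at)
   then show ?thesis using l by (rule isCont_tendsto_compose)
  qed
  moreover have "s k (act U x) = U ** s k x ** mat_adj U" for k using CX_D(3) s x U by blast
  ultimately show "l (act U x) = U ** l x ** mat_adj U" using LIMSEQ_unique[OF l[of "act U x"]] by simp
 next
  fix x assume x: "x \<notin> topspace X"
  have "s k x = 0" for k using CX_D(4) s x by blast
  then show "l x = 0" using LIMSEQ_unique[OF l[of x]] by simp
 qed
 have "(\<lambda>k. nm (\<lambda>x. s k x + mat_scale (-1) (l x))) \<longlonglongrightarrow> 0"
 proof (rule LIMSEQ_I)
  fix e :: real assume e: "0 < e"
  obtain N where N: "\<And>m x. N \<le> m \<Longrightarrow> mat_opnorm (s m x - l x) \<le> e/2" using ul[of "e/2"] e by auto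
  have d: "s m x + mat_scale (-1) (l x) = s m x - l x" for m x by (simp add: mat_scale_def vec_eq_iff)
  have "norm (nm (\<lambda>x. s m x + mat_scale (-1) (l x)) - 0) < e" if "N \<le> m" for m
  proof -
   have "(\<lambda>x. s m x + mat_scale (-1) (l x)) \<in> ca_carrier B" by (intro CX_add CX_smul lB) (use s in blast)
   then have "0 \<le> nm (\<lambda>x. s m x + mat_scale (-1) (l x))" by (rule nm_nonneg)
   moreover have "nm (\<lambda>x. s m x + mat_scale (-1) (l x)) \<le> e/2" by (rule nm_le) (use e N[OF that] d in auto)
   ultimately show ?thesis using e by simp
  qed
  then show "\<exists>N. \<forall>m\<ge>N. norm (nm (\<lambda>x. s m x + mat_scale (-1) (l x)) - 0) < e" by blast
 qed
 then show "\<exists>l\<in>ca_carrier B. (\<lambda>k. nm (\<lambda>x. s k x + mat_scale (-1) (l x))) \<longlonglongrightarrow> 0" using lB by blast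
qed

lemma CX_norm: "is_norm_on (ca_carrier B) (ca_zero B) (ca_add B) (ca_smul B) (ca_norm B)" unfolding is_norm_on_def CX_sel
proof (intro conjI ballI allI)
 fix f assume f: "f \<in> ca_carrier B"
 note n = nm_nonneg[OF f]
 show "0 \<le> nm f" by (rule n)
 show "nm f = 0 \<longleftrightarrow> f = (\<lambda>x. 0)"
 proof
  assume 0: "nm f = 0"
  have "norm (f x) \<le> 0" for x using norm_le_opnorm[of "f x"] nm_ge[OF f, of x] mat_opnorm_nonneg[of "f x"] 0 by simp
  then show "f = (\<lambda>x. 0)" by (simp add: fun_eq_iff)
 next
  assume "f = (\<lambda>x. 0)"
  then show "nm f = 0" using nm_le[of 0 f] n by simp
 qed
 have le: "nm (\<lambda>x. mat_scale c (f x)) \<le> cmod c * nm f" if f: "f \<in> ca_carrier B" for c f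
  by (rule nm_le) (auto intro!: mult_left_mono nm_ge[OF f] mult_nonneg_nonneg nm_nonneg[OF f])
 show "nm (\<lambda>x. mat_scale c (f x)) = cmod c * nm f" for c
 proof (cases "c = 0")
  case True
  then show ?thesis using le[OF f, of c] nm_nonneg[OF CX_smul[OF f, of c]] by simp
 next
  case False
  have "nm (\<lambda>x. mat_scale (inverse c) (mat_scale c (f x))) \<le> cmod (inverse c) * nm (\<lambda>x. mat_scale c (f x))" by (rule le[OF CX_smul[OF f]])
  then have "nm f \<le> inverse (cmod c) * nm (\<lambda>x. mat_scale c (f x))" using False by (simp add: norm_inverse)
  then have "cmod c * nm f \<le> nm (\<lambda>x. mat_scale c (f x))" using False by (simp add: field_simps)
  then show ?thesis using le[OF f, of c] by simp
 qed
 fix g assume g: "g \<in> ca_carrier B"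
 show "nm (\<lambda>x. f x + g x) \<le> nm f + nm g"
  by (rule nm_le) (use n nm_nonneg[OF g] in simp, rule order_trans[OF mat_opnorm_triangle add_mono[OF nm_ge[OF f] nm_ge[OF g]]])
qed

theorem CX_cstar: "cstar_algebra B" unfolding cstar_algebra_def Let_def
proof (intro conjI ballI allI)
 show "complex_vs (ca_carrier B) (ca_zero B) (ca_add B) (ca_smul B)" unfolding complex_vs_def CX_sel
  by (auto simp: CX_add CX_smul CX_zero add.assoc add.commute mat_scale_add fun_eq_iff)
 fix f g h assume f: "f \<in> ca_carrier B" and g: "g \<in> ca_carrier B"
 show "ca_norm B (ca_mult B f g) \<le> ca_norm B f * ca_norm B g" unfolding CX_sel
  by (rule nm_le) (auto intro!: mult_nonneg_nonneg nm_nonneg f g order_trans[OF mat_opnorm_mult mult_mono] nm_ge)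
next
 fix f assume f: "f \<in> ca_carrier B"
 have m: "(\<lambda>x. mat_adj (f x) ** f x) \<in> ca_carrier B" by (intro CX_mult CX_star f)
 have "nm (\<lambda>x. mat_adj (f x) ** f x) \<le> (nm f)\<^sup>2" by (rule nm_le) (auto simp: mat_opnorm_cstar intro!: power_mono nm_ge[OF f])
 moreover have "(nm f)\<^sup>2 \<le> nm (\<lambda>x. mat_adj (f x) ** f x)"
 proof -
  have "mat_opnorm (f x) \<le> sqrt (nm (\<lambda>x. mat_adj (f x) ** f x))" for x using nm_ge[OF m, of x] by (intro real_le_rsqrt) (simp add: mat_opnorm_cstar)
  then have "nm f \<le> sqrt (nm (\<lambda>x. mat_adj (f x) ** f x))" by (intro nm_le real_sqrt_ge_zero nm_nonneg m)
  then have "(nm f)\<^sup>2 \<le> (sqrt (nm (\<lambda>x. mat_adj (f x) ** f x)))\<^sup>2" by (intro power_mono nm_nonneg f)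
  then show ?thesis using nm_nonneg[OF m] by simp
 qed
 ultimately show "ca_norm B (ca_mult B (ca_star B f) f) = (ca_norm B f)\<^sup>2" unfolding CX_sel by simp
qed (use CX_norm CX_complete in \<open>auto simp: CX_sel CX_mult CX_star matrix_mul_assoc matrix_add_ldistrib matrix_add_mult mat_adj_simps\<close>)

text \<open>From here on the general results on carrier-set algebras, such as
  \<open>rep_contractive\<close> and \<open>matrix_units\<close>, apply to the function
  algebra.\<close>

sublocale calg B by unfold_locales (rule CX_cstar)

lemma mh_eval: "mhom (\<lambda>f. f x)" unfolding mhom_def by (simp add: CX_sel)

end

section \<open>Chebyshev centres and equivariant functions with prescribed values\<close>

text \<open>Chebyshev centres replace Haar averaging: they are continuous and equivariant under isometries.\<close>

definition crad :: "'b::euclidean_space set \<Rightarrow> 'b \<Rightarrow> real" where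
 "crad S c = (SUP s\<in>S. norm (c - s))"

definition cheb :: "'b::euclidean_space set \<Rightarrow> 'b" where
 "cheb S = (SOME c. \<forall>d. crad S c \<le> crad S d)"

lemma crad_ge: assumes "bounded S" "s \<in> S" shows "norm (c - s) \<le> crad S c"
proof -
 obtain b where b: "\<And>s. s \<in> S \<Longrightarrow> norm s \<le> b" using assms(1) by (auto simp: bounded_iff)
 have "norm (c - s) \<le> norm c + b" if "s \<in> S" for s using norm_triangle_ineq4[of c s] b[OF that] by linarith
 then show ?thesis unfolding crad_def using assms(2) by (auto intro!: cSUP_upper bdd_aboveI2)
qed

lemma crad_le: "S \<noteq> {} \<Longrightarrow> (\<And>s. s \<in> S \<Longrightarrow> norm (c - s) \<le> b) \<Longrightarrow> crad S c \<le> b" unfolding crad_def by (rule cSUP_least)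

lemma crad_nonneg: "bounded S \<Longrightarrow> S \<noteq> {} \<Longrightarrow> 0 \<le> crad S c" using crad_ge[of S _ c] norm_ge_zero by (metis all_not_in_conv order_trans)

lemma crad_close:
 assumes "bounded T" "S \<noteq> {}" "\<And>s. s \<in> S \<Longrightarrow> \<exists>t\<in>T. norm (t - s) \<le> \<eta>"
 shows "crad S c \<le> crad T c + \<eta>"
proof (rule crad_le[OF assms(2)])
 fix s assume "s \<in> S"
 then obtain t where t: "t \<in> T" "norm (t - s) \<le> \<eta>" using assms(3) by blast
 show "norm (c - s) \<le> crad T c + \<eta>" using norm_triangle_ineq[of "c - t" "t - s"] crad_ge[OF assms(1) t(1), of c] t(2) by simp
qed

lemma crad_lip: assumes "bounded S" "S \<noteq> {}" shows "crad S c \<le> crad S d + norm (c - d)"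
proof (rule crad_le[OF assms(2)])
 fix s assume s: "s \<in> S"
 show "norm (c - s) \<le> crad S d + norm (c - d)" using norm_triangle_ineq[of "c - d" "d - s"] crad_ge[OF assms(1) s, of d] by simp
qed

lemma cheb_min: assumes "bounded S" "S \<noteq> {}" shows "crad S (cheb S) \<le> crad S d"
proof -
 have "continuous_on UNIV (crad S)"
 proof (rule lipschitz_on_continuous_on[of 1], rule lipschitz_onI)
  fix c d show "dist (crad S c) (crad S d) \<le> 1 * dist c d"
   using crad_lip[OF assms, of c d] crad_lip[OF assms, of d c] by (simp add: dist_norm norm_minus_commute abs_le_iff)
 qed simp
 then have co: "continuous_on (cball s (crad S s)) (crad S)" for s by (rule continuous_on_subset) simp
 obtain s where s: "s \<in> S" using assms(2) by blast
 have "cball s (crad S s) \<noteq> {}" using crad_nonneg[OF assms, of s] by simp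
 then obtain c where c: "\<And>d. d \<in> cball s (crad S s) \<Longrightarrow> crad S c \<le> crad S d" using continuous_attains_inf[OF compact_cball _ co] by blast
 have "crad S c \<le> crad S d" for d
 proof (cases "d \<in> cball s (crad S s)")
  case False
  then have "crad S s < norm (d - s)" by (simp add: dist_norm norm_minus_commute)
  also have "\<dots> \<le> crad S d" by (rule crad_ge[OF assms(1) s])
  finally show ?thesis using c[of s] crad_nonneg[OF assms, of s] by simp
 qed (rule c)
 then have "\<exists>c. \<forall>d. crad S c \<le> crad S d" by blast
 from someI_ex[OF this] show ?thesis unfolding cheb_def by blast
qed

text \<open>The parallelogram law at the midpoint of c and the centre: strong convexity of the
  squared radius. Both uniqueness and continuity of the centre follow from it.\<close>

lemma cheb_strong: assumes S: "bounded S" "S \<noteq> {}"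
 shows "(norm (c - cheb S))\<^sup>2 \<le> 2 * ((crad S c)\<^sup>2 - (crad S (cheb S))\<^sup>2)"
proof -
 define d where "d = cheb S"
 define m where "m = (1/2) *\<^sub>R (c + d)"
 define q where "q = ((crad S c)\<^sup>2 + (crad S d)\<^sup>2) / 2 - (norm (c - d))\<^sup>2 / 4"
 have le: "(norm (m - s))\<^sup>2 \<le> q" if s: "s \<in> S" for s
 proof -
  have "(norm (m - s))\<^sup>2 = ((norm (c - s))\<^sup>2 + (norm (d - s))\<^sup>2) / 2 - (norm (c - d))\<^sup>2 / 4"
   by (simp add: m_def power2_norm_eq_inner inner_diff_left inner_diff_right inner_add_left inner_add_right inner_commute field_simps)
  also have "\<dots> \<le> q" unfolding q_def using crad_ge[OF S(1) s] by (intro diff_right_mono divide_right_mono add_mono power_mono) auto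
  finally show ?thesis .
 qed
 have q: "0 \<le> q" using S(2) le by (meson all_not_in_conv order_trans zero_le_power2)
 have "crad S m \<le> sqrt q" by (rule crad_le[OF S(2)]) (use le in \<open>auto intro: real_le_rsqrt\<close>)
 then have "crad S d \<le> sqrt q" using cheb_min[OF S, of m] by (simp add: d_def)
 then have "(crad S d)\<^sup>2 \<le> (sqrt q)\<^sup>2" by (intro power_mono crad_nonneg S)
 then have "(crad S d)\<^sup>2 \<le> q" using q by simp
 then show ?thesis by (simp add: q_def d_def field_simps)
qed

lemma cheb_unique: assumes S: "bounded S" "S \<noteq> {}" and c: "\<And>d. crad S c \<le> crad S d" shows "cheb S = c"
proof -
 have "(crad S c)\<^sup>2 \<le> (crad S (cheb S))\<^sup>2" by (intro power_mono c crad_nonneg S)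
 then have "2 * ((crad S c)\<^sup>2 - (crad S (cheb S))\<^sup>2) \<le> 0" by simp
 then have "(norm (c - cheb S))\<^sup>2 \<le> 0" by (rule order_trans[OF cheb_strong[OF S]])
 then show ?thesis by simp
qed

text \<open>The centre of T is optimal for S up to 2 \<eta>. With \<rho> the radius of S,
  \<open>cheb_strong\<close> bounds the squared distance by 2 ((\<rho> + 2 \<eta>)^2 - \<rho>^2) = 8
  \<eta> \<rho> + 8 \<eta>^2.\<close>

lemma cheb_near:
 assumes S: "bounded S" "S \<noteq> {}" and T: "bounded T" "T \<noteq> {}"
  and le: "\<And>c. crad S c \<le> crad T c + \<eta>" "\<And>c. crad T c \<le> crad S c + \<eta>"
  and m: "0 \<in> S" "crad S 0 \<le> m" and e: "8 * \<eta> * m + 8 * \<eta>\<^sup>2 < e\<^sup>2" and pos: "0 \<le> \<eta>" "0 < e"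
 shows "norm (cheb T - cheb S) < e"
proof -
 define \<rho> where "\<rho> = crad S (cheb S)"
 have \<rho>: "0 \<le> \<rho>" "\<rho> \<le> m" using cheb_min[OF S, of 0] m crad_nonneg[OF S] by (auto simp: \<rho>_def)
 have "crad S (cheb T) \<le> \<rho> + 2 * \<eta>" using le(1)[of "cheb T"] cheb_min[OF T, of "cheb S"] le(2)[of "cheb S"] by (simp add: \<rho>_def)
 then have "(crad S (cheb T))\<^sup>2 \<le> (\<rho> + 2 * \<eta>)\<^sup>2" by (intro power_mono crad_nonneg S)
 then have "(norm (cheb T - cheb S))\<^sup>2 \<le> 8 * \<eta> * \<rho> + 8 * \<eta>\<^sup>2"
  using cheb_strong[OF S, of "cheb T"] unfolding \<rho>_def[symmetric] by (simp add: power2_eq_square algebra_simps)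
 also have "\<dots> \<le> 8 * \<eta> * m + 8 * \<eta>\<^sup>2" using \<rho> pos by (intro add_right_mono mult_left_mono) auto
 finally have "(norm (cheb T - cheb S))\<^sup>2 < e\<^sup>2" using e by linarith
 then show ?thesis using pos(2) by (simp add: power2_less_imp_less)
qed

lemma cheb_image:
 assumes S: "bounded S" "S \<noteq> {}" and iso: "\<And>a b. norm (\<phi> a - \<phi> b) = norm (a - b)" and surj: "surj \<phi>"
 shows "cheb (\<phi> ` S) = \<phi> (cheb S)"
proof (rule cheb_unique)
 obtain b where b: "\<And>s. s \<in> S \<Longrightarrow> norm s \<le> b" using S(1) by (auto simp: bounded_iff)
 have "norm (\<phi> s) \<le> norm (\<phi> 0) + b" if "s \<in> S" for s using norm_triangle_ineq[of "\<phi> s - \<phi> 0" "\<phi> 0"] iso[of s 0] b[OF that] by simp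
 then show "bounded (\<phi> ` S)" by (auto simp: bounded_iff)
 have cr: "crad (\<phi> ` S) (\<phi> c) = crad S c" for c by (simp add: crad_def image_image iso)
 fix d
 obtain d' where "d = \<phi> d'" using surj by (metis surjE)
 then show "crad (\<phi> ` S) (\<phi> (cheb S)) \<le> crad (\<phi> ` S) d" using cheb_min[OF S, of d'] by (simp add: cr)
qed (use S in simp)

lemma cheb_zero [simp]: "cheb {0} = 0" by (rule cheb_unique) (auto simp: crad_def)

lemma crad_pair: "crad {0, M} c = max (norm c) (norm (c - M))" by (simp add: crad_def cSup_insert sup_max)

lemma cheb_pair: "cheb {0, M} = (1/2) *\<^sub>R M"
proof (rule cheb_unique)
 fix d
 have "(1/2) *\<^sub>R M - M = - ((1/2) *\<^sub>R M)" by (simp add: algebra_simps flip: scaleR_add_left)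
 then have "crad {0, M} ((1/2) *\<^sub>R M) = norm M / 2" by (simp add: crad_pair)
 then show "crad {0, M} ((1/2) *\<^sub>R M) \<le> crad {0, M} d" using norm_triangle_ineq4[of d "d - M"] by (simp add: crad_pair max_def)
qed simp_all

lemma norm_sq_entries: "(norm (N :: complex^'n^'n))\<^sup>2 = (\<Sum>i\<in>UNIV. \<Sum>j\<in>UNIV. (cmod (N $ i $ j))\<^sup>2)" by (simp add: power2_norm_eq_inner inner_vec_def)

lemma norm_sq_cols: "(norm (N :: complex^'n^'n))\<^sup>2 = (\<Sum>j\<in>UNIV. (norm (N *v axis j 1))\<^sup>2)"
proof -
 have "(norm (N *v axis j 1))\<^sup>2 = (\<Sum>i\<in>UNIV. (cmod (N $ i $ j))\<^sup>2)" for j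
 proof -
  have "(N *v axis j 1) $ i = N $ i $ j" for i by (simp add: matrix_vector_mult_def axis_def if_distrib cong: if_cong)
  then show ?thesis by (simp add: power2_norm_eq_inner[of "N *v axis j 1"] inner_vec_def power2_norm_eq_inner)
 qed
 then show ?thesis unfolding norm_sq_entries by (subst sum.swap) simp
qed

lemma norm_mat_adj: "norm (mat_adj N) = norm (N :: complex^'n^'n)"
proof -
 have "(norm (mat_adj N))\<^sup>2 = (norm N)\<^sup>2" unfolding norm_sq_entries mat_adj_def by (subst sum.swap) simp
 then show ?thesis by simp
qed

lemma norm_unitary_mult: assumes "unitary_mat U" shows "norm (U ** M) = norm (M :: complex^'n^'n)"
proof -
 have "(norm (U ** M))\<^sup>2 = (norm M)\<^sup>2" unfolding norm_sq_cols by (simp add: unitary_norm[OF assms] flip: matrix_vector_mul_assoc)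
 then show ?thesis by simp
qed

lemma norm_unitary_conj: assumes U: "unitary_mat U" shows "norm (U ** M ** mat_adj U) = norm (M :: complex^'n^'n)"
proof -
 have "norm (U ** M ** mat_adj U) = norm (U ** mat_adj (U ** M))" using norm_mat_adj[of "U ** M ** mat_adj U"] by (simp add: matrix_mul_assoc)
 then show ?thesis by (simp only: norm_unitary_mult[OF U] norm_mat_adj)
qed

lemma norm_mat_scale_real: "norm (mat_scale (of_real t) M - mat_scale (of_real u) M) = \<bar>t - u\<bar> * norm (M :: complex^'n^'n)"
proof -
 have "mat_scale (of_real t) M = t *\<^sub>R M" for t by (simp add: mat_scale_def vec_eq_iff flip: scaleR_conv_of_real)
 then show ?thesis by (simp flip: scaleR_left_diff_distrib)
qed

lemma small_eta: assumes "0 < e" "0 \<le> (m::real)" obtains \<eta> where "0 < \<eta>" "8 * \<eta> * m + 8 * \<eta>\<^sup>2 < e\<^sup>2"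
proof (rule that)
 define \<eta> where "\<eta> = min 1 (e\<^sup>2 / (16 * (m + 1)))"
 show p: "0 < min 1 (e\<^sup>2 / (16 * (m + 1)))" using assms by simp
 have "\<eta>\<^sup>2 \<le> \<eta> * 1" unfolding power2_eq_square using p by (intro mult_left_mono) (auto simp: \<eta>_def)
 moreover have "\<eta> \<le> e\<^sup>2 / (16 * (m + 1))" by (simp add: \<eta>_def)
 then have "16 * (\<eta> * m) + 16 * \<eta> \<le> e\<^sup>2" using assms by (simp add: pos_le_divide_eq algebra_simps)
 moreover have "0 < e\<^sup>2" using assms(1) by simp
 ultimately have "8 * (\<eta> * m) + 8 * \<eta>\<^sup>2 < e\<^sup>2" by linarith
 then have "8 * \<eta> * m + 8 * \<eta>\<^sup>2 < e\<^sup>2" by (simp add: mult.assoc)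
 then show "8 * min 1 (e\<^sup>2 / (16 * (m + 1))) * m + 8 * (min 1 (e\<^sup>2 / (16 * (m + 1))))\<^sup>2 < e\<^sup>2" by (simp add: \<eta>_def)
qed

context nsp
begin

abbreviation "UU \<equiv> {U :: complex^'n^'n. unitary_mat U}"

lemma UU_compact: "compactin (top_of_set UU) UU" unfolding compactin_subtopology using compact_unitary by simp

lemma act_adj_cont: "continuous_map (prod_topology (top_of_set UU) X) X (\<lambda>p. act (mat_adj (fst p)) (snd p))"
proof -
 have a: "continuous_map (top_of_set UU) (top_of_set UU) mat_adj" by (simp add: continuous_map_in_subtopology Pi_iff) (intro continuous_intros)
 have "continuous_map (prod_topology (top_of_set UU) X) (prod_topology (top_of_set UU) X) (\<lambda>p. (mat_adj (fst p), snd p))"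
  by (intro continuous_map_pairedI continuous_map_snd continuous_map_compose[OF continuous_map_fst a, unfolded o_def])
 from continuous_map_compose[OF this act_cont] show ?thesis by (simp add: o_def)
qed

lemma orbit_cont: assumes "x \<in> topspace X" shows "continuous_map (top_of_set UU) X (\<lambda>U. act (mat_adj U) x)"
proof -
 have "continuous_map (top_of_set UU) (prod_topology (top_of_set UU) X) (\<lambda>U. (U, x))"
  by (intro continuous_map_pairedI) (use assms in \<open>auto simp: id_def[symmetric]\<close>)
 from continuous_map_compose[OF this act_adj_cont] show ?thesis by (simp add: o_def)
qed

text \<open>The tube lemma: compactness of the unitary group makes continuity at x uniform in
  U.\<close>

lemma uniform_k:
 assumes k: "continuous_map X euclideanreal k" and x: "x \<in> topspace X" and \<eta>: "0 < \<eta>"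
 obtains Q where "openin X Q" "x \<in> Q" "\<And>y U. y \<in> Q \<Longrightarrow> unitary_mat U \<Longrightarrow> \<bar>k (act (mat_adj U) y) - k (act (mat_adj U) x)\<bar> < \<eta>"
proof -
 let ?P = "prod_topology (top_of_set UU) X"
 have 1: "continuous_map ?P euclideanreal (\<lambda>p. k (act (mat_adj (fst p)) (snd p)))"
  using continuous_map_compose[OF act_adj_cont k] by (simp add: o_def)
 have 2: "continuous_map ?P euclideanreal (\<lambda>p. k (act (mat_adj (fst p)) x))"
  using continuous_map_compose[OF continuous_map_compose[OF continuous_map_fst orbit_cont[OF x]] k] by (simp add: o_def)
 have "continuous_map ?P euclideanreal (\<lambda>p. \<bar>k (act (mat_adj (fst p)) (snd p)) - k (act (mat_adj (fst p)) x)\<bar>)" by (intro continuous_intros 1 2)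
 then have W: "openin ?P {p \<in> topspace ?P. \<bar>k (act (mat_adj (fst p)) (snd p)) - k (act (mat_adj (fst p)) x)\<bar> \<in> {..<\<eta>}}" (is "openin ?P ?W")
  by (rule openin_continuous_map_preimage) simp
 have s: "compactin X {x}" using x by simp
 obtain U Q where Q: "openin X Q" "UU \<subseteq> U" "{x} \<subseteq> Q" "U \<times> Q \<subseteq> ?W" by (rule Wallace_theorem_prod_topology[OF UU_compact s W]) (use x \<eta> in auto)
 show ?thesis
 proof (rule that[OF Q(1)])
  fix y and V :: "complex^'n^'n" assume "y \<in> Q" "unitary_mat V"
  then have "(V, y) \<in> ?W" using Q(2,4) by blast
  then show "\<bar>k (act (mat_adj V) y) - k (act (mat_adj V) x)\<bar> < \<eta>" by simp
 qed (use Q(3) in simp)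
qed

text \<open>The values whose group average would be the natural equivariant extension of M; the
  centre of this set takes the place of the average. The point 0 is inserted so that at a suitable
  point the set is close to the segment from 0 to M with both ends present, which fixes its centre
  near M / 2.\<close>

definition tset :: "('x \<Rightarrow> real) \<Rightarrow> complex^'n^'n \<Rightarrow> 'x \<Rightarrow> (complex^'n^'n) set" where
 "tset k M y = insert 0 ((\<lambda>U. mat_scale (of_real (k (act (mat_adj U) y))) (U ** M ** mat_adj U)) ` UU)"

lemma tset_bounded:
 assumes k: "\<forall>y\<in>topspace X. 0 \<le> k y \<and> k y \<le> 1" and y: "y \<in> topspace X"
 shows "\<And>s. s \<in> tset k M y \<Longrightarrow> norm s \<le> norm M" "bounded (tset k M y)" "tset k M y \<noteq> {}" "0 \<in> tset k M y" "crad (tset k M y) 0 \<le> norm M"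
proof -
 show le: "norm s \<le> norm M" if sm: "s \<in> tset k M y" for s
 proof (cases "s = 0")
  case False
  then obtain U where U: "unitary_mat U" "s = mat_scale (of_real (k (act (mat_adj U) y))) (U ** M ** mat_adj U)"
   using sm unfolding tset_def by blast
  let ?t = "k (act (mat_adj U) y)"
  have "norm s = \<bar>?t\<bar> * norm M" using norm_mat_scale_real[of ?t "U ** M ** mat_adj U" 0] U by (simp add: norm_unitary_conj)
  also have "\<dots> \<le> 1 * norm M" using k act_in[OF y, of "mat_adj U"] U(1) by (intro mult_right_mono) auto
  finally show ?thesis by simp
 qed simp
 then show "bounded (tset k M y)" by (auto simp: bounded_iff)
 show ne: "tset k M y \<noteq> {}" "0 \<in> tset k M y" by (auto simp: tset_def)
 show "crad (tset k M y) 0 \<le> norm M" by (rule crad_le[OF ne(1)]) (use le in simp)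
qed

lemma tset_act:
 assumes y: "y \<in> topspace X" and W: "unitary_mat W"
 shows "tset k M (act W y) = (\<lambda>N. W ** N ** mat_adj W) ` tset k M y"
proof -
 have 1: "mat_scale (of_real (k (act (mat_adj U) (act W y)))) (U ** M ** mat_adj U)
   = W ** mat_scale (of_real (k (act (mat_adj U') y))) (U' ** M ** mat_adj U') ** mat_adj W"
  if U: "unitary_mat U" and U': "U' = mat_adj W ** U" for U U'
 proof -
  have "act (mat_adj U) (act W y) = act (mat_adj U') y" using U W y by (simp add: U' act_mult[symmetric])
  moreover have "U = W ** U'" using W by (simp add: U' matrix_mul_assoc unitary_mat_def)
  ultimately show ?thesis by (simp add: matrix_mul_assoc)
 qed
 have "(\<lambda>U. mat_scale (of_real (k (act (mat_adj U) (act W y)))) (U ** M ** mat_adj U)) ` UU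
   = (\<lambda>U. W ** mat_scale (of_real (k (act (mat_adj U) y))) (U ** M ** mat_adj U) ** mat_adj W) ` UU" (is "?f ` UU = ?g ` UU")
 proof (intro subset_antisym subsetI)
  fix N assume "N \<in> ?f ` UU"
  then obtain U where U: "unitary_mat U" "N = ?f U" by blast
  have "N = ?g (mat_adj W ** U)" using 1[OF U(1) refl] U(2) by simp
  then show "N \<in> ?g ` UU" by (rule image_eqI) (use unitary_mult[of "mat_adj W" U] U(1) W in simp)
 next
  fix N assume "N \<in> ?g ` UU"
  then obtain U where U: "unitary_mat U" "N = ?g U" by blast
  have "U = mat_adj W ** (W ** U)" using W by (simp add: matrix_mul_assoc unitary_mat_def)
  then have "N = ?f (W ** U)" using 1[OF unitary_mult[OF W U(1)], of U] U(2) by simp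
  then show "N \<in> ?f ` UU" by (rule image_eqI) (use unitary_mult[OF W U(1)] in simp)
 qed
 then show ?thesis by (simp add: tset_def image_image)
qed

text \<open>Continuity combines \<open>uniform_k\<close> with \<open>cheb_near\<close>; equivariance
  holds because conjugation by a unitary is an isometry for the Euclidean norm.\<close>

lemma tset_center:
 assumes k: "continuous_map X euclideanreal k" "\<forall>y\<in>topspace X. 0 \<le> k y \<and> k y \<le> 1"
  and K: "compactin X K" "\<And>y. y \<in> topspace X \<Longrightarrow> y \<notin> K \<Longrightarrow> k y = 0"
 shows "(\<lambda>y. if y \<in> topspace X then cheb (tset k M y) else 0) \<in> ca_carrier B" (is "?f \<in> _")
proof (rule CX_I)
 note tb = tset_bounded[OF k(2)]
 have "continuous_map X Met_TC.mtopology ?f" unfolding Met_TC.continuous_map_to_metric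
 proof (intro ballI allI impI)
  fix x and e :: real assume x: "x \<in> topspace X" and e: "0 < e"
  obtain \<eta> where \<eta>: "0 < \<eta>" "8 * \<eta> * norm M + 8 * \<eta>\<^sup>2 < e\<^sup>2" using small_eta[OF e norm_ge_zero] by blast
  have "0 < \<eta> / (norm M + 1)" using \<eta> by (simp add: add_nonneg_pos)
  then obtain Q where Q: "openin X Q" "x \<in> Q" "\<And>y U. y \<in> Q \<Longrightarrow> unitary_mat U \<Longrightarrow> \<bar>k (act (mat_adj U) y) - k (act (mat_adj U) x)\<bar> < \<eta> / (norm M + 1)"
   using uniform_k[OF k(1) x] by blast
  have "norm (cheb (tset k M y) - cheb (tset k M x)) < e" if y: "y \<in> Q" for y
  proof -
   have yX: "y \<in> topspace X" using y Q(1) openin_subset by blast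
   have d: "norm (mat_scale (of_real (k (act (mat_adj U) y))) (U ** M ** mat_adj U) - mat_scale (of_real (k (act (mat_adj U) x))) (U ** M ** mat_adj U)) \<le> \<eta>"
    if U: "unitary_mat U" for U
   proof -
    have "\<bar>k (act (mat_adj U) y) - k (act (mat_adj U) x)\<bar> * norm M \<le> \<eta> / (norm M + 1) * (norm M + 1)" using Q(3)[OF y U] by (intro mult_mono) auto
    also have "\<dots> = \<eta>" using norm_ge_zero[of M] by (simp add: add_nonneg_eq_0_iff)
    finally show ?thesis by (simp add: norm_mat_scale_real norm_unitary_conj[OF U])
   qed
   have 1: "\<exists>t\<in>tset k M y. norm (t - s) \<le> \<eta>" if "s \<in> tset k M x" for s using that d \<eta>(1) by (force simp: tset_def)
   have 2: "\<exists>t\<in>tset k M x. norm (t - s) \<le> \<eta>" if "s \<in> tset k M y" for s using that d \<eta>(1) by (force simp: tset_def norm_minus_commute)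
   show ?thesis by (rule cheb_near[OF tb(2,3)[OF x] tb(2,3)[OF yX] _ _ tb(4)[OF x] tb(5)[OF x] \<eta>(2)])
      (use \<eta> e crad_close[OF tb(2)[OF yX] tb(3)[OF x] 1] crad_close[OF tb(2)[OF x] tb(3)[OF yX] 2] in auto)
  qed
  then show "\<exists>Q. openin X Q \<and> x \<in> Q \<and> (\<forall>y\<in>Q. ?f y \<in> Met_TC.mball (?f x) e)"
   using Q(1,2) x openin_subset[OF Q(1)] by (intro exI[of _ Q]) (auto simp: dist_norm norm_minus_commute)
 qed
 then show "continuous_map X euclidean ?f" by simp
 fix e :: real assume e: "0 < e"
 \<comment> \<open>The saturation of K is compact, and off it k vanishes along the whole orbit, so
   the set shrinks to {0}.\<close>
 let ?L = "(\<lambda>p. act (mat_adj (fst p)) (snd p)) ` (UU \<times> K)"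
 have "compactin (prod_topology (top_of_set UU) X) (UU \<times> K)" unfolding compactin_Times using UU_compact K(1) by blast
 then have L: "compactin X ?L" by (rule image_compactin[OF _ act_adj_cont])
 show "\<exists>K. compactin X K \<and> (\<forall>x\<in>topspace X - K. mat_opnorm (?f x) < e)"
 proof (rule CX_vanish_comp[OF L])
  fix y assume y: "y \<in> topspace X" "y \<notin> ?L"
  have "k (act (mat_adj U) y) = 0" if U: "unitary_mat U" for U
  proof (rule ccontr)
   assume n: "k (act (mat_adj U) y) \<noteq> 0"
   have yU: "act (mat_adj U) y \<in> K" using K(2)[OF act_in[OF y(1), of "mat_adj U"]] U n by auto
   have "act (mat_adj (mat_adj U)) (act (mat_adj U) y) = y" using act_inv(2)[OF y(1) U] by simp
   then have "y \<in> ?L" using yU U by (intro image_eqI[of _ _ "(mat_adj U, act (mat_adj U) y)"]) auto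
   then show False using y(2) by blast
  qed
  then have "tset k M y = {0}" by (auto simp: tset_def)
  then show "mat_opnorm (?f y) < e" using e by simp
 qed
next
 fix W :: "complex^'n^'n" and x assume x: "x \<in> topspace X" and W: "unitary_mat W"
 have "cheb (tset k M (act W x)) = W ** cheb (tset k M x) ** mat_adj W" unfolding tset_act[OF x W]
 proof (rule cheb_image[OF tset_bounded(2,3)[OF k(2) x]])
  show "norm (W ** a ** mat_adj W - W ** b ** mat_adj W) = norm (a - b)" for a b
   using norm_unitary_conj[OF W, of "a - b"] matrix_add_ldistrib[of W "a - b" b] by (simp add: matrix_add_mult)
  have "N = W ** (mat_adj W ** N ** W) ** mat_adj W" for N using W by (simp add: unitary_mat_def matrix_mul_assoc) (simp add: unitary_mat_def flip: matrix_mul_assoc)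
  then show "surj (\<lambda>N. W ** N ** mat_adj W)" by (rule surjI[OF sym])
 qed
 then show "?f (act W x) = W ** ?f x ** mat_adj W" using x act_in[OF x W] by simp
qed simp

text \<open>The point t N is within \<eta> of the segment from 0 to M, and the farthest point of a
  segment is one of its ends.\<close>

lemma scale_segment:
 fixes M N :: "complex^'n^'n"
 assumes t: "0 \<le> t" "t \<le> 1" and N: "norm (M - N) \<le> \<eta>"
 shows "norm (c - mat_scale (of_real t) N) \<le> crad {0, M} c + \<eta>"
proof -
 have sc: "mat_scale (of_real t) N = t *\<^sub>R N" by (simp add: mat_scale_def vec_eq_iff flip: scaleR_conv_of_real)
 have "c - t *\<^sub>R N = (1 - t) *\<^sub>R c + (t *\<^sub>R (c - M) + t *\<^sub>R (M - N))" by (simp add: algebra_simps)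
 then have "norm (c - t *\<^sub>R N) \<le> norm ((1 - t) *\<^sub>R c) + (norm (t *\<^sub>R (c - M)) + norm (t *\<^sub>R (M - N)))"
  by (simp only:) (rule order_trans[OF norm_triangle_ineq add_left_mono[OF norm_triangle_ineq]])
 also have "\<dots> \<le> (1 - t) * crad {0, M} c + (t * crad {0, M} c + 1 * \<eta>)"
 proof -
  have "t * norm (M - N) \<le> 1 * \<eta>" using t N by (intro mult_mono) auto
  then show ?thesis using t by (auto simp: crad_pair intro!: add_mono mult_left_mono)
 qed
 also have "\<dots> = crad {0, M} c + \<eta>" by (simp add: algebra_simps)
 finally show ?thesis by (simp add: sc)
qed

text \<open>The function k is 1 at x0 and vanishes at those translates of x0 by the inverse of U for
  which conjugation by U moves M far. They differ from x0 because, by freeness, stabilisers are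
  scalar and fix M. What survives of \<open>tset\<close> at x0 is close to the segment from 0 to M,
  whose centre is M / 2.\<close>

lemma bump_eval:
 assumes x0: "x0 \<in> topspace X" and E: "closedin X E" "x0 \<notin> E" and e: "0 < e"
 obtains f where "f \<in> ca_carrier B" "norm (f x0 - (1/2) *\<^sub>R M) < e"
  "\<And>y. y \<in> topspace X \<Longrightarrow> (\<And>U. unitary_mat U \<Longrightarrow> act U y \<in> E) \<Longrightarrow> f y = 0"
proof -
 obtain \<eta> where \<eta>: "0 < \<eta>" "8 * \<eta> * norm M + 8 * \<eta>\<^sup>2 < e\<^sup>2" using small_eta[OF e norm_ge_zero] by blast
 obtain U0 K0 where U0: "openin X U0" "compactin X K0" "x0 \<in> U0" "U0 \<subseteq> K0" using lcomp x0 unfolding locally_compact_space_def by blast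
 define bad where "bad = UU \<inter> {U. \<eta> \<le> norm (M - U ** M ** mat_adj U)}"
 have "closed {U. \<eta> \<le> norm (M - U ** M ** mat_adj U)}" by (intro closed_Collect_le continuous_intros)
 then have "compact bad" unfolding bad_def by (rule compact_Int_closed[OF compact_unitary])
 then have cb: "compactin (top_of_set UU) bad" by (auto simp: compactin_subtopology bad_def)
 define C0 where "C0 = (\<lambda>U. act (mat_adj U) x0) ` bad"
 have C0: "closedin X C0" unfolding C0_def by (intro compactin_imp_closedin Hausdorff image_compactin[OF cb orbit_cont[OF x0]])
 have xC: "x0 \<notin> C0"
 proof
  assume "x0 \<in> C0"
  then obtain U where U: "unitary_mat U" "\<eta> \<le> norm (M - U ** M ** mat_adj U)" "act (mat_adj U) x0 = x0" unfolding C0_def bad_def by force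
  obtain c where c: "mat_adj U = mat c" using act_free[OF x0 _ U(3)] U(1) by auto
  have "U ** M ** mat_adj U = U ** mat_adj U ** M" by (simp add: c mat_mult_scale)
  also have "\<dots> = M" using U(1) by (simp add: unitary_mat_def)
  finally show False using U(2) \<eta>(1) by simp
 qed
 define E1 where "E1 = E \<union> (topspace X - U0) \<union> C0"
 have E1: "closedin X E1" unfolding E1_def by (intro closedin_Un E C0 closedin_diff closedin_topspace U0)
 have "x0 \<in> topspace X - E1" using x0 E(2) xC U0(3) by (simp add: E1_def)
 moreover have "completely_regular_space X" by (rule locally_compact_regular_imp_completely_regular_space[OF lcomp]) (simp add: Hausdorff)
 ultimately obtain g :: "'x \<Rightarrow> real" where g: "continuous_map X (top_of_set {0..1}) g" "g x0 = 0" "g ` E1 \<subseteq> {1}"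
  using E1 unfolding completely_regular_space_def by blast
 define k where "k = (\<lambda>y. 1 - g y)"
 have gc: "continuous_map X euclideanreal g" and g01: "\<And>y. y \<in> topspace X \<Longrightarrow> g y \<in> {0..1}"
  using g(1) by (auto simp: continuous_map_in_subtopology Pi_iff)
 have kc: "continuous_map X euclideanreal k" unfolding k_def by (intro continuous_intros gc)
 have k01: "\<forall>y\<in>topspace X. 0 \<le> k y \<and> k y \<le> 1" using g01 by (simp add: k_def)
 have k0: "k y = 0" if "y \<in> E1" for y using that g(3) by (auto simp: k_def)
 have k1: "k x0 = 1" by (simp add: k_def g)
 let ?f = "\<lambda>y. if y \<in> topspace X then cheb (tset k M y) else 0"
 have f: "?f \<in> ca_carrier B" by (rule tset_center[OF kc k01 U0(2)]) (use U0(4) in \<open>auto intro!: k0 simp: E1_def\<close>)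
 note tb = tset_bounded[OF k01 x0]
 have mem: "{0, M} \<subseteq> tset k M x0"
 proof -
  have "M = mat_scale (of_real (k (act (mat_adj (mat 1)) x0))) (mat 1 ** M ** mat_adj (mat 1))" by (simp add: act_one[OF x0] k1)
  then have "M \<in> tset k M x0" unfolding tset_def by (intro insertI2 image_eqI[of _ _ "mat 1"]) auto
  then show ?thesis using tb(4) by simp
 qed
 have le1: "crad {0, M} c \<le> crad (tset k M x0) c + \<eta>" for c by (rule crad_close[OF tb(2)]) (use mem \<eta>(1) in force)+
 have le2: "crad (tset k M x0) c \<le> crad {0, M} c + \<eta>" for c
 proof (rule crad_le[OF tb(3)])
  fix s assume s: "s \<in> tset k M x0"
  show "norm (c - s) \<le> crad {0, M} c + \<eta>"
  proof (cases "s = 0")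
   case True
   then show ?thesis using \<eta>(1) by (simp add: crad_pair)
  next
   case False
   then obtain U where U: "unitary_mat U" "s = mat_scale (of_real (k (act (mat_adj U) x0))) (U ** M ** mat_adj U)"
    using s unfolding tset_def by blast
   have "U \<notin> bad"
   proof
    assume "U \<in> bad"
    then have "k (act (mat_adj U) x0) = 0" by (intro k0) (auto simp: E1_def C0_def)
    then show False using False U(2) by simp
   qed
   then have "norm (M - U ** M ** mat_adj U) \<le> \<eta>" using U(1) by (simp add: bad_def)
   then show ?thesis unfolding U(2) using k01 act_in[OF x0, of "mat_adj U"] U(1) by (intro scale_segment) auto
  qed
 qed
 have "norm (cheb (tset k M x0) - cheb {0, M}) < e" by (rule cheb_near[OF _ _ tb(2,3) le1 le2 _ _ \<eta>(2)]) (use \<eta> e in \<open>auto simp: crad_pair\<close>)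
 then have n: "norm (?f x0 - (1/2) *\<^sub>R M) < e" using x0 by (simp add: cheb_pair)
 show ?thesis
 proof (rule that[OF f n])
  fix y assume y: "y \<in> topspace X" "\<And>U. unitary_mat U \<Longrightarrow> act U y \<in> E"
  have "k (act (mat_adj U) y) = 0" if "unitary_mat U" for U using y(2)[of "mat_adj U"] that by (intro k0) (simp add: E1_def)
  then have "tset k M y = {0}" by (auto simp: tset_def)
  then show "?f y = 0" by simp
 qed
qed

text \<open>The image is a linear subspace, hence closed, and it is dense by
  \<open>bump_eval\<close> applied to 2 M.\<close>

theorem eval_surj: assumes x: "x \<in> topspace X" shows "(\<lambda>f. f x) ` ca_carrier B = UNIV"
proof -
 let ?S = "(\<lambda>f. f x) ` ca_carrier B"
 have "subspace ?S" unfolding subspace_def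
 proof (intro conjI ballI allI)
  show "0 \<in> ?S" using CX_zero by force
  fix a assume "a \<in> ?S"
  then obtain f where f: "f \<in> ca_carrier B" "a = f x" by blast
  show "c *\<^sub>R a \<in> ?S" for c
  proof -
   have "c *\<^sub>R a = (\<lambda>y. mat_scale (of_real c) (f y)) x" by (simp add: f mat_scale_def vec_eq_iff flip: scaleR_conv_of_real)
   then show ?thesis using CX_smul[OF f(1)] by (intro image_eqI) auto
  qed
  fix b assume "b \<in> ?S"
  then obtain g where g: "g \<in> ca_carrier B" "b = g x" by blast
  have "a + b = (\<lambda>y. f y + g y) x" by (simp add: f g)
  then show "a + b \<in> ?S" using CX_add[OF f(1) g(1)] by (intro image_eqI) auto
 qed
 then have cl: "closed ?S" by (rule closed_subspace)
 have "M \<in> ?S" for M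
 proof -
  have "\<exists>N\<in>?S. dist N M < e" if e: "0 < e" for e
  proof -
   obtain f where "f \<in> ca_carrier B" "norm (f x - (1/2) *\<^sub>R (2 *\<^sub>R M)) < e" using bump_eval[OF x closedin_empty _ e, of "2 *\<^sub>R M"] by blast
   then show ?thesis by (intro bexI[of _ "f x"]) (auto simp: dist_norm)
  qed
  then have "M \<in> closure ?S" by (simp add: closure_approachable)
  then show ?thesis using cl by simp
 qed
 then show ?thesis by blast
qed

text \<open>On one orbit, if every f agrees at x and at U x, then U commutes with all matrices, so
  it is scalar and acts trivially. For different orbits a bump at x vanishes on the orbit of
  y.\<close>

theorem CX_separates: assumes x: "x \<in> topspace X" and y: "y \<in> topspace X" and ne: "x \<noteq> y"
 obtains f where "f \<in> ca_carrier B" "f x \<noteq> f y"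
proof (cases "\<exists>U. unitary_mat U \<and> y = act U x")
 case True
 then obtain U where U: "unitary_mat U" "y = act U x" by blast
 have "\<exists>f\<in>ca_carrier B. f x \<noteq> f y"
 proof (rule ccontr)
  assume a: "\<not> ?thesis"
  have "U ** M = M ** U" for M
  proof -
   obtain f where f: "f \<in> ca_carrier B" "f x = M" using eval_surj[OF x] by (metis (no_types, lifting) UNIV_I imageE)
   have "U ** M ** mat_adj U = M" using a f CX_D(3)[OF f(1) x U(1)] U(2) by metis
   then have "U ** M ** mat_adj U ** U = M ** U" by simp
   then show ?thesis using U(1) by (simp add: unitary_mat_def flip: matrix_mul_assoc)
  qed
  then obtain c where c: "U = mat c" using commute_scalar by blast
  have "mat (c * cnj c) = (mat 1 :: complex^'n^'n)"
  proof -
   have "U ** mat_adj U = mat 1" using U(1) by (simp add: unitary_mat_def)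
   moreover have "mat_adj (mat c) = (mat (cnj c) :: complex^'n^'n)" by (simp add: mat_adj_def mat_def vec_eq_iff)
   moreover have "mat c ** mat (cnj c) = (mat (c * cnj c) :: complex^'n^'n)"
    unfolding mat_mult_scale(1) by (simp add: mat_scale_def mat_def vec_eq_iff)
   ultimately show ?thesis by (simp add: c)
  qed
  then have "(mat (c * cnj c) :: complex^'n^'n) $ undefined $ undefined = (mat 1 :: complex^'n^'n) $ undefined $ undefined" by simp
  then have "c * cnj c = 1" by (simp add: mat_def)
  then have "cmod c = 1" using complex_norm_square[of c] by (simp add: power2_eq_1_iff flip: of_real_power) (smt (verit) norm_ge_zero)
  then have "act (mat c ** mat 1) x = act (mat 1) x"
   using nsp_conj[THEN conjunct2, THEN conjunct2, THEN conjunct2, THEN conjunct2, THEN conjunct2, THEN conjunct1] x unitary_one by blast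
  then show False using ne U(2) c x by (simp add: act_one)
 qed
 then show ?thesis using that by blast
next
 case False
 define E where "E = (\<lambda>U. act (mat_adj U) y) ` UU"
 have "closedin X E" unfolding E_def by (intro compactin_imp_closedin Hausdorff image_compactin[OF UU_compact orbit_cont[OF y]])
 moreover have "x \<notin> E"
 proof
  assume "x \<in> E"
  then obtain U where "unitary_mat U" "x = act (mat_adj U) y" unfolding E_def by blast
  then show False using False act_inv(2)[OF y] by metis
 qed
 ultimately obtain f where f: "f \<in> ca_carrier B" "norm (f x - (1/2) *\<^sub>R (2 *\<^sub>R mat 1)) < 1"
  "\<And>w. w \<in> topspace X \<Longrightarrow> (\<And>U. unitary_mat U \<Longrightarrow> act U w \<in> E) \<Longrightarrow> f w = 0" by (rule bump_eval[OF x, of E 1 "2 *\<^sub>R mat 1"]) auto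
 have "f y = 0"
 proof (rule f(3)[OF y])
  fix U :: "complex^'n^'n" assume "unitary_mat U"
  then show "act U y \<in> E" unfolding E_def by (intro image_eqI[of _ _ "mat_adj U"]) auto
 qed
 moreover have "f x \<noteq> 0"
 proof
  assume "f x = 0"
  then have "norm (mat 1 :: complex^'n^'n) < 1" using f(2) by simp
  moreover have "norm ((mat 1 :: complex^'n^'n) $ undefined $ undefined) \<le> norm (mat 1 :: complex^'n^'n)"
   by (rule order_trans[OF Finite_Cartesian_Product.norm_nth_le Finite_Cartesian_Product.norm_nth_le])
  ultimately show False by (simp add: mat_def)
 qed
 ultimately show ?thesis using that f(1) by simp
qed

end

section \<open>Irreducible representations of the function algebra\<close>

context calg
begin

lemma annih_closed:
 assumes H: "hilbert_space H" and rep: "is_rep A H \<pi>" and S: "S \<subseteq> V"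
 shows "closed_subspace H {w \<in> hs_carrier H. \<forall>a\<in>S. \<pi> a w = hs_zero H}" (is "closed_subspace H ?K")
proof -
 interpret H: hilb H by unfold_locales (rule H)
 note R = is_repD[OF rep]
 have iff: "\<pi> a w = hs_zero H \<longleftrightarrow> (\<forall>y\<in>hs_carrier H. hs_inner H w (\<pi> (star a) y) = 0)" if a: "a \<in> V" and w: "w \<in> hs_carrier H" for a w
 proof
  assume "\<pi> a w = hs_zero H"
  then show "\<forall>y\<in>hs_carrier H. hs_inner H w (\<pi> (star a) y) = 0" using R(7)[OF a w] by simp
 next
  assume "\<forall>y\<in>hs_carrier H. hs_inner H w (\<pi> (star a) y) = 0"
  then show "\<pi> a w = hs_zero H" using R(1)[OF a w] R(7)[OF a w] by (intro H.ip_eqI) auto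
 qed
 show ?thesis unfolding closed_subspace_def
 proof (intro conjI ballI allI impI)
  show "hs_zero H \<in> ?K" using S R(1) by (auto simp: iff subset_iff)
  fix x assume x: "x \<in> ?K"
  show "hs_smul H c x \<in> ?K" for c using x S R(1) H.vs by (auto simp: iff subset_iff complex_vs_def)
  fix y assume y: "y \<in> ?K"
  show "hs_add H x y \<in> ?K" using x y S R(1) H.vs by (auto simp: iff subset_iff complex_vs_def)
 next
  fix s :: "nat \<Rightarrow> 'b" and l
  assume A: "(\<forall>k. s k \<in> ?K) \<and> l \<in> hs_carrier H \<and> (\<lambda>k. hs_norm H (hs_add H (s k) (hs_smul H (-1) l))) \<longlonglongrightarrow> 0"
  have "\<pi> a l = hs_zero H" if a: "a \<in> S" for a
  proof -
   have aV: "a \<in> V" using a S by blast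
   have l: "l \<in> hs_carrier H" and sk: "\<And>k. s k \<in> hs_carrier H" "\<And>k. \<pi> a (s k) = hs_zero H" using A a by auto
   have "hs_norm H (\<pi> a l) \<le> nr a * hs_norm H (hs_add H (s k) (hs_smul H (-1) l))" for k
   proof -
    have V1: "hs_smul H (-1) l \<in> hs_carrier H" using H.vs l unfolding complex_vs_def by blast
    have V2: "hs_add H (s k) (hs_smul H (-1) l) \<in> hs_carrier H" by (rule H.add_cl[OF sk(1) V1])
    have "\<pi> a (hs_add H (s k) (hs_smul H (-1) l)) = hs_add H (hs_zero H) (hs_smul H (-1) (\<pi> a l))"
     using R(2)[OF aV sk(1) V1] R(3)[OF aV l] sk(2) by simp
    also have "\<dots> = hs_smul H (-1) (\<pi> a l)" using H.vs R(1)[OF aV l] unfolding complex_vs_def by blast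
    finally have "hs_norm H (hs_smul H (-1) (\<pi> a l)) \<le> nr a * hs_norm H (hs_add H (s k) (hs_smul H (-1) l))"
     using rep_contractive[OF H rep aV V2] by simp
    moreover have "hs_norm H (hs_smul H (-1) (\<pi> a l)) = hs_norm H (\<pi> a l)" using R(1)[OF aV l] V1 H.vs by (simp add: hs_norm_def complex_vs_def)
    ultimately show ?thesis by simp
   qed
   moreover have "(\<lambda>k. nr a * hs_norm H (hs_add H (s k) (hs_smul H (-1) l))) \<longlonglongrightarrow> 0" using tendsto_mult_left[of _ 0 sequentially "nr a"] A by simp
   ultimately have "hs_norm H (\<pi> a l) \<le> 0" by (intro LIMSEQ_le_const) auto
   moreover have "0 \<le> hs_norm H (\<pi> a l)" using H.nm_nonneg[OF R(1)[OF aV l]] by simp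
   ultimately show ?thesis using H.nm_zero_iff[OF R(1)[OF aV l]] by simp
  qed
  then show "l \<in> ?K" using A by blast
 qed auto
qed

text \<open>The kernel of an irreducible representation is a prime ideal. This allows finitely many
  elements outside the kernel to be multiplied, with suitable factors in between, without falling
  into it.\<close>

lemma irrep_prime:
 assumes H: "hilbert_space H" and irr: "nonzero_irreducible_rep A H \<pi>" and h: "h \<in> V" and g: "g \<in> V"
  and x: "x \<in> hs_carrier H" "\<pi> h x \<noteq> hs_zero H" and y: "y \<in> hs_carrier H" "\<pi> g y \<noteq> hs_zero H"
 shows "\<exists>b\<in>V. \<exists>v\<in>hs_carrier H. \<pi> (mu h (mu b g)) v \<noteq> hs_zero H"
proof (rule ccontr)
 assume "\<not> ?thesis"
 then have z0: "\<pi> (mu h (mu b g)) v = hs_zero H" if "b \<in> V" "v \<in> hs_carrier H" for b v using that by blast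
 interpret H: hilb H by unfold_locales (rule H)
 have rep: "is_rep A H \<pi>" using irr by (simp add: nonzero_irreducible_rep_def)
 note R = is_repD[OF rep]
 have dich: "K = {hs_zero H} \<or> K = hs_carrier H"
  if "closed_subspace H K" "\<And>a x. a \<in> V \<Longrightarrow> x \<in> K \<Longrightarrow> \<pi> a x \<in> K" for K using irr that unfolding nonzero_irreducible_rep_def by blast
 \<comment> \<open>Vectors killed by h \<open>A\<close>. If all products h b g acted as zero, this
   invariant subspace would contain \<pi> g y and hence be everything.\<close>
 let ?K = "{w \<in> hs_carrier H. \<forall>a\<in>(\<lambda>b. mu h b) ` V. \<pi> a w = hs_zero H}"
 have K: "?K = {hs_zero H} \<or> ?K = hs_carrier H"
 proof (rule dich)
  show "closed_subspace H ?K" by (rule annih_closed[OF H rep]) (use h in auto)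
  fix c w assume c: "c \<in> V" and w: "w \<in> ?K"
  have "\<pi> (mu h b) (\<pi> c w) = hs_zero H" if b: "b \<in> V" for b
  proof -
   have "\<pi> (mu h b) (\<pi> c w) = \<pi> (mu (mu h b) c) w" using R(5)[of "mu h b" w c] w h b c by simp
   also have "\<dots> = \<pi> (mu h (mu b c)) w" using h b c by simp
   also have "\<dots> = hs_zero H" using w b c by auto
   finally show ?thesis .
  qed
  then show "\<pi> c w \<in> ?K" using R(1)[OF c] w by auto
 qed
 have "\<pi> g y \<in> ?K"
 proof -
  have "\<pi> (mu h b) (\<pi> g y) = hs_zero H" if b: "b \<in> V" for b using R(5)[of "mu h b" y g] z0[OF b y(1)] h b g y(1) by simp
  then show ?thesis using R(1)[OF g y(1)] by auto
 qed
 then have KH: "\<pi> (mu h b) w = hs_zero H" if "b \<in> V" "w \<in> hs_carrier H" for b w using K y(2) that by blast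
 let ?L = "{w \<in> hs_carrier H. \<forall>a\<in>V. \<pi> a w = hs_zero H}"
 have "?L = {hs_zero H} \<or> ?L = hs_carrier H"
 proof (rule dich)
  show "closed_subspace H ?L" by (rule annih_closed[OF H rep]) auto
  fix c w assume c: "c \<in> V" and w: "w \<in> ?L"
  have "\<pi> b (\<pi> c w) = hs_zero H" if b: "b \<in> V" for b using R(5)[OF b, of w c] w c b by auto
  then show "\<pi> c w \<in> ?L" using R(1)[OF c] w by auto
 qed
 moreover have "?L \<noteq> hs_carrier H" using irr unfolding nonzero_irreducible_rep_def by blast
 ultimately have L: "?L = {hs_zero H}" by blast
 \<comment> \<open>Taking adjoints, every b annihilates the range of the adjoint of h. No nonzero
   vector is killed by all of \<open>A\<close>, so this adjoint acts as zero, and then so does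
   h.\<close>
 have hs: "\<pi> (star h) w = hs_zero H" if w: "w \<in> hs_carrier H" for w
 proof -
  have V1: "\<pi> (star h) w \<in> hs_carrier H" using R(1) h w by simp
  have "\<pi> b (\<pi> (star h) w) = hs_zero H" if b: "b \<in> V" for b
  proof (rule H.ip_eqI)
   show "\<pi> b (\<pi> (star h) w) \<in> hs_carrier H" using R(1) b V1 by blast
   fix y' assume y': "y' \<in> hs_carrier H"
   have V2: "\<pi> (star b) y' \<in> hs_carrier H" using R(1) b y' by simp
   have "hs_inner H (\<pi> b (\<pi> (star h) w)) y' = hs_inner H (\<pi> (star h) w) (\<pi> (star b) y')" by (rule R(7)[OF b V1 y'])
   also have "\<dots> = hs_inner H w (\<pi> h (\<pi> (star b) y'))" using R(7)[of "star h" w] h w V2 by simp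
   also have "\<pi> h (\<pi> (star b) y') = \<pi> (mu h (star b)) y'" using R(5)[of h y' "star b"] h b y' by simp
   finally show "hs_inner H (\<pi> b (\<pi> (star h) w)) y' = hs_inner H (hs_zero H) y'" using KH[of "star b" y'] b w y' by simp
  qed simp
  then show ?thesis using L V1 by blast
 qed
 have "\<pi> h x = hs_zero H" by (rule H.ip_eqI) (use R(1)[OF h x(1)] R(7)[OF h x(1)] hs x(1) in auto)
 then show False using x(2) by blast
qed

end

context nsp
begin

text \<open>f is multiplied by a function of its own norm that is 0 up to \<delta> and 1 from 2
  \<delta> on. The change has norm at most 2 \<delta>, and \<delta> is chosen so small that
  contractivity cannot lose the vector \<pi> f v.\<close>

lemma cut_ex:
 assumes H: "hilbert_space H" and rep: "is_rep B H \<pi>" and f: "f \<in> V" and v: "v \<in> hs_carrier H" and nz: "\<pi> f v \<noteq> hs_zero H"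
 obtains \<delta> g where "0 < \<delta>" "g \<in> V" "\<And>y. mat_opnorm (f y) \<le> \<delta> \<Longrightarrow> g y = 0" "\<pi> g v \<noteq> hs_zero H"
proof -
 interpret H: hilb H by unfold_locales (rule H)
 note R = is_repD[OF rep]
 have n0: "0 \<le> hs_norm H v" "0 \<le> hs_norm H (\<pi> f v)" using H.nm_nonneg v R(1)[OF f v] by auto
 then have p: "0 < hs_norm H (\<pi> f v)" using H.nm_zero_iff[OF R(1)[OF f v]] nz by simp
 define \<delta> where "\<delta> = hs_norm H (\<pi> f v) / (4 * (hs_norm H v + 1))"
 have \<delta>: "0 < \<delta>" using p n0 by (simp add: \<delta>_def)
 have "\<delta> * (4 * (hs_norm H v + 1)) = hs_norm H (\<pi> f v)" using n0 by (simp add: \<delta>_def)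
 then have lt: "2 * \<delta> * hs_norm H v < hs_norm H (\<pi> f v)" using \<delta> n0 mult_nonneg_nonneg[of \<delta> "hs_norm H v"] by (simp add: algebra_simps)
 define \<psi> :: "real \<Rightarrow> real" where "\<psi> = (\<lambda>t. max 0 (min 1 (t / \<delta> - 1)))"
 define c where "c = (\<lambda>x. complex_of_real (\<psi> (mat_opnorm (f x))))"
 define g where "g = (\<lambda>x. mat_scale (c x) (f x))"
 have gV: "g \<in> V" unfolding g_def
 proof (rule CX_scale[OF f, of c 1])
  show "continuous_map X euclidean c"
   unfolding c_def \<psi>_def by (rule continuous_map_comp[OF CX_D(1)[OF f]]) (use \<delta> in \<open>auto intro!: continuous_intros\<close>)
  show "cmod (c x) \<le> 1" for x by (simp add: c_def \<psi>_def)
  show "c (act U x) = c x" if "x \<in> topspace X" "unitary_mat U" for U x using that by (simp add: c_def CX_D(3)[OF f] unitary_conj_opnorm)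
 qed
 define h where "h = (\<lambda>x. f x + mat_scale (-1) (g x))"
 have hV: "h \<in> V" unfolding h_def by (intro CX_add CX_smul f gV)
 have hle: "nr h \<le> 2 * \<delta>" unfolding CX_sel
 proof (rule nm_le)
  fix x
  define t where "t = mat_opnorm (f x)"
  have t: "0 \<le> t" by (simp add: t_def)
  have "h x = mat_scale (of_real (1 - \<psi> t)) (f x)" by (simp add: h_def g_def c_def t_def mat_scale_def vec_eq_iff algebra_simps)
  then have "mat_opnorm (h x) = \<bar>1 - \<psi> t\<bar> * t" by (simp add: t_def del: of_real_diff)
  also have "\<dots> \<le> 2 * \<delta>"
  proof (cases "2 * \<delta> \<le> t")
   case True
   then have "1 \<le> t / \<delta> - 1" using \<delta> by (simp add: field_simps)
   then have "\<psi> t = 1" by (simp add: \<psi>_def)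
   then show ?thesis using \<delta> by simp
  next
   case False
   have "\<bar>1 - \<psi> t\<bar> * t \<le> 1 * t" by (intro mult_right_mono t) (auto simp: \<psi>_def)
   then show ?thesis using False by simp
  qed
  finally show "mat_opnorm (h x) \<le> 2 * \<delta>" .
 qed (use \<delta> in simp)
 have "\<pi> g v \<noteq> hs_zero H"
 proof
  assume g0: "\<pi> g v = hs_zero H"
  have "f = add g h" by (simp add: CX_sel h_def fun_eq_iff mat_scale_def vec_eq_iff)
  then have "\<pi> f v = hs_add H (\<pi> g v) (\<pi> h v)" using R(4)[OF gV v hV] by simp
  also have "\<dots> = \<pi> h v" using g0 H.vs R(1)[OF hV v] unfolding complex_vs_def by simp
  finally have "hs_norm H (\<pi> f v) \<le> nr h * hs_norm H v" using rep_contractive[OF H rep hV v] by simp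
  also have "\<dots> \<le> 2 * \<delta> * hs_norm H v" using hle n0 by (intro mult_right_mono)
  finally show False using lt by simp
 qed
 moreover have "g y = 0" if "mat_opnorm (f y) \<le> \<delta>" for y
 proof -
  have "mat_opnorm (f y) / \<delta> - 1 \<le> 0" using that \<delta> by simp
  then have "\<psi> (mat_opnorm (f y)) = 0" unfolding \<psi>_def by linarith
  then show ?thesis by (simp add: g_def c_def)
 qed
 ultimately show ?thesis using that \<delta> gV by blast
qed

text \<open>Otherwise every point has a neighbourhood on which some element outside the kernel of
  \<pi> vanishes. Finitely many of these cover a compact K off which another such element vanishes.
  By \<open>irrep_prime\<close> a product of all of them is outside the kernel, although it is the
  zero function.\<close>

theorem irrep_factors:
 assumes H: "hilbert_space H" and irr: "nonzero_irreducible_rep B H \<pi>"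
 obtains x where "x \<in> topspace X" "\<And>f v. f \<in> V \<Longrightarrow> f x = 0 \<Longrightarrow> v \<in> hs_carrier H \<Longrightarrow> \<pi> f v = hs_zero H"
proof (rule ccontr)
 note ex = that
 assume "\<not> thesis"
 then have no: "\<exists>f v. f \<in> V \<and> f x = 0 \<and> v \<in> hs_carrier H \<and> \<pi> f v \<noteq> hs_zero H" if "x \<in> topspace X" for x using ex \<open>x \<in> topspace X\<close> by blast
 interpret H: hilb H by unfold_locales (rule H)
 have rep: "is_rep B H \<pi>" using irr by (simp add: nonzero_irreducible_rep_def)
 note R = is_repD[OF rep]
 define nzr where "nzr = (\<lambda>g. \<exists>v\<in>hs_carrier H. \<pi> g v \<noteq> hs_zero H)"
 define \<U> where "\<U> = {Q. openin X Q \<and> (\<exists>g\<in>V. nzr g \<and> (\<forall>y\<in>Q. g y = 0))}"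
 have cov: "\<exists>Q\<in>\<U>. x \<in> Q" if x: "x \<in> topspace X" for x
 proof -
  obtain f v where f: "f \<in> V" "f x = 0" "v \<in> hs_carrier H" "\<pi> f v \<noteq> hs_zero H" using no[OF x] by blast
  obtain \<delta> g where g: "0 < \<delta>" "g \<in> V" "\<And>y. mat_opnorm (f y) \<le> \<delta> \<Longrightarrow> g y = 0" "\<pi> g v \<noteq> hs_zero H" using cut_ex[OF H rep f(1,3,4)] by blast
  have "continuous_map X euclideanreal (\<lambda>y. mat_opnorm (f y))" by (rule continuous_map_comp[OF CX_D(1)[OF f(1)]]) (intro continuous_intros)
  then have "openin X {y \<in> topspace X. mat_opnorm (f y) \<in> {..<\<delta>}}" by (rule openin_continuous_map_preimage) simp
  moreover have "nzr g" using g(4) f(3) by (auto simp: nzr_def)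
  ultimately have "{y \<in> topspace X. mat_opnorm (f y) \<in> {..<\<delta>}} \<in> \<U>" using g(2,3) by (auto simp: \<U>_def)
  then show ?thesis using x f(2) g(1) by (intro bexI[of _ "{y \<in> topspace X. mat_opnorm (f y) \<in> {..<\<delta>}}"]) auto
 qed
 obtain a v where a: "a \<in> V" "v \<in> hs_carrier H" "\<pi> a v \<noteq> hs_zero H" using irr unfolding nonzero_irreducible_rep_def by blast
 obtain \<delta> g0 where g0: "0 < \<delta>" "g0 \<in> V" "\<And>y. mat_opnorm (a y) \<le> \<delta> \<Longrightarrow> g0 y = 0" "\<pi> g0 v \<noteq> hs_zero H" using cut_ex[OF H rep a] by blast
 obtain K where K: "compactin X K" "\<And>y. y \<in> topspace X \<Longrightarrow> y \<notin> K \<Longrightarrow> mat_opnorm (a y) < \<delta>" using CX_D(2)[OF a(1) g0(1)] by blast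
 have gK: "g0 y = 0" if "y \<notin> K" for y using that K(2)[of y] g0(3)[of y] CX_D(4)[OF g0(2), of y] by (cases "y \<in> topspace X") auto
 have "K \<subseteq> \<Union>\<U>" using cov compactin_subset_topspace[OF K(1)] by blast
 moreover have "\<And>Q. Q \<in> \<U> \<Longrightarrow> openin X Q" by (simp add: \<U>_def)
 ultimately obtain F where F: "finite F" "F \<subseteq> \<U>" "K \<subseteq> \<Union>F" using compactinD[OF K(1), of \<U>] by blast
 have "\<exists>h\<in>V. nzr h \<and> (\<forall>y\<in>\<Union>F. h y = 0) \<and> (\<forall>y. y \<notin> K \<longrightarrow> h y = 0)" using F(1,2)
 proof induction
  case empty
  show ?case using g0(2,4) gK a(2) by (auto simp: nzr_def intro!: bexI[of _ g0])
 next
  case (insert Q F)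
  then obtain h where h: "h \<in> V" "nzr h" "\<forall>y\<in>\<Union>F. h y = 0" "\<forall>y. y \<notin> K \<longrightarrow> h y = 0" by auto
  obtain g where g: "g \<in> V" "nzr g" "\<forall>y\<in>Q. g y = 0" using insert.prems by (auto simp: \<U>_def)
  obtain b where b: "b \<in> V" "nzr (mu h (mu b g))" using irrep_prime[OF H irr h(1) g(1)] h(2) g(2) unfolding nzr_def by blast
  have "mu h (mu b g) \<in> V" using h(1) g(1) b(1) by simp
  then show ?case using b(2) h(3,4) g(3) by (intro bexI[of _ "mu h (mu b g)"]) (auto simp: CX_sel)
 qed
 then obtain h where h: "h \<in> V" "nzr h" "\<And>y. y \<in> \<Union>F \<Longrightarrow> h y = 0" "\<And>y. y \<notin> K \<Longrightarrow> h y = 0" by blast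
 have "h y = 0" for y using h(3)[of y] h(4)[of y] F(3) by blast
 then have "h = z" by (simp add: CX_sel fun_eq_iff)
 then have "hs_norm H (\<pi> h w) \<le> 0" if "w \<in> hs_carrier H" for w using rep_contractive[OF H rep h(1) that] by simp
 then have "\<pi> h w = hs_zero H" if "w \<in> hs_carrier H" for w
  using that H.nm_zero_iff[OF R(1)[OF h(1) that]] H.nm_nonneg[OF R(1)[OF h(1) that]] by (metis H.nm_eq order_antisym)
 then show False using h(2) by (auto simp: nzr_def)
qed

text \<open>The representation factors through an evaluation, which is onto, so
  \<open>matrix_units\<close> provides a basis indexed by 'n, whatever type carries the Hilbert
  space.\<close>

theorem CX_homogeneous: "n_homogeneous TYPE('h) CARD('n) B" unfolding n_homogeneous_def
proof (intro allI impI)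
 fix H :: "'h hilb" and \<pi>
 assume A: "hilbert_space H \<and> nonzero_irreducible_rep B H \<pi>"
 then have H: "hilbert_space H" and irr: "nonzero_irreducible_rep B H \<pi>" by auto
 obtain x where x: "x \<in> topspace X" "\<And>f v. f \<in> V \<Longrightarrow> f x = 0 \<Longrightarrow> v \<in> hs_carrier H \<Longrightarrow> \<pi> f v = hs_zero H" by (rule irrep_factors[OF H irr]) blast
 obtain b :: "'n \<Rightarrow> 'h" where b: "hilb.honb H b" by (rule matrix_units[OF mh_eval eval_surj[OF x(1)] H irr]) (use x(2) in auto)
 interpret H: hilb H by unfold_locales (rule H)
 show "hs_has_dim H CARD('n)" by (rule H.honb_dim[OF b])
qed

end

section \<open>Transport along isomorphisms and uniqueness of the n-space\<close>

lemma cstar_hom_inverse: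
 assumes A: "cstar_algebra A" and f: "cstar_hom A B f" "bij_betw f (ca_carrier A) (ca_carrier B)"
 obtains g where "cstar_hom B A g" "bij_betw g (ca_carrier B) (ca_carrier A)"
  "\<And>x. x \<in> ca_carrier A \<Longrightarrow> g (f x) = x" "\<And>y. y \<in> ca_carrier B \<Longrightarrow> f (g y) = y"
proof -
 interpret calg A by unfold_locales (rule A)
 define g where "g = inv_into V f"
 have gf: "g (f x) = x" if "x \<in> V" for x using f(2) that by (simp add: g_def bij_betw_inv_into_left)
 have fg: "f (g y) = y" if "y \<in> ca_carrier B" for y using f(2) that by (simp add: g_def bij_betw_inv_into_right)
 have gV: "g y \<in> V" if "y \<in> ca_carrier B" for y using f(2) that unfolding g_def by (metis bij_betw_imp_surj_on inv_into_into)
 have F: "f (add x y) = ca_add B (f x) (f y)" "f (mu x y) = ca_mult B (f x) (f y)" "f (sm c x) = ca_smul B c (f x)" "f (star x) = ca_star B (f x)"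
  if "x \<in> V" "y \<in> V" for x y c using f(1) that unfolding cstar_hom_def by blast+
 have "cstar_hom B A g" unfolding cstar_hom_def
 proof (intro conjI ballI allI)
  fix x assume x: "x \<in> ca_carrier B"
  show "g x \<in> V" by (rule gV[OF x])
  show "g (ca_smul B c x) = sm c (g x)" for c using gf[of "sm c (g x)"] F(3)[OF gV[OF x] gV[OF x]] gV[OF x] fg[OF x] by simp
  show "g (ca_star B x) = star (g x)" using gf[of "star (g x)"] F(4)[OF gV[OF x] gV[OF x]] gV[OF x] fg[OF x] by simp
  fix y assume y: "y \<in> ca_carrier B"
  show "g (ca_add B x y) = add (g x) (g y)" using gf[of "add (g x) (g y)"] F(1)[OF gV[OF x] gV[OF y]] gV[OF x] gV[OF y] fg[OF x] fg[OF y] by simp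
  show "g (ca_mult B x y) = mu (g x) (g y)" using gf[of "mu (g x) (g y)"] F(2)[OF gV[OF x] gV[OF y]] gV[OF x] gV[OF y] fg[OF x] fg[OF y] by simp
 qed
 moreover have "bij_betw g (ca_carrier B) V" unfolding g_def by (rule bij_betw_inv_into[OF f(2)])
 ultimately show ?thesis using that gf fg by blast
qed

lemma irrep_transport:
 assumes g: "cstar_hom B A g" "g ` ca_carrier B = ca_carrier A" and irr: "nonzero_irreducible_rep A H \<pi>"
 shows "nonzero_irreducible_rep B H (\<lambda>b. \<pi> (g b))"
proof -
 have rep: "is_rep A H \<pi>" using irr by (simp add: nonzero_irreducible_rep_def)
 note R = is_repD[OF rep]
 have gV: "g x \<in> ca_carrier A" if "x \<in> ca_carrier B" for x using g(2) that by blast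
 have G: "g (ca_add B x y) = ca_add A (g x) (g y)" "g (ca_mult B x y) = ca_mult A (g x) (g y)"
  "g (ca_smul B c x) = ca_smul A c (g x)" "g (ca_star B x) = ca_star A (g x)"
  if "x \<in> ca_carrier B" "y \<in> ca_carrier B" for x y c using g(1) that unfolding cstar_hom_def by blast+
 show ?thesis unfolding nonzero_irreducible_rep_def
 proof (intro conjI allI impI)
  show "is_rep B H (\<lambda>b. \<pi> (g b))" unfolding is_rep_def
  proof (intro conjI ballI allI)
   fix a assume a: "a \<in> ca_carrier B"
   show "\<exists>C. \<forall>x\<in>hs_carrier H. hs_norm H (\<pi> (g a) x) \<le> C * hs_norm H x" using rep gV[OF a] unfolding is_rep_def by blast
  qed (simp_all add: gV G R)
  obtain a x where a: "a \<in> ca_carrier A" "x \<in> hs_carrier H" "\<pi> a x \<noteq> hs_zero H" using irr unfolding nonzero_irreducible_rep_def by blast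
  obtain b where "b \<in> ca_carrier B" "a = g b" using a(1) g(2) by (metis imageE)
  then show "\<exists>a\<in>ca_carrier B. \<exists>x\<in>hs_carrier H. \<pi> (g a) x \<noteq> hs_zero H" using a(2,3) by blast
  fix K assume "closed_subspace H K \<and> (\<forall>a\<in>ca_carrier B. \<forall>x\<in>K. \<pi> (g a) x \<in> K)"
  then have "closed_subspace H K" "\<forall>a\<in>ca_carrier A. \<forall>x\<in>K. \<pi> a x \<in> K" unfolding g(2)[symmetric] by blast+
  then show "K = {hs_zero H} \<or> K = hs_carrier H" using irr unfolding nonzero_irreducible_rep_def by blast
 qed
qed

lemma homogeneous_of_iso:
 fixes act :: "complex^'n^'n \<Rightarrow> 'x \<Rightarrow> 'x"
 assumes A: "cstar_algebra A" and X: "n_space X act" and iso: "cstar_iso A (CX X act)"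
 shows "n_homogeneous TYPE('h) CARD('n) A" unfolding n_homogeneous_def
proof (intro allI impI)
 fix H :: "'h hilb" and \<pi>
 assume H: "hilbert_space H \<and> nonzero_irreducible_rep A H \<pi>"
 obtain f where f: "cstar_hom A (CX X act) f" "bij_betw f (ca_carrier A) (ca_carrier (CX X act))" using iso unfolding cstar_iso_def by blast
 obtain g where g: "cstar_hom (CX X act) A g" "bij_betw g (ca_carrier (CX X act)) (ca_carrier A)" by (rule cstar_hom_inverse[OF A f])
 have "nonzero_irreducible_rep (CX X act) H (\<lambda>b. \<pi> (g b))" by (rule irrep_transport[OF g(1)]) (use g(2) H in \<open>auto simp: bij_betw_def\<close>)
 then show "hs_has_dim H CARD('n)" using nsp.CX_homogeneous[of X act, where 'h = 'h] X H unfolding n_homogeneous_def nsp_def by blast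
qed

context nhom
begin

text \<open>Each x becomes evaluation at x composed with the isomorphism. Comparing every n-space
  with the one spectrum reduces uniqueness to a single construction.\<close>

theorem spectrum_iso:
 fixes act :: "complex^'n^'n \<Rightarrow> 'x \<Rightarrow> 'x"
 assumes X: "n_space X act" and iso: "cstar_iso A (CX X act)"
 shows "nspace_iso X act (top_of_set XS) uact"
proof -
 interpret N: nsp X act by unfold_locales (rule X)
 let ?B = "CX X act"
 obtain \<phi> where \<phi>: "cstar_hom A ?B \<phi>" "bij_betw \<phi> V (ca_carrier ?B)" using iso unfolding cstar_iso_def by blast
 obtain \<psi> where \<psi>: "cstar_hom ?B A \<psi>" "bij_betw \<psi> (ca_carrier ?B) V"
  "\<And>a. a \<in> V \<Longrightarrow> \<psi> (\<phi> a) = a" "\<And>f. f \<in> ca_carrier ?B \<Longrightarrow> \<phi> (\<psi> f) = f" by (rule cstar_hom_inverse[OF calg \<phi>]) blast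
 have \<phi>V: "\<phi> a \<in> ca_carrier ?B" if "a \<in> V" for a using \<phi>(2) that by (auto simp: bij_betw_def)
 have \<psi>V: "\<psi> f \<in> V" if "f \<in> ca_carrier ?B" for f using \<psi>(2) that by (auto simp: bij_betw_def)
 define \<Psi> where "\<Psi> = (\<lambda>x a. if a \<in> V then \<phi> a x else 0)"
 have ev: "\<exists>a\<in>V. \<phi> a x = M" if x: "x \<in> topspace X" for x M
 proof -
  obtain f where "f \<in> ca_carrier ?B" "f x = M" using N.eval_surj[OF x] by (metis (no_types, lifting) UNIV_I imageE)
  then show ?thesis using \<psi>V \<psi>(4) by (intro bexI[of _ "\<psi> f"]) auto
 qed
 have m: "mh (\<Psi> x)" for x using \<phi>(1) unfolding mhom_def cstar_hom_def by (simp add: \<Psi>_def N.CX_sel)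
 have XSi: "\<Psi> x \<in> XS" if x: "x \<in> topspace X" for x
 proof -
  obtain a where "a \<in> V" "\<phi> a x = mun undefined undefined" using ev[OF x] by blast
  then have "\<exists>a\<in>V. \<Psi> x a \<noteq> 0" using mun_nz by (intro bexI[of _ a]) (auto simp: \<Psi>_def)
  then show ?thesis using m by (simp add: XS_def HM_def) (simp add: \<Psi>_def)
 qed
 have eq: "\<Psi> (act U x) = uact U (\<Psi> x)" if "x \<in> topspace X" "unitary_mat U" for U x
  using N.CX_D(3)[OF \<phi>V that] by (auto simp: \<Psi>_def uact_def fun_eq_iff)
 have cont: "continuous_map X (top_of_set XS) \<Psi>"
 proof -
  have "continuous_map X euclidean (\<lambda>x. \<Psi> x a)" for a using N.CX_D(1)[OF \<phi>V, of a] by (cases "a \<in> V") (simp_all add: \<Psi>_def)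
  then have "continuous_map X euclidean \<Psi>" unfolding euclidean_product_topology[symmetric] continuous_map_componentwise_UNIV by blast
  then show ?thesis using XSi by (simp add: continuous_map_in_subtopology Pi_iff)
 qed
 have inj: "inj_on \<Psi> (topspace X)"
 proof (rule inj_onI, rule ccontr)
  fix x y assume xy: "x \<in> topspace X" "y \<in> topspace X" "\<Psi> x = \<Psi> y" "x \<noteq> y"
  obtain f where f: "f \<in> ca_carrier ?B" "f x \<noteq> f y" by (rule N.CX_separates[OF xy(1,2,4)])
  show False using fun_cong[OF xy(3), of "\<psi> f"] \<psi>V[OF f(1)] \<psi>(4)[OF f(1)] f(2) by (simp add: \<Psi>_def)
 qed
 \<comment> \<open>Carried over to the function algebra, r is irreducible and factors through
   evaluation at some x. By \<open>mhom_unitary_equiv\<close> it differs from that evaluation by a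
   unitary, which only moves x along its orbit.\<close>
 have surj: "\<exists>x\<in>topspace X. r = \<Psi> x" if r: "r \<in> XS" for r
 proof -
  note rH = XS_HM[OF r] and rm = HM_mh[OF XS_HM[OF r]]
  have "nonzero_irreducible_rep ?B (subh UNIV) (\<lambda>f v. r (\<psi> f) *v v)"
   by (rule irrep_transport[OF \<psi>(1) _ mhom_surj_irrep[OF rm XS_surj[OF r]]]) (use \<psi>(2) in \<open>simp add: bij_betw_def\<close>)
  then obtain x where x: "x \<in> topspace X"
   "\<And>f v. f \<in> ca_carrier ?B \<Longrightarrow> f x = 0 \<Longrightarrow> v \<in> hs_carrier (subh UNIV) \<Longrightarrow> r (\<psi> f) *v v = hs_zero (subh UNIV)"
   using N.irrep_factors[OF subh_hilb(1)[OF vec.subspace_UNIV]] by blast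
  have ker: "r a = 0" if a: "a \<in> V" "\<Psi> x a = 0" for a
  proof -
   have "r a *v v = 0 *v v" for v using x(2)[OF \<phi>V[OF a(1)], of v] a \<psi>(3)[OF a(1)] by (simp add: \<Psi>_def)
   then show ?thesis using matrix_eq by blast
  qed
  obtain U where U: "unitary_mat U" "\<And>a. a \<in> V \<Longrightarrow> r a = U ** \<Psi> x a ** mat_adj U"
   by (rule mhom_unitary_equiv[OF m XS_surj[OF XSi[OF x(1)]] rm XS_surj[OF r]]) (use ker in auto)
  have "r a = uact U (\<Psi> x) a" for a using U(2)[of a] rH by (cases "a \<in> V") (auto simp: uact_def HM_def \<Psi>_def)
  then have "r = \<Psi> (act U x)" using eq[OF x(1) U(1)] by (simp add: fun_eq_iff)
  then show ?thesis using N.act_in[OF x(1) U(1)] by blast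
 qed
 have opn: "open_map X (top_of_set XS) \<Psi>" unfolding open_map_def
 proof (intro allI impI)
  fix Q assume Q: "openin X Q"
  show "openin (top_of_set XS) (\<Psi> ` Q)"
  proof (subst openin_subopen, intro ballI)
   fix r assume "r \<in> \<Psi> ` Q"
   then obtain x where x: "x \<in> Q" "x \<in> topspace X" "r = \<Psi> x" using openin_subset[OF Q] by blast
   obtain a where a: "a \<in> V" "\<phi> a x = mat 1" using ev[OF x(2)] by blast
   obtain K where K: "compactin X K" "\<And>y. y \<in> topspace X \<Longrightarrow> y \<notin> K \<Longrightarrow> mat_opnorm (\<phi> a y) < 1/2" using N.CX_D(2)[OF \<phi>V[OF a(1)], of "1/2"] by auto
   define C where "C = \<Psi> ` ((topspace X - Q) \<inter> K)"
   have "compactin X ((topspace X - Q) \<inter> K)" by (intro closed_Int_compactin K closedin_diff closedin_topspace Q)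
   then have "compactin (top_of_set XS) C" unfolding C_def by (rule image_compactin[OF _ cont])
   then have C: "closedin (top_of_set XS) C" by (rule compactin_imp_closedin[OF Hausdorff_space_subtopology[OF Hausdorff_fun]])
   have o: "openin (top_of_set XS) (XS \<inter> {r. 1/2 < mat_opnorm (r a)})" by (intro openin_open_Int open_Collect_less continuous_intros)
   \<comment> \<open>The inequality confines preimages to the compact set K. Removing the image of K
     - Q, closed because compact, leaves only images of points of Q.\<close>
   define T where "T = XS \<inter> {r. 1/2 < mat_opnorm (r a)} - C"
   have T: "openin (top_of_set XS) T" unfolding T_def by (intro openin_diff o C)
   have "r \<in> T"
   proof -
    have "cmod ((mat 1 :: complex^'n^'n) $ undefined $ undefined) \<le> mat_opnorm (mat 1 :: complex^'n^'n)" by (rule entry_le_opnorm)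
    then have "1/2 < mat_opnorm (r a)" using a x(3) by (simp add: \<Psi>_def mat_def)
    moreover have "r \<notin> C" using inj x(1,2) unfolding C_def x(3) inj_on_def by blast
    ultimately show ?thesis using XSi[OF x(2)] x(3) by (simp add: T_def)
   qed
   moreover have "T \<subseteq> \<Psi> ` Q"
   proof
    fix s assume s: "s \<in> T"
    then obtain y where y: "y \<in> topspace X" "s = \<Psi> y" using surj by (auto simp: T_def)
    have "1/2 < mat_opnorm (\<phi> a y)" using s a(1) y(2) by (simp add: T_def \<Psi>_def)
    then have "y \<in> K" using K(2)[OF y(1)] by fastforce
    then have "y \<in> Q" using s y by (auto simp: T_def C_def)
    then show "s \<in> \<Psi> ` Q" using y(2) by blast
   qed
   ultimately show "\<exists>T. openin (top_of_set XS) T \<and> r \<in> T \<and> T \<subseteq> \<Psi> ` Q" using T by blast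
  qed
 qed
 have "homeomorphic_map X (top_of_set XS) \<Psi>" by (rule bijective_open_imp_homeomorphic_map[OF cont opn _ inj]) (use XSi surj in auto)
 then show ?thesis unfolding nspace_iso_def using eq by blast
qed

end

lemma nspace_iso_trans_sym:
 fixes actX :: "complex^'n^'n \<Rightarrow> 'x \<Rightarrow> 'x" and actY :: "complex^'n^'n \<Rightarrow> 'y \<Rightarrow> 'y" and actZ :: "complex^'n^'n \<Rightarrow> 'z \<Rightarrow> 'z"
 assumes X: "nspace_iso X actX Z actZ" and Y: "nspace_iso Y actY Z actZ" and nY: "n_space Y actY"
 shows "nspace_iso X actX Y actY"
proof -
 interpret N: nsp Y actY by unfold_locales (rule nY)
 obtain \<psi>1 where 1: "homeomorphic_map X Z \<psi>1" "\<And>U x. x \<in> topspace X \<Longrightarrow> unitary_mat U \<Longrightarrow> \<psi>1 (actX U x) = actZ U (\<psi>1 x)"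
  using X unfolding nspace_iso_def by blast
 obtain \<psi>2 where 2: "homeomorphic_map Y Z \<psi>2" "\<And>U x. x \<in> topspace Y \<Longrightarrow> unitary_mat U \<Longrightarrow> \<psi>2 (actY U x) = actZ U (\<psi>2 x)"
  using Y unfolding nspace_iso_def by blast
 obtain g where g: "homeomorphic_maps Y Z \<psi>2 g" using 2(1) homeomorphic_map_maps by blast
 have gm: "homeomorphic_map Z Y g" using g homeomorphic_maps_sym homeomorphic_maps_imp_map by blast
 have gY: "g r \<in> topspace Y" "\<psi>2 (g r) = r" if "r \<in> topspace Z" for r
  using g that unfolding homeomorphic_maps_def continuous_map_def by (blast, blast)
 have gl: "g (\<psi>2 y) = y" if "y \<in> topspace Y" for y using g that unfolding homeomorphic_maps_def by blast
 have ge: "g (actZ U r) = actY U (g r)" if r: "r \<in> topspace Z" and U: "unitary_mat U" for r U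
  using 2(2)[OF gY(1)[OF r] U] gY(2)[OF r] gl[OF N.act_in[OF gY(1)[OF r] U]] by simp
 show ?thesis unfolding nspace_iso_def
 proof (intro exI conjI allI ballI impI)
  show "homeomorphic_map X Y (g \<circ> \<psi>1)" by (rule homeomorphic_map_compose[OF 1(1) gm])
  fix x and U :: "complex^'n^'n" assume x: "x \<in> topspace X" and U: "unitary_mat U"
  have "\<psi>1 x \<in> topspace Z" using 1(1) x homeomorphic_imp_surjective_map by blast
  then show "(g \<circ> \<psi>1) (actX U x) = actY U ((g \<circ> \<psi>1) x)" by (simp add: 1(2)[OF x U] ge[OF _ U])
 qed
qed

text \<open>The existence witness lives on functions from 'a to matrices because \<open>XS\<close>
  consists of such functions. The middle conjunct frees homogeneity from the particular type on
  which it is tested, and the uniqueness conjunct lets the two n-spaces live on unrelated types,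
  since both are compared with \<open>XS\<close>.\<close>

theorem theorem5p2:
  fixes A :: "'a cstar_alg"
  assumes "cstar_algebra A"
  shows "(n_homogeneous TYPE('a \<Rightarrow> complex) CARD('n) A \<longleftrightarrow>
            (\<exists>(X::('a \<Rightarrow> complex^'n^'n) topology) (act::complex^'n^'n \<Rightarrow> ('a \<Rightarrow> complex^'n^'n) \<Rightarrow> ('a \<Rightarrow> complex^'n^'n)).
                n_space X act \<and> cstar_iso A (CX X act)))
       \<and> (\<forall>(X::'x topology) (act::complex^'n^'n \<Rightarrow> 'x \<Rightarrow> 'x).
            n_space X act \<and> cstar_iso A (CX X act) \<longrightarrow> n_homogeneous TYPE('h) CARD('n) A)
       \<and> (n_homogeneous TYPE('a \<Rightarrow> complex) CARD('n) A \<longrightarrow>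
            (\<forall>(X::'x topology) (actX::complex^'n^'n \<Rightarrow> 'x \<Rightarrow> 'x) (Y::'y topology) (actY::complex^'n^'n \<Rightarrow> 'y \<Rightarrow> 'y).
               n_space X actX \<and> cstar_iso A (CX X actX) \<and> n_space Y actY \<and> cstar_iso A (CX Y actY)
               \<longrightarrow> nspace_iso X actX Y actY))"
proof (intro conjI allI impI iffI)
 let ?hom = "n_homogeneous TYPE('a \<Rightarrow> complex) CARD('n) A"
 have loc: "nhom TYPE('n) A" if ?hom using assms that by (simp add: nhom_def nhom_axioms_def calg_def)
 {
  assume h: ?hom
  interpret nhom where A = A and n_type = "TYPE('n)" by (rule loc[OF h])
  show "\<exists>(X::('a \<Rightarrow> complex^'n^'n) topology) (act::complex^'n^'n \<Rightarrow> ('a \<Rightarrow> complex^'n^'n) \<Rightarrow> ('a \<Rightarrow> complex^'n^'n)).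
    n_space X act \<and> cstar_iso A (CX X act)" using n_space_XS nhom_iso by blast
 next
  assume "\<exists>(X::('a \<Rightarrow> complex^'n^'n) topology) (act::complex^'n^'n \<Rightarrow> ('a \<Rightarrow> complex^'n^'n) \<Rightarrow> ('a \<Rightarrow> complex^'n^'n)).
    n_space X act \<and> cstar_iso A (CX X act)"
  then show ?hom using homogeneous_of_iso[OF assms] by blast
 next
  fix X :: "'x topology" and act :: "complex^'n^'n \<Rightarrow> 'x \<Rightarrow> 'x"
  assume "n_space X act \<and> cstar_iso A (CX X act)"
  then show "n_homogeneous TYPE('h) CARD('n) A" using homogeneous_of_iso[OF assms] by blast
 next
  fix X :: "'x topology" and actX :: "complex^'n^'n \<Rightarrow> 'x \<Rightarrow> 'x"
   and Y :: "'y topology" and actY :: "complex^'n^'n \<Rightarrow> 'y \<Rightarrow> 'y"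
  assume h: ?hom and XY: "n_space X actX \<and> cstar_iso A (CX X actX) \<and> n_space Y actY \<and> cstar_iso A (CX Y actY)"
  interpret nhom where A = A and n_type = "TYPE('n)" by (rule loc[OF h])
  show "nspace_iso X actX Y actY" by (rule nspace_iso_trans_sym[of _ _ "top_of_set XS" uact]) (use XY spectrum_iso in blast)+
 }
qed

end
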